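(* Let $\mathcal B$ be (the algebra of) a quantum projective space, with differential calculus $\Omega^\bullet$, $\Omega^1=\Omega=\Omega_+\oplus\Omega_-$, and quantum metric $g=g_{+-}+g_{-+}\in\Omega\otimes_{\mathcal B}\Omega$. Let $\nabla=\nabla_++\nabla_-:\Omega\to\Omega\otimes_{\mathcal B}\Omega$ be the connection given by $$\nabla(\partial p)=q^{(\alpha_s,\alpha_s)}\,\mathsf E_{23}\mathsf T_{1234}\,\bar\partial p\otimes\partial p-q^{(\alpha_s,\alpha_s)}q^{-(\omega_s,2\rho)}\,p\,g_{-+},\qquad \nabla(\bar\partial p)=\mathsf E_{23}\,\partial p\otimes\bar\partial p-q^{-(\omega_s,2\rho)}\,p\,g_{+-}.$$ Then $\nabla$ is a weak quantum Levi-Civita connection with respect to $g$, that is, $\nabla$ is torsion free and cotorsion free. Moreover, in the classical limit $\nabla$ reduces to the Levi-Civita connection for the Fubini--Study metric on the cotangent bundle.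
   Context: Quantum group. $0<q<1$ is real, $\mathfrak g=\mathfrak{sl}_{r+1}(\mathbb C)$ with $r\ge 1$, simple roots $\alpha_1,\dots,\alpha_r$, fundamental weights $\omega_i$, $\rho$ the half-sum of positive roots, $w_0$ the longest Weyl group element, $(\cdot,\cdot)$ the standard symmetric bilinear form on weights with $(\alpha_i,\alpha_i)=2$. $U_q(\mathfrak g)$ has generators $K_i^{\pm1},E_i,F_i$ with the standard (Klimyk--Schmüdgen) relations, and $\Delta(K_i)=K_i\otimes K_i$, $\Delta(E_i)=E_i\otimes K_i+1\otimes E_i$, $\Delta(F_i)=F_i\otimes 1+K_i^{-1}\otimes F_i$, $S(K_i)=K_i^{-1}$, $S(E_i)=-E_iK_i^{-1}$, $S(F_i)=-K_iF_i$. $V(\lambda)$ is the simple (type 1) module of highest weight $\lambda$; duals carry $(Xf)(v)=f(S(X)v)$. $\hat R_{V,W}:V\otimes W\to W\otimes V$ is the braiding of the category of finite-dimensional (type 1) modules determined on simple modules by $\hat R_{V(\lambda),V(\mu)}(v_\lambda\otimes v_{w_0\mu})=q^{(\lambda,w_0\mu)}v_{w_0\mu}\otimes v_\lambda$ for $v_\lambda$ a highest weight vector and $v_{w_0\mu}$ a lowest weight vector. Choose $\omega_s=\omega_1$ or $\omega_s=\omega_r$ (with $\alpha_s$ the corresponding simple root) and $V=V(\omega_s)$, $N=\dim V$, weight basis $\{e_i\}$ of $V$ with $\lambda_i$ the weight of $e_i$, dual basis $\{e^i\}$ of $V^*$. Put $\mathsf E(e^i\otimes e_j)=\delta_{ij}$,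 $\mathsf E'(e_i\otimes e^j)=q^{(2\rho,\lambda_i)}\delta_{ij}$. Index-free notation. Families of elements with several indices are regarded as elements of (module)$\otimes$(tensor product of copies of $V,V^*$): $f=\sum_i f^i\otimes e_i$, $v=\sum_i v^i\otimes e^i$, $p=\sum_{i,j}p^{ij}\otimes e_i\otimes e^j$, $\partial p=\sum\partial p^{ij}\otimes e_i\otimes e^j$, similarly $\bar\partial p$; products and tensor products multiply the module components and concatenate the legs, e.g. $p\,\partial p=\sum p^{ij}\partial p^{kl}\otimes e_i\otimes e^j\otimes e_k\otimes e^l$. Maps on modules act on components. Operators with subscripts act on the legs in the indicated positions, composed right to left; $\mathsf E_{i,i+1},\mathsf E'_{i,i+1}$ contract legs $i,i+1$. Algebra. $\mathcal A$ is the algebra with generators $f^i,v^i$ ($1\le i\le N$) and relations $ff=q^{-(\omega_s,\omega_s)}(\hat R_{V,V})_{12}ff$, $vv=q^{-(\omega_s,\omega_s)}(\hat R_{V^*,V^*})_{12}vv$, $vf=q^{(\omega_s,\omega_s)}(\hat R_{V,V^*})_{12}fv$, $\mathsf E_{12}vf=1$; it is graded by $\deg f^i=1$, $\deg v^i=-1$. The quantum projective space is the degree-zero subalgebra $\mathcal B\subset\mathcal A$, generated by $p^{ij}=f^iv^j$. Calculus. Put $\mathsf S_{123}=(\hat R_{V,V^*})_{23}(\hat R_{V,V})_{12}(\hat R_{V,V^*}^{-1})_{23}$, $\tilde{\mathsf S}_{234}=(\hat R_{V,V^*})_{23}(\hat R^{-1}_{V^*,V^*})_{34}(\hat R^{-1}_{V,V^*})_{23}$,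 $\mathsf T_{1234}=\mathsf S_{123}\tilde{\mathsf S}_{234}$ (and shifted versions). $\Omega_+$ is the left $\mathcal B$-module generated by the $\partial p^{ij}$ with relations $(\tilde{\mathsf S}_{234}-q^{-(\omega_s,\omega_s)})p\,\partial p=0$, $\mathsf E'_{12}\partial p=0$, and $\Omega_-$ the left $\mathcal B$-module generated by the $\bar\partial p^{ij}$ with relations $(\mathsf S_{123}-q^{(\omega_s,\omega_s)})p\,\bar\partial p=0$, $\mathsf E'_{12}\bar\partial p=0$. They are $\mathcal B$-bimodules via $\partial p\,p=q^{(\alpha_s,\alpha_s)}\mathsf T_{1234}\,p\,\partial p$, $\bar\partial p\,p=q^{-(\alpha_s,\alpha_s)}\mathsf T_{1234}\,p\,\bar\partial p$. $\Omega=\Omega_+\oplus\Omega_-$ with $d=\partial+\bar\partial$, where $\partial:\mathcal B\to\Omega_+$, $\bar\partial:\mathcal B\to\Omega_-$ are the derivations sending $p^{ij}$ to $\partial p^{ij}$, $\bar\partial p^{ij}$. $(\Omega^\bullet,d)$ is the universal differential calculus of $(\Omega,d)$: the tensor algebra of the $\mathcal B$-bimodule $\Omega$ modulo the ideal generated by all $\sum_i da_i\otimes db_i$ with $\sum_i a_i\,db_i=0$, and $d(a_0\,da_1\wedge\cdots\wedge da_n)=da_0\wedge da_1\wedge\cdots\wedge da_n$. Metric. $g_{+-}=\mathsf E'_{12}\mathsf E_{23}\,\partial p\otimes\bar\partial p=\sum_{i,j}q^{(2\rho,\lambda_i)}\partial p^{ij}\otimes\bar\partial p^{ji}$, $g_{-+}=\mathsf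 E'_{12}\mathsf E_{23}\,\bar\partial p\otimes\partial p=\sum_{i,j}q^{(2\rho,\lambda_i)}\bar\partial p^{ij}\otimes\partial p^{ji}$. Connections. A (left) connection on $\Omega$ is a linear map $\nabla:\Omega\to\Omega\otimes_{\mathcal B}\Omega$ with $\nabla(b\omega)=db\otimes\omega+b\nabla(\omega)$. Its torsion is $T_\nabla=\wedge\circ\nabla-d:\Omega\to\Omega^2$; torsion free means $T_\nabla=0$. Its cotorsion is $\mathrm{co}T_\nabla=(d\otimes\mathrm{id}-(\wedge\otimes\mathrm{id})\circ(\mathrm{id}\otimes\nabla))g\in\Omega^2\otimes_{\mathcal B}\Omega$; cotorsion free means $\mathrm{co}T_\nabla=0$. A weak quantum Levi-Civita connection is one that is torsion free and cotorsion free. Classical limit. This means setting $q=1$ (so that the braidings become flips and $\mathsf E'$ the plain pairing), replacing $p^{ij}$ by the functions $Z^i\bar Z^j/\|Z\|^2$ on $\mathbb CP^r$ and $\partial,\bar\partial$ by the Dolbeault operators; then the formulas become $\nabla(\partial p^{ij})=\sum_k\bar\partial p^{kj}\otimes\partial p^{ik}-p^{ij}g_{-+}$ and $\nabla(\bar\partial p^{ij})=\sum_k\partial p^{ik}\otimes\bar\partial p^{kj}-p^{ij}g_{+-}$, with $g_{+-}=\sum_{i,j}\partial p^{ij}\otimes\bar\partial p^{ji}$, $g_{-+}=\sum_{i,j}\bar\partial p^{ij}\otimes\partial p^{ji}$. The Fubini--Study metric is, in the coordinates $z^i=Z^i/Z^{r+1}$, $\sum_{i,j=1}^r\frac{(1+\|z\|^2)\delta_{ij}-\bar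 z^iz^j}{(1+\|z\|^2)^2}(dz^i\otimes d\bar z^j+d\bar z^j\otimes dz^i)$. *)

theory Defs
  imports "HOL-Analysis.Analysis" "HOL-Library.Poly_Mapping" "HOL-Library.Function_Algebras"
begin

section \<open>Complex vector spaces and algebras\<close>

class complex_vec = ab_group_add +
  fixes scaleC :: "complex \<Rightarrow> 'a \<Rightarrow> 'a"  (infixr "*\<^sub>C" 75)
  assumes scaleC_add_right: "c *\<^sub>C (x + y) = c *\<^sub>C x + c *\<^sub>C y"
    and scaleC_add_left: "(c + d) *\<^sub>C x = c *\<^sub>C x + d *\<^sub>C x"
    and scaleC_scaleC: "c *\<^sub>C d *\<^sub>C x = (c * d) *\<^sub>C x"
    and scaleC_one: "1 *\<^sub>C x = x"
begin

lemma scaleC_zero_right: "c *\<^sub>C 0 = 0"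
  using scaleC_add_right[of c 0 0] by simp

end

class complex_algebra_1 = complex_vec + ring_1 +
  assumes mult_scaleC_left: "(c *\<^sub>C x) * y = c *\<^sub>C (x * y)"
    and mult_scaleC_right: "x * (c *\<^sub>C y) = c *\<^sub>C (x * y)"

instantiation complex :: complex_algebra_1
begin
definition scaleC_complex :: "complex \<Rightarrow> complex \<Rightarrow> complex"
  where "scaleC_complex c x = c * x"
instance
  by standard (simp_all add: scaleC_complex_def algebra_simps)
end

instantiation prod :: (complex_vec, complex_vec) complex_vec
begin
definition scaleC_prod :: "complex \<Rightarrow> 'a \<times> 'b \<Rightarrow> 'a \<times> 'b"
  where "scaleC_prod c x = (c *\<^sub>C fst x, c *\<^sub>C snd x)"
instance
  by standard
    (simp_all add: scaleC_prod_def scaleC_add_right scaleC_add_left scaleC_scaleC scaleC_one)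
end

instantiation "fun" :: (type, complex_vec) complex_vec
begin
definition scaleC_fun :: "complex \<Rightarrow> ('a \<Rightarrow> 'b) \<Rightarrow> 'a \<Rightarrow> 'b"
  where "scaleC_fun c x = (\<lambda>a. c *\<^sub>C x a)"
instance
  by standard
    (simp_all add: scaleC_fun_def scaleC_add_right scaleC_add_left scaleC_scaleC scaleC_one
      fun_eq_iff)
end

instantiation poly_mapping :: (type, complex_vec) complex_vec
begin
definition scaleC_poly_mapping :: "complex \<Rightarrow> ('a \<Rightarrow>\<^sub>0 'b) \<Rightarrow> ('a \<Rightarrow>\<^sub>0 'b)"
  where "scaleC_poly_mapping c x = Poly_Mapping.map (scaleC c) x"
instance
proof
  have lk: "Poly_Mapping.lookup (c *\<^sub>C x) a = c *\<^sub>C Poly_Mapping.lookup x a"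
    for c and x :: "'a \<Rightarrow>\<^sub>0 'b" and a
    by (simp add: scaleC_poly_mapping_def map.rep_eq when_def scaleC_zero_right)
  fix c d :: complex and x y :: "'a \<Rightarrow>\<^sub>0 'b"
  show "c *\<^sub>C (x + y) = c *\<^sub>C x + c *\<^sub>C y"
    by (rule poly_mapping_eqI) (simp add: lk lookup_add scaleC_add_right)
  show "(c + d) *\<^sub>C x = c *\<^sub>C x + d *\<^sub>C x"
    by (rule poly_mapping_eqI) (simp add: lk lookup_add scaleC_add_left)
  show "c *\<^sub>C d *\<^sub>C x = (c * d) *\<^sub>C x"
    by (rule poly_mapping_eqI) (simp add: lk scaleC_scaleC)
  show "1 *\<^sub>C x = x"
    by (rule poly_mapping_eqI) (simp add: lk scaleC_one)
qed
end

section \<open>Weights of \<open>sl(r+1)\<close>\<close>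

text \<open>A weight is given by its coordinates with respect to \<open>\<epsilon>\<^sub>1, \<dots>, \<epsilon>\<^sub>r\<^sub>+\<^sub>1\<close>, normalised to have
  coordinate sum \<open>0\<close> and extended by \<open>0\<close> to all of \<open>nat\<close>.  In these coordinates the invariant form is
  the standard inner product, and the longest Weyl group element reverses the coordinates.\<close>

type_synonym weight = "nat \<Rightarrow> real"

definition simple_root :: "nat \<Rightarrow> weight"
  where "simple_root i = (\<lambda>k. of_bool (k = i) - of_bool (k = Suc i))"

definition fund_weight :: "nat \<Rightarrow> nat \<Rightarrow> weight"
  where "fund_weight r i = (\<lambda>k. of_bool (k \<in> {1..i}) - of_bool (k \<in> {1..r + 1}) * real i / real (r + 1))"

definition two_rho :: "nat \<Rightarrow> weight"
  where "two_rho r = (\<lambda>k. \<Sum>(i, j) \<in> {(i, j). 1 \<le> i \<and> i < j \<and> j \<le> r + 1}.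
    of_bool (k = i) - of_bool (k = j))"

definition weight_form :: "nat \<Rightarrow> weight \<Rightarrow> weight \<Rightarrow> real"
  where "weight_form r \<nu> \<mu> = (\<Sum>k = 1..r + 1. \<nu> k * \<mu> k)"

definition w0 :: "nat \<Rightarrow> weight \<Rightarrow> weight"
  where "w0 r \<nu> = (\<lambda>k. if k \<in> {1..r + 1} then \<nu> (r + 2 - k) else 0)"

definition dual_weight :: "nat \<Rightarrow> weight \<Rightarrow> weight"
  where "dual_weight r \<nu> = (\<lambda>k. - w0 r \<nu> k)"

definition weight_lattice :: "nat \<Rightarrow> weight set"
  where "weight_lattice r =
    range (\<lambda>(m :: nat \<Rightarrow> int) k. \<Sum>i = 1..r. real_of_int (m i) * fund_weight r i k)"

definition qpow :: "real \<Rightarrow> real \<Rightarrow> complex"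
  where "qpow q x = complex_of_real (q powr x)"

section \<open>Modules over \<open>U\<^sub>q(sl(r+1))\<close> and their braidings\<close>

text \<open>A finite-dimensional module together with a basis, indexed by a finite type, is given by the
  matrices of the generators \<open>K\<^sub>i, E\<^sub>i, F\<^sub>i\<close>, \<open>1 \<le> i \<le> r\<close>.\<close>

record 'n uq_module =
  Kop :: "nat \<Rightarrow> complex^'n^'n"
  Eop :: "nat \<Rightarrow> complex^'n^'n"
  Fop :: "nat \<Rightarrow> complex^'n^'n"

definition serre :: "real \<Rightarrow> nat \<Rightarrow> nat \<Rightarrow> (nat \<Rightarrow> complex^'n^'n::finite) \<Rightarrow> bool"
  where "serre q i j X \<longleftrightarrow>
    (if i = Suc j \<or> j = Suc i
     then X i ** X i ** X j - mat (qpow q 1 + qpow q (-1)) ** X i ** X j ** X i + X j ** X i ** X i = 0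
     else X i ** X j = X j ** X i)"

definition is_uq_module :: "nat \<Rightarrow> real \<Rightarrow> 'n::finite uq_module \<Rightarrow> bool"
  where "is_uq_module r q V \<longleftrightarrow>
    (\<forall>i\<in>{1..r}. invertible (Kop V i)) \<and>
    (\<forall>i\<in>{1..r}. \<forall>j\<in>{1..r}.
      Kop V i ** Kop V j = Kop V j ** Kop V i \<and>
      Kop V i ** Eop V j ** matrix_inv (Kop V i)
        = mat (qpow q (weight_form r (simple_root i) (simple_root j))) ** Eop V j \<and>
      Kop V i ** Fop V j ** matrix_inv (Kop V i)
        = mat (qpow q (- weight_form r (simple_root i) (simple_root j))) ** Fop V j \<and>
      Eop V i ** Fop V j - Fop V j ** Eop V i
        = (if i = j then mat (1 / (qpow q 1 - qpow q (-1))) ** (Kop V i - matrix_inv (Kop V i)) else 0) \<and>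
      serre q i j (Eop V) \<and> serre q i j (Fop V))"

definition has_weight :: "nat \<Rightarrow> real \<Rightarrow> 'n::finite uq_module \<Rightarrow> weight \<Rightarrow> complex^'n \<Rightarrow> bool"
  where "has_weight r q V \<nu> x \<longleftrightarrow>
    (\<forall>i\<in>{1..r}. Kop V i *v x = qpow q (weight_form r (simple_root i) \<nu>) *s x)"

definition highest_weight_vector ::
    "nat \<Rightarrow> real \<Rightarrow> 'n::finite uq_module \<Rightarrow> weight \<Rightarrow> complex^'n \<Rightarrow> bool"
  where "highest_weight_vector r q V \<nu> x \<longleftrightarrow>
    x \<noteq> 0 \<and> has_weight r q V \<nu> x \<and> (\<forall>i\<in>{1..r}. Eop V i *v x = 0)"

definition lowest_weight_vector ::
    "nat \<Rightarrow> real \<Rightarrow> 'n::finite uq_module \<Rightarrow> weight \<Rightarrow> complex^'n \<Rightarrow> bool"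
  where "lowest_weight_vector r q V \<nu> x \<longleftrightarrow>
    x \<noteq> 0 \<and> has_weight r q V \<nu> x \<and> (\<forall>i\<in>{1..r}. Fop V i *v x = 0)"

definition is_simple :: "nat \<Rightarrow> 'n::finite uq_module \<Rightarrow> bool"
  where "is_simple r V \<longleftrightarrow>
    (\<forall>W. vec.subspace W \<and>
      (\<forall>i\<in>{1..r}. \<forall>x\<in>W. Kop V i *v x \<in> W \<and> Eop V i *v x \<in> W \<and> Fop V i *v x \<in> W)
      \<longrightarrow> W = {0} \<or> W = UNIV)"

definition is_simple_hw_module :: "nat \<Rightarrow> real \<Rightarrow> weight \<Rightarrow> 'n::finite uq_module \<Rightarrow> bool"
  where "is_simple_hw_module r q \<nu> V \<longleftrightarrow>
    is_uq_module r q V \<and> is_simple r V \<and> (\<exists>x. highest_weight_vector r q V \<nu> x)"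

definition is_weight_basis :: "nat \<Rightarrow> real \<Rightarrow> 'n::finite uq_module \<Rightarrow> ('n \<Rightarrow> weight) \<Rightarrow> bool"
  where "is_weight_basis r q V wt \<longleftrightarrow>
    (\<forall>a. wt a \<in> weight_lattice r \<and> has_weight r q V (wt a) (axis a 1))"

text \<open>\<open>(X f)(v) = f (S(X) v)\<close>, in the dual basis.\<close>

definition dual_module :: "'n::finite uq_module \<Rightarrow> 'n uq_module"
  where "dual_module V =
    \<lparr>Kop = (\<lambda>i. transpose (matrix_inv (Kop V i))),
     Eop = (\<lambda>i. transpose (- (Eop V i ** matrix_inv (Kop V i)))),
     Fop = (\<lambda>i. transpose (- (Kop V i ** Fop V i)))\<rparr>"

definition kron :: "complex^'m^'m \<Rightarrow> complex^'n^'n \<Rightarrow> complex^('m \<times> 'n)^('m::finite \<times> 'n::finite)"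
  where "kron A B = (\<chi> a b. A $ fst a $ fst b * B $ snd a $ snd b)"

definition tensor_module :: "'m::finite uq_module \<Rightarrow> 'n::finite uq_module \<Rightarrow> ('m \<times> 'n) uq_module"
  where "tensor_module V W =
    \<lparr>Kop = (\<lambda>i. kron (Kop V i) (Kop W i)),
     Eop = (\<lambda>i. kron (Eop V i) (Kop W i) + kron (mat 1) (Eop W i)),
     Fop = (\<lambda>i. kron (Fop V i) (mat 1) + kron (matrix_inv (Kop V i)) (Fop W i))\<rparr>"

definition vec_tensor :: "complex^'m \<Rightarrow> complex^'n \<Rightarrow> complex^('m::finite \<times> 'n::finite)"
  where "vec_tensor x y = (\<chi> a. x $ fst a * y $ snd a)"

definition is_braiding ::
    "nat \<Rightarrow> real \<Rightarrow> weight \<Rightarrow> 'm::finite uq_module \<Rightarrow> weight \<Rightarrow> 'n::finite uq_module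
      \<Rightarrow> complex^('m \<times> 'n)^('n \<times> 'm) \<Rightarrow> bool"
  where "is_braiding r q \<nu> V \<mu> W R \<longleftrightarrow>
    (\<forall>i\<in>{1..r}. R ** Kop (tensor_module V W) i = Kop (tensor_module W V) i ** R \<and>
      R ** Eop (tensor_module V W) i = Eop (tensor_module W V) i ** R \<and>
      R ** Fop (tensor_module V W) i = Fop (tensor_module W V) i ** R) \<and>
    (\<forall>x y. highest_weight_vector r q V \<nu> x \<and> lowest_weight_vector r q W (w0 r \<mu>) y \<longrightarrow>
      R *v vec_tensor x y = qpow q (weight_form r \<nu> (w0 r \<mu>)) *s vec_tensor y x)"

text \<open>The braiding of \<open>V = V(\<nu>)\<close> and \<open>W = V(\<mu>)\<close>; it is unique because a highest weight vector
  tensor a lowest weight vector generates \<open>V \<otimes> W\<close>.\<close>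

definition braiding ::
    "nat \<Rightarrow> real \<Rightarrow> weight \<Rightarrow> 'm::finite uq_module \<Rightarrow> weight \<Rightarrow> 'n::finite uq_module
      \<Rightarrow> complex^('m \<times> 'n)^('n \<times> 'm)"
  where "braiding r q \<nu> V \<mu> W = (THE R. is_braiding r q \<nu> V \<mu> W R)"

text \<open>The three braidings \<open>R\<^sub>V\<^sub>,\<^sub>V\<close>, \<open>R\<^sub>V\<^sub>,\<^sub>V\<^sub>*\<close>, \<open>R\<^sub>V\<^sub>*\<^sub>,\<^sub>V\<^sub>*\<close> entering the formulas.\<close>

record 'n braidings =
  RVV :: "complex^('n \<times> 'n)^('n \<times> 'n)"
  RVD :: "complex^('n \<times> 'n)^('n \<times> 'n)"
  RDD :: "complex^('n \<times> 'n)^('n \<times> 'n)"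

definition quantum_braidings :: "nat \<Rightarrow> nat \<Rightarrow> real \<Rightarrow> 'n::finite uq_module \<Rightarrow> 'n braidings"
  where "quantum_braidings r s q V =
    (let \<omega> = fund_weight r s; \<omega>' = dual_weight r \<omega>; V' = dual_module V
     in \<lparr>RVV = braiding r q \<omega> V \<omega> V, RVD = braiding r q \<omega> V \<omega>' V', RDD = braiding r q \<omega>' V' \<omega>' V'\<rparr>)"

definition flip_braidings :: "'n::finite braidings"
  where "flip_braidings =
    (let P = (\<chi> a b. of_bool (a = prod.swap b)) in \<lparr>RVV = P, RVD = P, RDD = P\<rparr>)"

section \<open>Operators acting on legs\<close>

text \<open>An element of (module) \<open>\<otimes>\<close> (tensor product of copies of \<open>V\<close> and \<open>V*\<close>) is the family of its
  coefficients with respect to the basis \<open>e\<^sub>i\<close> of \<open>V\<close> and its dual basis \<open>e\<^sup>i\<close> of \<open>V*\<close>.\<close>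

type_synonym ('n, 'x) legs2 = "'n \<Rightarrow> 'n \<Rightarrow> 'x"
type_synonym ('n, 'x) legs4 = "'n \<Rightarrow> 'n \<Rightarrow> 'n \<Rightarrow> 'n \<Rightarrow> 'x"

definition on_legs ::
    "complex^('n \<times> 'n)^('n \<times> 'n) \<Rightarrow> ('n::finite, 'x::complex_vec) legs2 \<Rightarrow> ('n, 'x) legs2"
  where "on_legs R X = (\<lambda>a b. \<Sum>(i, j)\<in>UNIV. R $ (a, b) $ (i, j) *\<^sub>C X i j)"

definition on_legs12 ::
    "complex^('n \<times> 'n)^('n \<times> 'n) \<Rightarrow> ('n::finite, 'x::complex_vec) legs4 \<Rightarrow> ('n, 'x) legs4"
  where "on_legs12 R X = (\<lambda>a b c d. on_legs R (\<lambda>i j. X i j c d) a b)"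

definition on_legs23 ::
    "complex^('n \<times> 'n)^('n \<times> 'n) \<Rightarrow> ('n::finite, 'x::complex_vec) legs4 \<Rightarrow> ('n, 'x) legs4"
  where "on_legs23 R X = (\<lambda>a b c d. on_legs R (\<lambda>i j. X a i j d) b c)"

definition on_legs34 ::
    "complex^('n \<times> 'n)^('n \<times> 'n) \<Rightarrow> ('n::finite, 'x::complex_vec) legs4 \<Rightarrow> ('n, 'x) legs4"
  where "on_legs34 R X = (\<lambda>a b c d. on_legs R (\<lambda>i j. X a b i j) c d)"

definition S123 :: "'n::finite braidings \<Rightarrow> ('n, 'x::complex_vec) legs4 \<Rightarrow> ('n, 'x) legs4"
  where "S123 R X = on_legs23 (RVD R) (on_legs12 (RVV R) (on_legs23 (matrix_inv (RVD R)) X))"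

definition tildeS234 :: "'n::finite braidings \<Rightarrow> ('n, 'x::complex_vec) legs4 \<Rightarrow> ('n, 'x) legs4"
  where "tildeS234 R X =
    on_legs23 (RVD R) (on_legs34 (matrix_inv (RDD R)) (on_legs23 (matrix_inv (RVD R)) X))"

definition T1234 :: "'n::finite braidings \<Rightarrow> ('n, 'x::complex_vec) legs4 \<Rightarrow> ('n, 'x) legs4"
  where "T1234 R X = S123 R (tildeS234 R X)"

definition E23 :: "('n::finite, 'x::complex_vec) legs4 \<Rightarrow> ('n, 'x) legs2"
  where "E23 X = (\<lambda>a d. \<Sum>b\<in>UNIV. X a b b d)"

definition E'12 ::
    "nat \<Rightarrow> real \<Rightarrow> ('n \<Rightarrow> weight) \<Rightarrow> ('n::finite, 'x::complex_vec) legs2 \<Rightarrow> 'x"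
  where "E'12 r q wt X = (\<Sum>a\<in>UNIV. qpow q (weight_form r (two_rho r) (wt a)) *\<^sub>C X a a)"

definition concat_legs ::
    "('y \<Rightarrow> 'z \<Rightarrow> 'x) \<Rightarrow> ('n, 'y) legs2 \<Rightarrow> ('n, 'z) legs2 \<Rightarrow> ('n, 'x) legs4"
  where "concat_legs m X Y = (\<lambda>a b c d. m (X a b) (Y c d))"

text \<open>\<open>(\<omega>\<^sub>s, \<omega>\<^sub>s)\<close>, \<open>(\<alpha>\<^sub>s, \<alpha>\<^sub>s)\<close> and \<open>(\<omega>\<^sub>s, 2\<rho>)\<close>.\<close>

definition ww :: "nat \<Rightarrow> nat \<Rightarrow> real"
  where "ww r s = weight_form r (fund_weight r s) (fund_weight r s)"

definition aa :: "nat \<Rightarrow> nat \<Rightarrow> real"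
  where "aa r s = weight_form r (simple_root s) (simple_root s)"

definition wr :: "nat \<Rightarrow> nat \<Rightarrow> real"
  where "wr r s = weight_form r (fund_weight r s) (two_rho r)"

section \<open>Algebras given by generators and relations\<close>

datatype 'g word = Word (letters: "'g list")

instantiation word :: (type) monoid_add
begin
definition zero_word :: "'a word" where "0 = Word []"
definition plus_word :: "'a word \<Rightarrow> 'a word \<Rightarrow> 'a word"
  where "u + w = Word (letters u @ letters w)"
instance
  by standard (simp_all add: zero_word_def plus_word_def)
end

text \<open>The monoid algebra of the free monoid of words is the free algebra.\<close>

type_synonym 'g free_algebra = "'g word \<Rightarrow>\<^sub>0 complex"

definition free_gen :: "'g \<Rightarrow> 'g free_algebra"
  where "free_gen g = Poly_Mapping.single (Word [g]) 1"

definition free_eval :: "('g \<Rightarrow> 'a::complex_algebra_1) \<Rightarrow> 'g free_algebra \<Rightarrow> 'a"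
  where "free_eval \<phi> x =
    (\<Sum>w\<in>Poly_Mapping.keys x. Poly_Mapping.lookup x w *\<^sub>C prod_list (map \<phi> (letters w)))"

definition two_sided_ideal :: "'a::ring_1 set \<Rightarrow> bool"
  where "two_sided_ideal I \<longleftrightarrow>
    0 \<in> I \<and> (\<forall>x\<in>I. \<forall>y\<in>I. x + y \<in> I) \<and> (\<forall>x\<in>I. \<forall>a. a * x \<in> I \<and> x * a \<in> I)"

definition presented_algebra ::
    "('g \<Rightarrow> 'a::complex_algebra_1) \<Rightarrow> 'g free_algebra set \<Rightarrow> bool"
  where "presented_algebra \<phi> Rel \<longleftrightarrow>
    surj (free_eval \<phi>) \<and> {x. free_eval \<phi> x = 0} = two_sided_ideal hull Rel"

datatype 'n gens = Gf 'n | Gv 'n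

definition algebra_relations ::
    "nat \<Rightarrow> nat \<Rightarrow> real \<Rightarrow> 'n::finite braidings \<Rightarrow> 'n gens free_algebra set"
  where "algebra_relations r s q R =
    (let ff = (\<lambda>i j. free_gen (Gf i) * free_gen (Gf j));
         vv = (\<lambda>i j. free_gen (Gv i) * free_gen (Gv j));
         fv = (\<lambda>i j. free_gen (Gf i) * free_gen (Gv j));
         vf = (\<lambda>i j. free_gen (Gv i) * free_gen (Gf j))
     in {ff i j - qpow q (- ww r s) *\<^sub>C on_legs (RVV R) ff i j | i j. True} \<union>
        {vv i j - qpow q (- ww r s) *\<^sub>C on_legs (RDD R) vv i j | i j. True} \<union>
        {vf i j - qpow q (ww r s) *\<^sub>C on_legs (RVD R) fv i j | i j. True} \<union>
        {(\<Sum>i\<in>UNIV. vf i i) - 1})"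

fun gen_degree :: "'n gens \<Rightarrow> int"
  where "gen_degree (Gf i) = 1" | "gen_degree (Gv i) = -1"

definition degree_zero_part :: "('n gens \<Rightarrow> 'a::complex_algebra_1) \<Rightarrow> 'a set"
  where "degree_zero_part \<phi> = free_eval \<phi> `
    {x. \<forall>w\<in>Poly_Mapping.keys x. sum_list (map gen_degree (letters w)) = 0}"

section \<open>Modules over a subalgebra \<open>B\<close>\<close>

definition left_module ::
    "'a::complex_algebra_1 set \<Rightarrow> ('a \<Rightarrow> 'w::complex_vec \<Rightarrow> 'w) \<Rightarrow> bool"
  where "left_module B l \<longleftrightarrow>
    (\<forall>b\<in>B. \<forall>x y. l b (x + y) = l b x + l b y) \<and>
    (\<forall>b\<in>B. \<forall>b'\<in>B. \<forall>x. l (b + b') x = l b x + l b' x \<and> l (b * b') x = l b (l b' x)) \<and>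
    (\<forall>x. l 1 x = x) \<and>
    (\<forall>c. \<forall>b\<in>B. \<forall>x. l (c *\<^sub>C b) x = c *\<^sub>C l b x)"

definition right_module ::
    "'a::complex_algebra_1 set \<Rightarrow> ('w::complex_vec \<Rightarrow> 'a \<Rightarrow> 'w) \<Rightarrow> bool"
  where "right_module B rt \<longleftrightarrow>
    (\<forall>b\<in>B. \<forall>x y. rt (x + y) b = rt x b + rt y b) \<and>
    (\<forall>b\<in>B. \<forall>b'\<in>B. \<forall>x. rt x (b + b') = rt x b + rt x b' \<and> rt x (b * b') = rt (rt x b) b') \<and>
    (\<forall>x. rt x 1 = x) \<and>
    (\<forall>c. \<forall>b\<in>B. \<forall>x. rt x (c *\<^sub>C b) = c *\<^sub>C rt x b)"

definition bimodule ::
    "'a::complex_algebra_1 set \<Rightarrow> ('a \<Rightarrow> 'w::complex_vec \<Rightarrow> 'w) \<Rightarrow> ('w \<Rightarrow> 'a \<Rightarrow> 'w) \<Rightarrow> bool"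
  where "bimodule B l rt \<longleftrightarrow> left_module B l \<and> right_module B rt \<and>
    (\<forall>b\<in>B. \<forall>b'\<in>B. \<forall>x. rt (l b x) b' = l b (rt x b'))"

definition left_submodule :: "'a::complex_algebra_1 set \<Rightarrow> ('i \<Rightarrow> 'a) set \<Rightarrow> bool"
  where "left_submodule B M \<longleftrightarrow>
    0 \<in> M \<and> (\<forall>x\<in>M. \<forall>y\<in>M. x + y \<in> M) \<and> (\<forall>b\<in>B. \<forall>x\<in>M. (\<lambda>i. b * x i) \<in> M)"

text \<open>\<open>l\<close> is the left \<open>B\<close>-module with generators \<open>x i\<close> and relations \<open>Rel\<close>, the latter being elements
  of the free left module of \<open>B\<close>-valued functions on the index set.\<close>

definition presented_left_module ::
    "'a::complex_algebra_1 set \<Rightarrow> ('a \<Rightarrow> 'w::complex_vec \<Rightarrow> 'w) \<Rightarrow> ('i::finite \<Rightarrow> 'w)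
      \<Rightarrow> ('i \<Rightarrow> 'a) set \<Rightarrow> bool"
  where "presented_left_module B l x Rel \<longleftrightarrow>
    left_module B l \<and>
    (\<forall>w. \<exists>c. range c \<subseteq> B \<and> w = (\<Sum>i\<in>UNIV. l (c i) (x i))) \<and>
    {c. range c \<subseteq> B \<and> (\<Sum>i\<in>UNIV. l (c i) (x i)) = 0} = left_submodule B hull Rel"

definition free_elem :: "'a::zero \<Rightarrow> 'i \<Rightarrow> 'i \<Rightarrow> 'a"
  where "free_elem b i = (\<lambda>k. if k = i then b else 0)"

definition omega_plus_relations ::
    "nat \<Rightarrow> nat \<Rightarrow> real \<Rightarrow> ('n \<Rightarrow> weight) \<Rightarrow> 'n::finite braidings
      \<Rightarrow> ('n, 'a::complex_algebra_1) legs2 \<Rightarrow> ('n \<times> 'n \<Rightarrow> 'a) set"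
  where "omega_plus_relations r s q wt R p =
    (let X = (\<lambda>a b c d. free_elem (p a b) (c, d))
     in {tildeS234 R X a b c d - qpow q (- ww r s) *\<^sub>C X a b c d | a b c d. True} \<union>
        {E'12 r q wt (\<lambda>a b. free_elem 1 (a, b))})"

definition omega_minus_relations ::
    "nat \<Rightarrow> nat \<Rightarrow> real \<Rightarrow> ('n \<Rightarrow> weight) \<Rightarrow> 'n::finite braidings
      \<Rightarrow> ('n, 'a::complex_algebra_1) legs2 \<Rightarrow> ('n \<times> 'n \<Rightarrow> 'a) set"
  where "omega_minus_relations r s q wt R p =
    (let X = (\<lambda>a b c d. free_elem (p a b) (c, d))
     in {S123 R X a b c d - qpow q (ww r s) *\<^sub>C X a b c d | a b c d. True} \<union>
        {E'12 r q wt (\<lambda>a b. free_elem 1 (a, b))})"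

definition derivation ::
    "'a::complex_algebra_1 set \<Rightarrow> ('a \<Rightarrow> 'w::complex_vec \<Rightarrow> 'w) \<Rightarrow> ('w \<Rightarrow> 'a \<Rightarrow> 'w)
      \<Rightarrow> ('a \<Rightarrow> 'w) \<Rightarrow> bool"
  where "derivation B l rt D \<longleftrightarrow>
    (\<forall>a\<in>B. \<forall>b\<in>B. D (a + b) = D a + D b \<and> D (a * b) = l a (D b) + rt (D a) b) \<and>
    (\<forall>c. \<forall>a\<in>B. D (c *\<^sub>C a) = c *\<^sub>C D a)"

definition sum_lact ::
    "('a \<Rightarrow> 'w \<Rightarrow> 'w) \<Rightarrow> ('a \<Rightarrow> 'u \<Rightarrow> 'u) \<Rightarrow> 'a \<Rightarrow> 'w \<times> 'u \<Rightarrow> 'w \<times> 'u"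
  where "sum_lact l l' b x = (l b (fst x), l' b (snd x))"

definition sum_ract ::
    "('w \<Rightarrow> 'a \<Rightarrow> 'w) \<Rightarrow> ('u \<Rightarrow> 'a \<Rightarrow> 'u) \<Rightarrow> 'w \<times> 'u \<Rightarrow> 'a \<Rightarrow> 'w \<times> 'u"
  where "sum_ract rt rt' x b = (rt (fst x) b, rt' (snd x) b)"

section \<open>Tensor products over \<open>B\<close>\<close>

definition tensor_relations ::
    "'a set \<Rightarrow> ('u::ab_group_add \<Rightarrow> 'a \<Rightarrow> 'u) \<Rightarrow> ('a \<Rightarrow> 'w::ab_group_add \<Rightarrow> 'w)
      \<Rightarrow> ('u \<times> 'w \<Rightarrow>\<^sub>0 int) set"
  where "tensor_relations B rt l =
    {frag_of (x + x', y) - frag_of (x, y) - frag_of (x', y) | x x' y. True} \<union>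
    {frag_of (x, y + y') - frag_of (x, y) - frag_of (x, y') | x y y'. True} \<union>
    {frag_of (rt x b, y) - frag_of (x, l b y) | x b y. b \<in> B}"

definition add_subgroup :: "'a::ab_group_add set \<Rightarrow> bool"
  where "add_subgroup H \<longleftrightarrow> 0 \<in> H \<and> (\<forall>x\<in>H. \<forall>y\<in>H. x - y \<in> H)"

definition formal_sum :: "('u \<Rightarrow> 'w \<Rightarrow> 't::complex_vec) \<Rightarrow> ('u \<times> 'w \<Rightarrow>\<^sub>0 int) \<Rightarrow> 't"
  where "formal_sum tn z =
    (\<Sum>(x, y)\<in>Poly_Mapping.keys z. of_int (Poly_Mapping.lookup z (x, y)) *\<^sub>C tn x y)"

text \<open>The type \<open>'t\<close> with \<open>tn\<close> is the tensor product over \<open>B\<close> of the right module \<open>rt\<close> and the left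
  module \<open>l\<close>, i.e. the quotient of the free abelian group on pairs by the usual relations.\<close>

definition is_tensor_product ::
    "'a set \<Rightarrow> ('u::complex_vec \<Rightarrow> 'a \<Rightarrow> 'u) \<Rightarrow> ('a \<Rightarrow> 'w::complex_vec \<Rightarrow> 'w)
      \<Rightarrow> ('u \<Rightarrow> 'w \<Rightarrow> 't::complex_vec) \<Rightarrow> bool"
  where "is_tensor_product B rt l tn \<longleftrightarrow>
    surj (formal_sum tn) \<and>
    {z. formal_sum tn z = 0} = add_subgroup hull tensor_relations B rt l \<and>
    (\<forall>c x y. tn (c *\<^sub>C x) y = c *\<^sub>C tn x y)"

text \<open>The additive map induced by \<open>x \<otimes> y \<mapsto> \<phi> x y\<close>.\<close>

definition tensor_induced ::
    "('u \<Rightarrow> 'w \<Rightarrow> 't::ab_group_add) \<Rightarrow> ('u \<Rightarrow> 'w \<Rightarrow> 'z::ab_group_add) \<Rightarrow> 't \<Rightarrow> 'z"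
  where "tensor_induced tn \<phi> =
    (THE h. (\<forall>x y. h (x + y) = h x + h y) \<and> (\<forall>x y. h (tn x y) = \<phi> x y))"

definition tensor_lact ::
    "('u \<Rightarrow> 'w \<Rightarrow> 't::ab_group_add) \<Rightarrow> ('a \<Rightarrow> 'u \<Rightarrow> 'u) \<Rightarrow> 'a \<Rightarrow> 't \<Rightarrow> 't"
  where "tensor_lact tn l b = tensor_induced tn (\<lambda>x y. tn (l b x) y)"

definition tensor_ract ::
    "('u \<Rightarrow> 'w \<Rightarrow> 't::ab_group_add) \<Rightarrow> ('w \<Rightarrow> 'a \<Rightarrow> 'w) \<Rightarrow> 't \<Rightarrow> 'a \<Rightarrow> 't"
  where "tensor_ract tn rt t b = tensor_induced tn (\<lambda>x y. tn x (rt y b)) t"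

section \<open>The universal calculus in degree two\<close>

definition sub_bimodule ::
    "'a set \<Rightarrow> ('a \<Rightarrow> 't::ab_group_add \<Rightarrow> 't) \<Rightarrow> ('t \<Rightarrow> 'a \<Rightarrow> 't) \<Rightarrow> 't set \<Rightarrow> bool"
  where "sub_bimodule B l rt H \<longleftrightarrow>
    0 \<in> H \<and> (\<forall>x\<in>H. \<forall>y\<in>H. x + y \<in> H) \<and> (\<forall>b\<in>B. \<forall>x\<in>H. l b x \<in> H \<and> rt x b \<in> H)"

definition degree2_relations ::
    "'a set \<Rightarrow> ('a \<Rightarrow> 'w::complex_vec \<Rightarrow> 'w) \<Rightarrow> ('a \<Rightarrow> 'w) \<Rightarrow> ('w \<Rightarrow> 'w \<Rightarrow> 't::complex_vec) \<Rightarrow> 't set"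
  where "degree2_relations B l d tn =
    {sum_list (map (\<lambda>(a, b). tn (d a) (d b)) ps) | ps.
      set ps \<subseteq> B \<times> B \<and> sum_list (map (\<lambda>(a, b). l a (d b)) ps) = 0}"

text \<open>The ideal defining the universal calculus is generated in degree two, so its degree two part
  is a sub-bimodule of \<open>\<Omega> \<otimes>\<^sub>B \<Omega>\<close>.  Here \<open>\<pi>\<close> is the quotient map \<open>\<wedge> : \<Omega> \<otimes>\<^sub>B \<Omega> \<rightarrow> \<Omega>\<^sup>2\<close>, \<open>rt2\<close> is the induced
  right action on \<open>\<Omega>\<^sup>2\<close> and \<open>d2 : \<Omega> \<rightarrow> \<Omega>\<^sup>2\<close> is the differential.\<close>

definition is_universal_degree2 ::
    "'a set \<Rightarrow> ('a \<Rightarrow> 'w::complex_vec \<Rightarrow> 'w) \<Rightarrow> ('w \<Rightarrow> 'a \<Rightarrow> 'w) \<Rightarrow> ('a \<Rightarrow> 'w)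
      \<Rightarrow> ('w \<Rightarrow> 'w \<Rightarrow> 't::complex_vec) \<Rightarrow> ('t \<Rightarrow> 'z::complex_vec) \<Rightarrow> ('z \<Rightarrow> 'a \<Rightarrow> 'z) \<Rightarrow> ('w \<Rightarrow> 'z) \<Rightarrow> bool"
  where "is_universal_degree2 B l rt d tn \<pi> rt2 d2 \<longleftrightarrow>
    (\<forall>x y. \<pi> (x + y) = \<pi> x + \<pi> y) \<and> (\<forall>c x. \<pi> (c *\<^sub>C x) = c *\<^sub>C \<pi> x) \<and> surj \<pi> \<and>
    {t. \<pi> t = 0} =
      sub_bimodule B (tensor_lact tn l) (tensor_ract tn rt) hull degree2_relations B l d tn \<and>
    (\<forall>b\<in>B. \<forall>t. rt2 (\<pi> t) b = \<pi> (tensor_ract tn rt t b)) \<and>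
    (\<forall>x y. d2 (x + y) = d2 x + d2 y) \<and> (\<forall>c x. d2 (c *\<^sub>C x) = c *\<^sub>C d2 x) \<and>
    (\<forall>a\<in>B. \<forall>b\<in>B. d2 (l a (d b)) = \<pi> (tn (d a) (d b)))"

section \<open>Connections, torsion and cotorsion\<close>

definition is_connection ::
    "'a set \<Rightarrow> ('a \<Rightarrow> 'w::complex_vec \<Rightarrow> 'w) \<Rightarrow> ('a \<Rightarrow> 'w) \<Rightarrow> ('w \<Rightarrow> 'w \<Rightarrow> 't::complex_vec)
      \<Rightarrow> ('w \<Rightarrow> 't) \<Rightarrow> bool"
  where "is_connection B l d tn nab \<longleftrightarrow>
    (\<forall>x y. nab (x + y) = nab x + nab y) \<and> (\<forall>c x. nab (c *\<^sub>C x) = c *\<^sub>C nab x) \<and>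
    (\<forall>b\<in>B. \<forall>x. nab (l b x) = tn (d b) x + tensor_lact tn l b (nab x))"

definition torsion :: "('t \<Rightarrow> 'z::ab_group_add) \<Rightarrow> ('w \<Rightarrow> 'z) \<Rightarrow> ('w \<Rightarrow> 't) \<Rightarrow> 'w \<Rightarrow> 'z"
  where "torsion \<pi> d2 nab x = \<pi> (nab x) - d2 x"

text \<open>\<open>d \<otimes> id\<close> and \<open>(\<wedge> \<otimes> id) \<circ> (id \<otimes> \<nabla>)\<close> are not separately well defined on \<open>\<Omega> \<otimes>\<^sub>B \<Omega>\<close>; their difference
  is.  The inner induced map is \<open>\<gamma> \<otimes> \<delta> \<mapsto> (\<alpha> \<wedge> \<gamma>) \<otimes> \<delta>\<close>.\<close>

definition cotorsion ::
    "('w \<Rightarrow> 'w \<Rightarrow> 't::ab_group_add) \<Rightarrow> ('t \<Rightarrow> 'z) \<Rightarrow> ('w \<Rightarrow> 'z) \<Rightarrow> ('z \<Rightarrow> 'w \<Rightarrow> 'u::ab_group_add)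
      \<Rightarrow> ('w \<Rightarrow> 't) \<Rightarrow> 't \<Rightarrow> 'u"
  where "cotorsion tn \<pi> d2 tn2 nab =
    tensor_induced tn (\<lambda>\<alpha> \<beta>. tn2 (d2 \<alpha>) \<beta>
      - tensor_induced tn (\<lambda>\<gamma> \<delta>. tn2 (\<pi> (tn \<alpha> \<gamma>)) \<delta>) (nab \<beta>))"

text \<open>For \<open>X = \<partial>p \<otimes> \<partial>'p\<close> (resp. \<open>\<partial>'p \<otimes> \<partial>p\<close>), where \<open>\<partial>'\<close> is the antiholomorphic differential, this is
  \<open>g\<^sub>+\<^sub>-\<close> (resp. \<open>g\<^sub>-\<^sub>+\<close>).\<close>

definition metric_part ::
    "nat \<Rightarrow> real \<Rightarrow> ('n \<Rightarrow> weight) \<Rightarrow> ('n::finite, 't::complex_vec) legs4 \<Rightarrow> 't"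
  where "metric_part r q wt X = E'12 r q wt (E23 X)"

text \<open>The right-hand sides of the formulas for \<open>\<nabla>(\<partial>p)\<close>, with \<open>X = \<partial>'p \<otimes> \<partial>p\<close>, and for \<open>\<nabla>(\<partial>'p)\<close>, with
  \<open>X = \<partial>p \<otimes> \<partial>'p\<close>.  The braidings, the multiplication of a tensor by a function and \<open>q\<close> are parameters,
  so that the classical limit is the instance \<open>q = 1\<close> with flips as braidings.\<close>

definition nabla_del ::
    "nat \<Rightarrow> nat \<Rightarrow> real \<Rightarrow> ('n \<Rightarrow> weight) \<Rightarrow> 'n::finite braidings \<Rightarrow> ('n, 'a) legs2
      \<Rightarrow> ('a \<Rightarrow> 't::complex_vec \<Rightarrow> 't) \<Rightarrow> ('n, 't) legs4 \<Rightarrow> ('n, 't) legs2"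
  where "nabla_del r s q wt R p act X = (\<lambda>i j.
    qpow q (aa r s) *\<^sub>C E23 (T1234 R X) i j
    - (qpow q (aa r s) * qpow q (- wr r s)) *\<^sub>C act (p i j) (metric_part r q wt X))"

definition nabla_delbar ::
    "nat \<Rightarrow> nat \<Rightarrow> real \<Rightarrow> ('n \<Rightarrow> weight) \<Rightarrow> ('n::finite, 'a) legs2
      \<Rightarrow> ('a \<Rightarrow> 't::complex_vec \<Rightarrow> 't) \<Rightarrow> ('n, 't) legs4 \<Rightarrow> ('n, 't) legs2"
  where "nabla_delbar r s q wt p act X = (\<lambda>i j.
    E23 X i j - qpow q (- wr r s) *\<^sub>C act (p i j) (metric_part r q wt X))"

section \<open>The classical limit\<close>

text \<open>Points of the affine chart \<open>Z\<^sup>m \<noteq> 0\<close> of projective space are represented by homogeneous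
  coordinates \<open>Z\<close> with \<open>Z\<^sup>m = 1\<close>; the chart coordinates are then the \<open>Z\<^sup>i\<close> with \<open>i \<noteq> m\<close>.  The
  complexified cotangent bundle has the frame \<open>dz\<^sup>i, dz'\<^sup>i\<close> (\<open>i \<noteq> m\<close>) with \<open>z'\<close> the conjugate of \<open>z\<close>;
  forms and tensors are given by their components in this frame.  Only components with indices in
  \<open>chart_frame m\<close> are meaningful.\<close>

datatype 'n frame = Dz 'n | Dzbar 'n

definition chart_frame :: "'n \<Rightarrow> 'n frame set"
  where "chart_frame m = Dz ` (- {m}) \<union> Dzbar ` (- {m})"

fun frame_deriv :: "'n::finite frame \<Rightarrow> (complex^'n \<Rightarrow> complex) \<Rightarrow> complex^'n \<Rightarrow> complex"
  where
    "frame_deriv (Dz i) h Z =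
      (frechet_derivative h (at Z) (axis i 1) - \<i> * frechet_derivative h (at Z) (axis i \<i>)) / 2"
  | "frame_deriv (Dzbar i) h Z =
      (frechet_derivative h (at Z) (axis i 1) + \<i> * frechet_derivative h (at Z) (axis i \<i>)) / 2"

definition p_cl :: "'n::finite \<Rightarrow> 'n \<Rightarrow> complex^'n \<Rightarrow> complex"
  where "p_cl i j Z = Z $ i * cnj (Z $ j) / complex_of_real ((norm Z)\<^sup>2)"

definition dolbeault :: "(complex^'n::finite \<Rightarrow> complex) \<Rightarrow> complex^'n \<Rightarrow> 'n frame \<Rightarrow> complex"
  where "dolbeault h Z a = (case a of Dz i \<Rightarrow> frame_deriv (Dz i) h Z | Dzbar i \<Rightarrow> 0)"

definition dolbeault_bar :: "(complex^'n::finite \<Rightarrow> complex) \<Rightarrow> complex^'n \<Rightarrow> 'n frame \<Rightarrow> complex"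
  where "dolbeault_bar h Z a = (case a of Dz i \<Rightarrow> 0 | Dzbar i \<Rightarrow> frame_deriv (Dzbar i) h Z)"

definition form_tensor :: "('n frame \<Rightarrow> complex) \<Rightarrow> ('n frame \<Rightarrow> complex) \<Rightarrow> 'n frame \<Rightarrow> 'n frame \<Rightarrow> complex"
  where "form_tensor \<alpha> \<beta> = (\<lambda>a b. \<alpha> a * \<beta> b)"

text \<open>A connection on the cotangent bundle over the chart \<open>m\<close> is given by its coefficients:
  \<open>\<nabla>(dx\<^sup>c) = - \<Sum>a b. \<Gamma> c a b dx\<^sup>a \<otimes> dx\<^sup>b\<close>, with the direction of differentiation as first index.\<close>

type_synonym 'n coefficients = "complex^'n \<Rightarrow> 'n frame \<Rightarrow> 'n frame \<Rightarrow> 'n frame \<Rightarrow> complex"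

definition cov_deriv ::
    "'n::finite \<Rightarrow> 'n coefficients \<Rightarrow> (complex^'n \<Rightarrow> 'n frame \<Rightarrow> complex)
      \<Rightarrow> complex^'n \<Rightarrow> 'n frame \<Rightarrow> 'n frame \<Rightarrow> complex"
  where "cov_deriv m \<Gamma> \<omega> Z a b =
    frame_deriv a (\<lambda>W. \<omega> W b) Z - (\<Sum>c\<in>chart_frame m. \<Gamma> Z c a b * \<omega> Z c)"

definition is_classical_nabla ::
    "nat \<Rightarrow> nat \<Rightarrow> ('n \<Rightarrow> weight) \<Rightarrow> 'n::finite \<Rightarrow> 'n coefficients \<Rightarrow> bool"
  where "is_classical_nabla r s wt m \<Gamma> \<longleftrightarrow>
    (\<forall>Z. Z $ m = 1 \<longrightarrow>
      (let p = (\<lambda>i j. p_cl i j Z);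
           dp = (\<lambda>i j. dolbeault (p_cl i j) Z);
           dbp = (\<lambda>i j. dolbeault_bar (p_cl i j) Z)
       in \<forall>i j. \<forall>a\<in>chart_frame m. \<forall>b\<in>chart_frame m.
         cov_deriv m \<Gamma> (dolbeault (p_cl i j)) Z a b
           = nabla_del r s 1 wt flip_braidings p scaleC (concat_legs form_tensor dbp dp) i j a b \<and>
         cov_deriv m \<Gamma> (dolbeault_bar (p_cl i j)) Z a b
           = nabla_delbar r s 1 wt p scaleC (concat_legs form_tensor dp dbp) i j a b))"

definition fubini_study :: "complex^'n::finite \<Rightarrow> 'n frame \<Rightarrow> 'n frame \<Rightarrow> complex"
  where "fubini_study Z a b =
    (let n = complex_of_real ((norm Z)\<^sup>2);
         h = (\<lambda>i j. (n * of_bool (i = j) - cnj (Z $ i) * Z $ j) / n\<^sup>2)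
     in case (a, b) of
          (Dz i, Dzbar j) \<Rightarrow> h i j
        | (Dzbar j, Dz i) \<Rightarrow> h i j
        | _ \<Rightarrow> 0)"

text \<open>Torsion free (\<open>\<wedge> \<circ> \<nabla> = d\<close>, i.e. \<open>\<wedge>\<nabla>(dx\<^sup>c) = 0\<close> on the coordinate frame) and metric compatible.\<close>

definition is_levi_civita ::
    "'n::finite \<Rightarrow> (complex^'n \<Rightarrow> 'n frame \<Rightarrow> 'n frame \<Rightarrow> complex) \<Rightarrow> 'n coefficients \<Rightarrow> bool"
  where "is_levi_civita m G \<Gamma> \<longleftrightarrow>
    (\<forall>Z. Z $ m = 1 \<longrightarrow> (\<forall>a\<in>chart_frame m. \<forall>b\<in>chart_frame m. \<forall>c\<in>chart_frame m.
      \<Gamma> Z c a b = \<Gamma> Z c b a \<and>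
      frame_deriv c (\<lambda>W. G W a b) Z
        = (\<Sum>e\<in>chart_frame m. \<Gamma> Z e c a * G Z e b + \<Gamma> Z e c b * G Z a e)))"

end

(*
The simple modules V(omega_1) and V(omega_r) are chains e_0 -> e_1 -> ... -> e_r under the F_i, so the
three braidings are explicit matrices: Hecke-type ones for V (x) V and V* (x) V*, an upper triangular
correction of the flip for V (x) V*.  They enter only through a few leg identities: the Hecke relation
and the rules for moving the contractions E and E' through S, S~ and T.

For the matrices p, P = dp, Q = dbar p over the calculus (products contracted by E) these identities give
p P = 0 = Q p, p Q = Q, P p = P, and the products M = Q (x) P and M' = P (x) Q satisfy M p = T (p M)
and M = q^(-(omega_s, 2 rho)) p g, with g = g_-+ central.  Applying d to the bimodule relations
P p = q^2 T (p P) and Q p = q^(-2) T (p Q) gives two relations in degree two.  The trace of the first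
one yields g_+- = - g_-+ in Omega^2 and hence torsion freeness; the second one, tensored with P, is what
the cotorsion of the metric reduces to.

In the classical limit the formulas for the connection determine its Christoffel symbols in the chart
Z^m = 1, where the forms dp^(i m) and dbar p^(m j) already span; they are those of the Fubini-Study metric.
*)

theory Submission
  imports Defs
begin

section \<open>Operators acting on legs\<close>

text \<open>The braidings are given by a description operator and the module only by its simplicity
  and highest weight, so nothing can be computed before the matrices of the E i and F i are known.
  They follow from the fact that a vector killed by all E i and supported below the top vanishes; a
  braiding is then identified by its value on one generating vector. What survives of this are two
  exponents: \<nu> = -1/(r+1) = (omega_s, w_0 omega_s), and the exponent -\<nu> - 1 - r of the
  factor \<theta> by which E after the mixed braiding differs from E'. The constant in the
  connection is \<theta> q^(omega_s, omega_s) = q^(-(omega_s, 2 rho)). The matrix identities rest on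
  p p = p, a consequence of E vf = 1: its derivative splits P and Q into two products each, and
  contracting the module relations kills one of them. The obstacle in the cotorsion is a single
  term, the trace of Q times the contraction of T (Q (x) P). For it the relation for Q p is tensored
  with P, T is applied to the last two factors, and the trace, which is invariant under moving one
  factor past the other two, removes the double braiding.\<close>

lemma scaleC_zero_left: "0 *\<^sub>C (x::'x::complex_vec) = 0"
  using scaleC_add_left[of 0 0 x] by simp

lemma scaleC_minus_right: "c *\<^sub>C (- x) = - (c *\<^sub>C (x::'x::complex_vec))"
  using scaleC_add_right[of c x "- x"] by (simp add: scaleC_zero_right eq_neg_iff_add_eq_0 add.commute)

lemma scaleC_minus_left: "(- c) *\<^sub>C x = - (c *\<^sub>C (x::'x::complex_vec))"
  using scaleC_add_left[of c "- c" x] by (simp add: scaleC_zero_left eq_neg_iff_add_eq_0 add.commute)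

lemma scaleC_diff_right: "c *\<^sub>C (x - y) = c *\<^sub>C x - c *\<^sub>C (y::'x::complex_vec)"
  using scaleC_add_right[of c x "- y"] by (simp add: scaleC_minus_right)

lemma scaleC_diff_left: "(c - d) *\<^sub>C x = c *\<^sub>C x - d *\<^sub>C (x::'x::complex_vec)"
  using scaleC_add_left[of c "- d" x] by (simp add: scaleC_minus_left)

lemma scaleC_sum_right: "c *\<^sub>C (\<Sum>i\<in>A. f i) = (\<Sum>i\<in>A. c *\<^sub>C (f i :: 'x::complex_vec))"
  by (induction A rule: infinite_finite_induct) (simp_all add: scaleC_zero_right scaleC_add_right)

lemma scaleC_sum_left: "(\<Sum>i\<in>A. f i) *\<^sub>C x = (\<Sum>i\<in>A. f i *\<^sub>C (x :: 'x::complex_vec))"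
  by (induction A rule: infinite_finite_induct) (simp_all add: scaleC_zero_left scaleC_add_left)

lemma scaleC_fun_apply: "(c *\<^sub>C (f :: 'b \<Rightarrow> 'x::complex_vec)) a = c *\<^sub>C f a"
  by (simp add: scaleC_fun_def)

lemma scaleC_cancel: "c \<noteq> 0 \<Longrightarrow> c *\<^sub>C x = c *\<^sub>C y \<longleftrightarrow> x = (y::'x::complex_vec)"
  by (metis left_inverse scaleC_one scaleC_scaleC)

lemma sum_fun_app: "(\<Sum>i\<in>A. f i) a = (\<Sum>i\<in>A. (f i a :: 'x::complex_vec))"
  by (induction A rule: infinite_finite_induct) (simp_all)

definition csubspace :: "'x::complex_vec set \<Rightarrow> bool"
  where "csubspace S \<longleftrightarrow> 0 \<in> S \<and> (\<forall>x\<in>S. \<forall>y\<in>S. x + y \<in> S) \<and> (\<forall>c. \<forall>x\<in>S. c *\<^sub>C x \<in> S)"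

text \<open>Linearity is relative to a subspace because evaluation in a presented module is linear
  only on functions with values in B.\<close>

definition clinear_on :: "'x::complex_vec set \<Rightarrow> ('x \<Rightarrow> 'y::complex_vec) \<Rightarrow> bool"
  where "clinear_on S G \<longleftrightarrow> csubspace S \<and> (\<forall>x\<in>S. \<forall>y\<in>S. G (x + y) = G x + G y) \<and>
    (\<forall>c. \<forall>x\<in>S. G (c *\<^sub>C x) = c *\<^sub>C G x)"

abbreviation clinear :: "('x::complex_vec \<Rightarrow> 'y::complex_vec) \<Rightarrow> bool"
  where "clinear \<equiv> clinear_on UNIV"

lemma csubspace_UNIV [simp]: "csubspace UNIV"
  by (simp add: csubspace_def)

lemma clinear_onI:
  "csubspace S \<Longrightarrow> (\<And>x y. x \<in> S \<Longrightarrow> y \<in> S \<Longrightarrow> G (x + y) = G x + G y) \<Longrightarrow>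
    (\<And>c x. x \<in> S \<Longrightarrow> G (c *\<^sub>C x) = c *\<^sub>C G x) \<Longrightarrow> clinear_on S G"
  by (simp add: clinear_on_def)

lemma clinearI:
  "(\<And>x y. G (x + y) = G x + G y) \<Longrightarrow> (\<And>c x. G (c *\<^sub>C x) = c *\<^sub>C G x) \<Longrightarrow> clinear G"
  by (simp add: clinear_on_def)

lemma csubspace_scale: "csubspace S \<Longrightarrow> x \<in> S \<Longrightarrow> c *\<^sub>C x \<in> S"
  by (simp add: csubspace_def)

lemma csubspace_diff: "csubspace S \<Longrightarrow> x \<in> S \<Longrightarrow> y \<in> S \<Longrightarrow> x - y \<in> S"
  unfolding csubspace_def
  by (metis add_uminus_conv_diff scaleC_minus_left scaleC_one)

lemma csubspace_sum: "csubspace S \<Longrightarrow> (\<And>i. i \<in> A \<Longrightarrow> f i \<in> S) \<Longrightarrow> (\<Sum>i\<in>A. f i) \<in> S"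
  by (induction A rule: infinite_finite_induct) (simp_all add: csubspace_def)

lemma clinear_on_zero: "clinear_on S G \<Longrightarrow> G 0 = 0"
  unfolding clinear_on_def csubspace_def by (metis add_cancel_right_right)

lemma clinear_on_add: "clinear_on S G \<Longrightarrow> x \<in> S \<Longrightarrow> y \<in> S \<Longrightarrow> G (x + y) = G x + G y"
  by (simp add: clinear_on_def)

lemma clinear_on_scale: "clinear_on S G \<Longrightarrow> x \<in> S \<Longrightarrow> G (c *\<^sub>C x) = c *\<^sub>C G x"
  by (simp add: clinear_on_def)

lemma clinear_on_diff:
  assumes "clinear_on S G" "x \<in> S" "y \<in> S" shows "G (x - y) = G x - G y"
proof -
  have "csubspace S" using assms by (simp add: clinear_on_def)
  then have "G ((x - y) + y) = G (x - y) + G y"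
    using assms csubspace_diff clinear_on_add by blast
  then show ?thesis by (simp add: algebra_simps)
qed

lemma clinear_on_sum:
  assumes "clinear_on S G" and "\<And>i. i \<in> A \<Longrightarrow> f i \<in> S"
  shows "G (\<Sum>i\<in>A. f i) = (\<Sum>i\<in>A. G (f i))"
  using assms(2)
proof (induction A rule: infinite_finite_induct)
  case (insert x F)
  have "csubspace S" using assms by (simp add: clinear_on_def)
  then show ?case using insert assms(1) csubspace_sum[of S F f]
    by (simp add: clinear_on_add)
qed (simp_all add: clinear_on_zero[OF assms(1)])

text \<open>Function spaces carry the pointwise structure, so an operator on two legs also acts on
  longer families whose further legs are arguments of the coefficients; such an argument may be
  fixed before or after.\<close>

lemma on_legs_apply: "on_legs R X a b c = on_legs R (\<lambda>i j. X i j c) a b"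
  by (simp add: on_legs_def sum_fun_app scaleC_fun_apply case_prod_unfold)

lemma on_legs_in: "csubspace S \<Longrightarrow> (\<And>i j. X i j \<in> S) \<Longrightarrow> on_legs R X a b \<in> S"
  unfolding on_legs_def by (intro csubspace_sum) (auto intro: csubspace_scale)

lemma on_legs_map_on:
  assumes "clinear_on S G" "\<And>i j. X i j \<in> S"
  shows "G (on_legs R X a b) = on_legs R (\<lambda>i j. G (X i j)) a b"
proof -
  have S: "csubspace S" using assms by (simp add: clinear_on_def)
  show ?thesis unfolding on_legs_def
    by (subst clinear_on_sum[OF assms(1)])
      (auto intro!: sum.cong csubspace_scale S assms simp: clinear_on_scale[OF assms(1) assms(2)])
qed

lemmas on_legs_map = on_legs_map_on[where S = UNIV, simplified]

lemma clinear_on_legs: "clinear (on_legs R)"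
  by (rule clinearI; rule ext; rule ext)
    (simp_all add: on_legs_def case_prod_unfold scaleC_add_right sum.distrib scaleC_sum_right
      scaleC_fun_apply scaleC_scaleC mult.commute)

lemma on_legs_mult: "on_legs A (on_legs B X) = on_legs (A ** B) X"
proof (intro ext)
  fix a b
  have "on_legs A (on_legs B X) a b
    = (\<Sum>x\<in>UNIV. \<Sum>y\<in>UNIV. (A $ (a, b) $ x * B $ x $ y) *\<^sub>C X (fst y) (snd y))"
    by (simp add: on_legs_def case_prod_unfold scaleC_sum_right scaleC_scaleC)
  also have "\<dots> = on_legs (A ** B) X a b"
    by (subst sum.swap)
      (simp add: on_legs_def case_prod_unfold matrix_matrix_mult_def scaleC_sum_left)
  finally show "on_legs A (on_legs B X) a b = on_legs (A ** B) X a b" .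
qed

lemma on_legs_id [simp]: "on_legs (mat 1) X = X"
proof (intro ext)
  fix a b
  have "on_legs (mat 1) X a b = (\<Sum>y\<in>UNIV. if y = (a, b) then X a b else 0)"
    unfolding on_legs_def case_prod_unfold
    by (intro sum.cong) (auto simp: mat_def scaleC_one scaleC_zero_left)
  then show "on_legs (mat 1) X a b = X a b" by simp
qed

lemma on_legs_add: "on_legs (A + B) X = on_legs A X + on_legs B X"
  by (intro ext) (simp add: on_legs_def case_prod_unfold scaleC_add_left sum.distrib)

text \<open>Operators on disjoint pairs of legs commute, since the one given by B is a linear map on
  the coefficients seen by the one given by A.\<close>

lemma on_legs_commute:
  "on_legs A (\<lambda>i j. on_legs B (X i j)) a b = on_legs B (on_legs A X a b)"
  by (rule on_legs_map[OF clinear_on_legs, symmetric])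

text \<open>The parts of \<^const>\<open>S123\<close> and \<^const>\<open>tildeS234\<close> acting on three legs; further legs are
  carried by the coefficients.\<close>

definition S3 :: "'n::finite braidings \<Rightarrow> ('n \<Rightarrow> 'n \<Rightarrow> 'n \<Rightarrow> 'x::complex_vec) \<Rightarrow> 'n \<Rightarrow> 'n \<Rightarrow> 'n \<Rightarrow> 'x"
  where "S3 R X = (\<lambda>a. on_legs (RVD R)
    (on_legs (RVV R) (\<lambda>a. on_legs (matrix_inv (RVD R)) (X a)) a))"

definition tS3 :: "'n::finite braidings \<Rightarrow> ('n \<Rightarrow> 'n \<Rightarrow> 'n \<Rightarrow> 'x::complex_vec) \<Rightarrow> 'n \<Rightarrow> 'n \<Rightarrow> 'n \<Rightarrow> 'x"
  where "tS3 R X = on_legs (RVD R)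
    (\<lambda>a. on_legs (matrix_inv (RDD R)) (on_legs (matrix_inv (RVD R)) X a))"

lemma on_legs23_eq: "on_legs23 R X = (\<lambda>a. on_legs R (X a))"
  by (intro ext) (simp add: on_legs23_def on_legs_apply[of R "X _"])

lemma on_legs12_eq: "on_legs12 R X = on_legs R X"
  by (intro ext) (simp add: on_legs12_def on_legs_apply)

lemma on_legs34_eq: "on_legs34 R X = (\<lambda>a b. on_legs R (X a b))"
  by (intro ext) (simp add: on_legs34_def)

lemma S123_eq: "S123 R X = S3 R X"
  by (simp add: S123_def S3_def on_legs23_eq on_legs12_eq)

lemma tildeS234_eq: "tildeS234 R X = (\<lambda>a. tS3 R (X a))"
  by (simp add: tildeS234_def tS3_def on_legs23_eq on_legs34_eq)

lemma on_legs_map_on_apply: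
  assumes "clinear_on S G" "\<And>i j k. X i j k \<in> S"
  shows "G (on_legs R X a b c) = on_legs R (\<lambda>i j k. G (X i j k)) a b c"
  by (subst (1 2) on_legs_apply) (rule on_legs_map_on[OF assms(1)], rule assms(2))

lemma on_legs_in_apply: "csubspace S \<Longrightarrow> (\<And>i j k. X i j k \<in> S) \<Longrightarrow> on_legs R X a b c \<in> S"
  by (subst on_legs_apply) (intro on_legs_in)

lemma S3_map_on:
  assumes "clinear_on S G" "\<And>i j k. X i j k \<in> S"
  shows "G (S3 R X a b c) = S3 R (\<lambda>i j k. G (X i j k)) a b c"
proof -
  have S: "csubspace S" using assms by (simp add: clinear_on_def)
  let ?Ri = "matrix_inv (RVD R)"
  have 1: "on_legs ?Ri (X i) j k \<in> S" for i j k by (intro on_legs_in S assms)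
  show ?thesis unfolding S3_def
    by (subst on_legs_map_on[OF assms(1)], intro on_legs_in_apply S 1,
        subst on_legs_map_on_apply[OF assms(1)], intro 1,
        subst on_legs_map_on[OF assms(1)], intro assms, rule refl)
qed

lemma tS3_map_on:
  assumes "clinear_on S G" "\<And>i j k. X i j k \<in> S"
  shows "G (tS3 R X a b c) = tS3 R (\<lambda>i j k. G (X i j k)) a b c"
proof -
  have S: "csubspace S" using assms by (simp add: clinear_on_def)
  let ?Ri = "matrix_inv (RVD R)"
  have 1: "on_legs ?Ri X i j k \<in> S" for i j k by (intro on_legs_in_apply S assms)
  have 2: "on_legs (matrix_inv (RDD R)) (on_legs ?Ri X i) j k \<in> S" for i j k
    by (intro on_legs_in S 1)
  show ?thesis unfolding tS3_def
    by (subst on_legs_map_on_apply[OF assms(1)], intro 2,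
        subst on_legs_map_on[OF assms(1)], intro 1,
        subst on_legs_map_on_apply[OF assms(1)], intro assms, rule refl)
qed

lemmas S3_map = S3_map_on[where S = UNIV, simplified]
lemmas tS3_map = tS3_map_on[where S = UNIV, simplified]

lemma sum_UNIV_prod: "(\<Sum>x\<in>UNIV. f x) = (\<Sum>i\<in>UNIV. \<Sum>j\<in>UNIV. f (i, j))"
  by (simp add: sum.cartesian_product)

lemma on_legs_double:
  "on_legs R X a b = (\<Sum>i\<in>UNIV. \<Sum>j\<in>UNIV. R $ (a, b) $ (i, j) *\<^sub>C X i j)"
  by (simp add: on_legs_def sum_UNIV_prod)

text \<open>Naturality of the braiding with respect to a pairing, in coordinates: if a leg is moved
  past a pair of legs that is then contracted, the pair may as well be contracted at once. The
  hypothesis is what remains to be known about matrix entries; u and u' are the weights of the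
  pairing.\<close>

lemma contract_two:
  assumes "\<And>c m n j. (\<Sum>a\<in>UNIV. \<Sum>i\<in>UNIV. u a * A $ (a, c) $ (i, j) * B $ (a, i) $ (m, n))
    = (if m = c \<and> n = j then u' n else 0)"
  shows "(\<Sum>a\<in>UNIV. u a *\<^sub>C on_legs A (on_legs B X a) a c) = (\<Sum>n\<in>UNIV. u' n *\<^sub>C X c n n)"
proof -
  have "(\<Sum>a\<in>UNIV. u a *\<^sub>C on_legs A (on_legs B X a) a c)
    = (\<Sum>a\<in>UNIV. \<Sum>i\<in>UNIV. \<Sum>j\<in>UNIV. \<Sum>m\<in>UNIV. \<Sum>n\<in>UNIV.
        (u a * A $ (a, c) $ (i, j) * B $ (a, i) $ (m, n)) *\<^sub>C X m n j)"
    by (simp add: on_legs_double sum_fun_app scaleC_fun_apply scaleC_sum_right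
        scaleC_scaleC mult.assoc)
  also have "\<dots> = (\<Sum>j\<in>UNIV. \<Sum>m\<in>UNIV. \<Sum>n\<in>UNIV. \<Sum>a\<in>UNIV. \<Sum>i\<in>UNIV.
        (u a * A $ (a, c) $ (i, j) * B $ (a, i) $ (m, n)) *\<^sub>C X m n j)"
    unfolding sum.cartesian_product UNIV_Times_UNIV
    by (rule sum.reindex_bij_witness[of _ "\<lambda>(j, m, n, a, i). (a, i, j, m, n)" "\<lambda>(a, i, j, m, n). (j, m, n, a, i)"])
      auto
  also have "\<dots> = (\<Sum>j\<in>UNIV. \<Sum>m\<in>UNIV. \<Sum>n\<in>UNIV. (if m = c \<and> n = j then u' n else 0) *\<^sub>C X m n j)"
    by (simp add: scaleC_sum_left[symmetric] assms)
  also have "\<dots> = (\<Sum>j\<in>UNIV. \<Sum>m\<in>UNIV. if m = c then u' j *\<^sub>C X c j j else 0)"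
    by (intro sum.cong refl) (auto simp: if_distrib[of "\<lambda>x. x *\<^sub>C _"] scaleC_zero_left cong: if_cong)
  also have "\<dots> = (\<Sum>n\<in>UNIV. u' n *\<^sub>C X c n n)" by simp
  finally show ?thesis .
qed

section \<open>Powers of q\<close>

lemma qpow_add: "0 < q \<Longrightarrow> qpow q (x + y) = qpow q x * qpow q y"
  by (simp add: qpow_def powr_add)

lemma qpow_0 [simp]: "0 < q \<Longrightarrow> qpow q 0 = 1"
  by (simp add: qpow_def)

lemma qpow_nonzero: "0 < q \<Longrightarrow> qpow q x \<noteq> 0"
  by (simp add: qpow_def)

lemma qpow_minus: "0 < q \<Longrightarrow> qpow q (- x) = inverse (qpow q x)"
  by (simp add: qpow_def powr_minus)

lemma qpow_diff: "0 < q \<Longrightarrow> qpow q (x - y) = qpow q x / qpow q y"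
  by (simp add: qpow_def powr_diff)

text \<open>The coefficient q - 1/q of the Hecke relation, and with it of every deviation of a
  braiding from a flip.\<close>

definition qdiff :: "real \<Rightarrow> complex"
  where "qdiff q = qpow q 1 - qpow q (- 1)"

section \<open>Explicit braidings\<close>

text \<open>With \<open>k\<close> the position of a basis vector in the chain and \<open>\<nu> = (\<omega>\<^sub>s, w\<^sub>0 \<omega>\<^sub>s) = - 1 / (r + 1)\<close>,
  \<open>hecke\<close> is the braiding of \<open>V \<otimes> V\<close> or, for the reversed order \<open>gt\<close>, of \<open>V\<^sup>* \<otimes> V\<^sup>*\<close>, and \<open>mixed\<close> that of
  \<open>V \<otimes> V\<^sup>*\<close>.\<close>

definition hecke :: "real \<Rightarrow> real \<Rightarrow> ('n \<Rightarrow> 'n \<Rightarrow> bool) \<Rightarrow> complex^('n \<times> 'n)^('n::finite \<times> 'n)"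
  where "hecke q \<nu> gt = (\<chi> x y. qpow q \<nu> *
    ((if y = prod.swap x then if fst x = snd x then qpow q 1 else 1 else 0)
      + (if gt (fst x) (snd x) \<and> y = x then qdiff q else 0)))"

text \<open>By the Hecke relation the inverse is the same matrix with q replaced by 1/q and the
  correction moved to the opposite order.\<close>

definition hecke_inv :: "real \<Rightarrow> real \<Rightarrow> ('n \<Rightarrow> 'n \<Rightarrow> bool) \<Rightarrow> complex^('n \<times> 'n)^('n::finite \<times> 'n)"
  where "hecke_inv q \<nu> gt = (\<chi> x y. qpow q (- \<nu>) *
    ((if y = prod.swap x then if fst x = snd x then qpow q (- 1) else 1 else 0)
      - (if gt (snd x) (fst x) \<and> y = x then qdiff q else 0)))"

definition mixed :: "real \<Rightarrow> real \<Rightarrow> ('n \<Rightarrow> nat) \<Rightarrow> complex^('n \<times> 'n)^('n::finite \<times> 'n)"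
  where "mixed q \<nu> k = (\<chi> x y. qpow q (- \<nu>) *
    ((if y = prod.swap x then if fst x = snd x then qpow q (- 1) else 1 else 0)
      - (if fst x = snd x \<and> fst y = snd y \<and> k (fst x) < k (fst y)
         then qdiff q * qpow q (2 * real (k (fst x)) - 2 * real (k (fst y))) else 0)))"

text \<open>Only the pairs (a, a) have weight zero in V (x) V', so the correction to the flip is
  confined to them. Its entries are constant here, while those of \<open>mixed\<close> carry the
  quotients of the weights of E' in the two ranks; this makes the inverse the easier of the
  two.\<close>

definition mixed_inv :: "real \<Rightarrow> real \<Rightarrow> ('n \<Rightarrow> nat) \<Rightarrow> complex^('n \<times> 'n)^('n::finite \<times> 'n)"
  where "mixed_inv q \<nu> k = (\<chi> x y. qpow q \<nu> *
    ((if y = prod.swap x then if fst x = snd x then qpow q 1 else 1 else 0)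
      + (if fst x = snd x \<and> fst y = snd y \<and> k (fst x) < k (fst y) then qdiff q else 0)))"

text \<open>The source of all telescoping sums: steps of two in the exponent match the two terms of
  q - 1/q.\<close>

lemma qdiff_qpow:
  assumes "0 < q" shows "qdiff q * qpow q x = qpow q (x + 1) - qpow q (x - 1)"
  unfolding qdiff_def left_diff_distrib qpow_add[OF assms, symmetric] by (simp add: add.commute)

lemma sum_if_Collect:
  "(\<Sum>a\<in>UNIV. if P a then f a else 0) = (\<Sum>a\<in>{a::'i::finite. P a}. f a :: 'x::comm_monoid_add)"
  by (simp add: sum.If_cases)

lemma qpow_telescope_nat:
  assumes "0 < q"
  shows "qdiff q * (\<Sum>t\<in>{i<..<Suc (i + n)}. qpow q (2 * real t))
    = qpow q (2 * real (Suc (i + n)) - 1) - qpow q (2 * real i + 1)"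
proof (induction n)
  case 0
  have "{i<..<Suc i} = {}" by auto
  then show ?case by (simp add: add.commute)
next
  case (Suc n)
  have "{i<..<Suc (i + Suc n)} = insert (Suc (i + n)) {i<..<Suc (i + n)}" by auto
  then have "qdiff q * (\<Sum>t\<in>{i<..<Suc (i + Suc n)}. qpow q (2 * real t))
    = qdiff q * qpow q (2 * real (Suc (i + n))) + qdiff q * (\<Sum>t\<in>{i<..<Suc (i + n)}. qpow q (2 * real t))"
    by (simp only: sum.insert finite_greaterThanLessThan greaterThanLessThan_iff less_irrefl
        simp_thms distrib_left)
  moreover have "2 * real (Suc (i + Suc n)) - 1 = 2 * real (Suc (i + n)) + 1" by simp
  ultimately show ?case unfolding Suc.IH qdiff_qpow[OF assms] by simp
qed

lemma qpow_telescope0_nat: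
  assumes "0 < q"
  shows "qdiff q * (\<Sum>t<n. qpow q (2 * real t)) = qpow q (2 * real n - 1) - qpow q (- 1)"
proof (induction n)
  case (Suc n)
  have "2 * real (Suc n) - 1 = 2 * real n + 1" by simp
  then show ?case unfolding sum.lessThan_Suc distrib_left Suc.IH qdiff_qpow[OF assms] by (simp add: add.commute)
qed simp

text \<open>The rank k a will be the number of lowering operators that lead from the highest weight
  vector to the basis vector a.\<close>

locale ranked_basis =
  fixes q :: real and r :: nat and k :: "'n::finite \<Rightarrow> nat"
  assumes q: "0 < q" and k: "bij_betw k UNIV {..r}"
begin

lemma rank_eq_iff: "k a = k b \<longleftrightarrow> a = b"
  using k by (meson UNIV_I bij_betw_imp_inj_on inj_onD)

lemma sum_rank: "(\<Sum>a\<in>{a. P (k a)}. f (k a)) = (\<Sum>t\<in>{t. t \<le> r \<and> P t}. f t)"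
proof -
  have "bij_betw k {a. P (k a)} {t. t \<le> r \<and> P t}"
    using k unfolding bij_betw_def by (force simp: inj_on_def set_eq_iff)
  then show ?thesis by (rule sum.reindex_bij_betw)
qed

lemma rank_le: "k a \<le> r"
  using k by (auto simp: bij_betw_def)

lemma qpow_telescope:
  assumes "k c < k j"
  shows "qdiff q * (\<Sum>a\<in>{a. k c < k a \<and> k a < k j}. qpow q (2 * real (k a)))
    = qpow q (2 * real (k j) - 1) - qpow q (2 * real (k c) + 1)"
proof -
  have "{t. t \<le> r \<and> k c < t \<and> t < k j} = {k c<..<k j}" using rank_le[of j] by auto
  then have "(\<Sum>a\<in>{a. k c < k a \<and> k a < k j}. qpow q (2 * real (k a)))
    = (\<Sum>t\<in>{k c<..<k j}. qpow q (2 * real t))"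
    using sum_rank[where P = "\<lambda>t. k c < t \<and> t < k j" and f = "\<lambda>t. qpow q (2 * real t)"] by simp
  then show ?thesis
    using qpow_telescope_nat[OF q, of "k c" "k j - k c - 1"] assms by simp
qed

lemma qpow_telescope_neg:
  assumes "k c < k j"
  shows "qdiff q * (\<Sum>a\<in>{a. k c < k a \<and> k a < k j}. qpow q (- (2 * real (k a))))
    = qpow q (- (2 * real (k c)) - 1) - qpow q (1 - 2 * real (k j))"
proof -
  have "{t. t \<le> r \<and> k c < t \<and> t < k j} = {k c<..<k j}" using rank_le[of j] by auto
  then have 1: "(\<Sum>a\<in>{a. k c < k a \<and> k a < k j}. qpow q (- (2 * real (k a))))
    = (\<Sum>t\<in>{k c<..<k j}. qpow q (- (2 * real t)))"
    using sum_rank[where P = "\<lambda>t. k c < t \<and> t < k j" and f = "\<lambda>t. qpow q (- (2 * real t))"] by simp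
  \<comment> \<open>Replacing q by 1/q changes the sign of every exponent and of
    \<open>qdiff\<close>, so the sum with positive exponents for 1/q is the one wanted.\<close>
  have 2: "qpow (1 / q) x = qpow q (- x)" for x
    using q by (simp add: qpow_def powr_minus powr_divide inverse_eq_divide)
  have 3: "qdiff (1 / q) = - qdiff q" by (simp add: qdiff_def 2)
  have 4: "Suc (k c + (k j - k c - 1)) = k j" using assms by simp
  have "0 < 1 / q" using q by simp
  note 5 = qpow_telescope_nat[OF this, of "k c" "k j - k c - 1", unfolded 2 3 4]
  have "qdiff q * (\<Sum>t\<in>{k c<..<k j}. qpow q (- (2 * real t)))
    = - (- qdiff q * (\<Sum>t\<in>{k c<..<k j}. qpow q (- (2 * real t))))"
    by simp
  also have "\<dots> = qpow q (- (2 * real (k c) + 1)) - qpow q (- (2 * real (k j) - 1))"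
    unfolding 5 by (rule minus_diff_eq)
  finally have "qdiff q * (\<Sum>t\<in>{k c<..<k j}. qpow q (- (2 * real t)))
    = qpow q (- (2 * real (k c) + 1)) - qpow q (- (2 * real (k j) - 1))" .
  then show ?thesis unfolding 1 minus_add_distrib minus_diff_eq by simp
qed

lemma qpow_telescope0:
  "qdiff q * (\<Sum>a\<in>{a. k a < k j}. qpow q (2 * real (k a))) = qpow q (2 * real (k j) - 1) - qpow q (- 1)"
proof -
  have "{t. t \<le> r \<and> t < k j} = {..<k j}" using rank_le[of j] by auto
  then show ?thesis
    using sum_rank[where P = "\<lambda>t. t < k j" and f = "\<lambda>t. qpow q (2 * real t)"] qpow_telescope0_nat[OF q, of "k j"] by simp
qed

abbreviation (input) "gtk \<equiv> \<lambda>a b. k b < k a"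
abbreviation (input) "ltk \<equiv> \<lambda>a b. k a < k b"

text \<open>A row of a braiding has one entry from the flip and the others from the correction; for
  a fixed second index the sum over the first one collapses to at most two terms. F is in general a
  column of the matrix standing to the right in a product.\<close>

lemma hecke_sum:
  "(\<Sum>i\<in>UNIV. hecke q \<nu> gt $ (a, c) $ (i, j) * F i) = qpow q \<nu> *
    ((if j = a then (if a = c then qpow q 1 else 1) * F c else 0)
      + (if gt a c \<and> j = c then qdiff q * F a else 0))"
proof -
  have "(\<Sum>i\<in>UNIV. hecke q \<nu> gt $ (a, c) $ (i, j) * F i) = qpow q \<nu> *
    ((\<Sum>i\<in>UNIV. if i = c then (if j = a then (if a = c then qpow q 1 else 1) * F c else 0) else 0)
      + (\<Sum>i\<in>UNIV. if i = a then (if gt a c \<and> j = c then qdiff q * F a else 0) else 0))"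
    unfolding hecke_def sum_distrib_left sum.distrib[symmetric]
    by (intro sum.cong refl) (auto simp: algebra_simps)
  then show ?thesis by simp
qed

lemma hecke_inv_sum:
  "(\<Sum>i\<in>UNIV. hecke_inv q \<nu> gt $ (a, c) $ (i, j) * F i) = qpow q (- \<nu>) *
    ((if j = a then (if a = c then qpow q (- 1) else 1) * F c else 0)
      - (if gt c a \<and> j = c then qdiff q * F a else 0))"
proof -
  have "(\<Sum>i\<in>UNIV. hecke_inv q \<nu> gt $ (a, c) $ (i, j) * F i) = qpow q (- \<nu>) *
    ((\<Sum>i\<in>UNIV. if i = c then (if j = a then (if a = c then qpow q (- 1) else 1) * F c else 0) else 0)
      - (\<Sum>i\<in>UNIV. if i = a then (if gt c a \<and> j = c then qdiff q * F a else 0) else 0))"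
    unfolding hecke_inv_def sum_distrib_left sum_subtractf[symmetric]
    by (intro sum.cong refl) (auto simp: algebra_simps)
  then show ?thesis by simp
qed

lemma mixed_sum:
  "(\<Sum>i\<in>UNIV. mixed q \<nu> k $ (a, c) $ (i, j) * F i) = qpow q (- \<nu>) *
    ((if j = a then (if a = c then qpow q (- 1) else 1) * F c else 0)
      - (if a = c \<and> k a < k j then qdiff q * qpow q (2 * real (k a) - 2 * real (k j)) * F j else 0))"
proof -
  have "(\<Sum>i\<in>UNIV. mixed q \<nu> k $ (a, c) $ (i, j) * F i) = qpow q (- \<nu>) *
    ((\<Sum>i\<in>UNIV. if i = c then (if j = a then (if a = c then qpow q (- 1) else 1) * F c else 0) else 0)
      - (\<Sum>i\<in>UNIV. if i = j then (if a = c \<and> k a < k j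
           then qdiff q * qpow q (2 * real (k a) - 2 * real (k j)) * F j else 0) else 0))"
    unfolding mixed_def sum_distrib_left sum_subtractf[symmetric]
    by (intro sum.cong refl) (auto simp: algebra_simps)
  then show ?thesis by simp
qed

lemma mixed_inv_sum:
  "(\<Sum>i\<in>UNIV. mixed_inv q \<nu> k $ (a, c) $ (i, j) * F i) = qpow q \<nu> *
    ((if j = a then (if a = c then qpow q 1 else 1) * F c else 0)
      + (if a = c \<and> k a < k j then qdiff q * F j else 0))"
proof -
  have "(\<Sum>i\<in>UNIV. mixed_inv q \<nu> k $ (a, c) $ (i, j) * F i) = qpow q \<nu> *
    ((\<Sum>i\<in>UNIV. if i = c then (if j = a then (if a = c then qpow q 1 else 1) * F c else 0) else 0)
      + (\<Sum>i\<in>UNIV. if i = j then (if a = c \<and> k a < k j then qdiff q * F j else 0) else 0))"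
    unfolding mixed_inv_def sum_distrib_left sum.distrib[symmetric]
    by (intro sum.cong refl) (auto simp: algebra_simps)
  then show ?thesis by simp
qed

lemma qpow_cancel: "qpow q \<nu> * qpow q (- \<nu>) = 1" "qpow q (- \<nu>) * qpow q \<nu> = 1"
  by (simp_all add: qpow_add[OF q, symmetric] q)

lemma qpow_cancel': "qpow q \<nu> * (qpow q (- \<nu>) * x) = x" "qpow q (- \<nu>) * (qpow q \<nu> * x) = x"
  by (simp_all add: mult.assoc[symmetric] qpow_cancel)

lemma qpow_cancel'': "qpow q \<nu> * (y * (qpow q (- \<nu>) * x)) = y * x" "qpow q (- \<nu>) * (y * (qpow q \<nu> * x)) = y * x"
   "qpow q \<nu> * (y * qpow q (- \<nu>)) = y" "qpow q (- \<nu>) * (y * qpow q \<nu>) = y"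
  by (simp_all only: mult.left_commute[of "qpow q \<nu>" y] mult.left_commute[of "qpow q (- \<nu>)" y]
    qpow_cancel' qpow_cancel mult_1_right)

lemmas qcancel = qpow_cancel qpow_cancel' qpow_cancel''

text \<open>Scalar form of moving a leg V past a pair contracted by E'. In rank k the weight of E'
  is q^(\<mu> - 2k); the exponent \<mu> is left free because a common factor does not
  matter.\<close>

lemma weight_mixed_hecke:
  "(\<Sum>a\<in>UNIV. \<Sum>i\<in>UNIV. qpow q (\<mu> - 2 * real (k a)) * mixed q \<nu> k $ (a, c) $ (i, j) * hecke q \<nu> gtk $ (a, i) $ (m, n))
    = (if m = c \<and> n = j then qpow q (\<mu> - 2 * real (k n)) else 0)"
proof -
  have 1: "(\<Sum>i\<in>UNIV. qpow q (\<mu> - 2 * real (k a)) * mixed q \<nu> k $ (a, c) $ (i, j) * hecke q \<nu> gtk $ (a, i) $ (m, n))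
    = (if a = j then qpow q (\<mu> - 2 * real (k j)) * (if j = c then qpow q (- 1) else 1) * qpow q (- \<nu>) * hecke q \<nu> gtk $ (j, c) $ (m, n) else 0)
     - (if a = c then (if k c < k j then qpow q (\<mu> - 2 * real (k c)) * qpow q (- \<nu>) * qdiff q * qpow q (2 * real (k c) - 2 * real (k j))
          * hecke q \<nu> gtk $ (c, j) $ (m, n) else 0) else 0)" for a
    unfolding mult.assoc sum_distrib_left[symmetric] mixed_sum by (simp add: algebra_simps)
  show ?thesis (is "?L = ?R")
  proof -
    have "?L = qpow q (\<mu> - 2 * real (k j)) * (if j = c then qpow q (- 1) else 1) * qpow q (- \<nu>) * hecke q \<nu> gtk $ (j, c) $ (m, n) 
     - (if k c < k j then qpow q (\<mu> - 2 * real (k c)) * qpow q (- \<nu>) * qdiff q * qpow q (2 * real (k c) - 2 * real (k j))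
          * hecke q \<nu> gtk $ (c, j) $ (m, n) else 0)"
      unfolding 1 sum_subtractf by simp
    also have "\<dots> = ?R"
    proof (cases "j = c")
      case True then show ?thesis by (auto simp add: hecke_def qpow_minus[OF q] qpow_nonzero[OF q] field_simps)
    next
      case False
      then show ?thesis by (auto simp add: hecke_def qpow_minus[OF q] qpow_diff[OF q] qpow_nonzero[OF q])
    qed
    finally show ?thesis .
  qed
qed

text \<open>The analogue for E. The corrections of both braidings meet in a sum over the ranks
  strictly between those of c and m, which telescopes.\<close>

lemma contraction_hecke_mixed:
  "(\<Sum>a\<in>UNIV. \<Sum>i\<in>UNIV. 1 * hecke q \<nu> gtk $ (a, c) $ (i, j) * mixed q \<nu> k $ (a, i) $ (m, n))
    = (if m = c \<and> n = j then 1 else 0)"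
proof -
  let ?W = "\<lambda>a. qpow q (2 * real (k a) - 2 * real (k m))"
  have "(\<Sum>a\<in>UNIV. \<Sum>i\<in>UNIV. 1 * hecke q \<nu> gtk $ (a, c) $ (i, j) * mixed q \<nu> k $ (a, i) $ (m, n))
    = (\<Sum>a\<in>UNIV. (if a = j then qpow q \<nu> * (if j = c then qpow q 1 else 1) * mixed q \<nu> k $ (j, c) $ (m, n) else 0)
     + (if j = c then qpow q \<nu> * (if k c < k a then qdiff q * mixed q \<nu> k $ (a, a) $ (m, n) else 0) else 0))"
    unfolding mult_1 hecke_sum by (intro sum.cong refl) (simp add: algebra_simps)
  also have "\<dots> = qpow q \<nu> * (if j = c then qpow q 1 else 1) * mixed q \<nu> k $ (j, c) $ (m, n)
     + (if j = c then qpow q \<nu> * qdiff q * (\<Sum>a\<in>{a. k c < k a}. mixed q \<nu> k $ (a, a) $ (m, n)) else 0)"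
    by (simp add: sum.distrib sum_distrib_left[symmetric] sum_if_Collect mult.assoc)
  also have "(\<Sum>a\<in>{a. k c < k a}. mixed q \<nu> k $ (a, a) $ (m, n))
    = (if m = n then qpow q (- \<nu>) * ((if k c < k m then qpow q (- 1) else 0)
        - qdiff q * (\<Sum>a\<in>{a. k c < k a \<and> k a < k m}. ?W a)) else 0)"
  proof -
    have "(\<Sum>a\<in>{a. k c < k a}. mixed q \<nu> k $ (a, a) $ (m, n)) =
      (if m = n then qpow q (- \<nu>) * ((\<Sum>a\<in>{a. k c < k a}. if a = m then qpow q (- 1) else 0)
        - (\<Sum>a\<in>{a. k c < k a}. if k a < k m then qdiff q * ?W a else 0)) else 0)"
      by (auto simp: mixed_def sum_subtractf[symmetric] sum_distrib_left intro!: sum.cong sum.neutral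
          simp del: sum.delta sum.delta')
    also have "(\<Sum>a\<in>{a. k c < k a}. if k a < k m then qdiff q * ?W a else 0)
      = qdiff q * (\<Sum>a\<in>{a. k c < k a \<and> k a < k m}. ?W a)"
      by (simp add: sum.If_cases sum_distrib_left Collect_conj_eq)
    finally show ?thesis by simp
  qed
  also have "(\<Sum>a\<in>{a. k c < k a \<and> k a < k m}. ?W a)
    = (\<Sum>a\<in>{a. k c < k a \<and> k a < k m}. qpow q (2 * real (k a))) / qpow q (2 * real (k m))"
    by (simp add: qpow_diff[OF q] sum_divide_distrib)
  also have "qdiff q * \<dots> = (if k c < k m then qpow q (- 1) - qpow q (2 * real (k c) - 2 * real (k m) + 1) else 0)"
  proof (cases "k c < k m")
    case True
    then show ?thesis unfolding times_divide_eq_right qpow_telescope[OF True]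
      by (simp add: qpow_diff[OF q] qpow_add[OF q] qpow_minus[OF q] qpow_nonzero[OF q] field_simps)
  next
    case False
    then have "{a. k c < k a \<and> k a < k m} = {}" by auto
    with False show ?thesis by (simp only: sum.empty if_False) simp
  qed
  finally have *: "(\<Sum>a\<in>UNIV. \<Sum>i\<in>UNIV. 1 * hecke q \<nu> gtk $ (a, c) $ (i, j) * mixed q \<nu> k $ (a, i) $ (m, n)) = 
    qpow q \<nu> * (if j = c then qpow q 1 else 1) * mixed q \<nu> k $ (j, c) $ (m, n)
    + (if j = c then qpow q \<nu> * qdiff q * (if m = n then qpow q (- \<nu>) * ((if k c < k m then qpow q (- 1) else 0) -
         (if k c < k m then qpow q (- 1) - qpow q (2 * real (k c) - 2 * real (k m) + 1) else 0)) else 0) else 0)" .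
  have "qpow q \<nu> * (if j = c then qpow q 1 else 1) * mixed q \<nu> k $ (j, c) $ (m, n)
    + (if j = c then qpow q \<nu> * qdiff q * (if m = n then qpow q (- \<nu>) * ((if k c < k m then qpow q (- 1) else 0) -
         (if k c < k m then qpow q (- 1) - qpow q (2 * real (k c) - 2 * real (k m) + 1) else 0)) else 0) else 0)
    = (if m = c \<and> n = j then 1 else 0)"
  proof -
    have e: "qpow q (2 * real (k c) - 2 * real (k m) + 1) = qpow q (2 * real (k c) - 2 * real (k m)) * qpow q 1" for m
      by (simp only: qpow_add[OF q])
    consider "j \<noteq> c" | "j = c" "m \<noteq> n" | "j = c" "m = n" "k c < k m" | "j = c" "m = n" "\<not> k c < k m"
      by blast
    then show ?thesis
    proof cases
      case 1 then show ?thesis by (simp add: mixed_def qcancel)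
    next
      case 2
      then have "\<not> (m = c \<and> n = j)" by auto
      moreover have "mixed q \<nu> k $ (j, c) $ (m, n) = 0" using 2 by (auto simp: mixed_def)
      ultimately show ?thesis using 2 by (simp only: if_False mult_zero_right add_0_right if_True simp_thms)
    next
      \<comment> \<open>The entry of \<open>mixed\<close> is now pure correction and cancels the
        lower boundary term of the telescoping sum.\<close>
      case 3
      then have ne: "n \<noteq> c" by auto
      then have 1: "mixed q \<nu> k $ (j, c) $ (m, n) = qpow q (- \<nu>) * - (qdiff q * qpow q (2 * real (k c) - 2 * real (k m)))"
        using 3 by (simp add: mixed_def)
      have "?thesis \<longleftrightarrow> qpow q \<nu> * qpow q 1 * (qpow q (- \<nu>) * - (qdiff q * qpow q (2 * real (k c) - 2 * real (k m))))
        + qpow q \<nu> * qdiff q * (qpow q (- \<nu>) * (qpow q (2 * real (k c) - 2 * real (k m)) * qpow q 1)) = 0"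
        unfolding 1 e using ne 3 by simp
      also have "\<dots>" by (simp add: mult_ac)
      finally show ?thesis by simp
    next
      case 4 then show ?thesis by (auto simp: mixed_def qcancel mult.assoc)
    qed
  qed
  with * show ?thesis by (rule trans)
qed

end

lemma matrix_mult_pairs:
  "(A ** B) $ x $ y = (\<Sum>j\<in>UNIV. \<Sum>i\<in>UNIV. A $ x $ (i, j) * B $ (i, j) $ y :: 'a::comm_semiring_1)"
  unfolding matrix_matrix_mult_def by (simp add: sum_UNIV_prod) (rule sum.swap)

context ranked_basis
begin

text \<open>With inverse braidings it is a leg of the dual module that moves past the pair, hence
  the reversed order in the Hecke part.\<close>

lemma contraction_mixed_inv_hecke_inv:
  "(\<Sum>a\<in>UNIV. \<Sum>i\<in>UNIV. 1 * mixed_inv q \<nu> k $ (a, c) $ (i, j) * hecke_inv q \<nu> ltk $ (a, i) $ (m, n))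
    = (if m = c \<and> n = j then 1 else 0)"
proof -
  have "(\<Sum>a\<in>UNIV. \<Sum>i\<in>UNIV. 1 * mixed_inv q \<nu> k $ (a, c) $ (i, j) * hecke_inv q \<nu> ltk $ (a, i) $ (m, n))
    = (\<Sum>a\<in>UNIV. (if a = j then qpow q \<nu> * (if j = c then qpow q 1 else 1) * hecke_inv q \<nu> ltk $ (j, c) $ (m, n) else 0)
     + (if a = c then qpow q \<nu> * (if k c < k j then qdiff q * hecke_inv q \<nu> ltk $ (c, j) $ (m, n) else 0) else 0))"
    unfolding mult_1 mixed_inv_sum by (intro sum.cong refl) (simp add: algebra_simps)
  also have "\<dots> = qpow q \<nu> * (if j = c then qpow q 1 else 1) * hecke_inv q \<nu> ltk $ (j, c) $ (m, n)
     + qpow q \<nu> * (if k c < k j then qdiff q * hecke_inv q \<nu> ltk $ (c, j) $ (m, n) else 0)"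
    by (simp add: sum.distrib)
  also have "\<dots> = (if m = c \<and> n = j then 1 else 0)"
  proof -
    consider "j = c" | "k c < k j" "\<not> k j < k c" "j \<noteq> c" | "\<not> k c < k j" "k j < k c" "j \<noteq> c"
      using rank_eq_iff[of j c] by fastforce
    then show ?thesis by cases (simp_all add: hecke_inv_def mult.assoc qcancel)
  qed
  finally show ?thesis .
qed

lemma weight_hecke_inv_mixed_inv:
  "(\<Sum>a\<in>UNIV. \<Sum>i\<in>UNIV. qpow q (\<mu> - 2 * real (k a)) * hecke_inv q \<nu> ltk $ (a, c) $ (i, j) * mixed_inv q \<nu> k $ (a, i) $ (m, n))
    = (if m = c \<and> n = j then qpow q (\<mu> - 2 * real (k n)) else 0)"
proof -
  let ?W = "\<lambda>a. qpow q (\<mu> - 2 * real (k a))"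
  have "(\<Sum>a\<in>UNIV. \<Sum>i\<in>UNIV. ?W a * hecke_inv q \<nu> ltk $ (a, c) $ (i, j) * mixed_inv q \<nu> k $ (a, i) $ (m, n))
    = (\<Sum>a\<in>UNIV. (if a = j then ?W j * qpow q (- \<nu>) * (if j = c then qpow q (- 1) else 1) * mixed_inv q \<nu> k $ (j, c) $ (m, n) else 0)
     - (if j = c then qpow q (- \<nu>) * qdiff q * (if k c < k a then ?W a * mixed_inv q \<nu> k $ (a, a) $ (m, n) else 0) else 0))"
    unfolding mult.assoc sum_distrib_left[symmetric] hecke_inv_sum
    by (intro sum.cong refl) (simp add: algebra_simps)
  also have "\<dots> = ?W j * qpow q (- \<nu>) * (if j = c then qpow q (- 1) else 1) * mixed_inv q \<nu> k $ (j, c) $ (m, n)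
     - (if j = c then qpow q (- \<nu>) * qdiff q * (\<Sum>a\<in>{a. k c < k a}. ?W a * mixed_inv q \<nu> k $ (a, a) $ (m, n)) else 0)"
    by (simp add: sum_subtractf sum_distrib_left[symmetric] sum_if_Collect mult.assoc)
  also have "(\<Sum>a\<in>{a. k c < k a}. ?W a * mixed_inv q \<nu> k $ (a, a) $ (m, n))
    = (if m = n then qpow q \<nu> * ((if k c < k m then ?W m * qpow q 1 else 0)
        + qdiff q * (\<Sum>a\<in>{a. k c < k a \<and> k a < k m}. ?W a)) else 0)"
  proof -
    have "(\<Sum>a\<in>{a. k c < k a}. ?W a * mixed_inv q \<nu> k $ (a, a) $ (m, n)) =
      (if m = n then qpow q \<nu> * ((\<Sum>a\<in>{a. k c < k a}. if a = m then ?W m * qpow q 1 else 0)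
        + (\<Sum>a\<in>{a. k c < k a}. if k a < k m then qdiff q * ?W a else 0)) else 0)"
      by (auto simp: mixed_inv_def sum.distrib[symmetric] sum_distrib_left intro!: sum.cong sum.neutral
          simp del: sum.delta sum.delta')
    also have "(\<Sum>a\<in>{a. k c < k a}. if k a < k m then qdiff q * ?W a else 0)
      = qdiff q * (\<Sum>a\<in>{a. k c < k a \<and> k a < k m}. ?W a)"
      by (simp add: sum.If_cases sum_distrib_left Collect_conj_eq)
    finally show ?thesis by simp
  qed
  also have "(\<Sum>a\<in>{a. k c < k a \<and> k a < k m}. ?W a)
    = qpow q \<mu> * (\<Sum>a\<in>{a. k c < k a \<and> k a < k m}. qpow q (- (2 * real (k a))))"
    unfolding sum_distrib_left
    by (intro sum.cong refl) (simp add: qpow_add[OF q, symmetric])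
  also have "qdiff q * \<dots> = (if k c < k m then qpow q \<mu> * (qpow q (- (2 * real (k c)) - 1) - qpow q (1 - 2 * real (k m))) else 0)"
  proof (cases "k c < k m")
    case True
    then show ?thesis using qpow_telescope_neg[OF True] by simp
  next
    case False
    then have "{a. k c < k a \<and> k a < k m} = {}" by auto
    with False show ?thesis by (simp only: sum.empty if_False) simp
  qed
  also have "?W j * qpow q (- \<nu>) * (if j = c then qpow q (- 1) else 1) * mixed_inv q \<nu> k $ (j, c) $ (m, n)
    - (if j = c then qpow q (- \<nu>) * qdiff q * (if m = n then qpow q \<nu> * ((if k c < k m then ?W m * qpow q 1 else 0)
         + (if k c < k m then qpow q \<mu> * (qpow q (- (2 * real (k c)) - 1) - qpow q (1 - 2 * real (k m))) else 0)) else 0) else 0) =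
    ?W j * qpow q (- \<nu>) * (if j = c then qpow q (- 1) else 1) * mixed_inv q \<nu> k $ (j, c) $ (m, n)
    - (if j = c then qpow q (- \<nu>) * qdiff q * (if m = n then qpow q \<nu> * (if k c < k m then 
        ?W m * qpow q 1 + qpow q \<mu> * (qpow q (- (2 * real (k c)) - 1) - qpow q (1 - 2 * real (k m))) else 0) else 0) else 0)"
    by simp
  finally have *: "(\<Sum>a\<in>UNIV. \<Sum>i\<in>UNIV. ?W a * hecke_inv q \<nu> ltk $ (a, c) $ (i, j) * mixed_inv q \<nu> k $ (a, i) $ (m, n)) = \<dots>" .
  \<comment> \<open>The upper boundary term of the telescoping sum cancels the entry at m, and only
    the one at c remains.\<close>
  have 1: "?W m * qpow q 1 + qpow q \<mu> * (qpow q (- (2 * real (k c)) - 1) - qpow q (1 - 2 * real (k m)))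
    = ?W c * qpow q (- 1)" for m c
    by (simp add: right_diff_distrib qpow_add[OF q, symmetric] algebra_simps)
  show ?thesis unfolding * 1
  proof (cases "j = c")
    case True
    then show "?W j * qpow q (- \<nu>) * (if j = c then qpow q (- 1) else 1) * mixed_inv q \<nu> k $ (j, c) $ (m, n)
    - (if j = c then qpow q (- \<nu>) * qdiff q * (if m = n then qpow q \<nu> * (if k c < k m then ?W c * qpow q (- 1) else 0) else 0) else 0)
     = (if m = c \<and> n = j then ?W n else 0)"
      by (cases "m = n"; cases "k c < k m") (simp_all add: mixed_inv_def mult.assoc qcancel distrib_left)
  qed (simp add: mixed_inv_def mult.assoc qcancel)
qed

text \<open>Both sides are invariant pairings on V (x) V', hence proportional. The factor can be
  read off in rank 0, where only the diagonal entry q^(-\<nu> - 1) of \<open>mixed\<close> occurs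
  and E' has weight q^\<mu>.\<close>

lemma contraction_mixed:
  "(\<Sum>b\<in>UNIV. on_legs (mixed q \<nu> k) X b b)
    = qpow q (- \<nu> - 1 - \<mu>) *\<^sub>C (\<Sum>b\<in>UNIV. qpow q (\<mu> - 2 * real (k b)) *\<^sub>C X b b)"
proof -
  have 1: "(\<Sum>b\<in>UNIV. mixed q \<nu> k $ (b, b) $ (i, j)) = (if i = j then qpow q (- \<nu> - 1 - \<mu>) * qpow q (\<mu> - 2 * real (k i)) else 0)" for i j
  proof (cases "i = j")
    case True
    have "(\<Sum>b\<in>UNIV. mixed q \<nu> k $ (b, b) $ (i, j)) =
      qpow q (- \<nu>) * ((\<Sum>b\<in>UNIV. if b = i then qpow q (- 1) else 0)
        - (\<Sum>b\<in>UNIV. if k b < k i then qdiff q * qpow q (2 * real (k b) - 2 * real (k i)) else 0))"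
      unfolding sum_subtractf[symmetric] sum_distrib_left
      by (intro sum.cong refl) (auto simp: mixed_def True)
    also have "(\<Sum>b\<in>UNIV. if k b < k i then qdiff q * qpow q (2 * real (k b) - 2 * real (k i)) else 0)
      = (qdiff q * (\<Sum>b\<in>{b. k b < k i}. qpow q (2 * real (k b)))) / qpow q (2 * real (k i))"
      by (simp add: sum_if_Collect qpow_diff[OF q] sum_divide_distrib[symmetric] sum_distrib_left[symmetric])
    also have "\<dots> = qpow q (- 1) - qpow q (- 1 - 2 * real (k i))"
      unfolding qpow_telescope0
      by (simp add: diff_divide_distrib qpow_diff[OF q, symmetric])
    finally show ?thesis using True by (simp add: qpow_add[OF q, symmetric] algebra_simps)
  next
    case False
    then show ?thesis by (auto simp: mixed_def intro!: sum.neutral)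
  qed
  have "(\<Sum>b\<in>UNIV. on_legs (mixed q \<nu> k) X b b) =
    (\<Sum>i\<in>UNIV. \<Sum>j\<in>UNIV. (\<Sum>b\<in>UNIV. mixed q \<nu> k $ (b, b) $ (i, j)) *\<^sub>C X i j)"
    unfolding on_legs_double scaleC_sum_left
    unfolding sum.cartesian_product UNIV_Times_UNIV
    by (rule sum.reindex_bij_witness[of _ "\<lambda>(i, j, b). (b, i, j)" "\<lambda>(b, i, j). (i, j, b)"]) auto
  also have "\<dots> = (\<Sum>i\<in>UNIV. \<Sum>j\<in>UNIV. if i = j then (qpow q (- \<nu> - 1 - \<mu>) * qpow q (\<mu> - 2 * real (k i))) *\<^sub>C X i i else 0)"
    unfolding 1 by (intro sum.cong refl) (auto simp: scaleC_zero_left)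
  also have "\<dots> = (\<Sum>i\<in>UNIV. (qpow q (- \<nu> - 1 - \<mu>) * qpow q (\<mu> - 2 * real (k i))) *\<^sub>C X i i)"
    by simp
  finally show ?thesis by (simp add: scaleC_sum_right scaleC_scaleC)
qed

lemma hecke_hecke_inv: "hecke q \<nu> gtk ** hecke_inv q \<nu> gtk = mat 1"
proof -
  have "(hecke q \<nu> gtk ** hecke_inv q \<nu> gtk) $ (a, c) $ (m, n) = mat 1 $ (a, c) $ (m, n)" for a c m n
  proof -
    have "(hecke q \<nu> gtk ** hecke_inv q \<nu> gtk) $ (a, c) $ (m, n) 
      = (\<Sum>j\<in>UNIV. \<Sum>i\<in>UNIV. hecke q \<nu> gtk $ (a, c) $ (i, j) * hecke_inv q \<nu> gtk $ (i, j) $ (m, n))"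
      by (rule matrix_mult_pairs)
    also have "\<dots> = qpow q \<nu> * ((if a = c then qpow q 1 else 1) * hecke_inv q \<nu> gtk $ (c, a) $ (m, n)
       + (if k c < k a then qdiff q * hecke_inv q \<nu> gtk $ (a, c) $ (m, n) else 0))"
      unfolding hecke_sum by (simp add: sum_distrib_left[symmetric] sum.distrib)
    also have "\<dots> = mat 1 $ (a, c) $ (m, n)"
    proof -
      have 2: "hecke_inv q \<nu> gtk $ (a, c) $ (m, n) = qpow q (- \<nu>) *
        ((if m = c \<and> n = a then if a = c then qpow q (- 1) else 1 else 0)
        - (if k a < k c \<and> m = a \<and> n = c then qdiff q else 0))" for a c
        by (auto simp: hecke_inv_def)
      have 3: "mat 1 $ (a, c) $ (m, n) = (if m = a \<and> n = c then 1 else 0)" by (auto simp: mat_def)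
      consider "a = c" | "k c < k a" "\<not> k a < k c" "a \<noteq> c" | "\<not> k c < k a" "k a < k c" "a \<noteq> c"
        using rank_eq_iff[of a c] by fastforce
      then show ?thesis unfolding 2 3 by cases (simp_all add: qcancel)
    qed
    finally show ?thesis .
  qed
  then show ?thesis by (simp add: vec_eq_iff)
qed

lemma mixed_mixed_inv: "mixed q \<nu> k ** mixed_inv q \<nu> k = mat 1"
proof -
  have "(mixed q \<nu> k ** mixed_inv q \<nu> k) $ (a, c) $ (m, n) = mat 1 $ (a, c) $ (m, n)" for a c m n
  proof -
    have "(\<Sum>j\<in>UNIV. if k a < k j then qdiff q * qpow q (2 * real (k a) - 2 * real (k j)) * mixed_inv q \<nu> k $ (j, j) $ (m, n) else 0)
      = (\<Sum>j\<in>{j. k a < k j}. qdiff q * qpow q (2 * real (k a) - 2 * real (k j)) * mixed_inv q \<nu> k $ (j, j) $ (m, n))"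
      by (rule sum_if_Collect)
    also have "\<dots> = (if m = n \<and> k a < k m then qpow q \<nu> * qdiff q * qpow q (- 1) else 0)"
    proof (cases "m = n \<and> k a < k m")
      case True
      have "(\<Sum>j\<in>{j. k a < k j}. qdiff q * qpow q (2 * real (k a) - 2 * real (k j)) * mixed_inv q \<nu> k $ (j, j) $ (m, n))
        = qpow q \<nu> * qdiff q * ((\<Sum>j\<in>{j. k a < k j}. if j = m then qpow q (2 * real (k a) - 2 * real (k m)) * qpow q 1 else 0)
          + (\<Sum>j\<in>{j. k a < k j}. if k j < k m then qdiff q * qpow q (2 * real (k a) - 2 * real (k j)) else 0))"
        unfolding sum.distrib[symmetric] sum_distrib_left using True
        by (intro sum.cong refl) (auto simp: mixed_inv_def)
      also have "(\<Sum>j\<in>{j. k a < k j}. if k j < k m then qdiff q * qpow q (2 * real (k a) - 2 * real (k j)) else 0)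
        = qpow q (2 * real (k a)) * (qdiff q * (\<Sum>j\<in>{j. k a < k j \<and> k j < k m}. qpow q (- (2 * real (k j)))))"
        by (simp add: sum.If_cases sum_distrib_left Collect_conj_eq qpow_diff[OF q] qpow_minus[OF q] field_simps)
      also have "\<dots> = qpow q (- 1) - qpow q (2 * real (k a) - 2 * real (k m) + 1)"
        unfolding qpow_telescope_neg[OF conjunct2[OF True]] by (simp add: right_diff_distrib qpow_add[OF q, symmetric] algebra_simps)
      finally show ?thesis using True by (auto simp add: qpow_add[OF q, symmetric])
    next
      case False
      then have "qdiff q * qpow q (2 * real (k a) - 2 * real (k j)) * mixed_inv q \<nu> k $ (j, j) $ (m, n) = 0" if "k a < k j" for j
        using that by (auto simp: mixed_inv_def)
      with False show ?thesis by (auto intro!: sum.neutral)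
    qed
    finally have sumv: "(\<Sum>j\<in>UNIV. if k a < k j then qdiff q * qpow q (2 * real (k a) - 2 * real (k j)) * mixed_inv q \<nu> k $ (j, j) $ (m, n) else 0)
      = (if m = n \<and> k a < k m then qpow q \<nu> * qdiff q * qpow q (- 1) else 0)" .
    have "(mixed q \<nu> k ** mixed_inv q \<nu> k) $ (a, c) $ (m, n) 
      = (\<Sum>j\<in>UNIV. \<Sum>i\<in>UNIV. mixed q \<nu> k $ (a, c) $ (i, j) * mixed_inv q \<nu> k $ (i, j) $ (m, n))"
      by (rule matrix_mult_pairs)
    also have "\<dots> = qpow q (- \<nu>) * ((if a = c then qpow q (- 1) else 1) * mixed_inv q \<nu> k $ (c, a) $ (m, n)
       - (if a = c then \<Sum>j\<in>UNIV. if k a < k j then qdiff q * qpow q (2 * real (k a) - 2 * real (k j)) * mixed_inv q \<nu> k $ (j, j) $ (m, n) else 0 else 0))"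
    proof -
      let ?D = "\<lambda>j. if k a < k j then qdiff q * qpow q (2 * real (k a) - 2 * real (k j)) * mixed_inv q \<nu> k $ (j, j) $ (m, n) else 0"
      have "(\<Sum>i\<in>UNIV. mixed q \<nu> k $ (a, c) $ (i, j) * mixed_inv q \<nu> k $ (i, j) $ (m, n))
        = (if j = a then qpow q (- \<nu>) * ((if a = c then qpow q (- 1) else 1) * mixed_inv q \<nu> k $ (c, a) $ (m, n)) else 0)
          - (if a = c then qpow q (- \<nu>) else 0) * ?D j" for j
        unfolding mixed_sum by (cases "j = a"; cases "a = c"; cases "k a < k j") (simp_all only: if_True if_False simp_thms
          mult_zero_right mult_zero_left diff_0_right diff_0 mult_minus_right right_diff_distrib)
      then show ?thesis
        by (simp only: sum_subtractf sum_distrib_left[of "if a = c then qpow q (- \<nu>) else 0" ?D, symmetric] sum.delta finite UNIV_I if_True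
            right_diff_distrib) simp
    qed
    also have "\<dots> = mat 1 $ (a, c) $ (m, n)"
    proof -
      have 2: "mixed_inv q \<nu> k $ (c, a) $ (m, n) = qpow q \<nu> * ((if m = a \<and> n = c then if a = c then qpow q 1 else 1 else 0)
        + (if a = c \<and> m = n \<and> k a < k m then qdiff q else 0))"
        by (cases "a = c"; cases "m = n"; cases "m = a"; cases "n = c") (simp_all add: mixed_inv_def)
      have 3: "mat 1 $ (a, c) $ (m, n) = (if m = a \<and> n = c then 1 else 0)" by (auto simp: mat_def)
      have "qpow q (- \<nu>) * ((if a = c then qpow q (- 1) else 1) * (qpow q \<nu> * ((if m = a \<and> n = c then if a = c then qpow q 1 else 1 else 0)
        + (if a = c \<and> m = n \<and> k a < k m then qdiff q else 0)))
           - (if a = c then if m = n \<and> k a < k m then qpow q \<nu> * qdiff q * qpow q (- 1) else 0 else 0)) = (if m = a \<and> n = c then 1 else 0)"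
      proof (cases "a = c")
        case True
        then show ?thesis
          by (cases "m = a"; cases "m = n"; cases "k a < k m")
            (simp_all add: qcancel right_diff_distrib distrib_left mult.assoc)
      qed (simp add: qcancel)
      then show ?thesis unfolding sumv 2 3 .
    qed
    finally show ?thesis .
  qed
  then show ?thesis by (simp add: vec_eq_iff)
qed

text \<open>The Hecke relation: up to the factor q^\<nu> the braiding satisfies (x - q)(x + 1/q) =
  0. It exchanges a braiding for its inverse where it is the inverse that can be moved past a
  pairing.\<close>

lemma hecke_square:
  "hecke q \<nu> gtk = mat (qpow q (2 * \<nu>)) ** hecke_inv q \<nu> gtk + mat (qpow q \<nu> * qdiff q)"
proof -
  have "hecke q \<nu> gtk $ (a, c) $ (m, n) = (mat (qpow q (2 * \<nu>)) ** hecke_inv q \<nu> gtk + mat (qpow q \<nu> * qdiff q)) $ (a, c) $ (m, n)" for a c m n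
  proof -
    have e: "qpow q (2 * \<nu>) * qpow q (- \<nu>) = qpow q \<nu>" by (simp add: qpow_add[OF q, symmetric])
    have 1: "(mat (qpow q (2 * \<nu>)) ** hecke_inv q \<nu> gtk) $ (a, c) $ (m, n) = qpow q (2 * \<nu>) * hecke_inv q \<nu> gtk $ (a, c) $ (m, n)"
      by (simp add: matrix_matrix_mult_def mat_def if_distrib[of "\<lambda>x. x * _"] cong: if_cong)
    have e2: "qpow q (2 * \<nu>) * (qpow q (- \<nu>) * x) = qpow q \<nu> * x" for x
      by (simp only: mult.assoc[symmetric] e)
    have 2: "hecke_inv q \<nu> gtk $ (a, c) $ (m, n) = qpow q (- \<nu>) *
      ((if m = c \<and> n = a then if a = c then qpow q (- 1) else 1 else 0)
      - (if k a < k c \<and> m = a \<and> n = c then qdiff q else 0))"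
      by (auto simp: hecke_inv_def)
    have 3: "hecke q \<nu> gtk $ (a, c) $ (m, n) = qpow q \<nu> *
      ((if m = c \<and> n = a then if a = c then qpow q 1 else 1 else 0)
      + (if k c < k a \<and> m = a \<and> n = c then qdiff q else 0))"
      by (auto simp: hecke_def)
    have 4: "mat (qpow q \<nu> * qdiff q) $ (a, c) $ (m, n) = qpow q \<nu> * (if m = a \<and> n = c then qdiff q else 0)"
      by (auto simp: mat_def)
    consider "a = c" | "k a < k c" "\<not> k c < k a" "a \<noteq> c" | "k c < k a" "\<not> k a < k c" "a \<noteq> c"
      using rank_eq_iff[of a c] by fastforce
    then show ?thesis unfolding vector_add_component 1 2 3 4 e2 distrib_left[symmetric]
      by cases (auto simp: qdiff_def)
  qed
  then show ?thesis by (simp add: vec_eq_iff)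
qed

end

text \<open>The dual module is the same chain read backwards, so that whatever is proved for k holds
  for it with r - k.\<close>

lemma (in ranked_basis) reversed: "ranked_basis q r (\<lambda>a. r - k a)"
proof
  have "bij_betw (\<lambda>t. r - t) {..r} {..r}"
    by (rule bij_betw_byWitness[of _ "\<lambda>t. r - t"]) auto
  from bij_betw_trans[OF k this] show "bij_betw (\<lambda>a. r - k a) UNIV {..r}"
    by (simp add: o_def)
qed (rule q)

lemma (in ranked_basis) hecke_hecke_inv_reversed: "hecke q \<nu> ltk ** hecke_inv q \<nu> ltk = mat 1"
proof -
  have "(\<lambda>a b. r - k b < r - k a) = ltk"
    by (intro ext) (use rank_le in \<open>auto simp: le_Suc_eq less_diff_conv2 diff_less_mono2\<close>)
  then show ?thesis
    using ranked_basis.hecke_hecke_inv[OF reversed, of \<nu>] by simp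
qed

text \<open>For square matrices a one-sided inverse is two-sided, which pins down the choice made in
  \<open>matrix_inv\<close>.\<close>

lemma matrix_inv_eqI:
  fixes A B :: "complex^'m::finite^'m"
  assumes "A ** B = mat 1" shows "matrix_inv A = B"
proof -
  have "B ** A = mat 1" using assms by (simp add: matrix_left_right_inverse)
  with assms have "matrix_inv A ** A = mat 1"
    unfolding matrix_inv_def by (metis (mono_tags, lifting) someI)
  then show ?thesis
    by (metis assms matrix_mul_assoc matrix_mul_lid matrix_mul_rid)
qed

section \<open>Leg identities for the pairings E and E'\<close>

locale quantum_legs = ranked_basis q r k
  for q :: real and r :: nat and k :: "'n::finite \<Rightarrow> nat" +
  fixes \<nu> :: real and R :: "'n braidings" and wt :: "'n \<Rightarrow> weight"
  assumes RVV: "RVV R = hecke q \<nu> (\<lambda>a b. k b < k a)"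
    and RVD: "RVD R = mixed q \<nu> k"
    and RDD: "RDD R = hecke q \<nu> (\<lambda>a b. k a < k b)"
    and wt: "weight_form r (two_rho r) (wt a) = real r - 2 * real (k a)"
begin

text \<open>E on the first two legs, as \<open>et\<close> is E'; all further legs are carried by the
  coefficients.\<close>

definition ct :: "('n, 'x::complex_vec) legs2 \<Rightarrow> 'x"
  where "ct X = (\<Sum>b\<in>UNIV. X b b)"

abbreviation et :: "('n, 'x::complex_vec) legs2 \<Rightarrow> 'x"
  where "et \<equiv> E'12 r q wt"

text \<open>On the vector of rank 0 the mixed braiding has exponent -\<nu> - 1 and E' has exponent
  r; the difference is the exponent of \<theta>.\<close>

abbreviation \<theta> :: complex where "\<theta> \<equiv> qpow q (- \<nu> - 1 - real r)"

lemma RVD_inv: "matrix_inv (RVD R) = mixed_inv q \<nu> k"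
  unfolding RVD by (rule matrix_inv_eqI[OF mixed_mixed_inv])

lemma RDD_inv: "matrix_inv (RDD R) = hecke_inv q \<nu> (\<lambda>a b. k a < k b)"
  unfolding RDD by (rule matrix_inv_eqI[OF hecke_hecke_inv_reversed])

lemma RVD_cancel: "on_legs (RVD R) (on_legs (matrix_inv (RVD R)) X) = X"
  "on_legs (matrix_inv (RVD R)) (on_legs (RVD R) X) = X"
proof -
  have "mixed_inv q \<nu> k ** mixed q \<nu> k = mat 1"
    by (metis mixed_mixed_inv matrix_left_right_inverse)
  then show "on_legs (RVD R) (on_legs (matrix_inv (RVD R)) X) = X"
    "on_legs (matrix_inv (RVD R)) (on_legs (RVD R) X) = X"
    unfolding on_legs_mult RVD_inv unfolding RVD by (simp_all add: mixed_mixed_inv)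
qed

lemma et_eq: "et X = (\<Sum>a\<in>UNIV. qpow q (real r - 2 * real (k a)) *\<^sub>C X a a)"
  by (simp add: E'12_def wt)

lemma et_apply: "et X c = et (\<lambda>a b. X a b c)"
  by (simp add: et_eq sum_fun_app scaleC_fun_apply)

lemma E23_eq: "E23 X = (\<lambda>a. ct (X a))"
  by (intro ext) (simp add: E23_def ct_def sum_fun_app)

lemma ct_map: "clinear G \<Longrightarrow> G (ct X) = ct (\<lambda>a b. G (X a b))"
  by (simp add: ct_def clinear_on_sum)

lemma et_map: "clinear G \<Longrightarrow> G (et X) = et (\<lambda>a b. G (X a b))"
  by (simp add: et_eq clinear_on_sum clinear_on_scale)

lemma clinear_ct: "clinear ct"
  by (rule clinearI) (simp_all add: ct_def sum.distrib scaleC_sum_right scaleC_fun_apply)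

lemma clinear_et: "clinear et"
  by (rule clinearI) (simp_all add: et_eq sum.distrib scaleC_sum_right scaleC_fun_apply
    scaleC_add_right scaleC_scaleC mult.commute)

lemma ct_RVD: "ct (on_legs (RVD R) X) = \<theta> *\<^sub>C et X"
  unfolding ct_def et_eq RVD by (rule contraction_mixed)

lemma et_RVD_inv: "et (on_legs (matrix_inv (RVD R)) X) = inverse \<theta> *\<^sub>C ct X"
  using ct_RVD[of "on_legs (matrix_inv (RVD R)) X"]
  by (simp add: RVD_cancel scaleC_scaleC qpow_nonzero[OF q] scaleC_one)

text \<open>This and the next three identities express that E and E' are module maps: a leg V or V'
  can be moved past the pair that they contract.\<close>

lemma et_RDD_RVD:
  "et (\<lambda>a. on_legs (matrix_inv (RDD R)) (on_legs (matrix_inv (RVD R)) X a)) = (\<lambda>a. et (X a))"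
  unfolding RVD_inv RDD_inv
  by (rule ext, subst et_apply) (simp only: et_eq contract_two[OF weight_hecke_inv_mixed_inv])

lemma et_RVD_RVV: "et (\<lambda>a. on_legs (RVD R) (on_legs (RVV R) X a)) = (\<lambda>a. et (X a))"
  unfolding RVD RVV
  by (rule ext, subst et_apply) (simp only: et_eq contract_two[OF weight_mixed_hecke])

lemma ct_RVV_RVD: "ct (\<lambda>a. on_legs (RVV R) (on_legs (RVD R) X a)) = (\<lambda>a. ct (X a))"
  unfolding RVD RVV ct_def
  by (rule ext) (use contract_two[OF contraction_hecke_mixed] in \<open>simp add: scaleC_one sum_fun_app\<close>)

lemma ct_RVD_RDD:
  "ct (\<lambda>a. on_legs (matrix_inv (RVD R)) (on_legs (matrix_inv (RDD R)) X a)) = (\<lambda>a. ct (X a))"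
  unfolding RVD_inv RDD_inv ct_def
  by (rule ext) (use contract_two[OF contraction_mixed_inv_hecke_inv] in \<open>simp add: scaleC_one sum_fun_app\<close>)

text \<open>The inverse enters later only through these two properties and can therefore stay
  unnamed.\<close>

lemma RVV_hecke:
  "\<exists>Ri. (\<forall>X :: ('n, 'x::complex_vec) legs2. on_legs (RVV R) (on_legs Ri X) = X) \<and>
    (\<forall>X :: ('n, 'x) legs2. on_legs (RVV R) X = qpow q (2 * \<nu>) *\<^sub>C on_legs Ri X + (qpow q \<nu> * qdiff q) *\<^sub>C X)"
proof -
  have 1: "on_legs (mat c) X = c *\<^sub>C X" for c and X :: "('n, 'x) legs2"
  proof (intro ext)
    fix a b
    have "on_legs (mat c) X a b = (\<Sum>y\<in>UNIV. if y = (a, b) then c *\<^sub>C X a b else 0)"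
      unfolding on_legs_def case_prod_unfold
      by (intro sum.cong) (auto simp: mat_def scaleC_zero_left)
    then show "on_legs (mat c) X a b = (c *\<^sub>C X) a b" by (simp add: scaleC_fun_apply)
  qed
  show ?thesis
  proof (intro exI[of _ "hecke_inv q \<nu> gtk"] conjI allI)
    fix X :: "('n, 'x) legs2"
    show "on_legs (RVV R) (on_legs (hecke_inv q \<nu> gtk) X) = X"
      by (simp add: on_legs_mult RVV hecke_hecke_inv)
    show "on_legs (RVV R) X = qpow q (2 * \<nu>) *\<^sub>C on_legs (hecke_inv q \<nu> gtk) X + (qpow q \<nu> * qdiff q) *\<^sub>C X"
      unfolding RVV by (subst hecke_square) (simp only: on_legs_add on_legs_mult[symmetric] 1)
  qed
qed

text \<open>Under E the outermost braiding of S~ turns into \<theta> E', and E' absorbs the two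
  inverse braidings that remain.\<close>

lemma ct_tS3: "ct (tS3 R X) = \<theta> *\<^sub>C (\<lambda>a. et (X a))"
  unfolding tS3_def ct_RVD et_RDD_RVD ..

lemma E23_tildeS: "E23 (tildeS234 R X) = (\<lambda>a b. \<theta> *\<^sub>C et (X a b))"
  by (intro ext) (simp add: tildeS234_eq E23_eq ct_tS3 scaleC_fun_apply)

text \<open>E' absorbs the two outer braidings of S and meets the inverse mixed braiding, which
  turns it back into E.\<close>

lemma et_S3: "et (S3 R X) = inverse \<theta> *\<^sub>C (\<lambda>a. ct (X a))"
  unfolding S3_def et_RVD_RVV et_RVD_inv by (simp add: scaleC_fun_def)

text \<open>In both orders of S and S~ the inner mixed braidings on legs 2 and 3 cancel; what is
  left between the outer ones acts on legs 1, 2 and on legs 3, 4 and hence commutes.\<close>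

lemma T_eq: "T1234 R X = S123 R (tildeS234 R X)" "T1234 R X = tildeS234 R (S123 R X)"
proof -
  show "T1234 R X = S123 R (tildeS234 R X)" by (simp add: T1234_def)
  show "T1234 R X = tildeS234 R (S123 R X)"
    unfolding T1234_def S123_eq tildeS234_eq S3_def tS3_def RVD_cancel
    by (intro ext) (simp only: on_legs_commute[of "RVV R" "matrix_inv (RDD R)", symmetric])
qed

lemma et_T: "et (T1234 R X) = (\<lambda>a b. et (X a b))"
  unfolding T_eq(1) S123_eq et_S3 tildeS234_eq ct_tS3
  by (intro ext) (simp add: scaleC_fun_apply scaleC_scaleC qpow_nonzero[OF q] scaleC_one)

text \<open>With S~ outermost E produces \<theta> E', and the two applications of E' to S give back
  E with the inverse factor.\<close>

lemma et_E23_T: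
  fixes X :: "('n, 'x::complex_vec) legs4"
  shows "et (E23 (T1234 R X)) = et (E23 X)"
proof -
  have "et (E23 (T1234 R X)) = et (\<lambda>a b. \<theta> *\<^sub>C et (S123 R X a b))"
    unfolding T_eq(2) E23_tildeS ..
  also have "\<dots> = \<theta> *\<^sub>C et (et (S123 R X))"
  proof -
    have "clinear (\<lambda>x::'x. \<theta> *\<^sub>C x)"
      by (rule clinearI) (simp_all add: scaleC_add_right scaleC_scaleC mult.commute)
    from et_map[OF this] et_map[OF clinear_et] show ?thesis by metis
  qed
  also have "\<dots> = et (E23 X)"
    unfolding S123_eq et_S3 clinear_on_scale[OF clinear_et UNIV_I]
    by (simp add: scaleC_scaleC qpow_nonzero[OF q] scaleC_one E23_eq)
  finally show ?thesis .
qed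

text \<open>Under E the outermost braiding of S becomes \<theta> E', which would absorb the inverse
  of \<open>RVV\<close> but not \<open>RVV\<close> itself. The Hecke relation exchanges the two, at
  the price of the second term.\<close>

lemma E23_S:
  fixes X :: "('n, 'a::complex_vec) legs4"
  shows "E23 (S123 R X) = (\<theta> * qpow q (2 * \<nu>)) *\<^sub>C et X + (qpow q \<nu> * qdiff q) *\<^sub>C E23 X"
proof -
  let ?Y = "\<lambda>a. on_legs (matrix_inv (RVD R)) (X a)"
  obtain Ri where Ri: "\<And>X :: ('n, 'n \<Rightarrow> 'n \<Rightarrow> 'a) legs2. on_legs (RVV R) (on_legs Ri X) = X"
    "\<And>X :: ('n, 'n \<Rightarrow> 'n \<Rightarrow> 'a) legs2. on_legs (RVV R) X = qpow q (2 * \<nu>) *\<^sub>C on_legs Ri X + (qpow q \<nu> * qdiff q) *\<^sub>C X"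
    using RVV_hecke by blast
  have "E23 (S123 R X) = (\<lambda>a. \<theta> *\<^sub>C et (on_legs (RVV R) ?Y a))"
    unfolding E23_eq S123_eq S3_def ct_RVD ..
  also have "\<dots> = (\<lambda>a. \<theta> *\<^sub>C (qpow q (2 * \<nu>) *\<^sub>C et (on_legs Ri ?Y a) + (qpow q \<nu> * qdiff q) *\<^sub>C et (?Y a)))"
    unfolding Ri(2) plus_fun_apply scaleC_fun_apply
      clinear_on_add[OF clinear_et UNIV_I UNIV_I] clinear_on_scale[OF clinear_et UNIV_I] ..
  also have "\<dots> = (\<lambda>a. \<theta> *\<^sub>C (qpow q (2 * \<nu>) *\<^sub>C et X a + (qpow q \<nu> * qdiff q) *\<^sub>C inverse \<theta> *\<^sub>C ct (X a)))"
  proof -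
    have "(\<lambda>a. et (on_legs Ri ?Y a)) = et X"
      using et_RVD_RVV[of "on_legs Ri ?Y"] by (simp only: Ri(1) RVD_cancel)
    then have "et (on_legs Ri ?Y a) = et X a" for a by (rule fun_cong)
    then show ?thesis by (simp only: et_RVD_inv)
  qed
  also have "\<dots> = (\<theta> * qpow q (2 * \<nu>)) *\<^sub>C et X + (qpow q \<nu> * qdiff q) *\<^sub>C E23 X"
    unfolding E23_eq
    by (rule ext) (simp add: scaleC_fun_apply scaleC_add_right scaleC_scaleC qpow_nonzero[OF q] mult.left_commute[of \<theta>])
  finally show ?thesis .
qed

text \<open>T exchanges two pairs of legs V, V' one leg at a time: \<open>lower\<close> moves leg 2
  past legs 3 and 4, then \<open>upper\<close> moves leg 1 past the two legs that follow it.\<close>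

definition upper :: "('n \<Rightarrow> 'n \<Rightarrow> 'n \<Rightarrow> 'x::complex_vec) \<Rightarrow> 'n \<Rightarrow> 'n \<Rightarrow> 'n \<Rightarrow> 'x"
  where "upper X = (\<lambda>a. on_legs (RVD R) (on_legs (RVV R) X a))"

definition lower :: "('n \<Rightarrow> 'n \<Rightarrow> 'n \<Rightarrow> 'x::complex_vec) \<Rightarrow> 'n \<Rightarrow> 'n \<Rightarrow> 'n \<Rightarrow> 'x"
  where "lower X = (\<lambda>a. on_legs (matrix_inv (RDD R)) (on_legs (matrix_inv (RVD R)) X a))"

lemma T_upper_lower: "T1234 R X = upper (\<lambda>a. lower (X a))"
  unfolding T1234_def S123_eq tildeS234_eq S3_def tS3_def RVD_cancel upper_def lower_def ..

lemma upper_map: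
  assumes "clinear G" shows "G (upper X a b c) = upper (\<lambda>i j k. G (X i j k)) a b c"
  unfolding upper_def
  by (subst on_legs_map[OF assms], subst on_legs_map_on_apply[OF assms], simp, rule refl)

lemma clinear_lower: "clinear (lower :: ('n \<Rightarrow> 'n \<Rightarrow> 'n \<Rightarrow> 'x::complex_vec) \<Rightarrow> _)"
  unfolding lower_def
  by (rule clinearI)
    (simp_all add: fun_eq_iff clinear_on_add[OF clinear_on_legs] clinear_on_scale[OF clinear_on_legs] scaleC_fun_apply)

text \<open>The first of three pairs passes the other two, one after the other. The contraction
  joining these two can be done before, and then a single passage suffices. In this way commutation
  rules of two matrices with p yield one for their product.\<close>

lemma E23_T_T:
  "E23 (\<lambda>a b. T1234 R (T1234 R X a b)) = T1234 R (\<lambda>a b. E23 (X a b))"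
proof -
  let ?Z = "\<lambda>a. lower (X a)"
  let ?Q = "\<lambda>a b c. lower (?Z a b c)"
  have "E23 (\<lambda>a b. T1234 R (T1234 R X a b)) = E23 (\<lambda>a b. upper (upper ?Q a b))"
    unfolding T_upper_lower by (simp only: upper_map[OF clinear_lower])
  also have "\<dots> = (\<lambda>a. on_legs (RVD R) (ct (\<lambda>b. on_legs (RVV R) (upper ?Q a b))))"
    unfolding E23_eq upper_def ct_map[OF clinear_on_legs] ..
  also have "\<dots> = (\<lambda>a. on_legs (RVD R) (\<lambda>b. ct (on_legs (RVV R) ?Q a b)))"
    unfolding upper_def ct_RVV_RVD ..
  also have "\<dots> = upper (\<lambda>a b. ct (?Q a b))"
    unfolding upper_def on_legs_map[OF clinear_ct] ..
  also have "(\<lambda>a b. ct (?Q a b)) = (\<lambda>a. lower (\<lambda>b. E23 (X a b)))"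
  proof (intro ext)
    fix a b c d
    have "ct (?Q a b) = on_legs (matrix_inv (RDD R)) (ct (\<lambda>c. on_legs (matrix_inv (RVD R)) (?Z a b c)))"
      unfolding ct_map[OF clinear_on_legs] by (simp only: lower_def[of "lower (X _) _ _"])
    also have "\<dots> = on_legs (matrix_inv (RDD R)) (\<lambda>c. ct (on_legs (matrix_inv (RVD R)) (X a) b c))"
      unfolding lower_def ct_RVD_RDD ..
    also have "\<dots> = lower (\<lambda>b. E23 (X a b)) b"
      unfolding lower_def E23_eq on_legs_map[OF clinear_ct] ..
    finally show "ct (?Q a b) c d = lower (\<lambda>b. E23 (X a b)) b c d" by simp
  qed
  finally show ?thesis unfolding T_upper_lower .
qed

end

section \<open>Leg operators and linear maps on coefficients\<close>

lemma clinear_app: "clinear (\<lambda>\<phi>. \<phi> a)"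
  by (rule clinearI) (simp_all add: scaleC_fun_apply)

lemma clinear_comp: "clinear F \<Longrightarrow> clinear G \<Longrightarrow> clinear (\<lambda>x. F (G x))"
  by (simp add: clinear_on_def)

lemma S123_apply: "S123 R X a b c d = S3 R (\<lambda>i j k. X i j k d) a b c"
  unfolding S123_eq by (rule S3_map[OF clinear_app])

lemma S123_map_on:
  assumes "clinear_on S G" "\<And>a b c d. X a b c d \<in> S"
  shows "G (S123 R X a b c d) = S123 R (\<lambda>a b c d. G (X a b c d)) a b c d"
  unfolding S123_apply by (rule S3_map_on[OF assms(1)]) (rule assms(2))

lemma tildeS234_map_on:
  assumes "clinear_on S G" "\<And>a b c d. X a b c d \<in> S"
  shows "G (tildeS234 R X a b c d) = tildeS234 R (\<lambda>a b c d. G (X a b c d)) a b c d"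
  unfolding tildeS234_eq by (rule tS3_map_on[OF assms(1)]) (rule assms(2))

lemmas S123_map = S123_map_on[where S = UNIV, simplified]
lemmas tildeS234_map = tildeS234_map_on[where S = UNIV, simplified]

lemma T1234_map:
  assumes "clinear G"
  shows "G (T1234 R X a b c d) = T1234 R (\<lambda>a b c d. G (X a b c d)) a b c d"
  unfolding T1234_def S123_map[OF assms]
  by (subst tildeS234_map[OF assms]) (rule refl)

lemma clinear_funI: "(\<And>a. clinear (\<lambda>X. F X a)) \<Longrightarrow> clinear F"
  by (rule clinearI) (simp_all add: fun_eq_iff clinear_on_def scaleC_fun_apply)

lemma clinear_S3: "clinear (S3 R)"
  unfolding S3_def
proof (rule clinear_funI)
  fix a
  have 1: "clinear (\<lambda>X a. on_legs (matrix_inv (RVD R)) (X a))"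
    by (rule clinear_funI) (rule clinear_comp[OF clinear_on_legs clinear_app])
  show "clinear (\<lambda>X. on_legs (RVD R) (on_legs (RVV R) (\<lambda>a. on_legs (matrix_inv (RVD R)) (X a)) a))"
    by (rule clinear_comp[OF clinear_on_legs clinear_comp[OF clinear_app clinear_comp[OF clinear_on_legs 1]]])
qed

lemma clinear_tS3: "clinear (tS3 R)"
  unfolding tS3_def
proof (rule clinear_comp[OF clinear_on_legs], rule clinear_funI)
  fix a
  show "clinear (\<lambda>X. on_legs (matrix_inv (RDD R)) (on_legs (matrix_inv (RVD R)) X a))"
    by (rule clinear_comp[OF clinear_on_legs clinear_comp[OF clinear_app clinear_on_legs]])
qed

lemma clinear_S123: "clinear (S123 R)"
  using clinear_S3 by (simp add: S123_eq[abs_def])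

lemma clinear_tildeS234: "clinear (tildeS234 R)"
  unfolding tildeS234_eq
  by (rule clinearI)
    (simp_all add: fun_eq_iff clinear_on_add[OF clinear_tS3] clinear_on_scale[OF clinear_tS3]
      scaleC_fun_apply)

lemma clinear_T1234: "clinear (T1234 R)"
  unfolding T1234_def by (rule clinear_comp[OF clinear_S123 clinear_tildeS234])

lemma clinear_E23: "clinear (E23 :: ('n::finite, 'x::complex_vec) legs4 \<Rightarrow> ('n, 'x) legs2)"
  by (rule clinearI)
    (simp_all add: fun_eq_iff E23_def sum.distrib scaleC_sum_right scaleC_fun_apply)

lemma E23_map: "clinear G \<Longrightarrow> G (E23 X a b) = E23 (\<lambda>a b c d. G (X a b c d)) a b"
  by (simp add: E23_def clinear_on_sum)

section \<open>Tensor products\<close>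

lemma formal_sum_superset:
  "finite S \<Longrightarrow> Poly_Mapping.keys z \<subseteq> S \<Longrightarrow>
    formal_sum tn z = (\<Sum>p\<in>S. of_int (Poly_Mapping.lookup z p) *\<^sub>C tn (fst p) (snd p))"
  unfolding formal_sum_def case_prod_unfold
  by (rule sum.mono_neutral_cong_left) (auto simp: in_keys_iff scaleC_zero_left)

lemma formal_sum_diff: "formal_sum tn (x - y) = formal_sum tn x - formal_sum tn y"
proof -
  let ?S = "Poly_Mapping.keys x \<union> Poly_Mapping.keys y"
  have "finite ?S" by simp
  moreover have "Poly_Mapping.keys (x - y) \<subseteq> ?S" by (rule keys_diff)
  ultimately show ?thesis
    by (simp add: formal_sum_superset[of ?S] lookup_minus scaleC_diff_left sum_subtractf)
qed

lemma formal_sum_0 [simp]: "formal_sum tn 0 = 0"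
  by (simp add: formal_sum_def)

lemma formal_sum_of [simp]: "formal_sum tn (frag_of (x, y)) = tn x y"
  by (simp add: formal_sum_def scaleC_one)

lemma additive_diff:
  assumes "\<And>x y. h (x + y) = h x + h y"
  shows "h (x - y :: 'a::ab_group_add) = (h x - h y :: 'b::ab_group_add)"
  using assms[of "x - y" y] by simp

locale tensor_product =
  fixes B :: "'a set" and rt :: "'u::complex_vec \<Rightarrow> 'a \<Rightarrow> 'u" and l :: "'a \<Rightarrow> 'w::complex_vec \<Rightarrow> 'w"
    and tn :: "'u \<Rightarrow> 'w \<Rightarrow> 't::complex_vec"
  assumes tensor_product: "is_tensor_product B rt l tn"
begin

lemma relation_vanishes: "z \<in> tensor_relations B rt l \<Longrightarrow> formal_sum tn z = 0"
  using tensor_product hull_subset[of "tensor_relations B rt l" add_subgroup]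
  unfolding is_tensor_product_def by blast

lemma tn_add_left: "tn (x + x') y = tn x y + tn x' y"
proof -
  have "frag_of (x + x', y) - frag_of (x, y) - frag_of (x', y) \<in> tensor_relations B rt l"
    unfolding tensor_relations_def by blast
  from relation_vanishes[OF this] have "tn (x + x') y - tn x y - tn x' y = 0"
    by (simp add: formal_sum_diff)
  then show ?thesis by (simp add: algebra_simps)
qed

lemma tn_add_right: "tn x (y + y') = tn x y + tn x y'"
proof -
  have "frag_of (x, y + y') - frag_of (x, y) - frag_of (x, y') \<in> tensor_relations B rt l"
    unfolding tensor_relations_def by blast
  from relation_vanishes[OF this] have "tn x (y + y') - tn x y - tn x y' = 0"
    by (simp add: formal_sum_diff)
  then show ?thesis by (simp add: algebra_simps)
qed

lemma tn_balanced: "b \<in> B \<Longrightarrow> tn (rt x b) y = tn x (l b y)"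
proof -
  assume "b \<in> B"
  then have "frag_of (rt x b, y) - frag_of (x, l b y) \<in> tensor_relations B rt l"
    unfolding tensor_relations_def by blast
  from relation_vanishes[OF this] show ?thesis by (simp add: formal_sum_diff)
qed

lemma tn_scale_left: "tn (c *\<^sub>C x) y = c *\<^sub>C tn x y"
  using tensor_product by (simp add: is_tensor_product_def)

lemma clinear_left: "clinear (\<lambda>x. tn x y)"
  by (rule clinearI) (simp_all add: tn_add_left tn_scale_left)

lemma tensor_cases: obtains z where "t = formal_sum tn z"
proof -
  have "surj (formal_sum tn)" using tensor_product by (simp add: is_tensor_product_def)
  then show ?thesis using that by (rule surjE)
qed

text \<open>Closure under differences is enough, since the elementary tensors generate the tensor
  product as an abelian group.\<close>

lemma tensor_induct:
  assumes "\<And>x y. Pr (tn x y)" "\<And>s t. Pr s \<Longrightarrow> Pr t \<Longrightarrow> Pr (s - t)"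
  shows "Pr t"
proof -
  obtain z where t: "t = formal_sum tn z" by (rule tensor_cases)
  have "Pr 0" using assms(2)[OF assms(1) assms(1), of 0 0 0 0] by simp
  have "Pr (formal_sum tn z)"
    by (rule frag_induction[of z UNIV]) (auto simp: formal_sum_diff assms \<open>Pr 0\<close>)
  then show ?thesis by (simp add: t)
qed

lemma additive_unique:
  assumes "\<And>x y. h (x + y) = h x + h y" "\<And>x y. h' (x + y) = h' x + h' y"
    and "\<And>x y. h (tn x y) = (h' (tn x y) :: 'z::ab_group_add)"
  shows "h t = h' t"
proof (rule tensor_induct)
  fix s t assume "h s = h' s" "h t = h' t"
  then show "h (s - t) = h' (s - t)"
    by (simp only: additive_diff[of h, OF assms(1)] additive_diff[of h', OF assms(2)])
qed (rule assms(3))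

context
  fixes \<phi> :: "'u \<Rightarrow> 'w \<Rightarrow> 'z::complex_vec"
  assumes add_left: "\<And>x x' y. \<phi> (x + x') y = \<phi> x y + \<phi> x' y"
    and add_right: "\<And>x y y'. \<phi> x (y + y') = \<phi> x y + \<phi> x y'"
    and balanced: "\<And>x b y. b \<in> B \<Longrightarrow> \<phi> (rt x b) y = \<phi> x (l b y)"
begin

text \<open>The formal sums on which \<phi> vanishes form a subgroup containing the tensor
  relations, hence the hull of these.\<close>

lemma kernel_le: "formal_sum tn z = 0 \<Longrightarrow> formal_sum \<phi> z = 0"
proof -
  assume "formal_sum tn z = 0"
  then have "z \<in> add_subgroup hull tensor_relations B rt l"
    using tensor_product unfolding is_tensor_product_def by blast
  moreover have "tensor_relations B rt l \<subseteq> {z. formal_sum \<phi> z = 0}"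
    by (auto simp: tensor_relations_def formal_sum_diff add_left add_right balanced)
  moreover have "add_subgroup {z. formal_sum \<phi> z = 0}"
    by (auto simp: add_subgroup_def formal_sum_diff)
  ultimately show ?thesis using hull_minimal by blast
qed

text \<open>The universal property, which gives the description operator in
  \<open>tensor_induced\<close> its meaning.\<close>

lemma tensor_induced_ex1:
  "\<exists>!h. (\<forall>x y. h (x + y) = h x + h y) \<and> (\<forall>x y. h (tn x y) = \<phi> x y)"
proof -
  \<comment> \<open>Any preimage in the free abelian group may be chosen: two of them differ by an
    element of the kernel, on which \<phi> vanishes.\<close>
  define h where "h = (\<lambda>t. formal_sum \<phi> (SOME z. formal_sum tn z = t))"
  have h: "h (formal_sum tn z) = formal_sum \<phi> z" for z
  proof -
    let ?z = "SOME z'. formal_sum tn z' = formal_sum tn z"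
    have "formal_sum tn ?z = formal_sum tn z"
      by (rule someI) (rule refl)
    then have "formal_sum tn (?z - z) = 0"
      by (simp add: formal_sum_diff)
    from kernel_le[OF this] show ?thesis by (simp add: h_def formal_sum_diff)
  qed
  have diff: "h (s - t) = h s - h t" for s t
  proof -
    obtain x where x: "s = formal_sum tn x" by (rule tensor_cases)
    obtain y where y: "t = formal_sum tn y" by (rule tensor_cases)
    have "formal_sum tn x - formal_sum tn y = formal_sum tn (x - y)"
      by (rule formal_sum_diff[symmetric])
    then have "h (s - t) = formal_sum \<phi> (x - y)"
      by (simp only: x y h)
    also have "\<dots> = h s - h t"
      by (simp only: x y h formal_sum_diff)
    finally show ?thesis .
  qed
  have add: "h (s + t) = h s + h t" for s t
    using diff[of "s + t" t] by (simp add: algebra_simps)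
  have tn: "h (tn x y) = \<phi> x y" for x y using h[of "frag_of (x, y)"] by simp
  show ?thesis
  proof (rule ex1I[of _ h])
    show "(\<forall>x y. h (x + y) = h x + h y) \<and> (\<forall>x y. h (tn x y) = \<phi> x y)"
      using add tn by blast
    fix h'
    assume h': "(\<forall>x y. h' (x + y) = h' x + h' y) \<and> (\<forall>x y. h' (tn x y) = \<phi> x y)"
    show "h' = h"
    proof
      fix t
      show "h' t = h t" by (rule additive_unique[of h' h]) (use h' add tn in simp_all)
    qed
  qed
qed

lemma tensor_induced_spec:
  "(\<forall>s t. tensor_induced tn \<phi> (s + t) = tensor_induced tn \<phi> s + tensor_induced tn \<phi> t) \<and>
    (\<forall>x y. tensor_induced tn \<phi> (tn x y) = \<phi> x y)"
  unfolding tensor_induced_def by (rule theI'[OF tensor_induced_ex1])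

lemma tensor_induced_add: "tensor_induced tn \<phi> (s + t) = tensor_induced tn \<phi> s + tensor_induced tn \<phi> t"
  using tensor_induced_spec by simp

lemma tensor_induced_tn: "tensor_induced tn \<phi> (tn x y) = \<phi> x y"
  using tensor_induced_spec by simp

lemma clinear_tensor_induced:
  assumes "\<And>c x y. \<phi> (c *\<^sub>C x) y = c *\<^sub>C \<phi> x y"
  shows "clinear (tensor_induced tn \<phi>)"
proof (rule clinearI[OF tensor_induced_add])
  fix c t
  let ?h = "tensor_induced tn \<phi>"
  show "?h (c *\<^sub>C t) = c *\<^sub>C ?h t"
  proof (rule additive_unique[of "\<lambda>t. ?h (c *\<^sub>C t)" "\<lambda>t. c *\<^sub>C ?h t"])
    show "?h (c *\<^sub>C tn x y) = c *\<^sub>C ?h (tn x y)" for x y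
      by (simp only: tn_scale_left[symmetric] tensor_induced_tn assms)
  qed (simp_all only: scaleC_add_right tensor_induced_add)
qed

end

end

section \<open>The first order calculus\<close>

text \<open>A family with legs V and V' is a matrix, and contracting the two inner legs by E is the
  matrix product formed with \<open>m\<close>.\<close>

definition contract_mult :: "('x \<Rightarrow> 'y \<Rightarrow> 'z::complex_vec) \<Rightarrow> ('n::finite, 'x) legs2 \<Rightarrow> ('n, 'y) legs2 \<Rightarrow> ('n, 'z) legs2"
  where "contract_mult m X Y = E23 (concat_legs m X Y)"

lemma contract_mult_eq: "contract_mult m X Y a c = (\<Sum>b\<in>UNIV. m (X a b) (Y b c))"
  by (simp add: contract_mult_def E23_def concat_legs_def)

text \<open>P and Q stand for the matrices of the two partial differentials of p, and \<omega>,
  \<alpha> for the numbers (omega_s, omega_s), (alpha_s, alpha_s). The splittings of P and Q are the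
  derivatives of p p = p.\<close>

locale quantum_calculus = quantum_legs q r k \<nu> R wt + \<Omega>: tensor_product B rt l tn
  for q :: real and r :: nat and k :: "'n::finite \<Rightarrow> nat" and \<nu> :: real and R :: "'n braidings"
    and wt :: "'n \<Rightarrow> weight"
    and B :: "'a::complex_algebra_1 set"
    and rt :: "'w::complex_vec \<Rightarrow> 'a \<Rightarrow> 'w" and l :: "'a \<Rightarrow> 'w \<Rightarrow> 'w"
    and tn :: "'w \<Rightarrow> 'w \<Rightarrow> 't::complex_vec" +
  fixes d :: "'a \<Rightarrow> 'w" and p :: "('n, 'a) legs2" and P Q :: "('n, 'w) legs2"
    and \<omega> \<alpha> :: real
  assumes one_in: "1 \<in> B" and B_subspace: "csubspace B"
    and B_mult: "a \<in> B \<Longrightarrow> b \<in> B \<Longrightarrow> a * b \<in> B" and p_in: "p i j \<in> B"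
    and bimodule: "bimodule B l rt" and derivation: "derivation B l rt d"
    and d_p: "d (p i j) = P i j + Q i j"
    and generated: "(\<And>i j b. b \<in> B \<Longrightarrow> Pr (l b (P i j))) \<Longrightarrow> (\<And>i j b. b \<in> B \<Longrightarrow> Pr (l b (Q i j))) \<Longrightarrow>
      (\<And>x y. Pr x \<Longrightarrow> Pr y \<Longrightarrow> Pr (x + y)) \<Longrightarrow> Pr x"
    and tS_P: "tildeS234 R (concat_legs l p P) = qpow q (- \<omega>) *\<^sub>C concat_legs l p P"
    and S_Q: "S123 R (concat_legs l p Q) = qpow q \<omega> *\<^sub>C concat_legs l p Q"
    and et_P: "E'12 r q wt P = 0" and et_Q: "E'12 r q wt Q = 0"
    and P_p: "rt (P i j) (p m n) = qpow q \<alpha> *\<^sub>C T1234 R (concat_legs l p P) i j m n"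
    and Q_p: "rt (Q i j) (p m n) = qpow q (- \<alpha>) *\<^sub>C T1234 R (concat_legs l p Q) i j m n"
    and P_split: "P = contract_mult l p P + contract_mult rt P p" and Q_split: "Q = contract_mult l p Q + contract_mult rt Q p"
begin

lemma left_module: "left_module B l" and right_module: "right_module B rt"
  and l_rt: "b \<in> B \<Longrightarrow> b' \<in> B \<Longrightarrow> rt (l b x) b' = l b (rt x b')"
  using bimodule by (simp_all add: bimodule_def)

lemma scale_in: "b \<in> B \<Longrightarrow> c *\<^sub>C b \<in> B"
  using B_subspace by (simp add: csubspace_def)

lemma uminus_in: "b \<in> B \<Longrightarrow> - b \<in> B"
  using scale_in[of b "- 1"] by (simp add: scaleC_minus_left scaleC_one)

lemma l_add: "b \<in> B \<Longrightarrow> l b (x + y) = l b x + l b y"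
  and l_add_left: "b \<in> B \<Longrightarrow> b' \<in> B \<Longrightarrow> l (b + b') x = l b x + l b' x"
  and l_mult: "b \<in> B \<Longrightarrow> b' \<in> B \<Longrightarrow> l (b * b') x = l b (l b' x)"
  and l_one: "l 1 x = x"
  and l_scale_left: "b \<in> B \<Longrightarrow> l (c *\<^sub>C b) x = c *\<^sub>C l b x"
  using left_module by (simp_all add: left_module_def)

lemma rt_add: "b \<in> B \<Longrightarrow> rt (x + y) b = rt x b + rt y b"
  and rt_one: "rt x 1 = x"
  and rt_scale_right: "b \<in> B \<Longrightarrow> rt x (c *\<^sub>C b) = c *\<^sub>C rt x b"
  using right_module by (simp_all add: right_module_def)

text \<open>A scalar c acts as the element c 1 of B, so homogeneity in the module variable reduces
  to that in the algebra variable. The same trick moves scalars across tensor products over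
  B.\<close>

lemma l_scale: assumes "b \<in> B" shows "l b (c *\<^sub>C x) = c *\<^sub>C l b x"
proof -
  have 1: "c *\<^sub>C x = l (c *\<^sub>C 1) x" by (simp add: l_scale_left one_in l_one)
  have "l b (l (c *\<^sub>C 1) x) = l (b * (c *\<^sub>C 1)) x"
    by (simp add: l_mult assms scale_in one_in)
  also have "b * (c *\<^sub>C 1) = c *\<^sub>C b" by (simp add: mult_scaleC_right)
  finally show ?thesis by (simp only: 1 l_scale_left assms)
qed

lemma clinear_l: "b \<in> B \<Longrightarrow> clinear (l b)"
  by (rule clinearI) (simp_all add: l_add l_scale)

lemma tn_scale_right: "tn x (c *\<^sub>C y) = c *\<^sub>C tn x y"
proof -
  have "tn x (c *\<^sub>C y) = tn x (l (c *\<^sub>C 1) y)" by (simp add: l_scale_left one_in l_one)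
  also have "\<dots> = tn (rt x (c *\<^sub>C 1)) y" by (simp add: \<Omega>.tn_balanced scale_in one_in)
  finally show ?thesis by (simp add: rt_scale_right one_in rt_one \<Omega>.tn_scale_left)
qed

lemma clinear_tn: "clinear (tn x)"
  by (rule clinearI) (simp_all add: \<Omega>.tn_add_right tn_scale_right)

lemma clinear_tn': "clinear (\<lambda>x. tn x y)"
  by (rule \<Omega>.clinear_left)

abbreviation "pP \<equiv> concat_legs l p P"
abbreviation "pQ \<equiv> concat_legs l p Q"

text \<open>Contract the relation of Omega_+ by E: one side is a nonzero multiple of p P, the other
  becomes E' of P, which is zero.\<close>

lemma contract_mult_p_P: "contract_mult l p P = 0"
proof -
  have "qpow q (- \<omega>) *\<^sub>C E23 pP = E23 (tildeS234 R pP)"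
    unfolding tS_P clinear_on_scale[OF clinear_E23 UNIV_I] ..
  also have "\<dots> = (\<lambda>a b. \<theta> *\<^sub>C et (\<lambda>c d. l (p a b) (P c d)))"
    unfolding E23_tildeS concat_legs_def ..
  also have "\<dots> = 0"
    by (intro ext) (simp add: et_map[OF clinear_l[OF p_in], symmetric] et_P scaleC_zero_right
        clinear_on_zero[OF clinear_l[OF p_in]])
  finally have "qpow q (- \<omega>) *\<^sub>C E23 pP = qpow q (- \<omega>) *\<^sub>C 0" by (simp add: scaleC_zero_right)
  then show ?thesis by (simp add: scaleC_cancel qpow_nonzero[OF q] contract_mult_def)
qed

text \<open>The bimodule rule turns Q p into T (p Q). Here S acts as a scalar by the relation of
  Omega_-, and S~ under E leaves E' of Q, which is zero.\<close>

lemma contract_mult_Q_p: "contract_mult rt Q p = 0"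
proof -
  have "contract_mult rt Q p = E23 (qpow q (- \<alpha>) *\<^sub>C T1234 R pQ)"
    unfolding contract_mult_def by (rule arg_cong[of _ _ E23], intro ext) (simp add: concat_legs_def Q_p scaleC_fun_apply)
  also have "T1234 R pQ = qpow q \<omega> *\<^sub>C tildeS234 R pQ"
    unfolding T_eq(2) S_Q clinear_on_scale[OF clinear_tildeS234 UNIV_I] ..
  also have "E23 (qpow q (- \<alpha>) *\<^sub>C qpow q \<omega> *\<^sub>C tildeS234 R pQ) = qpow q (- \<alpha>) *\<^sub>C qpow q \<omega> *\<^sub>C E23 (tildeS234 R pQ)"
    unfolding clinear_on_scale[OF clinear_E23 UNIV_I] ..
  also have "E23 (tildeS234 R pQ) = (\<lambda>a b. \<theta> *\<^sub>C et (\<lambda>c d. l (p a b) (Q c d)))"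
    unfolding E23_tildeS concat_legs_def ..
  also have "\<dots> = 0"
    by (intro ext) (simp add: et_map[OF clinear_l[OF p_in], symmetric] et_Q scaleC_zero_right
        clinear_on_zero[OF clinear_l[OF p_in]])
  finally show ?thesis by (simp add: fun_eq_iff scaleC_fun_apply scaleC_zero_right)
qed

lemma contract_mult_P_p: "contract_mult rt P p = P"
  using P_split contract_mult_p_P by simp

lemma contract_mult_p_Q: "contract_mult l p Q = Q"
  using Q_split contract_mult_Q_p by simp

abbreviation "lact \<equiv> tensor_lact tn l"
abbreviation "ract \<equiv> tensor_ract tn rt"

context fixes b assumes b: "b \<in> B" begin

lemma lact_tn: "lact b (tn x y) = tn (l b x) y"
  unfolding tensor_lact_def
  by (rule \<Omega>.tensor_induced_tn)
    (simp_all add: l_add b \<Omega>.tn_add_left \<Omega>.tn_add_right l_rt[symmetric] \<Omega>.tn_balanced)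

lemma clinear_lact: "clinear (lact b)"
  unfolding tensor_lact_def
  by (rule \<Omega>.clinear_tensor_induced)
    (simp_all add: l_add b \<Omega>.tn_add_left \<Omega>.tn_add_right l_rt[symmetric] \<Omega>.tn_balanced l_scale \<Omega>.tn_scale_left)

lemma ract_tn: "ract (tn x y) b = tn x (rt y b)"
  unfolding tensor_ract_def
  by (rule \<Omega>.tensor_induced_tn)
    (simp_all add: rt_add b \<Omega>.tn_add_left \<Omega>.tn_add_right l_rt \<Omega>.tn_balanced)

lemma clinear_ract: "clinear (\<lambda>t. ract t b)"
  unfolding tensor_ract_def
  by (rule \<Omega>.clinear_tensor_induced)
    (simp_all add: rt_add b \<Omega>.tn_add_left \<Omega>.tn_add_right l_rt \<Omega>.tn_balanced \<Omega>.tn_scale_left)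

end

lemma tn_mm: "tn (contract_mult rt X p a c) y = (\<Sum>b\<in>UNIV. tn (X a b) (l (p b c) y))"
  by (simp add: contract_mult_eq clinear_on_sum[OF clinear_tn'] \<Omega>.tn_balanced p_in)

lemma contract_mult_tn_p: "contract_mult tn (contract_mult rt X p) Y = contract_mult tn X (contract_mult l p Y)"
proof (intro ext)
  fix a c
  have "contract_mult tn (contract_mult rt X p) Y a c = (\<Sum>b\<in>UNIV. \<Sum>e\<in>UNIV. tn (X a e) (l (p e b) (Y b c)))"
    by (simp add: contract_mult_eq[of tn] tn_mm)
  also have "\<dots> = (\<Sum>e\<in>UNIV. \<Sum>b\<in>UNIV. tn (X a e) (l (p e b) (Y b c)))" by (rule sum.swap)
  also have "\<dots> = contract_mult tn X (contract_mult l p Y) a c"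
    by (simp add: contract_mult_eq clinear_on_sum[OF clinear_tn])
  finally show "contract_mult tn (contract_mult rt X p) Y a c = contract_mult tn X (contract_mult l p Y) a c" .
qed

text \<open>P P = (P p) P = P (p P) = 0, because the tensor product is taken over B.\<close>

lemma contract_mult_P_P: "contract_mult tn P P = 0"
  using contract_mult_tn_p[of P P] unfolding contract_mult_P_p contract_mult_p_P
  by (simp add: fun_eq_iff contract_mult_eq clinear_on_zero[OF clinear_tn])

text \<open>Q Q = Q (p Q) = (Q p) Q = 0.\<close>

lemma contract_mult_Q_Q: "contract_mult tn Q Q = 0"
  using contract_mult_tn_p[of Q Q] unfolding contract_mult_Q_p contract_mult_p_Q
  by (simp add: fun_eq_iff contract_mult_eq clinear_on_zero[OF clinear_tn'])

definition "M = contract_mult tn Q P"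
definition "M' = contract_mult tn P Q"

text \<open>The entry of p passes first Y and then X, each time by T and a scalar; the scalars
  cancel and \<open>E23_T_T\<close> merges the two passages.\<close>

lemma ract_mm:
  assumes X: "\<And>i j m n. rt (X i j) (p m n) = c1 *\<^sub>C T1234 R (concat_legs l p X) i j m n"
    and Y: "\<And>i j m n. rt (Y i j) (p m n) = c2 *\<^sub>C T1234 R (concat_legs l p Y) i j m n"
    and "c1 * c2 = 1"
  shows "concat_legs ract (contract_mult tn X Y) p = T1234 R (concat_legs lact p (contract_mult tn X Y))"
proof (intro ext)
  fix i j m n
  \<comment> \<open>The six legs of p, X and Y, with p in its final place on the left.\<close>
  let ?X6 = "\<lambda>a b c d e f. lact (p a b) (tn (X c d) (Y e f))"
  have 1: "tn (X i e) (l (p a b) (Y c d)) = c1 *\<^sub>C T1234 R ?X6 i e a b c d" for e a b c d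
  proof -
    have "tn (X i e) (l (p a b) (Y c d)) = c1 *\<^sub>C tn (T1234 R (concat_legs l p X) i e a b) (Y c d)"
      by (simp add: \<Omega>.tn_balanced[symmetric] p_in X \<Omega>.tn_scale_left)
    also have "tn (T1234 R (concat_legs l p X) i e a b) (Y c d)
      = T1234 R (\<lambda>a' b' e f. tn (l (p a' b') (X e f)) (Y c d)) i e a b"
      unfolding T1234_map[OF clinear_tn'] concat_legs_def ..
    also have "\<dots> = T1234 R ?X6 i e a b c d"
      unfolding T1234_map[OF clinear_app, of R ?X6 i e a b c]
        T1234_map[OF clinear_app, of R _ i e a b d] by (simp add: lact_tn p_in)
    finally show ?thesis .
  qed
  have "concat_legs ract (contract_mult tn X Y) p i j m n = (\<Sum>e\<in>UNIV. tn (X i e) (rt (Y e j) (p m n)))"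
    by (simp add: concat_legs_def contract_mult_eq clinear_on_sum[OF clinear_ract[OF p_in]] ract_tn p_in)
  also have "\<dots> = (\<Sum>e\<in>UNIV. T1234 R (T1234 R ?X6 i e) e j m n)"
  proof (rule sum.cong[OF refl])
    fix e
    have "tn (X i e) (rt (Y e j) (p m n)) = c2 *\<^sub>C tn (X i e) (T1234 R (concat_legs l p Y) e j m n)"
      by (simp add: Y tn_scale_right)
    also have "tn (X i e) (T1234 R (concat_legs l p Y) e j m n) = T1234 R (\<lambda>a b c d. tn (X i e) (l (p a b) (Y c d))) e j m n"
      unfolding T1234_map[OF clinear_tn] concat_legs_def ..
    also have "(\<lambda>a b c d. tn (X i e) (l (p a b) (Y c d))) = c1 *\<^sub>C T1234 R ?X6 i e"
      by (intro ext) (simp add: 1 scaleC_fun_apply)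
    also have "T1234 R (c1 *\<^sub>C T1234 R ?X6 i e) e j m n = c1 *\<^sub>C T1234 R (T1234 R ?X6 i e) e j m n"
      by (simp add: clinear_on_scale[OF clinear_T1234] scaleC_fun_apply)
    finally show "tn (X i e) (rt (Y e j) (p m n)) = T1234 R (T1234 R ?X6 i e) e j m n"
      using assms(3) by (simp add: scaleC_scaleC scaleC_one mult.commute)
  qed
  also have "\<dots> = E23 (\<lambda>a b. T1234 R (T1234 R ?X6 a b)) i j m n"
    by (simp add: E23_def sum_fun_app)
  also have "\<dots> = T1234 R (\<lambda>a b. E23 (?X6 a b)) i j m n"
    unfolding E23_T_T ..
  also have "(\<lambda>a b. E23 (?X6 a b)) = concat_legs lact p (contract_mult tn X Y)"
    by (intro ext) (simp add: E23_def concat_legs_def contract_mult_eq clinear_on_sum[OF clinear_lact[OF p_in]])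
  finally show "concat_legs ract (contract_mult tn X Y) p i j m n = T1234 R (concat_legs lact p (contract_mult tn X Y)) i j m n" .
qed

lemma M_p: "concat_legs ract M p = T1234 R (concat_legs lact p M)"
  unfolding M_def by (rule ract_mm[OF Q_p P_p]) (simp add: qpow_cancel)

lemma M'_p: "concat_legs ract M' p = T1234 R (concat_legs lact p M')"
  unfolding M'_def by (rule ract_mm[OF P_p Q_p]) (simp add: qpow_cancel)

lemma contract_mult_ract: "contract_mult ract (contract_mult tn X Y) p = contract_mult tn X (contract_mult rt Y p)"
proof (intro ext)
  fix a c
  have "contract_mult ract (contract_mult tn X Y) p a c = (\<Sum>b\<in>UNIV. \<Sum>e\<in>UNIV. tn (X a e) (rt (Y e b) (p b c)))"
    by (simp add: contract_mult_eq clinear_on_sum[OF clinear_ract[OF p_in]] ract_tn p_in)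
  also have "\<dots> = (\<Sum>e\<in>UNIV. \<Sum>b\<in>UNIV. tn (X a e) (rt (Y e b) (p b c)))" by (rule sum.swap)
  also have "\<dots> = contract_mult tn X (contract_mult rt Y p) a c"
    by (simp add: contract_mult_eq clinear_on_sum[OF clinear_tn])
  finally show "contract_mult ract (contract_mult tn X Y) p a c = contract_mult tn X (contract_mult rt Y p) a c" .
qed

lemma contract_mult_M_p: "contract_mult ract M p = M"
  unfolding M_def contract_mult_ract contract_mult_P_p ..

lemma contract_mult_M'_p: "contract_mult ract M' p = 0"
  unfolding M'_def contract_mult_ract contract_mult_Q_p by (simp add: fun_eq_iff contract_mult_eq clinear_on_zero[OF clinear_tn])

lemma contract_mult_lact: "contract_mult lact p (contract_mult tn X Y) = contract_mult tn (contract_mult l p X) Y"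
proof (intro ext)
  fix a c
  have "contract_mult lact p (contract_mult tn X Y) a c = (\<Sum>b\<in>UNIV. \<Sum>e\<in>UNIV. tn (l (p a b) (X b e)) (Y e c))"
    by (simp add: contract_mult_eq clinear_on_sum[OF clinear_lact[OF p_in]] lact_tn p_in)
  also have "\<dots> = (\<Sum>e\<in>UNIV. \<Sum>b\<in>UNIV. tn (l (p a b) (X b e)) (Y e c))" by (rule sum.swap)
  also have "\<dots> = contract_mult tn (contract_mult l p X) Y a c"
    by (simp add: contract_mult_eq clinear_on_sum[OF clinear_tn'])
  finally show "contract_mult lact p (contract_mult tn X Y) a c = contract_mult tn (contract_mult l p X) Y a c" .
qed

lemma contract_mult_p_M: "contract_mult lact p M = M"
  unfolding M_def contract_mult_lact contract_mult_p_Q ..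

lemma contract_mult_p_M': "contract_mult lact p M' = 0"
  unfolding M'_def contract_mult_lact contract_mult_p_P by (simp add: fun_eq_iff contract_mult_eq clinear_on_zero[OF clinear_tn'])

definition "g = et M"
definition "g' = et M'"

text \<open>S acts on the legs of p and on the first leg of M only, so it sees the factor p (x) Q
  and the relation of Omega_- applies.\<close>

lemma S_p_M: "S123 R (concat_legs lact p M) = qpow q \<omega> *\<^sub>C concat_legs lact p M"
proof (intro ext)
  fix a b c f
  let ?G = "\<lambda>\<phi>. \<Sum>e\<in>UNIV. tn (\<phi> e) (P e f)"
  have G: "clinear ?G"
    by (rule clinearI) (simp_all add: \<Omega>.tn_add_left sum.distrib \<Omega>.tn_scale_left scaleC_sum_right scaleC_fun_apply)
  have "S123 R (concat_legs lact p M) a b c f = S3 R (\<lambda>a b c. concat_legs lact p M a b c f) a b c"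
    by (rule S123_apply)
  also have "(\<lambda>a b c. concat_legs lact p M a b c f) = (\<lambda>a b c. ?G (pQ a b c))"
    by (intro ext) (simp add: concat_legs_def M_def contract_mult_eq clinear_on_sum[OF clinear_lact[OF p_in]] lact_tn p_in)
  also have "S3 R (\<lambda>a b c. ?G (pQ a b c)) a b c = ?G (S3 R pQ a b c)"
    by (rule S3_map[OF G, symmetric])
  also have "\<dots> = qpow q \<omega> *\<^sub>C ?G (pQ a b c)"
    by (simp add: S123_eq[symmetric] S_Q scaleC_fun_apply \<Omega>.tn_scale_left scaleC_sum_right)
  also have "?G (pQ a b c) = concat_legs lact p M a b c f"
    by (simp add: concat_legs_def M_def contract_mult_eq clinear_on_sum[OF clinear_lact[OF p_in]] lact_tn p_in)
  finally show "S123 R (concat_legs lact p M) a b c f = (qpow q \<omega> *\<^sub>C concat_legs lact p M) a b c f"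
    by (simp add: scaleC_fun_apply)
qed

text \<open>Write M as M p and bring p to the left by T. Then S is a scalar, and S~ under E turns M
  into \<theta> times E' of M, that is, into \<theta> g.\<close>

lemma M_eq: "M i j = (\<theta> * qpow q \<omega>) *\<^sub>C lact (p i j) g"
proof -
  have "M = E23 (concat_legs ract M p)" using contract_mult_M_p by (simp add: contract_mult_def)
  also have "\<dots> = E23 (tildeS234 R (S123 R (concat_legs lact p M)))"
    unfolding M_p T_eq(2) ..
  also have "\<dots> = (\<lambda>a b. \<theta> *\<^sub>C et ((qpow q \<omega> *\<^sub>C concat_legs lact p M) a b))"
    unfolding E23_tildeS S_p_M ..
  also have "\<dots> = (\<lambda>a b. (\<theta> * qpow q \<omega>) *\<^sub>C lact (p a b) g)"
    unfolding scaleC_fun_apply clinear_on_scale[OF clinear_et UNIV_I] scaleC_scaleC g_def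
    by (intro ext) (simp only: concat_legs_def et_map[OF clinear_lact[OF p_in]])
  finally show ?thesis by metis
qed

text \<open>E' on the first pair after T is E' on the second pair before it.\<close>

lemma g_central: "ract g (p i j) = lact (p i j) g"
proof -
  have "ract g (p i j) = et (concat_legs ract M p) i j"
    unfolding g_def et_map[OF clinear_ract[OF p_in]] et_apply[of _ i] et_apply[of _ j]
    by (simp add: concat_legs_def)
  also have "\<dots> = et (\<lambda>a b. concat_legs lact p M i j a b)"
    unfolding M_p et_T ..
  also have "\<dots> = lact (p i j) g"
    unfolding g_def concat_legs_def by (rule et_map[OF clinear_lact[OF p_in], symmetric])
  finally show ?thesis .
qed

text \<open>Since P = P p, a factor p can be inserted next to the second P, where the relation of
  Omega_+ applies.\<close>

lemma tS_P_P: "tildeS234 R (concat_legs tn P P) = qpow q (- \<omega>) *\<^sub>C concat_legs tn P P"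
proof (intro ext)
  fix a b c f
  have 1: "concat_legs tn P P a b c f = (\<Sum>e\<in>UNIV. tn (P a e) (pP e b c f))" for b c f
    using tn_mm[of P a b "P c f"] unfolding contract_mult_P_p by (simp add: concat_legs_def)
  have "tildeS234 R (concat_legs tn P P) a b c f = tS3 R (\<lambda>b c f. \<Sum>e\<in>UNIV. tn (P a e) (pP e b c f)) b c f"
    by (simp add: tildeS234_eq 1[abs_def])
  also have "\<dots> = (\<Sum>e\<in>UNIV. tn (P a e) (tS3 R (pP e) b c f))"
  proof -
    let ?G = "\<lambda>\<phi>. \<Sum>e\<in>UNIV. tn (P a e) (\<phi> e)"
    have G: "clinear ?G"
      by (rule clinearI) (simp_all add: \<Omega>.tn_add_right sum.distrib tn_scale_right scaleC_sum_right scaleC_fun_apply)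
    have 2: "tS3 R (\<lambda>b c f e. pP e b c f) b c f e = tS3 R (pP e) b c f" for e
      by (rule tS3_map[OF clinear_app])
    show ?thesis using tS3_map[OF G, of R "\<lambda>b c f e. pP e b c f" b c f] by (simp add: 2)
  qed
  also have "\<dots> = qpow q (- \<omega>) *\<^sub>C (\<Sum>e\<in>UNIV. tn (P a e) (pP e b c f))"
  proof -
    have "tS3 R (pP e) b c f = qpow q (- \<omega>) *\<^sub>C pP e b c f" for e
      using tS_P by (simp add: tildeS234_eq fun_eq_iff scaleC_fun_apply)
    then show ?thesis by (simp add: tn_scale_right scaleC_sum_right)
  qed
  finally show "tildeS234 R (concat_legs tn P P) a b c f = (qpow q (- \<omega>) *\<^sub>C concat_legs tn P P) a b c f"
    by (simp add: 1[symmetric] scaleC_fun_apply)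
qed

text \<open>S~ acts as a scalar, and E after S combines the contractions of P (x) P by E' and by E,
  both of which vanish.\<close>

lemma E23_T_P_P: "E23 (T1234 R (concat_legs tn P P)) = 0"
proof -
  have "et (concat_legs tn P P) = 0"
  proof (intro ext)
    fix c f
    have "et (concat_legs tn P P) c f = et (\<lambda>a b. tn (P a b) (P c f))"
      by (simp add: et_apply concat_legs_def)
    also have "\<dots> = tn (et P) (P c f)" by (rule et_map[OF clinear_tn', symmetric])
    finally show "et (concat_legs tn P P) c f = 0 c f" by (simp add: et_P clinear_on_zero[OF clinear_tn'])
  qed
  moreover have "E23 (concat_legs tn P P) = 0" using contract_mult_P_P by (simp add: contract_mult_def)
  ultimately show ?thesis
    unfolding T_eq(1) tS_P_P clinear_on_scale[OF clinear_S123 UNIV_I] clinear_on_scale[OF clinear_E23 UNIV_I] E23_S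
    by (simp add: scaleC_zero_right)
qed

end

section \<open>Torsion and cotorsion\<close>

text \<open>Here \<rho> is the number (omega_s, 2 rho). The equation between exponents identifies
  \<theta> q^\<omega> with the constant q^(-\<rho>) of the connection.\<close>

locale quantum_connection =
  quantum_calculus q r k \<nu> R wt B rt l tn d p P Q \<omega> \<alpha> + \<Omega>2: tensor_product B rt2 l tn2
  for q :: real and r :: nat and k :: "'n::finite \<Rightarrow> nat" and \<nu> :: real and R :: "'n braidings"
    and wt :: "'n \<Rightarrow> weight"
    and B :: "'a::complex_algebra_1 set"
    and rt :: "'w::complex_vec \<Rightarrow> 'a \<Rightarrow> 'w" and l :: "'a \<Rightarrow> 'w \<Rightarrow> 'w"
    and tn :: "'w \<Rightarrow> 'w \<Rightarrow> 't::complex_vec"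
    and d :: "'a \<Rightarrow> 'w" and p :: "('n, 'a) legs2" and P Q :: "('n, 'w) legs2"
    and \<omega> \<alpha> :: real
    and rt2 :: "'z::complex_vec \<Rightarrow> 'a \<Rightarrow> 'z" and tn2 :: "'z \<Rightarrow> 'w \<Rightarrow> 'u::complex_vec" +
  fixes \<pi> :: "'t \<Rightarrow> 'z" and d2 :: "'w \<Rightarrow> 'z" and nab :: "'w \<Rightarrow> 't" and \<rho> :: real
  assumes universal: "is_universal_degree2 B l rt d tn \<pi> rt2 d2"
    and connection: "is_connection B l d tn nab"
    and nab_P: "nab (P i j) = qpow q \<alpha> *\<^sub>C E23 (T1234 R (concat_legs tn Q P)) i j
      - (qpow q \<alpha> * qpow q (- \<rho>)) *\<^sub>C tensor_lact tn l (p i j) (metric_part r q wt (concat_legs tn Q P))"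
    and nab_Q: "nab (Q i j) = E23 (concat_legs tn P Q) i j
      - qpow q (- \<rho>) *\<^sub>C tensor_lact tn l (p i j) (metric_part r q wt (concat_legs tn P Q))"
    and \<rho>: "- \<nu> - 1 - real r + \<omega> = - \<rho>"
begin

lemma clinear_\<pi>: "clinear \<pi>" and clinear_d2: "clinear d2" and \<pi>_surj: "surj \<pi>"
  and \<pi>_kernel_set: "{t. \<pi> t = 0} = sub_bimodule B lact ract hull degree2_relations B l d tn"
  using universal unfolding is_universal_degree2_def by (simp_all add: clinear_on_def)

lemma \<pi>_kernel: "\<pi> t = 0 \<longleftrightarrow> t \<in> sub_bimodule B lact ract hull degree2_relations B l d tn"
  unfolding \<pi>_kernel_set[symmetric] by simp

lemma rt2_\<pi>: "b \<in> B \<Longrightarrow> rt2 (\<pi> t) b = \<pi> (ract t b)"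
  and d2_l_d: "a \<in> B \<Longrightarrow> b \<in> B \<Longrightarrow> d2 (l a (d b)) = \<pi> (tn (d a) (d b))"
  using universal unfolding is_universal_degree2_def by simp_all

lemma clinear_nab: "clinear nab"
  and nab_l: "b \<in> B \<Longrightarrow> nab (l b x) = tn (d b) x + lact b (nab x)"
  using connection unfolding is_connection_def by (simp_all add: clinear_on_def)

lemmas \<pi>_add = clinear_on_add[OF clinear_\<pi> UNIV_I UNIV_I]
lemmas \<pi>_diff = clinear_on_diff[OF clinear_\<pi> UNIV_I UNIV_I]
lemmas \<pi>_scale = clinear_on_scale[OF clinear_\<pi> UNIV_I]
lemmas d2_add = clinear_on_add[OF clinear_d2 UNIV_I UNIV_I]
lemmas d2_diff = clinear_on_diff[OF clinear_d2 UNIV_I UNIV_I]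

text \<open>There is no separate left action on Omega^2; instead \<open>lact\<close> descends along
  \<pi>, whose kernel is a sub-bimodule.\<close>

lemma \<pi>_lact:
  assumes "\<pi> s = \<pi> t" "b \<in> B" shows "\<pi> (lact b s) = \<pi> (lact b t)"
proof -
  let ?H = "sub_bimodule B lact ract hull degree2_relations B l d tn"
  have "sub_bimodule B lact ract ?H"
    by (rule hull_in) (auto simp: sub_bimodule_def)
  moreover have "s - t \<in> ?H" using assms(1) by (simp add: \<pi>_kernel[symmetric] \<pi>_diff)
  ultimately have "lact b (s - t) \<in> ?H" using assms(2) by (simp add: sub_bimodule_def)
  then show ?thesis
    by (simp add: \<pi>_kernel[symmetric] \<pi>_diff clinear_on_diff[OF clinear_lact[OF assms(2)] UNIV_I UNIV_I])
qed

lemma \<pi>_cases: obtains t where "z = \<pi> t"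
  using \<pi>_surj by (rule surjE)

lemma d_mult: "a \<in> B \<Longrightarrow> b \<in> B \<Longrightarrow> d (a * b) = l a (d b) + rt (d a) b"
  using derivation by (simp add: derivation_def)

lemma d_one: "d 1 = 0"
  using d_mult[OF one_in one_in] by (simp add: l_one rt_one)

lemma tn_d_one: "tn (d 1) x = 0"
  by (simp add: d_one clinear_on_zero[OF clinear_tn'])

text \<open>The forms a db generate: Q = p dp because p P = 0 and p Q = Q, and then P = dp - Q. On
  such forms \<open>d2\<close> is known explicitly.\<close>

lemma generated_d:
  assumes base: "\<And>a b. a \<in> B \<Longrightarrow> b \<in> B \<Longrightarrow> Pr (l a (d b))" and add: "\<And>x y. Pr x \<Longrightarrow> Pr y \<Longrightarrow> Pr (x + y)"
  shows "Pr x"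
proof -
  have "0 \<in> B" using B_subspace by (simp add: csubspace_def)
  have "Pr 0"
  proof -
    have "l 0 (d 1) = 0" using l_scale_left[OF one_in, of 0] by (simp add: scaleC_zero_left)
    then show ?thesis using base[OF \<open>0 \<in> B\<close> one_in] by simp
  qed
  then have sum: "(\<And>i. i \<in> I \<Longrightarrow> Pr (f i)) \<Longrightarrow> Pr (\<Sum>i\<in>I. f i)" for I :: "'n set" and f
    by (induction I rule: infinite_finite_induct) (auto intro: add)
  have Q: "Pr (l b (Q i j))" if b: "b \<in> B" for b i j
  proof -
    have "Q i j = (\<Sum>e\<in>UNIV. l (p i e) (d (p e j)))"
      using fun_cong[OF fun_cong[OF contract_mult_p_P], of i j] fun_cong[OF fun_cong[OF contract_mult_p_Q], of i j]
      by (simp add: contract_mult_eq d_p l_add p_in sum.distrib)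
    then have "l b (Q i j) = (\<Sum>e\<in>UNIV. l (b * p i e) (d (p e j)))"
      by (simp add: clinear_on_sum[OF clinear_l] b l_mult p_in)
    then show ?thesis using b by (auto intro!: sum base B_mult p_in)
  qed
  have P: "Pr (l b (P i j))" if b: "b \<in> B" for b i j
  proof -
    have "l (- b) (Q i j) = - l b (Q i j)"
      using l_scale_left[OF b, of "- 1" "Q i j"] by (simp add: scaleC_minus_left scaleC_one)
    then have "l b (P i j) = l b (d (p i j)) + l (- b) (Q i j)"
      by (simp add: d_p l_add b)
    then show ?thesis using b by (auto intro!: add base Q uminus_in p_in)
  qed
  show ?thesis by (rule generated[of Pr x]) (auto intro: P Q add)
qed

text \<open>On a dc this is the Leibniz rule for d (b a). The induction carries along some preimage
  of \<open>d2 x\<close>, since b acts on preimages; the value does not depend on the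
  preimage.\<close>

lemma d2_left:
  assumes b: "b \<in> B" and t: "d2 x = \<pi> t"
  shows "d2 (l b x) = \<pi> (tn (d b) x) + \<pi> (lact b t)"
proof -
  have "\<exists>t. d2 x = \<pi> t \<and> d2 (l b x) = \<pi> (tn (d b) x) + \<pi> (lact b t)"
  proof (rule generated_d[of _ x])
    fix a c assume a: "a \<in> B" and c: "c \<in> B"
    have "d2 (l b (l a (d c))) = d2 (l (b * a) (d c))" using a b by (simp add: l_mult)
    also have "\<dots> = \<pi> (tn (d (b * a)) (d c))" using a b c by (simp add: d2_l_d B_mult)
    also have "\<dots> = \<pi> (tn (d b) (l a (d c))) + \<pi> (lact b (tn (d a) (d c)))"
      using a b by (simp add: d_mult \<Omega>.tn_add_left \<pi>_add lact_tn \<Omega>.tn_balanced)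
    finally show "\<exists>t. d2 (l a (d c)) = \<pi> t \<and>
        d2 (l b (l a (d c))) = \<pi> (tn (d b) (l a (d c))) + \<pi> (lact b t)"
      using a c d2_l_d by blast
  next
    fix x y
    assume "\<exists>t. d2 x = \<pi> t \<and> d2 (l b x) = \<pi> (tn (d b) x) + \<pi> (lact b t)"
      and "\<exists>t. d2 y = \<pi> t \<and> d2 (l b y) = \<pi> (tn (d b) y) + \<pi> (lact b t)"
    then obtain s t where "d2 x = \<pi> s" "d2 (l b x) = \<pi> (tn (d b) x) + \<pi> (lact b s)"
      and "d2 y = \<pi> t" "d2 (l b y) = \<pi> (tn (d b) y) + \<pi> (lact b t)" by blast
    then show "\<exists>t. d2 (x + y) = \<pi> t \<and> d2 (l b (x + y)) = \<pi> (tn (d b) (x + y)) + \<pi> (lact b t)"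
      by (intro exI[of _ "s + t"])
        (simp add: d2_add \<pi>_add l_add b \<Omega>.tn_add_right clinear_on_add[OF clinear_lact])
  qed
  then obtain s where s: "d2 x = \<pi> s" "d2 (l b x) = \<pi> (tn (d b) x) + \<pi> (lact b s)" by blast
  have "\<pi> s = \<pi> t" using s(1) t by simp
  from \<pi>_lact[OF this b] show ?thesis by (simp only: s(2))
qed

lemma d2_right:
  assumes b: "b \<in> B" shows "d2 (rt x b) = rt2 (d2 x) b - \<pi> (tn x (d b))"
proof -
  have "\<exists>t. d2 x = \<pi> t \<and> d2 (rt x b) = \<pi> (ract t b) - \<pi> (tn x (d b))"
  proof (rule generated_d[of _ x])
    fix a c assume a: "a \<in> B" and c: "c \<in> B"
    \<comment> \<open>Rewriting (dc) b keeps everything in the form a db, on which \<open>d2\<close>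
      is known.\<close>
    have "rt (d c) b = d (c * b) - l c (d b)" using b c by (simp add: d_mult)
    then have "rt (l a (d c)) b = l a (d (c * b)) - l (a * c) (d b)"
      using a b c by (simp add: l_rt clinear_on_diff[OF clinear_l] l_mult)
    then have "d2 (rt (l a (d c)) b) = \<pi> (tn (d a) (d (c * b))) - \<pi> (tn (d (a * c)) (d b))"
      using a b c by (simp add: d2_diff d2_l_d B_mult)
    also have "\<dots> = \<pi> (ract (tn (d a) (d c)) b) - \<pi> (tn (l a (d c)) (d b))"
      using a b c
      by (simp add: d_mult \<Omega>.tn_add_left \<Omega>.tn_add_right \<pi>_add ract_tn \<Omega>.tn_balanced)
    finally show "\<exists>t. d2 (l a (d c)) = \<pi> t \<and>
        d2 (rt (l a (d c)) b) = \<pi> (ract t b) - \<pi> (tn (l a (d c)) (d b))"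
      using a c d2_l_d by blast
  next
    fix x y
    assume "\<exists>t. d2 x = \<pi> t \<and> d2 (rt x b) = \<pi> (ract t b) - \<pi> (tn x (d b))"
      and "\<exists>t. d2 y = \<pi> t \<and> d2 (rt y b) = \<pi> (ract t b) - \<pi> (tn y (d b))"
    then obtain s t where "d2 x = \<pi> s" "d2 (rt x b) = \<pi> (ract s b) - \<pi> (tn x (d b))"
      and "d2 y = \<pi> t" "d2 (rt y b) = \<pi> (ract t b) - \<pi> (tn y (d b))" by blast
    then show "\<exists>t. d2 (x + y) = \<pi> t \<and> d2 (rt (x + y) b) = \<pi> (ract t b) - \<pi> (tn (x + y) (d b))"
      by (intro exI[of _ "s + t"])
        (simp add: d2_add \<pi>_add rt_add b \<Omega>.tn_add_left clinear_on_add[OF clinear_ract])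
  qed
  then show ?thesis by (auto simp: rt2_\<pi> b)
qed

lemma d2_d: "d2 (d (p i j)) = 0"
  using d2_l_d[OF one_in p_in, of i j] by (simp add: l_one tn_d_one clinear_on_zero[OF clinear_\<pi>])

text \<open>A preimage under the wedge of the matrix product of dp with itself, the products P P and
  Q Q being zero.\<close>

definition \<eta> :: "('n, 't) legs2"
  where "\<eta> = (\<lambda>i j. M i j + M' i j)"

lemma d2_Q: "d2 (Q i j) = \<pi> (\<eta> i j)"
proof -
  have "Q i j = (\<Sum>e\<in>UNIV. l (p i e) (d (p e j)))"
    using fun_cong[OF fun_cong[OF contract_mult_p_P], of i j] fun_cong[OF fun_cong[OF contract_mult_p_Q], of i j]
    by (simp add: contract_mult_eq d_p l_add p_in sum.distrib)
  then have "d2 (Q i j) = (\<Sum>e\<in>UNIV. \<pi> (tn (d (p i e)) (d (p e j))))"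
    by (simp add: clinear_on_sum[OF clinear_d2] d2_l_d p_in)
  also have "\<dots> = \<pi> (contract_mult tn P P i j + contract_mult tn P Q i j + contract_mult tn Q P i j + contract_mult tn Q Q i j)"
    by (simp add: d_p \<Omega>.tn_add_left \<Omega>.tn_add_right contract_mult_eq sum.distrib clinear_on_sum[OF clinear_\<pi>] \<pi>_add algebra_simps)
  finally show ?thesis by (simp add: contract_mult_P_P contract_mult_Q_Q M_def M'_def add.commute \<eta>_def)
qed

lemma \<pi>_minus: "\<pi> (- t) = - \<pi> t"
  using \<pi>_diff[of 0 t] by (simp add: clinear_on_zero[OF clinear_\<pi>])

lemma lact_minus: "b \<in> B \<Longrightarrow> lact b (- t) = - lact b t"
  using clinear_on_diff[OF clinear_lact UNIV_I UNIV_I, of b 0 t] by (simp add: clinear_on_zero[OF clinear_lact])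

lemma ract_minus: "b \<in> B \<Longrightarrow> ract (- t) b = - ract t b"
  using clinear_on_diff[OF clinear_ract UNIV_I UNIV_I, of b 0 t] by (simp add: clinear_on_zero[OF clinear_ract])

lemma d2_P: "d2 (P i j) = \<pi> (- \<eta> i j)"
  using d2_d[of i j] unfolding d_p d2_add d2_Q \<pi>_minus by (simp add: eq_neg_iff_add_eq_0)

abbreviation zz :: "('n, 'w) legs2 \<Rightarrow> ('n, 'w) legs2 \<Rightarrow> ('n, 'z) legs4"
  where "zz X Y \<equiv> \<lambda>a b c e. \<pi> (tn (X a b) (Y c e))"

definition ze :: "('n, 'z) legs4"
  where "ze = (\<lambda>a b c e. \<pi> (lact (p a b) (\<eta> c e)))"

text \<open>M and M' obey the same commutation rule with p, hence so does their sum \<eta>.\<close>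

lemma T_ze: "T1234 R ze i j m n = \<pi> (ract (\<eta> i j) (p m n))"
proof -
  have "ract (\<eta> i j) (p m n) = concat_legs ract M p i j m n + concat_legs ract M' p i j m n"
    by (simp add: concat_legs_def clinear_on_add[OF clinear_ract[OF p_in]] \<eta>_def)
  also have "\<dots> = T1234 R (concat_legs lact p M + concat_legs lact p M') i j m n"
    unfolding M_p M'_p clinear_on_add[OF clinear_T1234 UNIV_I UNIV_I] by simp
  also have "concat_legs lact p M + concat_legs lact p M' = (\<lambda>a b c e. lact (p a b) (\<eta> c e))"
    by (intro ext) (simp add: \<eta>_def concat_legs_def clinear_on_add[OF clinear_lact[OF p_in]])
  finally show ?thesis by (simp add: T1234_map[OF clinear_\<pi>] ze_def)
qed

text \<open>Differentiating P p = q^\<alpha> T (p P) produces T (p \<eta>) on both sides, with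
  factor 1 from the right multiplication and q^\<alpha> from the left one; the difference of the
  factors stays on the right.\<close>

lemma relation_P:
  "zz P P + zz P Q + qpow q \<alpha> *\<^sub>C T1234 R (zz P P + zz Q P) = (qpow q \<alpha> - 1) *\<^sub>C T1234 R ze"
proof (intro ext)
  fix i j m n
  have "d2 (rt (P i j) (p m n)) = - T1234 R ze i j m n - (zz P P i j m n + zz P Q i j m n)"
    unfolding d2_right[OF p_in] d2_P rt2_\<pi>[OF p_in]
    unfolding ract_minus[OF p_in] \<pi>_minus T_ze d_p \<Omega>.tn_add_right \<pi>_add ..
  moreover have "d2 (rt (P i j) (p m n)) = qpow q \<alpha> *\<^sub>C (T1234 R (zz P P + zz Q P) i j m n - T1234 R ze i j m n)"
  proof -
    have "d2 (rt (P i j) (p m n)) = qpow q \<alpha> *\<^sub>C T1234 R (\<lambda>a b c e. d2 (l (p a b) (P c e))) i j m n"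
      by (simp add: P_p clinear_on_scale[OF clinear_d2] T1234_map[OF clinear_d2] concat_legs_def)
    also have "(\<lambda>a b c e. d2 (l (p a b) (P c e))) = (zz P P + zz Q P) - ze"
      by (intro ext) (simp add: d2_left[OF p_in d2_P] lact_minus p_in \<pi>_minus ze_def d_p \<Omega>.tn_add_left \<pi>_add)
    finally show ?thesis unfolding clinear_on_diff[OF clinear_T1234 UNIV_I UNIV_I] by simp
  qed
  ultimately have "- T1234 R ze i j m n - (zz P P i j m n + zz P Q i j m n)
     = qpow q \<alpha> *\<^sub>C T1234 R (zz P P + zz Q P) i j m n - qpow q \<alpha> *\<^sub>C T1234 R ze i j m n"
    by (simp add: scaleC_diff_right)
  then show "(zz P P + zz P Q + qpow q \<alpha> *\<^sub>C T1234 R (zz P P + zz Q P)) i j m n = ((qpow q \<alpha> - 1) *\<^sub>C T1234 R ze) i j m n"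
    by (simp add: scaleC_fun_apply scaleC_diff_left scaleC_one algebra_simps)
qed

lemma relation_Q:
  "zz Q P + zz Q Q + qpow q (- \<alpha>) *\<^sub>C T1234 R (zz P Q + zz Q Q) = (1 - qpow q (- \<alpha>)) *\<^sub>C T1234 R ze"
proof (intro ext)
  fix i j m n
  have "d2 (rt (Q i j) (p m n)) = T1234 R ze i j m n - (zz Q P i j m n + zz Q Q i j m n)"
    by (simp add: d2_right p_in d2_Q rt2_\<pi> T_ze d_p \<Omega>.tn_add_right \<pi>_add)
  moreover have "d2 (rt (Q i j) (p m n)) = qpow q (- \<alpha>) *\<^sub>C (T1234 R (zz P Q + zz Q Q) i j m n + T1234 R ze i j m n)"
  proof -
    have "d2 (rt (Q i j) (p m n)) = qpow q (- \<alpha>) *\<^sub>C T1234 R (\<lambda>a b c e. d2 (l (p a b) (Q c e))) i j m n"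
      by (simp add: Q_p clinear_on_scale[OF clinear_d2] T1234_map[OF clinear_d2] concat_legs_def)
    also have "(\<lambda>a b c e. d2 (l (p a b) (Q c e))) = (zz P Q + zz Q Q) + ze"
      by (intro ext) (simp add: d2_left[OF p_in d2_Q] p_in ze_def d_p \<Omega>.tn_add_left \<pi>_add)
    finally show ?thesis unfolding clinear_on_add[OF clinear_T1234 UNIV_I UNIV_I] by simp
  qed
  ultimately have "T1234 R ze i j m n - (zz Q P i j m n + zz Q Q i j m n)
     = qpow q (- \<alpha>) *\<^sub>C T1234 R (zz P Q + zz Q Q) i j m n + qpow q (- \<alpha>) *\<^sub>C T1234 R ze i j m n"
    by (simp add: scaleC_add_right)
  then show "(zz Q P + zz Q Q + qpow q (- \<alpha>) *\<^sub>C T1234 R (zz P Q + zz Q Q)) i j m n = ((1 - qpow q (- \<alpha>)) *\<^sub>C T1234 R ze) i j m n"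
    by (simp add: scaleC_fun_apply scaleC_diff_left scaleC_one algebra_simps)
qed

lemma E23_zz: "E23 (zz X Y) = (\<lambda>i j. \<pi> (contract_mult tn X Y i j))"
  by (intro ext) (simp add: E23_def contract_mult_eq clinear_on_sum[OF clinear_\<pi>])

lemma E23_T_zz: "E23 (T1234 R (zz X Y)) = (\<lambda>i j. \<pi> (E23 (T1234 R (concat_legs tn X Y)) i j))"
  unfolding E23_map[OF clinear_\<pi>] T1234_map[OF clinear_\<pi>] concat_legs_def ..

text \<open>T (p \<eta>) is \<eta> p, and contracting it gives M p + M' p = M + 0.\<close>

lemma E23_T_ze: "E23 (T1234 R ze) = (\<lambda>i j. \<pi> (M i j))"
proof -
  have "E23 (T1234 R ze) = (\<lambda>i j. \<pi> (contract_mult ract M p i j + contract_mult ract M' p i j))"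
    by (intro ext)
      (simp add: E23_def T_ze \<eta>_def contract_mult_eq clinear_on_add[OF clinear_ract[OF p_in]] \<pi>_add clinear_on_sum[OF clinear_\<pi>] sum.distrib)
  then show ?thesis by (simp add: contract_mult_M_p contract_mult_M'_p)
qed

text \<open>The contraction of \<open>relation_P\<close>, in which the terms with P P vanish. It
  evaluates the wedge of the braided term of the connection on P.\<close>

lemma E23_T_QP:
  "qpow q \<alpha> *\<^sub>C E23 (T1234 R (zz Q P)) = (\<lambda>i j. (qpow q \<alpha> - 1) *\<^sub>C \<pi> (M i j) - \<pi> (M' i j))"
proof -
  note add = clinear_on_add[OF clinear_E23 UNIV_I UNIV_I]
  note scale = clinear_on_scale[OF clinear_E23 UNIV_I]
  have 0: "E23 (zz P P) = 0" "E23 (T1234 R (zz P P)) = 0"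
    by (simp_all add: E23_zz E23_T_zz contract_mult_P_P E23_T_P_P clinear_on_zero[OF clinear_\<pi>] fun_eq_iff)
  have "E23 (zz P P + zz P Q + qpow q \<alpha> *\<^sub>C T1234 R (zz P P + zz Q P))
    = E23 ((qpow q \<alpha> - 1) *\<^sub>C T1234 R ze)"
    by (rule arg_cong[OF relation_P])
  then have "(\<lambda>i j. \<pi> (M' i j)) + qpow q \<alpha> *\<^sub>C E23 (T1234 R (zz Q P)) = (qpow q \<alpha> - 1) *\<^sub>C (\<lambda>i j. \<pi> (M i j))"
    unfolding clinear_on_add[OF clinear_T1234 UNIV_I UNIV_I] add scale 0 E23_T_ze E23_zz M'_def by simp
  then show ?thesis by (simp add: fun_eq_iff scaleC_fun_apply algebra_simps eq_diff_eq)
qed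

lemma et_\<pi>: "et (\<lambda>i j. \<pi> (X i j)) = \<pi> (et X)"
  by (rule et_map[OF clinear_\<pi>, symmetric])

text \<open>E' absorbs T, so the trace of \<open>E23_T_QP\<close> reads q^\<alpha> g = (q^\<alpha> -
  1) g - g' in Omega^2.\<close>

lemma \<pi>_g': "\<pi> g' = - \<pi> g"
proof -
  have "qpow q \<alpha> *\<^sub>C \<pi> g = et (qpow q \<alpha> *\<^sub>C E23 (T1234 R (zz Q P)))"
    unfolding clinear_on_scale[OF clinear_et UNIV_I] et_E23_T E23_zz et_\<pi> by (simp add: g_def M_def)
  also have "\<dots> = et ((qpow q \<alpha> - 1) *\<^sub>C (\<lambda>i j. \<pi> (M i j)) - (\<lambda>i j. \<pi> (M' i j)))"
    unfolding E23_T_QP by (rule arg_cong[of _ _ et]) (simp add: fun_eq_iff scaleC_fun_apply)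
  also have "\<dots> = (qpow q \<alpha> - 1) *\<^sub>C \<pi> g - \<pi> g'"
    unfolding clinear_on_diff[OF clinear_et UNIV_I UNIV_I] clinear_on_scale[OF clinear_et UNIV_I] et_\<pi>
    by (simp add: g_def g'_def)
  finally show ?thesis by (simp add: scaleC_diff_left scaleC_one algebra_simps eq_neg_iff_add_eq_0)
qed

lemma M_g: "M i j = qpow q (- \<rho>) *\<^sub>C lact (p i j) g"
  unfolding M_eq qpow_add[OF q, symmetric] \<rho> ..

lemma nab_P': "nab (P i j) = qpow q \<alpha> *\<^sub>C E23 (T1234 R (concat_legs tn Q P)) i j - qpow q \<alpha> *\<^sub>C M i j"
  unfolding nab_P M_g metric_part_def by (simp add: g_def M_def contract_mult_def scaleC_scaleC)

lemma nab_Q': "nab (Q i j) = M' i j - qpow q (- \<rho>) *\<^sub>C lact (p i j) g'"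
  unfolding nab_Q metric_part_def by (simp add: g'_def M'_def contract_mult_def)

lemma torsion_P: "\<pi> (nab (P i j)) = d2 (P i j)"
proof -
  have "\<pi> (nab (P i j)) = (qpow q \<alpha> *\<^sub>C E23 (T1234 R (zz Q P))) i j - qpow q \<alpha> *\<^sub>C \<pi> (M i j)"
    unfolding nab_P' \<pi>_diff \<pi>_scale E23_T_zz by (simp add: scaleC_fun_apply)
  then show ?thesis unfolding E23_T_QP d2_P \<pi>_minus \<eta>_def \<pi>_add
    by (simp add: scaleC_diff_left scaleC_one)
qed

text \<open>In Omega^2 the metric term is -q^(-\<rho>) p g' = q^(-\<rho>) p g = M, which completes
  M' to the differential of Q.\<close>

lemma torsion_Q: "\<pi> (nab (Q i j)) = d2 (Q i j)"
proof -
  have "\<pi> (lact (p i j) g') = - \<pi> (lact (p i j) g)"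
    using \<pi>_lact[of g' "- g", OF _ p_in] by (simp add: \<pi>_g' \<pi>_minus lact_minus p_in)
  then show ?thesis
    unfolding nab_Q' \<pi>_diff \<pi>_scale d2_Q \<eta>_def \<pi>_add M_g
    by (simp add: scaleC_minus_right \<pi>_scale)
qed

text \<open>The wedge of the connection and the differential obey the same Leibniz rule, so they
  need only be compared on the entries of P and Q.\<close>

theorem torsion_free: "torsion \<pi> d2 nab x = 0"
proof -
  have l: "\<pi> (nab (l b x)) = d2 (l b x)" if "\<pi> (nab x) = d2 x" "b \<in> B" for b x
    using d2_left[OF that(2) that(1)[symmetric]] that(2) by (simp add: nab_l \<pi>_add)
  have "\<pi> (nab x) = d2 x"
  proof (rule generated[of _ x])
    fix x y assume "\<pi> (nab x) = d2 x" "\<pi> (nab y) = d2 y"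
    then show "\<pi> (nab (x + y)) = d2 (x + y)"
      by (simp add: clinear_on_add[OF clinear_nab] \<pi>_add d2_add)
  qed (rule l, rule torsion_P torsion_Q, assumption)+
  then show ?thesis by (simp add: torsion_def)
qed

end

section \<open>Cotorsion of the metric\<close>

context quantum_connection
begin

lemma ract_scale_one: "ract t (c *\<^sub>C 1) = c *\<^sub>C t"
proof (rule \<Omega>.tensor_induct[of _ t])
  have c: "c *\<^sub>C 1 \<in> B" by (rule scale_in[OF one_in])
  show "ract (tn x y) (c *\<^sub>C 1) = c *\<^sub>C tn x y" for x y
    by (simp add: ract_tn[OF c] rt_scale_right[OF one_in] rt_one tn_scale_right)
  show "ract (s - t) (c *\<^sub>C 1) = c *\<^sub>C (s - t)"
    if "ract s (c *\<^sub>C 1) = c *\<^sub>C s" "ract t (c *\<^sub>C 1) = c *\<^sub>C t" for s t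
    using that by (simp add: clinear_on_diff[OF clinear_ract[OF c] UNIV_I UNIV_I] scaleC_diff_right)
qed

lemma tn2_scale_right: "tn2 z (c *\<^sub>C y) = c *\<^sub>C tn2 z y"
proof -
  have c: "c *\<^sub>C 1 \<in> B" by (rule scale_in[OF one_in])
  obtain t where z: "z = \<pi> t" by (rule \<pi>_cases)
  have "tn2 z (c *\<^sub>C y) = tn2 z (l (c *\<^sub>C 1) y)" by (simp add: l_scale_left one_in l_one)
  also have "\<dots> = tn2 (rt2 z (c *\<^sub>C 1)) y" by (simp add: \<Omega>2.tn_balanced c)
  also have "rt2 z (c *\<^sub>C 1) = c *\<^sub>C z" by (simp add: z rt2_\<pi> c ract_scale_one \<pi>_scale)
  finally show ?thesis by (simp add: \<Omega>2.tn_scale_left)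
qed

lemma clinear_tn2: "clinear (tn2 z)"
  by (rule clinearI) (simp_all add: \<Omega>2.tn_add_right tn2_scale_right)

lemma clinear_tn2': "clinear (\<lambda>z. tn2 z y)"
  by (rule \<Omega>2.clinear_left)

text \<open>The inner induced map in the cotorsion: it sends y (x) z to the wedge of x and y,
  tensored with z.\<close>

definition wedge :: "'w \<Rightarrow> 't \<Rightarrow> 'u"
  where "wedge x = tensor_induced tn (\<lambda>y z. tn2 (\<pi> (tn x y)) z)"

lemma tn2_\<pi>_balanced: "b \<in> B \<Longrightarrow> tn2 (\<pi> (tn x (rt y b))) z = tn2 (\<pi> (tn x y)) (l b z)"
  by (simp add: ract_tn[symmetric] rt2_\<pi>[symmetric] \<Omega>2.tn_balanced)

lemma wedge_tn: "wedge x (tn y z) = tn2 (\<pi> (tn x y)) z"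
  unfolding wedge_def
  by (rule \<Omega>.tensor_induced_tn)
    (simp_all add: \<Omega>.tn_add_right \<Omega>2.tn_add_left \<Omega>2.tn_add_right \<pi>_add tn2_\<pi>_balanced)

lemma clinear_wedge: "clinear (wedge x)"
  unfolding wedge_def
  by (rule \<Omega>.clinear_tensor_induced)
    (simp_all add: \<Omega>.tn_add_right \<Omega>2.tn_add_left \<Omega>2.tn_add_right \<pi>_add tn2_\<pi>_balanced
      tn_scale_right \<Omega>2.tn_scale_left \<pi>_scale)

lemmas wedge_add = clinear_on_add[OF clinear_wedge UNIV_I UNIV_I]
lemmas wedge_diff = clinear_on_diff[OF clinear_wedge UNIV_I UNIV_I]
lemmas wedge_scale = clinear_on_scale[OF clinear_wedge UNIV_I]

lemma clinear_wedge': "clinear (\<lambda>x. wedge x t)"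
proof (rule clinearI)
  show "wedge (x + y) t = wedge x t + wedge y t" for x y
    by (rule \<Omega>.tensor_induct[of _ t])
      (simp_all add: wedge_tn \<Omega>.tn_add_left \<pi>_add \<Omega>2.tn_add_left wedge_diff)
  show "wedge (c *\<^sub>C x) t = c *\<^sub>C wedge x t" for c x
    by (rule \<Omega>.tensor_induct[of _ t])
      (simp_all add: wedge_tn \<Omega>.tn_scale_left \<pi>_scale \<Omega>2.tn_scale_left wedge_diff scaleC_diff_right)
qed

lemma wedge_lact: "b \<in> B \<Longrightarrow> wedge x (lact b t) = wedge (rt x b) t"
  by (rule \<Omega>.tensor_induct[of _ t])
    (simp_all add: lact_tn wedge_tn \<Omega>.tn_balanced wedge_diff clinear_on_diff[OF clinear_lact UNIV_I UNIV_I])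

definition coT :: "'w \<Rightarrow> 'w \<Rightarrow> 'u"
  where "coT x y = tn2 (d2 x) y - wedge x (nab y)"

lemma cotorsion_eq: "cotorsion tn \<pi> d2 tn2 nab = tensor_induced tn coT"
  unfolding cotorsion_def coT_def wedge_def ..

text \<open>The differential of x b and the connection on b y both produce the wedge of x and db
  tensored with y, with the same sign. This is why only the difference is defined on the tensor
  product.\<close>

lemma coT_balanced: assumes "b \<in> B" shows "coT (rt x b) y = coT x (l b y)"
  using assms
  by (simp add: coT_def d2_right clinear_on_diff[OF clinear_tn2' UNIV_I UNIV_I] \<Omega>2.tn_balanced
      nab_l wedge_add wedge_tn wedge_lact)

lemma coT_add: "coT (x + x') y = coT x y + coT x' y" "coT x (y + y') = coT x y + coT x y'"
  by (simp_all add: coT_def d2_add \<Omega>2.tn_add_left \<Omega>2.tn_add_right wedge_add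
      clinear_on_add[OF clinear_wedge'] clinear_on_add[OF clinear_nab])

lemma coT_scale: "coT (c *\<^sub>C x) y = c *\<^sub>C coT x y"
  by (simp add: coT_def clinear_on_scale[OF clinear_d2] \<Omega>2.tn_scale_left
      clinear_on_scale[OF clinear_wedge'] scaleC_diff_right)

lemma cotorsion_tn: "cotorsion tn \<pi> d2 tn2 nab (tn x y) = coT x y"
  unfolding cotorsion_eq by (rule \<Omega>.tensor_induced_tn) (simp_all add: coT_add coT_balanced)

lemma clinear_cotorsion: "clinear (cotorsion tn \<pi> d2 tn2 nab)"
  unfolding cotorsion_eq
  by (rule \<Omega>.clinear_tensor_induced) (simp_all add: coT_add coT_balanced coT_scale)

text \<open>The product of a matrix over Omega (x) Omega, read in Omega^2, with a matrix over
  Omega.\<close>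

abbreviation U :: "('n, 't) legs2 \<Rightarrow> ('n, 'w) legs2 \<Rightarrow> ('n, 'u) legs2"
  where "U \<equiv> contract_mult (\<lambda>t. tn2 (\<pi> t))"

lemma U_mm: "U (contract_mult tn X Y) Z = contract_mult wedge X (contract_mult tn Y Z)"
proof (intro ext)
  fix a c
  have "U (contract_mult tn X Y) Z a c = (\<Sum>b\<in>UNIV. \<Sum>e\<in>UNIV. wedge (X a e) (tn (Y e b) (Z b c)))"
    by (simp add: contract_mult_eq clinear_on_sum[OF clinear_\<pi>] clinear_on_sum[OF clinear_tn2'] wedge_tn)
  also have "\<dots> = (\<Sum>e\<in>UNIV. \<Sum>b\<in>UNIV. wedge (X a e) (tn (Y e b) (Z b c)))" by (rule sum.swap)
  also have "\<dots> = contract_mult wedge X (contract_mult tn Y Z) a c"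
    by (simp add: contract_mult_eq clinear_on_sum[OF clinear_wedge])
  finally show "U (contract_mult tn X Y) Z a c = contract_mult wedge X (contract_mult tn Y Z) a c" .
qed

lemma contract_mult_wedge_0: "contract_mult wedge X 0 = 0"
  by (simp add: fun_eq_iff contract_mult_eq clinear_on_zero[OF clinear_wedge])

lemma contract_mult_wedge_lact: "contract_mult wedge X (\<lambda>a b. lact (p a b) t) = (\<lambda>a c. wedge (contract_mult rt X p a c) t)"
  by (intro ext) (simp add: contract_mult_eq wedge_lact p_in clinear_on_sum[OF clinear_wedge'])

lemma et_0: "et (0 :: ('n, 'x::complex_vec) legs2) = 0"
  by (rule clinear_on_zero[OF clinear_et])

lemma et_zero: "et (\<lambda>a b. 0 :: 'x::complex_vec) = 0"
  by (simp add: E'12_def scaleC_zero_right)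

lemma et_wedge: "et (\<lambda>a c. wedge (X a c) t) = wedge (et X) t"
  by (rule et_map[OF clinear_wedge', symmetric])

lemma wedge_0: "wedge 0 t = 0"
  by (rule clinear_on_zero[OF clinear_wedge'])

lemma U_M'_Q: "U M' Q = 0"
  unfolding M'_def U_mm contract_mult_Q_Q contract_mult_wedge_0 ..

lemma U_M_P: "U M P = 0"
  unfolding M_def U_mm contract_mult_P_P contract_mult_wedge_0 ..

lemma contract_mult_wedge_scale: "contract_mult wedge X (\<lambda>a b. c *\<^sub>C Y a b) = (\<lambda>a b. c *\<^sub>C contract_mult wedge X Y a b)"
  by (intro ext) (simp add: contract_mult_eq wedge_scale scaleC_sum_right)

lemma contract_mult_wedge_diff: "contract_mult wedge X (\<lambda>a b. Y a b - Y' a b) = (\<lambda>a b. contract_mult wedge X Y a b - contract_mult wedge X Y' a b)"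
  by (intro ext) (simp add: contract_mult_eq wedge_diff sum_subtractf)

lemma et_scale: "et (\<lambda>a b. c *\<^sub>C X a b) = c *\<^sub>C et X"
  using clinear_on_scale[OF clinear_et UNIV_I, of c X] by (simp add: scaleC_fun_def)

lemma et_diff: "et (\<lambda>a b. X a b - Y a b) = et X - et Y"
  using clinear_on_diff[OF clinear_et UNIV_I UNIV_I, of X Y] by (simp add: fun_diff_def)

lemma et_add: "et (\<lambda>a b. X a b + Y a b) = et X + et Y"
  using clinear_on_add[OF clinear_et UNIV_I UNIV_I, of X Y] by (simp add: plus_fun_def)

lemma M_fun: "M = (\<lambda>a b. qpow q (- \<rho>) *\<^sub>C lact (p a b) g)"
  by (intro ext) (rule M_g)

text \<open>M is a multiple of p g and P p = P, so the trace is a multiple of E' of P wedged with g,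
  and E' of P is zero.\<close>

lemma et_P_M: "et (contract_mult wedge P M) = 0"
  by (subst M_fun) (simp only: contract_mult_wedge_scale contract_mult_wedge_lact contract_mult_P_p et_scale et_wedge et_P wedge_0 scaleC_zero_right)

lemma et_U_M'_P: "et (U M' P) = 0"
  using et_P_M unfolding M'_def U_mm M_def .

text \<open>Centrality of g makes M a multiple of g p as well; with p Q = Q the trace becomes g
  times E' of Q, which is zero.\<close>

lemma et_U_M_Q: "et (U M Q) = 0"
proof -
  have "U M Q a c = qpow q (- \<rho>) *\<^sub>C tn2 (\<pi> g) (Q a c)" for a c
  proof -
    have "U M Q a c = (\<Sum>b\<in>UNIV. qpow q (- \<rho>) *\<^sub>C tn2 (\<pi> g) (l (p a b) (Q b c)))"
      by (simp add: contract_mult_eq M_g \<pi>_scale \<Omega>2.tn_scale_left g_central[symmetric] rt2_\<pi>[symmetric] p_in \<Omega>2.tn_balanced)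
    also have "\<dots> = qpow q (- \<rho>) *\<^sub>C tn2 (\<pi> g) (contract_mult l p Q a c)"
      by (simp add: contract_mult_eq clinear_on_sum[OF clinear_tn2] scaleC_sum_right)
    finally show ?thesis by (simp add: contract_mult_p_Q)
  qed
  then have "U M Q = (\<lambda>a c. qpow q (- \<rho>) *\<^sub>C tn2 (\<pi> g) (Q a c))" by (intro ext)
  then have "et (U M Q) = qpow q (- \<rho>) *\<^sub>C et (\<lambda>a c. tn2 (\<pi> g) (Q a c))"
    by (simp only: et_scale)
  also have "et (\<lambda>a c. tn2 (\<pi> g) (Q a c)) = tn2 (\<pi> g) (et Q)"
    by (rule et_map[OF clinear_tn2, symmetric])
  finally show ?thesis by (simp add: et_Q clinear_on_zero[OF clinear_tn2] scaleC_zero_right)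
qed

lemma contract_mult_tn2_d2: "contract_mult (\<lambda>x. tn2 (d2 x)) Q Z = (\<lambda>a c. U M Z a c + U M' Z a c)"
  "contract_mult (\<lambda>x. tn2 (d2 x)) P Z = (\<lambda>a c. - (U M Z a c + U M' Z a c))"
proof -
  have minus: "tn2 (- x) y = - tn2 x y" for x y
    using clinear_on_diff[OF clinear_tn2' UNIV_I UNIV_I, of 0 x y] by (simp add: clinear_on_zero[OF clinear_tn2'])
  have P: "tn2 (d2 (P a b)) y = - (tn2 (\<pi> (M a b)) y + tn2 (\<pi> (M' a b)) y)" for a b y
    unfolding d2_P \<pi>_minus \<eta>_def \<pi>_add minus \<Omega>2.tn_add_left ..
  have Q: "tn2 (d2 (Q a b)) y = tn2 (\<pi> (M a b)) y + tn2 (\<pi> (M' a b)) y" for a b y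
    unfolding d2_Q \<eta>_def \<pi>_add \<Omega>2.tn_add_left ..
  show "contract_mult (\<lambda>x. tn2 (d2 x)) Q Z = (\<lambda>a c. U M Z a c + U M' Z a c)"
    by (intro ext) (simp only: contract_mult_eq Q sum.distrib)
  show "contract_mult (\<lambda>x. tn2 (d2 x)) P Z = (\<lambda>a c. - (U M Z a c + U M' Z a c))"
    by (intro ext) (simp only: contract_mult_eq P sum.distrib sum_negf)
qed

lemma contract_mult_coT: "contract_mult coT X Y = (\<lambda>a c. contract_mult (\<lambda>x. tn2 (d2 x)) X Y a c - contract_mult wedge X (\<lambda>a b. nab (Y a b)) a c)"
  by (intro ext) (simp add: contract_mult_eq coT_def sum_subtractf)

lemma cotorsion_et_mm: "cotorsion tn \<pi> d2 tn2 nab (et (contract_mult tn X Y)) = et (contract_mult coT X Y)"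
  by (simp add: et_map[OF clinear_cotorsion] contract_mult_eq[abs_def] clinear_on_sum[OF clinear_cotorsion] cotorsion_tn)

text \<open>No braiding occurs here: P M' = (P P) Q = 0, the metric term carries E' of P, and the
  differential gives the products M Q and M' Q, whose traces vanish.\<close>

lemma cotorsion_g': "cotorsion tn \<pi> d2 tn2 nab g' = 0"
proof -
  have "et (contract_mult wedge P (\<lambda>a b. nab (Q a b))) = et (contract_mult wedge P M') - qpow q (- \<rho>) *\<^sub>C wedge (et P) g'"
    unfolding nab_Q' contract_mult_wedge_diff contract_mult_wedge_scale contract_mult_wedge_lact et_diff et_scale et_wedge contract_mult_P_p ..
  also have "contract_mult wedge P M' = 0"
    unfolding M'_def U_mm[symmetric] contract_mult_P_P by (simp add: fun_eq_iff contract_mult_eq clinear_on_zero[OF clinear_\<pi>] clinear_on_zero[OF clinear_tn2'])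
  finally have 1: "et (contract_mult wedge P (\<lambda>a b. nab (Q a b))) = 0"
    by (simp add: et_0 et_zero et_P wedge_0 scaleC_zero_right)
  have "et (contract_mult (\<lambda>x. tn2 (d2 x)) P Q) = - et (U M Q) - et (U M' Q)"
    unfolding contract_mult_tn2_d2 using et_diff[of "\<lambda>a c. - U M Q a c" "U M' Q"] et_diff[of "0" "U M Q"]
    by (simp add: et_0)
  moreover have "g' = et (contract_mult tn P Q)" by (simp add: g'_def M'_def)
  ultimately show ?thesis
    by (simp add: cotorsion_et_mm contract_mult_coT et_diff 1 et_U_M_Q U_M'_Q et_0)
qed

text \<open>The trace by E' of a product of three matrices, as a functional of the six legs.\<close>

definition chain :: "('n \<Rightarrow> 'n \<Rightarrow> ('n, 'u) legs4) \<Rightarrow> 'u"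
  where "chain F = et (E23 (\<lambda>a b. E23 (F a b)))"

text \<open>Moving the first factor past the product of the other two does not change the
  trace.\<close>

lemma chain_T_T: "chain (\<lambda>a b. T1234 R (T1234 R F a b)) = chain F"
proof -
  have swap: "E23 (\<lambda>a b. E23 (G a b)) = E23 (E23 G)" for G :: "'n \<Rightarrow> 'n \<Rightarrow> ('n, 'u) legs4"
    by (intro ext) (simp add: E23_def sum_fun_app, rule sum.swap)
  have "chain (\<lambda>a b. T1234 R (T1234 R F a b)) = et (E23 (E23 (\<lambda>a b. T1234 R (T1234 R F a b))))"
    unfolding chain_def swap ..
  also have "\<dots> = chain F" unfolding E23_T_T et_E23_T chain_def ..
  finally show ?thesis .
qed

lemma clinear_chain: "clinear chain"
  unfolding chain_def
  by (intro clinear_comp[OF clinear_et] clinear_comp[OF clinear_E23] clinear_funI clinear_comp[OF clinear_app clinear_app])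
  
definition third :: "('n, 'z) legs4 \<Rightarrow> 'n \<Rightarrow> 'n \<Rightarrow> ('n, 'u) legs4"
  where "third z = (\<lambda>a b c e i j. tn2 (z a b c e) (P i j))"

lemma clinear_third: "clinear third"
  by (rule clinearI)
    (simp_all add: third_def fun_eq_iff \<Omega>2.tn_add_left \<Omega>2.tn_scale_left scaleC_fun_apply)

lemma third_T: "third (T1234 R z) = T1234 R (third z)"
proof (intro ext)
  fix a b c e i j
  show "third (T1234 R z) a b c e i j = T1234 R (third z) a b c e i j"
    unfolding T1234_map[OF clinear_app, of R "third z" a b c e i]
      T1234_map[OF clinear_app, of R _ a b c e j]
    by (simp add: third_def T1234_map[OF clinear_tn2'])
qed

lemma chain_third_zz: "chain (third (zz X Y)) = et (contract_mult wedge X (contract_mult tn Y P))"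
  unfolding chain_def
  by (rule arg_cong[of _ _ et], intro ext)
    (simp add: E23_def third_def contract_mult_eq wedge_tn[symmetric] clinear_on_sum[OF clinear_wedge])

text \<open>The trace with T put on the last two factors, as needed for the braided term of the
  connection. A second T on the first two factors then completes it to the double passage in
  \<open>chain_T_T\<close>.\<close>

definition twist :: "('n \<Rightarrow> 'n \<Rightarrow> ('n, 'u) legs4) \<Rightarrow> 'u"
  where "twist F = chain (\<lambda>a b. T1234 R (F a b))"

lemma clinear_twist: "clinear twist"
  unfolding twist_def
  by (intro clinear_comp[OF clinear_chain] clinear_funI clinear_comp[OF clinear_T1234] clinear_comp[OF clinear_app clinear_app])

lemma twist_third_zz:
  "twist (third (zz X Y)) = et (contract_mult wedge X (E23 (T1234 R (concat_legs tn Y P))))"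
proof -
  have "third (zz X Y) a b = (\<lambda>c e i j. wedge (X a b) (concat_legs tn Y P c e i j))" for a b
    by (intro ext) (simp add: third_def concat_legs_def wedge_tn)
  then have "T1234 R (third (zz X Y) a b) c e i j = wedge (X a b) (T1234 R (concat_legs tn Y P) c e i j)" for a b c e i j
    by (simp add: T1234_map[OF clinear_wedge])
  then show ?thesis
    unfolding twist_def chain_def
    by (intro arg_cong[of _ _ et] ext) (simp add: E23_def contract_mult_eq clinear_on_sum[OF clinear_wedge])
qed

text \<open>Tensor \<open>relation_Q\<close> with P and apply \<open>twist\<close>. Terms already
  carrying T turn into plain traces of three factors, which vanish by P M, Q Q and M P; of the
  others, the one with Q P P vanishes by \<open>E23_T_P_P\<close>. Only the wanted term is
  left.\<close>

lemma twist_third_Q_Q: "et (contract_mult wedge Q (E23 (T1234 R (concat_legs tn Q P)))) = 0"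
proof -
  let ?L = "\<lambda>z. twist (third z)"
  have L: "clinear ?L" by (rule clinear_comp[OF clinear_twist clinear_third])
  note add = clinear_on_add[OF L UNIV_I UNIV_I] and scale = clinear_on_scale[OF L UNIV_I]
  have T: "?L (T1234 R z) = chain (third z)" for z
    unfolding third_T twist_def chain_T_T ..
  \<comment> \<open>The product p \<eta> is p M + p M' = M, so this is the trace of M P.\<close>
  have ze: "chain (third ze) = 0"
  proof -
    have "chain (third ze) = et (\<lambda>a c. \<Sum>b\<in>UNIV. tn2 (\<pi> (contract_mult lact p M a b + contract_mult lact p M' a b)) (P b c))"
      unfolding chain_def
    proof (intro arg_cong[of _ _ et] ext)
      fix a c
      have "E23 (\<lambda>a b. E23 (third ze a b)) a c = (\<Sum>b\<in>UNIV. \<Sum>e\<in>UNIV. tn2 (\<pi> (lact (p a b) (\<eta> b e))) (P e c))"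
        by (simp add: E23_def third_def ze_def)
      also have "\<dots> = (\<Sum>e\<in>UNIV. \<Sum>b\<in>UNIV. tn2 (\<pi> (lact (p a b) (\<eta> b e))) (P e c))" by (rule sum.swap)
      also have "\<dots> = (\<Sum>e\<in>UNIV. tn2 (\<pi> (contract_mult lact p M a e + contract_mult lact p M' a e)) (P e c))"
        by (simp add: \<eta>_def contract_mult_eq clinear_on_add[OF clinear_lact[OF p_in]] \<pi>_add \<Omega>2.tn_add_left sum.distrib
          clinear_on_sum[OF clinear_\<pi>] clinear_on_sum[OF clinear_tn2'])
      finally show "E23 (\<lambda>a b. E23 (third ze a b)) a c = (\<Sum>e\<in>UNIV. tn2 (\<pi> (contract_mult lact p M a e + contract_mult lact p M' a e)) (P e c))" .
    qed
    also have "\<dots> = et (U M P)"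
      unfolding contract_mult_p_M contract_mult_p_M' by (rule arg_cong[of _ _ et], intro ext) (simp add: contract_mult_eq)
    finally show ?thesis by (simp add: U_M_P et_0)
  qed
  have "?L (zz Q P + zz Q Q + qpow q (- \<alpha>) *\<^sub>C T1234 R (zz P Q + zz Q Q)) = ?L ((1 - qpow q (- \<alpha>)) *\<^sub>C T1234 R ze)"
    by (rule arg_cong[OF relation_Q])
  then have "?L (zz Q P) + ?L (zz Q Q) + qpow q (- \<alpha>) *\<^sub>C (chain (third (zz P Q)) + chain (third (zz Q Q))) = 0"
    unfolding clinear_on_add[OF clinear_T1234 UNIV_I UNIV_I] add scale T ze scaleC_zero_right .
  moreover have "?L (zz Q P) = 0"
    unfolding twist_third_zz E23_T_P_P contract_mult_wedge_0 et_0 ..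
  moreover have "chain (third (zz P Q)) = 0"
    unfolding chain_third_zz using et_P_M by (simp add: M_def)
  moreover have "chain (third (zz Q Q)) = 0"
    unfolding chain_third_zz U_mm[symmetric] contract_mult_Q_Q
    by (simp add: contract_mult_eq[abs_def] clinear_on_zero[OF clinear_\<pi>] clinear_on_zero[OF clinear_tn2'] et_zero)
  ultimately show ?thesis by (simp add: twist_third_zz scaleC_zero_right)
qed

text \<open>Since Q p = 0 also Q M = 0, which leaves the braided term; the differential contributes
  M P = 0 and the trace of M' P = P M.\<close>

lemma cotorsion_g: "cotorsion tn \<pi> d2 tn2 nab g = 0"
proof -
  have "et (contract_mult wedge Q (\<lambda>a b. nab (P a b)))
    = qpow q \<alpha> *\<^sub>C et (contract_mult wedge Q (E23 (T1234 R (concat_legs tn Q P)))) - qpow q \<alpha> *\<^sub>C et (contract_mult wedge Q M)"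
    unfolding nab_P' contract_mult_wedge_diff contract_mult_wedge_scale et_diff et_scale ..
  also have "contract_mult wedge Q M = 0"
    by (subst M_fun) (simp add: contract_mult_wedge_scale contract_mult_wedge_lact contract_mult_Q_p wedge_0 scaleC_zero_right fun_eq_iff)
  finally have 1: "et (contract_mult wedge Q (\<lambda>a b. nab (P a b))) = 0"
    by (simp add: et_0 et_zero twist_third_Q_Q scaleC_zero_right)
  have "et (contract_mult (\<lambda>x. tn2 (d2 x)) Q P) = et (U M P) + et (U M' P)"
    unfolding contract_mult_tn2_d2 et_add ..
  moreover have "g = et (contract_mult tn Q P)" by (simp add: g_def M_def)
  ultimately show ?thesis
    by (simp add: cotorsion_et_mm contract_mult_coT et_diff 1 et_U_M'_P U_M_P et_0)
qed

theorem cotorsion_free: "cotorsion tn \<pi> d2 tn2 nab (g' + g) = 0"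
  by (simp add: clinear_on_add[OF clinear_cotorsion] cotorsion_g cotorsion_g')

end

section \<open>Presented algebras and modules\<close>

lemma free_eval_superset:
  "finite S \<Longrightarrow> Poly_Mapping.keys x \<subseteq> S \<Longrightarrow>
    free_eval \<phi> x = (\<Sum>w\<in>S. Poly_Mapping.lookup x w *\<^sub>C prod_list (map \<phi> (letters w)))"
  unfolding free_eval_def
  by (rule sum.mono_neutral_cong_left) (auto simp: in_keys_iff scaleC_zero_left)

lemma free_eval_add: "free_eval \<phi> (x + y) = free_eval \<phi> x + free_eval \<phi> y"
proof -
  let ?S = "Poly_Mapping.keys x \<union> Poly_Mapping.keys y"
  have "finite ?S" "Poly_Mapping.keys (x + y) \<subseteq> ?S" by (simp_all add: Poly_Mapping.keys_add)
  then show ?thesis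
    by (simp add: free_eval_superset[of ?S] lookup_add scaleC_add_left sum.distrib)
qed

lemma free_eval_0 [simp]: "free_eval \<phi> 0 = 0"
  by (simp add: free_eval_def)

lemma free_eval_sum: "free_eval \<phi> (\<Sum>i\<in>A. f i) = (\<Sum>i\<in>A. free_eval \<phi> (f i))"
  by (induction A rule: infinite_finite_induct) (simp_all add: free_eval_add)

lemma free_eval_single: "free_eval \<phi> (Poly_Mapping.single w c) = c *\<^sub>C prod_list (map \<phi> (letters w))"
  by (simp add: free_eval_superset[of "{w}"])

lemma free_eval_diff: "free_eval \<phi> (x - y) = free_eval \<phi> x - free_eval \<phi> y"
  by (rule additive_diff[OF free_eval_add])

lemma poly_mapping_single_induct:
  assumes "Pr 0" "\<And>k v. Pr (Poly_Mapping.single k v)" "\<And>x y. Pr x \<Longrightarrow> Pr y \<Longrightarrow> Pr (x + y)"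
  shows "Pr (x :: 'k \<Rightarrow>\<^sub>0 'v::comm_monoid_add)"
proof -
  have eq: "x = (\<Sum>k\<in>Poly_Mapping.keys x. Poly_Mapping.single k (Poly_Mapping.lookup x k))"
  proof (rule poly_mapping_eqI)
    fix i
    have "(\<Sum>k\<in>Poly_Mapping.keys x. Poly_Mapping.lookup (Poly_Mapping.single k (Poly_Mapping.lookup x k)) i) =
      (\<Sum>k\<in>Poly_Mapping.keys x. if k = i then Poly_Mapping.lookup x i else 0)"
      by (intro sum.cong refl) (simp add: lookup_single when_def)
    then show "Poly_Mapping.lookup x i =
        Poly_Mapping.lookup (\<Sum>k\<in>Poly_Mapping.keys x. Poly_Mapping.single k (Poly_Mapping.lookup x k)) i"
      by (simp add: lookup_sum in_keys_iff)
  qed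
  have "Pr (\<Sum>k\<in>A. Poly_Mapping.single k (Poly_Mapping.lookup x k))" for A
    by (induction A rule: infinite_finite_induct) (simp_all add: assms)
  then show ?thesis by (subst eq)
qed

lemma free_eval_mult: "free_eval \<phi> (x * y) = free_eval \<phi> x * free_eval \<phi> y"
proof -
  have single: "free_eval \<phi> (Poly_Mapping.single u c * y) = free_eval \<phi> (Poly_Mapping.single u c) * free_eval \<phi> y" for u c y
  proof (induction y rule: poly_mapping_single_induct)
    case (2 k v)
    show ?case
      by (simp add: Poly_Mapping.mult_single free_eval_single plus_word_def mult_scaleC_left
          mult_scaleC_right scaleC_scaleC mult.commute)
  qed (simp_all add: distrib_left free_eval_add)
  show ?thesis
    by (induction x rule: poly_mapping_single_induct) (simp_all add: single distrib_right free_eval_add)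
qed

lemma free_eval_gen: "free_eval \<phi> (free_gen g) = \<phi> g"
  by (simp add: free_gen_def free_eval_single scaleC_one)

lemma free_eval_one: "free_eval \<phi> 1 = 1"
  using free_eval_single[of \<phi> 0 1] by (simp only: single_one) (simp add: zero_word_def scaleC_one)

lemma presented_algebra_relation: "presented_algebra \<phi> Rel \<Longrightarrow> x \<in> Rel \<Longrightarrow> free_eval \<phi> x = 0"
  using hull_subset[of Rel two_sided_ideal] by (auto simp: presented_algebra_def)

text \<open>This relation makes p idempotent.\<close>

lemma algebra_relations_unit:
  assumes "presented_algebra (case_gens f v) (algebra_relations r s q R)"
  shows "(\<Sum>i\<in>UNIV. v i * f i) = 1"
proof -
  have "(\<Sum>i\<in>UNIV. free_gen (Gv i) * free_gen (Gf i)) - 1 \<in> algebra_relations r s q R"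
    by (simp add: algebra_relations_def Let_def)
  from presented_algebra_relation[OF assms this] show ?thesis
    by (simp add: free_eval_diff free_eval_sum free_eval_mult free_eval_gen free_eval_one)
qed

definition degree_zero :: "'n gens free_algebra \<Rightarrow> bool"
  where "degree_zero x \<longleftrightarrow> (\<forall>w\<in>Poly_Mapping.keys x. sum_list (map gen_degree (letters w)) = 0)"

lemma degree_zero_part_eq: "degree_zero_part \<phi> = free_eval \<phi> ` Collect degree_zero"
  unfolding degree_zero_part_def degree_zero_def ..

lemma degree_zero_add: "degree_zero x \<Longrightarrow> degree_zero y \<Longrightarrow> degree_zero (x + y)"
  using Poly_Mapping.keys_add[of x y] by (auto simp: degree_zero_def)

lemma degree_zero_mult: assumes "degree_zero x" "degree_zero y" shows "degree_zero (x * y)"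
  unfolding degree_zero_def
proof
  fix w assume "w \<in> Poly_Mapping.keys (x * y)"
  then obtain a b where "w = a + b" "a \<in> Poly_Mapping.keys x" "b \<in> Poly_Mapping.keys y"
    using keys_mult[of x y] by blast
  then show "sum_list (map gen_degree (letters w)) = 0"
    using assms by (simp add: degree_zero_def plus_word_def)
qed

lemma degree_zero_single: "sum_list (map gen_degree (letters w)) = 0 \<Longrightarrow> degree_zero (Poly_Mapping.single w c)"
  by (simp add: degree_zero_def)

lemma degree_zero_part_closed:
  defines "D \<equiv> degree_zero_part"
  shows "1 \<in> D \<phi>" "0 \<in> D \<phi>" "a \<in> D \<phi> \<Longrightarrow> b \<in> D \<phi> \<Longrightarrow> a + b \<in> D \<phi>"
    "a \<in> D \<phi> \<Longrightarrow> b \<in> D \<phi> \<Longrightarrow> a * b \<in> D \<phi>" "a \<in> D \<phi> \<Longrightarrow> c *\<^sub>C a \<in> D \<phi>"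
    "\<phi> (Gf i) * \<phi> (Gv j) \<in> D \<phi>"
proof -
  have eval: "free_eval \<phi> x \<in> D \<phi>" if "degree_zero x" for x
    unfolding D_def degree_zero_part_eq using that by blast
  have scalar: "degree_zero (Poly_Mapping.single 0 c)" for c by (rule degree_zero_single) (simp add: zero_word_def)
  show one: "1 \<in> D \<phi>" using eval[OF scalar[of 1]] by (simp add: free_eval_single zero_word_def scaleC_one)
  show "0 \<in> D \<phi>" using eval[of 0] by (simp add: degree_zero_def)
  have cases: "\<exists>x. degree_zero x \<and> a = free_eval \<phi> x" if "a \<in> D \<phi>" for a
    using that unfolding D_def degree_zero_part_eq by blast
  show "a + b \<in> D \<phi>" if "a \<in> D \<phi>" "b \<in> D \<phi>" for a b
    using cases[OF that(1)] cases[OF that(2)] eval degree_zero_add by (metis free_eval_add)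
  show mult: "a * b \<in> D \<phi>" if "a \<in> D \<phi>" "b \<in> D \<phi>" for a b
    using cases[OF that(1)] cases[OF that(2)] eval degree_zero_mult by (metis free_eval_mult)
  show "c *\<^sub>C a \<in> D \<phi>" if "a \<in> D \<phi>" for a
  proof -
    have "free_eval \<phi> (Poly_Mapping.single 0 c) * a \<in> D \<phi>" by (intro mult eval scalar that)
    then show ?thesis by (simp add: free_eval_single zero_word_def mult_scaleC_left)
  qed
  have "degree_zero (free_gen (Gf i) * free_gen (Gv j))"
    unfolding free_gen_def Poly_Mapping.mult_single by (rule degree_zero_single) (simp add: plus_word_def)
  from eval[OF this] show "\<phi> (Gf i) * \<phi> (Gv j) \<in> D \<phi>" by (simp add: free_eval_mult free_eval_gen)
qed

lemma on_legs_in_apply2: "csubspace S \<Longrightarrow> (\<And>i j k l. X i j k l \<in> S) \<Longrightarrow> on_legs R X a b c d \<in> S"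
  by (subst on_legs_apply) (intro on_legs_in_apply)

lemma S3_in: "csubspace S \<Longrightarrow> (\<And>i j k l. X i j k l \<in> S) \<Longrightarrow> S3 R X a b c d \<in> S"
  unfolding S3_def by (intro on_legs_in_apply2 on_legs_in_apply on_legs_in)

lemma tS3_in: "csubspace S \<Longrightarrow> (\<And>i j k. X i j k \<in> S) \<Longrightarrow> tS3 R X a b c \<in> S"
  unfolding tS3_def by (intro on_legs_in_apply on_legs_in)

text \<open>The common part of the descriptions of \<open>\<Omega>\<^sub>+\<close> and \<open>\<Omega>\<^sub>-\<close>.\<close>

locale calculus_part =
  fixes B :: "'a::complex_algebra_1 set" and l :: "'a \<Rightarrow> 'w::complex_vec \<Rightarrow> 'w" and rt :: "'w \<Rightarrow> 'a \<Rightarrow> 'w"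
    and dp :: "('n::finite, 'w) legs2" and D :: "'a \<Rightarrow> 'w" and p :: "('n, 'a) legs2"
    and Rel :: "('n \<times> 'n \<Rightarrow> 'a) set"
  assumes one_in: "1 \<in> B" and B_subspace: "csubspace B"
    and B_mult: "a \<in> B \<Longrightarrow> b \<in> B \<Longrightarrow> a * b \<in> B" and p_in: "p i j \<in> B"
    and idempotent: "(\<Sum>k\<in>UNIV. p i k * p k j) = p i j"
    and presented: "presented_left_module B l (\<lambda>(i, j). dp i j) Rel"
    and bimodule: "bimodule B l rt" and derivation: "derivation B l rt D"
    and D_p: "D (p i j) = dp i j"
begin

text \<open>The presentation map from the free left module of B-valued functions; its kernel is
  generated by \<open>Rel\<close>.\<close>

definition ev :: "('n \<times> 'n \<Rightarrow> 'a) \<Rightarrow> 'w"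
  where "ev c = (\<Sum>x\<in>UNIV. l (c x) (case x of (i, j) \<Rightarrow> dp i j))"

lemma l_add_left: "b \<in> B \<Longrightarrow> b' \<in> B \<Longrightarrow> l (b + b') x = l b x + l b' x"
  and l_one: "l 1 x = x"
  and l_scale_left: "b \<in> B \<Longrightarrow> l (c *\<^sub>C b) x = c *\<^sub>C l b x"
  and l_add: "b \<in> B \<Longrightarrow> l b (x + y) = l b x + l b y"
  and rt_add: "b \<in> B \<Longrightarrow> rt (x + y) b = rt x b + rt y b"
  using bimodule by (simp_all add: bimodule_def left_module_def right_module_def)

lemma zero_in: "0 \<in> B"
  using B_subspace by (simp add: csubspace_def)

lemma l_0: "l 0 x = 0"
  using l_scale_left[OF one_in, of 0 x] by (simp add: scaleC_zero_left)

lemma l_zero: "b \<in> B \<Longrightarrow> l b 0 = 0"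
  using l_add[of b 0 0] by simp

lemma rt_zero: "b \<in> B \<Longrightarrow> rt 0 b = 0"
  using rt_add[of b 0 0] by simp

lemma clinear_ev: "clinear_on {c. range c \<subseteq> B} ev"
proof (rule clinear_onI)
  show "csubspace {c. range c \<subseteq> B}"
    using B_subspace unfolding csubspace_def image_subset_iff
    by (simp add: scaleC_fun_apply)
next
  fix x y :: "'n \<times> 'n \<Rightarrow> 'a"
  assume "x \<in> {c. range c \<subseteq> B}" "y \<in> {c. range c \<subseteq> B}"
  then have "x i \<in> B" "y i \<in> B" for i by auto
  then show "ev (x + y) = ev x + ev y" by (simp add: ev_def l_add_left sum.distrib)
next
  fix c and x :: "'n \<times> 'n \<Rightarrow> 'a"
  assume "x \<in> {c. range c \<subseteq> B}"
  then have "x i \<in> B" for i by auto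
  then show "ev (c *\<^sub>C x) = c *\<^sub>C ev x" by (simp add: ev_def scaleC_fun_apply l_scale_left scaleC_sum_right)
qed

lemma ev_free_elem: "ev (free_elem b (i, j)) = l b (dp i j)"
proof -
  have "ev (free_elem b (i, j)) = (\<Sum>x\<in>UNIV. if x = (i, j) then l b (dp i j) else 0)"
    unfolding ev_def by (intro sum.cong refl) (auto simp: free_elem_def l_0)
  then show ?thesis by simp
qed

lemma free_elem_in: "b \<in> B \<Longrightarrow> free_elem b i \<in> {c. range c \<subseteq> B}"
  using zero_in by (auto simp: free_elem_def)

lemma relation: "c \<in> Rel \<Longrightarrow> ev c = 0"
  using presented hull_subset[of Rel "left_submodule B"] unfolding presented_left_module_def ev_def by blast

lemma generated:
  obtains c where "range c \<subseteq> B" "w = ev c"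
  using presented unfolding presented_left_module_def ev_def by blast

lemma E'12_eq_0:
  assumes "E'12 r q wt (\<lambda>a b. free_elem 1 (a, b)) \<in> Rel" shows "E'12 r q wt dp = 0"
proof -
  let ?S = "{c :: 'n \<times> 'n \<Rightarrow> 'a. range c \<subseteq> B}"
  have S: "csubspace ?S" using clinear_ev by (simp add: clinear_on_def)
  have "ev (E'12 r q wt (\<lambda>a b. free_elem 1 (a, b))) = E'12 r q wt (\<lambda>a b. ev (free_elem 1 (a, b)))"
    unfolding E'12_def clinear_on_scale[OF clinear_ev free_elem_in[OF one_in], symmetric]
    by (rule clinear_on_sum[OF clinear_ev csubspace_scale[OF S free_elem_in[OF one_in]]])
  then show ?thesis using relation[OF assms] by (simp add: ev_free_elem l_one)
qed

text \<open>The derivation applied to p p = p.\<close>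

lemma split: "dp = contract_mult l p dp + contract_mult rt dp p"
proof (intro ext)
  fix i j
  have D_mult: "D (a * b) = l a (D b) + rt (D a) b" "D (a + b) = D a + D b" if "a \<in> B" "b \<in> B" for a b
    using derivation that by (simp_all add: derivation_def)
  have "D (c *\<^sub>C a) = c *\<^sub>C D a" if "a \<in> B" for c a
    using derivation that by (simp add: derivation_def)
  then have "clinear_on B D" by (intro clinear_onI B_subspace D_mult)
  then have "D (\<Sum>k\<in>UNIV. p i k * p k j) = (\<Sum>k\<in>UNIV. D (p i k * p k j))"
    by (rule clinear_on_sum) (intro B_mult p_in)
  then have "dp i j = (\<Sum>k\<in>UNIV. l (p i k) (dp k j) + rt (dp i k) (p k j))"
    unfolding idempotent D_p by (simp add: D_mult p_in D_p)
  then show "dp i j = (contract_mult l p dp + contract_mult rt dp p) i j"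
    by (simp add: contract_mult_eq sum.distrib)
qed

text \<open>The relation holds in the free module; evaluation carries it over because S stays within
  B-valued functions, where evaluation is linear.\<close>

lemma S123_relation:
  assumes "S123 R (\<lambda>a b c d. free_elem (p a b) (c, d)) a b c d - x *\<^sub>C free_elem (p a b) (c, d) \<in> Rel"
  shows "S123 R (concat_legs l p dp) a b c d = x *\<^sub>C concat_legs l p dp a b c d"
proof -
  let ?S = "{c :: 'n \<times> 'n \<Rightarrow> 'a. range c \<subseteq> B}" and ?X = "\<lambda>a b c d. free_elem (p a b) (c, d)"
  have S: "csubspace ?S" using clinear_ev by (simp add: clinear_on_def)
  have X: "?X a b c d \<in> ?S" for a b c d by (rule free_elem_in[OF p_in])
  have "S123 R ?X a b c d \<in> ?S" unfolding S123_eq by (rule S3_in[OF S X])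
  from clinear_on_diff[OF clinear_ev this csubspace_scale[OF S X], of x a b c d]
  have "ev (S123 R ?X a b c d) = x *\<^sub>C ev (?X a b c d)"
    using relation[OF assms] clinear_on_scale[OF clinear_ev X, of x a b c d] by simp
  then show ?thesis
    unfolding S123_map_on[OF clinear_ev X] ev_free_elem concat_legs_def .
qed

lemma tildeS234_relation:
  assumes "tildeS234 R (\<lambda>a b c d. free_elem (p a b) (c, d)) a b c d - x *\<^sub>C free_elem (p a b) (c, d) \<in> Rel"
  shows "tildeS234 R (concat_legs l p dp) a b c d = x *\<^sub>C concat_legs l p dp a b c d"
proof -
  let ?S = "{c :: 'n \<times> 'n \<Rightarrow> 'a. range c \<subseteq> B}" and ?X = "\<lambda>a b c d. free_elem (p a b) (c, d)"
  have S: "csubspace ?S" using clinear_ev by (simp add: clinear_on_def)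
  have X: "?X a b c d \<in> ?S" for a b c d by (rule free_elem_in[OF p_in])
  have "tildeS234 R ?X a b c d \<in> ?S" unfolding tildeS234_eq by (rule tS3_in[OF S X])
  from clinear_on_diff[OF clinear_ev this csubspace_scale[OF S X], of x a b c d]
  have "ev (tildeS234 R ?X a b c d) = x *\<^sub>C ev (?X a b c d)"
    using relation[OF assms] clinear_on_scale[OF clinear_ev X, of x a b c d] by simp
  then show ?thesis
    unfolding tildeS234_map_on[OF clinear_ev X] ev_free_elem concat_legs_def .
qed

end

section \<open>The direct sum of the two parts and the noncommutative statement\<close>

lemma clinear_inl: "clinear (\<lambda>x. (x, 0))" and clinear_inr: "clinear (\<lambda>x. (0, x))"
  by (auto intro!: clinearI simp: scaleC_prod_def scaleC_zero_right)

lemma bimodule_sum: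
  assumes "bimodule B l rt" "bimodule B l' rt'" shows "bimodule B (sum_lact l l') (sum_ract rt rt')"
  using assms
  by (simp add: bimodule_def left_module_def right_module_def sum_lact_def sum_ract_def scaleC_prod_def)

lemma derivation_sum:
  assumes "derivation B l rt D" "derivation B l' rt' D'"
  shows "derivation B (sum_lact l l') (sum_ract rt rt') (\<lambda>b. (D b, D' b))"
  using assms by (simp add: derivation_def sum_lact_def sum_ract_def scaleC_prod_def)

text \<open>The quantum half of the result, with the explicit braidings supplied through
  \<open>legs\<close>. The two values of inner products are stated separately because their
  combination with \<nu> = -1/(r+1) is the required equation between exponents.\<close>

theorem weak_levi_civita:
  fixes r s :: nat and q :: real and V :: "'n::finite uq_module" and wt :: "'n \<Rightarrow> weight" and R :: "'n braidings"
    and f v :: "'n \<Rightarrow> 'a::complex_algebra_1" and B :: "'a set" and p :: "('n, 'a) legs2"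
    and lP :: "'a \<Rightarrow> 'wp::complex_vec \<Rightarrow> 'wp" and rP :: "'wp \<Rightarrow> 'a \<Rightarrow> 'wp"
    and dp :: "('n, 'wp) legs2" and del :: "'a \<Rightarrow> 'wp"
    and lM :: "'a \<Rightarrow> 'wm::complex_vec \<Rightarrow> 'wm" and rM :: "'wm \<Rightarrow> 'a \<Rightarrow> 'wm"
    and dbp :: "('n, 'wm) legs2" and delbar :: "'a \<Rightarrow> 'wm"
    and l :: "'a \<Rightarrow> 'wp \<times> 'wm \<Rightarrow> 'wp \<times> 'wm" and rt :: "'wp \<times> 'wm \<Rightarrow> 'a \<Rightarrow> 'wp \<times> 'wm"
    and d :: "'a \<Rightarrow> 'wp \<times> 'wm"
    and Dp Dbp :: "('n, 'wp \<times> 'wm) legs2"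
    and tn :: "'wp \<times> 'wm \<Rightarrow> 'wp \<times> 'wm \<Rightarrow> 't::complex_vec"
    and \<pi> :: "'t \<Rightarrow> 'z::complex_vec" and rt2 :: "'z \<Rightarrow> 'a \<Rightarrow> 'z" and d2 :: "'wp \<times> 'wm \<Rightarrow> 'z"
    and tn2 :: "'z \<Rightarrow> 'wp \<times> 'wm \<Rightarrow> 'u::complex_vec"
    and nab :: "'wp \<times> 'wm \<Rightarrow> 't"
  assumes legs: "quantum_legs q r k (- 1 / (real r + 1)) R wt"
    and weights: "ww r s = 1 - 1 / (real r + 1)" "wr r s = real r"
    and A: "presented_algebra (case_gens f v) (algebra_relations r s q R)"
    and B: "B = degree_zero_part (case_gens f v)" and p: "p = (\<lambda>i j. f i * v j)"
    and plus: "presented_left_module B lP (\<lambda>(i, j). dp i j) (omega_plus_relations r s q wt R p)"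
      "bimodule B lP rP"
      "\<And>i j k m. rP (dp i j) (p k m) = qpow q (aa r s) *\<^sub>C T1234 R (concat_legs lP p dp) i j k m"
      "derivation B lP rP del" "\<And>i j. del (p i j) = dp i j"
    and minus: "presented_left_module B lM (\<lambda>(i, j). dbp i j) (omega_minus_relations r s q wt R p)"
      "bimodule B lM rM"
      "\<And>i j k m. rM (dbp i j) (p k m) = qpow q (- aa r s) *\<^sub>C T1234 R (concat_legs lM p dbp) i j k m"
      "derivation B lM rM delbar" "\<And>i j. delbar (p i j) = dbp i j"
    and sum: "l = sum_lact lP lM" "rt = sum_ract rP rM" "d = (\<lambda>b. (del b, delbar b))"
      "Dp = (\<lambda>i j. (dp i j, 0))" "Dbp = (\<lambda>i j. (0, dbp i j))"
    and tensor: "is_tensor_product B rt l tn" "is_universal_degree2 B l rt d tn \<pi> rt2 d2" "is_tensor_product B rt2 l tn2"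
    and connection: "is_connection B l d tn nab"
      "\<And>i j. nab (Dp i j) = nabla_del r s q wt R p (tensor_lact tn l) (concat_legs tn Dbp Dp) i j"
      "\<And>i j. nab (Dbp i j) = nabla_delbar r s q wt p (tensor_lact tn l) (concat_legs tn Dp Dbp) i j"
  shows "torsion \<pi> d2 nab x = 0"
    and "cotorsion tn \<pi> d2 tn2 nab (metric_part r q wt (concat_legs tn Dp Dbp) + metric_part r q wt (concat_legs tn Dbp Dp)) = 0"
proof -
  note B_closed = degree_zero_part_closed[where \<phi> = "case_gens f v", folded B]
  have subspace: "csubspace B" using B_closed by (simp add: csubspace_def)
  have p_in: "p i j \<in> B" for i j using B_closed(6)[of i j] by (simp add: p)
  have idempotent: "(\<Sum>k\<in>UNIV. p i k * p k j) = p i j" for i j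
  proof -
    have "(\<Sum>k\<in>UNIV. p i k * p k j) = f i * (\<Sum>k\<in>UNIV. v k * f k) * v j"
      by (simp add: p sum_distrib_left sum_distrib_right mult.assoc)
    then show ?thesis unfolding algebra_relations_unit[OF A] by (simp add: p)
  qed
  interpret plus: calculus_part B lP rP dp del p "omega_plus_relations r s q wt R p"
    by unfold_locales (fact B_closed subspace p_in idempotent plus)+
  interpret minus: calculus_part B lM rM dbp delbar p "omega_minus_relations r s q wt R p"
    by unfold_locales (fact B_closed subspace p_in idempotent minus)+
  \<comment> \<open>All relations are proved within the two summands and carried over along the
    inclusions, which are linear and so commute with the leg operators.\<close>
  have inl: "concat_legs l p Dp = (\<lambda>a b c d. (concat_legs lP p dp a b c d, 0))"
    by (intro ext) (simp add: concat_legs_def sum sum_lact_def minus.l_zero p_in)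
  have inr: "concat_legs l p Dbp = (\<lambda>a b c d. (0, concat_legs lM p dbp a b c d))"
    by (intro ext) (simp add: concat_legs_def sum sum_lact_def plus.l_zero p_in)
  have tS: "tildeS234 R (concat_legs lP p dp) a b c d = qpow q (- ww r s) *\<^sub>C concat_legs lP p dp a b c d" for a b c d
    by (rule plus.tildeS234_relation) (auto simp: omega_plus_relations_def Let_def)
  have S: "S123 R (concat_legs lM p dbp) a b c d = qpow q (ww r s) *\<^sub>C concat_legs lM p dbp a b c d" for a b c d
    by (rule minus.S123_relation) (auto simp: omega_minus_relations_def Let_def)
  have et: "E'12 r q wt dp = 0" "E'12 r q wt dbp = 0"
    by (rule plus.E'12_eq_0 minus.E'12_eq_0; simp add: omega_plus_relations_def omega_minus_relations_def Let_def)+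
  interpret legs: quantum_legs q r k "- 1 / (real r + 1)" R wt by (rule legs)
  interpret quantum_connection q r k "- 1 / (real r + 1)" R wt B rt l tn d p Dp Dbp "ww r s" "aa r s" rt2 tn2 \<pi> d2 nab "wr r s"
  proof
    show "is_tensor_product B rt l tn" "is_universal_degree2 B l rt d tn \<pi> rt2 d2" "is_tensor_product B rt2 l tn2"
      "is_connection B l d tn nab" by fact+
    show "1 \<in> B" "csubspace B" "p i j \<in> B" for i j by fact+
    show "a * b \<in> B" if "a \<in> B" "b \<in> B" for a b using that by (rule B_closed)
    show "bimodule B l rt" unfolding sum using plus(2) minus(2) by (rule bimodule_sum)
    show "derivation B l rt d" unfolding sum using plus(4) minus(4) by (rule derivation_sum)
    show "d (p i j) = Dp i j + Dbp i j" for i j by (simp add: sum plus(5) minus(5))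
    show "tildeS234 R (concat_legs l p Dp) = qpow q (- ww r s) *\<^sub>C concat_legs l p Dp"
      unfolding inl
      by (intro ext) (simp add: tildeS234_map[OF clinear_inl, symmetric] tS scaleC_fun_apply scaleC_prod_def
          scaleC_zero_right)
    show "S123 R (concat_legs l p Dbp) = qpow q (ww r s) *\<^sub>C concat_legs l p Dbp"
      unfolding inr
      by (intro ext) (simp add: S123_map[OF clinear_inr, symmetric] S scaleC_fun_apply scaleC_prod_def
          scaleC_zero_right)
    show "E'12 r q wt Dp = 0" "E'12 r q wt Dbp = 0"
      using et by (simp_all add: sum E'12_def scaleC_prod_def scaleC_zero_right sum_prod zero_prod_def)
    show "rt (Dp i j) (p m n) = qpow q (aa r s) *\<^sub>C T1234 R (concat_legs l p Dp) i j m n" for i j m n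
      unfolding inl T1234_map[OF clinear_inl, symmetric]
      by (simp add: sum sum_ract_def plus(3) minus.rt_zero p_in scaleC_prod_def scaleC_zero_right)
    show "rt (Dbp i j) (p m n) = qpow q (- aa r s) *\<^sub>C T1234 R (concat_legs l p Dbp) i j m n" for i j m n
      unfolding inr T1234_map[OF clinear_inr, symmetric]
      by (simp add: sum sum_ract_def minus(3) plus.rt_zero p_in scaleC_prod_def scaleC_zero_right)
    show "Dp = contract_mult l p Dp + contract_mult rt Dp p"
    proof (intro ext)
      fix i j
      have "dp i j = contract_mult lP p dp i j + contract_mult rP dp p i j" using plus.split by (metis plus_fun_apply)
      then show "Dp i j = (contract_mult l p Dp + contract_mult rt Dp p) i j"
        by (simp add: sum contract_mult_eq sum_lact_def sum_ract_def minus.l_zero minus.rt_zero p_in sum_prod)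
    qed
    show "Dbp = contract_mult l p Dbp + contract_mult rt Dbp p"
    proof (intro ext)
      fix i j
      have "dbp i j = contract_mult lM p dbp i j + contract_mult rM dbp p i j" using minus.split by (metis plus_fun_apply)
      then show "Dbp i j = (contract_mult l p Dbp + contract_mult rt Dbp p) i j"
        by (simp add: sum contract_mult_eq sum_lact_def sum_ract_def plus.l_zero plus.rt_zero p_in sum_prod)
    qed
    show "Pr x" if P: "\<And>i j b. b \<in> B \<Longrightarrow> Pr (l b (Dp i j))" and Q: "\<And>i j b. b \<in> B \<Longrightarrow> Pr (l b (Dbp i j))"
      and add: "\<And>x y. Pr x \<Longrightarrow> Pr y \<Longrightarrow> Pr (x + y)" for Pr x
    proof -
      obtain c where c: "range c \<subseteq> B" "fst x = plus.ev c" by (rule plus.generated)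
      obtain c' where c': "range c' \<subseteq> B" "snd x = minus.ev c'" by (rule minus.generated)
      have c_in: "c i \<in> B" "c' i \<in> B" for i using c c' by auto
      have sum_closed: "Pr (\<Sum>i\<in>I. g i)" if "\<And>i. Pr (g i)" for g :: "'n \<times> 'n \<Rightarrow> 'wp \<times> 'wm" and I
      proof (induction I rule: infinite_finite_induct)
        \<comment> \<open>The zero form, needed for empty sums, is the coefficient 0 in front of an
          arbitrary generator.\<close>
        have "Pr (l 0 (Dp undefined undefined))" by (rule P[OF plus.zero_in])
        then have "Pr 0" by (simp add: sum sum_lact_def plus.l_0 minus.l_0 zero_prod_def)
        then show "Pr (\<Sum>i\<in>{}. g i)" "\<And>I. infinite I \<Longrightarrow> Pr (\<Sum>i\<in>I. g i)" by simp_all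
      qed (simp add: that add)
      have "x = (\<Sum>i\<in>UNIV. l (c i) (Dp (fst i) (snd i))) + (\<Sum>i\<in>UNIV. l (c' i) (Dbp (fst i) (snd i)))"
        using c(2) c'(2) c_in
        by (intro prod_eqI) (simp_all add: sum sum_lact_def plus.ev_def minus.ev_def case_prod_unfold sum_prod plus.l_zero minus.l_zero)
      moreover have "Pr (\<Sum>i\<in>UNIV. l (c i) (Dp (fst i) (snd i)))" by (intro sum_closed P c_in)
      moreover have "Pr (\<Sum>i\<in>UNIV. l (c' i) (Dbp (fst i) (snd i)))" by (intro sum_closed Q c_in)
      ultimately show ?thesis using add by simp
    qed
    show "nab (Dp i j) = qpow q (aa r s) *\<^sub>C E23 (T1234 R (concat_legs tn Dbp Dp)) i j
      - (qpow q (aa r s) * qpow q (- wr r s)) *\<^sub>C tensor_lact tn l (p i j) (metric_part r q wt (concat_legs tn Dbp Dp))" for i j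
      unfolding connection(2) nabla_del_def ..
    show "nab (Dbp i j) = E23 (concat_legs tn Dp Dbp) i j
      - qpow q (- wr r s) *\<^sub>C tensor_lact tn l (p i j) (metric_part r q wt (concat_legs tn Dp Dbp))" for i j
      unfolding connection(3) nabla_delbar_def ..
    \<comment> \<open>The value is 1/(r+1) - 1 - r + 1 - 1/(r+1) = -r.\<close>
    show "- (- 1 / (real r + 1)) - 1 - real r + ww r s = - wr r s" unfolding weights by simp
  qed
  show "torsion \<pi> d2 nab x = 0" by (rule torsion_free)
  show "cotorsion tn \<pi> d2 tn2 nab (metric_part r q wt (concat_legs tn Dp Dbp) + metric_part r q wt (concat_legs tn Dbp Dp)) = 0"
    using cotorsion_free unfolding g_def g'_def M_def M'_def metric_part_def contract_mult_def .
qed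

section \<open>Braidings of the vector representations\<close>

text \<open>The basis vector of rank \<open>0\<close> is a highest weight vector, and \<open>F (\<sigma> i)\<close> maps the vector of rank \<open>i - 1\<close>
  to \<open>c i\<close> times the vector of rank \<open>i\<close>.\<close>

locale chain = ranked_basis q r k for q r and k :: "'n::finite \<Rightarrow> nat" +
  fixes \<sigma> :: "nat \<Rightarrow> nat" and c :: "nat \<Rightarrow> complex" and V :: "'n uq_module"
  assumes \<sigma>: "bij_betw \<sigma> {1..r} {1..r}"
    and c: "i \<in> {1..r} \<Longrightarrow> c i \<noteq> 0"
    and K: "i \<in> {1..r} \<Longrightarrow> Kop V (\<sigma> i) $ a $ b =
      (if a = b then qpow q (of_bool (Suc (k a) = i) - of_bool (k a = i)) else 0)"
    and E: "i \<in> {1..r} \<Longrightarrow> Eop V (\<sigma> i) $ a $ b = (if k b = i \<and> Suc (k a) = i then inverse (c i) else 0)"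
    and F: "i \<in> {1..r} \<Longrightarrow> Fop V (\<sigma> i) $ a $ b = (if k a = i \<and> Suc (k b) = i then c i else 0)"

lemma matrix_vector_axis: "(A *v axis b 1) $ a = (A $ a $ b :: 'x::comm_semiring_1)"
  by (simp add: matrix_vector_mult_def axis_def if_distrib[of "\<lambda>x. _ * x"] cong: if_cong)

lemma matrix_mult_diagonal:
  "(A ** (\<chi> a b. if a = b then D a else 0)) $ x $ y = A $ x $ y * (D y :: 'x::comm_semiring_1)"
  by (simp add: matrix_matrix_mult_def if_distrib[of "\<lambda>x. _ * x"] cong: if_cong)

lemma diagonal_matrix_mult:
  "((\<chi> a b. if a = b then D a else 0) ** A) $ x $ y = (D x :: 'x::comm_semiring_1) * A $ x $ y"
  by (simp add: matrix_matrix_mult_def if_distrib[of "\<lambda>x. x * _"] cong: if_cong)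

context chain
begin

text \<open>Modules are described by the nodes 1, ..., r, chains by the order \<sigma> in which the
  nodes act.\<close>

lemma ball_\<sigma>: "(\<forall>i\<in>{1..r}. Pr i) \<longleftrightarrow> (\<forall>i\<in>{1..r}. Pr (\<sigma> i))"
proof -
  have "{1..r} = \<sigma> ` {1..r}" using \<sigma> by (simp add: bij_betw_def)
  then have "(\<forall>i\<in>{1..r}. Pr i) \<longleftrightarrow> (\<forall>i\<in>\<sigma> ` {1..r}. Pr i)" by (rule arg_cong)
  then show ?thesis by simp
qed

lemma obtain_index:
  assumes "i \<le> r" obtains a where "k a = i"
proof -
  have "i \<in> range k" using k assms by (simp add: bij_betw_def)
  then show ?thesis using that by blast
qed

lemma K_inv: assumes "i \<in> {1..r}"
  shows "matrix_inv (Kop V (\<sigma> i)) = (\<chi> a b. if a = b then qpow q (of_bool (k a = i) - of_bool (Suc (k a) = i)) else 0)"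
proof (rule matrix_inv_eqI)
  show "Kop V (\<sigma> i) ** (\<chi> a b. if a = b then qpow q (of_bool (k a = i) - of_bool (Suc (k a) = i)) else 0) = mat 1"
    unfolding vec_eq_iff
  proof (intro allI)
    fix a b
    have "(Kop V (\<sigma> i) ** (\<chi> a b. if a = b then qpow q (of_bool (k a = i) - of_bool (Suc (k a) = i)) else 0)) $ a $ b
      = (\<Sum>j\<in>UNIV. if j = a then (if a = b then 1 else 0) else 0)"
      unfolding matrix_matrix_mult_def vec_lambda_beta
      by (intro sum.cong refl) (auto simp: K[OF assms] qpow_add[OF q, symmetric] q)
    then show "(Kop V (\<sigma> i) ** (\<chi> a b. if a = b then qpow q (of_bool (k a = i) - of_bool (Suc (k a) = i)) else 0)) $ a $ b = mat 1 $ a $ b"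
      by (simp add: mat_def)
  qed
qed

lemma K_diagonal: "i \<in> {1..r} \<Longrightarrow> Kop V (\<sigma> i) =
    (\<chi> a b. if a = b then qpow q (of_bool (Suc (k a) = i) - of_bool (k a = i)) else 0)"
  by (simp add: vec_eq_iff K)

lemma dual_K: "i \<in> {1..r} \<Longrightarrow> Kop (dual_module V) (\<sigma> i) $ a $ b =
    (if a = b then qpow q (of_bool (k a = i) - of_bool (Suc (k a) = i)) else 0)"
  by (cases "a = b") (simp_all add: dual_module_def transpose_def K_inv)

lemma dual_E:
  assumes i: "i \<in> {1..r}"
  shows "Eop (dual_module V) (\<sigma> i) $ a $ b = (if Suc (k b) = i \<and> k a = i then - qpow q 1 * inverse (c i) else 0)"
proof -
  have "Eop (dual_module V) (\<sigma> i) $ a $ b = - (Eop V (\<sigma> i) $ b $ a * qpow q (of_bool (k a = i) - of_bool (Suc (k a) = i)))"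
    by (simp add: dual_module_def transpose_def K_inv[OF i] matrix_mult_diagonal)
  then show ?thesis by (auto simp: E[OF i])
qed

lemma dual_F:
  assumes i: "i \<in> {1..r}"
  shows "Fop (dual_module V) (\<sigma> i) $ a $ b = (if Suc (k a) = i \<and> k b = i then - qpow q (- 1) * c i else 0)"
proof -
  have "Fop (dual_module V) (\<sigma> i) $ a $ b = - (qpow q (of_bool (Suc (k b) = i) - of_bool (k b = i)) * Fop V (\<sigma> i) $ b $ a)"
    by (simp only: dual_module_def transpose_def vec_lambda_beta K_diagonal[OF i] diagonal_matrix_mult uq_module.simps vector_uminus_component)
  then show ?thesis by (auto simp: F[OF i])
qed

text \<open>The covector of the lowest basis vector is the highest weight vector of the dual, so
  ranks and nodes are reversed. The new coefficients come from S(F) = -K F, where K acts on the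
  target by 1/q.\<close>

lemma dual: "chain q r (\<lambda>a. r - k a) (\<lambda>i. \<sigma> (r + 1 - i)) (\<lambda>i. - qpow q (- 1) * c (r + 1 - i)) (dual_module V)"
proof -
  interpret rev: ranked_basis q r "\<lambda>a. r - k a" by (rule reversed)
  show ?thesis
  proof
    have "bij_betw (\<lambda>i. r + 1 - i) {1..r} {1..r}"
      by (rule bij_betw_byWitness[of _ "\<lambda>i. r + 1 - i"]) auto
    from bij_betw_trans[OF this \<sigma>] show "bij_betw (\<lambda>i. \<sigma> (r + 1 - i)) {1..r} {1..r}" by (simp add: o_def)
  next
    fix i assume i: "i \<in> {1..r}"
    define j where "j = r + 1 - i"
    then have j: "j \<in> {1..r}" using i by auto
    show "- qpow q (- 1) * c (r + 1 - i) \<noteq> 0"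
      unfolding j_def[symmetric] using c[OF j] qpow_nonzero[OF q] by simp
    have 1: "(Suc (r - k a) = i) = (k a = j)" "(r - k a = i) = (Suc (k a) = j)" for a
      using rank_le[of a] i by (auto simp: j_def)
    fix a b
    show "Kop (dual_module V) (\<sigma> (r + 1 - i)) $ a $ b =
      (if a = b then qpow q (of_bool (Suc (r - k a) = i) - of_bool (r - k a = i)) else 0)"
      unfolding 1 j_def[symmetric] by (rule dual_K[OF j])
    show "Eop (dual_module V) (\<sigma> (r + 1 - i)) $ a $ b =
      (if r - k b = i \<and> Suc (r - k a) = i then inverse (- qpow q (- 1) * c (r + 1 - i)) else 0)"
      unfolding 1 j_def[symmetric] dual_E[OF j] by (simp add: qpow_minus[OF q])
    show "Fop (dual_module V) (\<sigma> (r + 1 - i)) $ a $ b =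
      (if r - k a = i \<and> Suc (r - k b) = i then - qpow q (- 1) * c (r + 1 - i) else 0)"
      unfolding 1 j_def[symmetric] dual_F[OF j] by auto
  qed
qed

lemma E_axis: assumes "i \<in> {1..r}" "k b = i" "Suc (k a) = i"
  shows "Eop V (\<sigma> i) *v axis b 1 = inverse (c i) *s axis a 1"
proof -
  have "Suc (k x) = i \<longleftrightarrow> x = a" for x using assms(3) rank_eq_iff[of x a] by auto
  then show ?thesis
    unfolding vec_eq_iff matrix_vector_axis vector_smult_component using assms(2)
    by (simp add: E[OF assms(1)] axis_def)
qed

lemma E_axis_0: assumes "i \<in> {1..r}" "k b \<noteq> i" shows "Eop V (\<sigma> i) *v axis b 1 = 0"
  unfolding vec_eq_iff matrix_vector_axis using assms(2)
  by (auto simp: E[OF assms(1)])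

lemma F_axis: assumes "i \<in> {1..r}" "k b = i" "Suc (k a) = i"
  shows "Fop V (\<sigma> i) *v axis a 1 = c i *s axis b 1"
proof -
  have "k x = i \<longleftrightarrow> x = b" for x using assms(2) rank_eq_iff[of x b] by auto
  then show ?thesis
    unfolding vec_eq_iff matrix_vector_axis vector_smult_component using assms(3)
    by (simp add: F[OF assms(1)] axis_def)
qed

lemma F_axis_0: assumes "i \<in> {1..r}" "Suc (k b) \<noteq> i" shows "Fop V (\<sigma> i) *v axis b 1 = 0"
  unfolding vec_eq_iff matrix_vector_axis using assms(2)
  by (auto simp: F[OF assms(1)])

lemma K_axis: assumes "i \<in> {1..r}"
  shows "Kop V (\<sigma> i) *v axis b 1 = qpow q (of_bool (Suc (k b) = i) - of_bool (k b = i)) *s axis b 1"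
  unfolding vec_eq_iff matrix_vector_axis vector_smult_component
  by (auto simp: K[OF assms(1)] axis_def)

lemma K_inv_axis: assumes "i \<in> {1..r}"
  shows "matrix_inv (Kop V (\<sigma> i)) *v axis b 1 = qpow q (of_bool (k b = i) - of_bool (Suc (k b) = i)) *s axis b 1"
  unfolding vec_eq_iff matrix_vector_axis vector_smult_component
  by (auto simp: K_inv[OF assms(1)] axis_def)

text \<open>The weights with which the K i act on the two ends of the chain are \<mu> and its image
  under the longest element.\<close>

definition fits :: "weight \<Rightarrow> bool"
  where "fits \<mu> \<longleftrightarrow> (\<forall>i\<in>{1..r}. weight_form r (simple_root (\<sigma> i)) \<mu> = of_bool (i = 1) \<and>
    weight_form r (simple_root (\<sigma> i)) (w0 r \<mu>) = - of_bool (i = r))"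

lemma highest_weight_vector_axis:
  assumes "fits \<mu>" "k a = 0" shows "highest_weight_vector r q V \<mu> (axis a 1)"
  unfolding highest_weight_vector_def has_weight_def
proof (intro conjI)
  show "\<forall>i\<in>{1..r}. Kop V i *v axis a 1 = qpow q (weight_form r (simple_root i) \<mu>) *s axis a 1"
    unfolding ball_\<sigma>[of "\<lambda>i. Kop V i *v axis a 1 = _ i"] using assms
    by (auto simp: K_axis fits_def of_bool_def)
  show "\<forall>i\<in>{1..r}. Eop V i *v axis a 1 = 0"
    unfolding ball_\<sigma>[of "\<lambda>i. Eop V i *v axis a 1 = 0"] using assms by (simp add: E_axis_0)
qed (simp add: axis_eq_0_iff)

lemma lowest_weight_vector_axis:
  assumes "fits \<mu>" "k a = r" shows "lowest_weight_vector r q V (w0 r \<mu>) (axis a 1)"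
  unfolding lowest_weight_vector_def has_weight_def
proof (intro conjI)
  show "\<forall>i\<in>{1..r}. Kop V i *v axis a 1 = qpow q (weight_form r (simple_root i) (w0 r \<mu>)) *s axis a 1"
    unfolding ball_\<sigma>[of "\<lambda>i. Kop V i *v axis a 1 = _ i"] using assms
    by (auto simp: K_axis fits_def of_bool_def)
  show "\<forall>i\<in>{1..r}. Fop V i *v axis a 1 = 0"
    unfolding ball_\<sigma>[of "\<lambda>i. Fop V i *v axis a 1 = 0"] using assms by (simp add: F_axis_0)
qed (simp add: axis_eq_0_iff)

text \<open>A coordinate of positive rank would survive the raising operator that starts there. The
  normalisation of a braiding concerns all highest weight vectors, so they have to be known up to
  scalars.\<close>

lemma highest_weight_vector_eq:
  assumes "highest_weight_vector r q V \<mu> x" "k a = 0"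
  shows "x = x $ a *s axis a 1"
proof -
  have "x $ b = 0" if "b \<noteq> a" for b
  proof -
    have i: "k b \<in> {1..r}" using that rank_eq_iff[of a b] rank_le[of b] assms(2) by (auto simp: Suc_le_eq)
    obtain b' where "k b' = k b - 1"
      by (rule obtain_index[of "k b - 1"]) (use rank_le[of b] in auto)
    then have b': "Suc (k b') = k b" using i by simp
    have "\<sigma> (k b) \<in> {1..r}" using i \<sigma> by (meson bij_betw_apply)
    then have "0 = (Eop V (\<sigma> (k b)) *v x) $ b'"
      using assms(1) by (simp add: highest_weight_vector_def)
    also have "\<dots> = (\<Sum>j\<in>UNIV. if j = b then inverse (c (k b)) * x $ b else 0)"
    proof -
      have "k j = k b \<longleftrightarrow> j = b" for j by (rule rank_eq_iff)
      then show ?thesis unfolding matrix_vector_mult_def vec_lambda_beta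
        by (intro sum.cong refl) (simp add: b' E[OF i])
    qed
    finally show ?thesis using c[OF i] by simp
  qed
  then show ?thesis by (auto simp: vec_eq_iff axis_def)
qed

lemma lowest_weight_vector_eq:
  assumes "lowest_weight_vector r q V \<mu> x" "k a = r"
  shows "x = x $ a *s axis a 1"
proof -
  have "x $ b = 0" if "b \<noteq> a" for b
  proof -
    have "k b \<noteq> r" using that rank_eq_iff[of a b] assms(2) by auto
    then have i: "Suc (k b) \<in> {1..r}" using rank_le[of b] by auto
    obtain b' where b': "k b' = Suc (k b)"
      by (rule obtain_index[of "Suc (k b)"]) (use i in auto)
    have "\<sigma> (Suc (k b)) \<in> {1..r}" using i \<sigma> by (meson bij_betw_apply)
    then have "0 = (Fop V (\<sigma> (Suc (k b))) *v x) $ b'"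
      using assms(1) by (simp add: lowest_weight_vector_def)
    also have "\<dots> = (\<Sum>j\<in>UNIV. if j = b then c (Suc (k b)) * x $ b else 0)"
    proof -
      have "k j = k b \<longleftrightarrow> j = b" for j by (rule rank_eq_iff)
      then show ?thesis unfolding matrix_vector_mult_def vec_lambda_beta
        by (intro sum.cong refl) (simp add: b' F[OF i])
    qed
    finally show ?thesis using c[OF i] by simp
  qed
  then show ?thesis by (auto simp: vec_eq_iff axis_def)
qed

end

section \<open>Uniqueness of the braiding\<close>

lemma kron_vec_tensor: "kron A B *v vec_tensor x y = vec_tensor (A *v x) (B *v y)"
  by (simp add: vec_eq_iff kron_def vec_tensor_def matrix_vector_mult_def sum_UNIV_prod sum_product
      mult_ac)

lemma vec_tensor_scale: "vec_tensor (s *s x) (t *s y) = (s * t) *s vec_tensor x y"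
  by (simp add: vec_eq_iff vec_tensor_def mult_ac)

lemma vec_tensor_axis: "vec_tensor (axis a 1) (axis b 1) = axis (a, b) 1"
  by (auto simp: vec_eq_iff vec_tensor_def axis_def prod_eq_iff)

lemma vec_tensor_add_right: "vec_tensor x (y + z) = vec_tensor x y + vec_tensor x z"
  by (simp add: vec_eq_iff vec_tensor_def algebra_simps)

lemma vec_tensor_zero: "vec_tensor x 0 = 0" "vec_tensor 0 x = 0"
  by (simp_all add: vec_eq_iff vec_tensor_def)

text \<open>The vectors on which two braidings agree form a submodule containing highest (x) lowest,
  and this vector generates V (x) W: raise the second factor, then lower the first.\<close>

lemma braiding_unique:
  assumes V: "chain q r k \<sigma> c V" and W: "chain q r k' \<sigma>' c' W"
    and \<mu>: "chain.fits r \<sigma> \<mu>" and \<mu>': "chain.fits r \<sigma>' \<mu>'"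
    and R: "is_braiding r q \<mu> V \<mu>' W R" and R': "is_braiding r q \<mu> V \<mu>' W R'"
  shows "R = R'"
proof -
  interpret V: chain q r k \<sigma> c V by (rule V)
  interpret W: chain q r k' \<sigma>' c' W by (rule W)
  define S where "S = {z. R *v z = R' *v z}"
  have add: "x + y \<in> S" if "x \<in> S" "y \<in> S" for x y
    using that by (simp add: S_def matrix_vector_right_distrib)
  have scale: "s *s x \<in> S" if "x \<in> S" for s x
    using that by (simp add: S_def vector_scalar_commute)
  have zero: "0 \<in> S" by (simp add: S_def)
  have diff: "x - y \<in> S" if "x \<in> S" "y \<in> S" for x y
    using add[OF that(1) scale[OF that(2), of "- 1"]] by (simp add: vector_sneg_minus1[symmetric])
  have intertwine: "A *v z \<in> S" if "R ** A = A' ** R" "R' ** A = A' ** R'" "z \<in> S" for A A' z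
  proof -
    have "R *v (A *v z) = A' *v (R *v z)" by (simp only: matrix_vector_mul_assoc that)
    moreover have "R' *v (A *v z) = A' *v (R' *v z)" by (simp only: matrix_vector_mul_assoc that)
    ultimately show ?thesis using that(3) by (simp add: S_def)
  qed
  have E_S: "Eop (tensor_module V W) i *v z \<in> S" if i: "i \<in> {1..r}" and z: "z \<in> S" for i z
  proof (rule intertwine[OF _ _ z])
    show "R ** Eop (tensor_module V W) i = Eop (tensor_module W V) i ** R"
      using R i by (simp add: is_braiding_def)
    show "R' ** Eop (tensor_module V W) i = Eop (tensor_module W V) i ** R'"
      using R' i by (simp add: is_braiding_def)
  qed
  have F_S: "Fop (tensor_module V W) i *v z \<in> S" if i: "i \<in> {1..r}" and z: "z \<in> S" for i z
  proof (rule intertwine[OF _ _ z])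
    show "R ** Fop (tensor_module V W) i = Fop (tensor_module W V) i ** R"
      using R i by (simp add: is_braiding_def)
    show "R' ** Fop (tensor_module V W) i = Fop (tensor_module W V) i ** R'"
      using R' i by (simp add: is_braiding_def)
  qed
  obtain a0 where a0: "k a0 = 0" by (rule V.obtain_index[of 0]) auto
  obtain br where br: "k' br = r" by (rule W.obtain_index[of r]) auto
  have base: "vec_tensor (axis a0 1) (axis br 1) \<in> S"
    using R R' V.highest_weight_vector_axis[OF \<mu> a0] W.lowest_weight_vector_axis[OF \<mu>' br]
    unfolding is_braiding_def S_def by simp
  \<comment> \<open>E acts as E (x) K + 1 (x) E, and the first summand kills the highest weight
    vector.\<close>
  have right: "vec_tensor (axis a0 1) (axis b 1) \<in> S" for b
  proof (induction "r - k' b" arbitrary: b)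
    case 0
    then have "b = br" using W.rank_le[of b] W.rank_eq_iff[of b br] br by simp
    then show ?case using base by simp
  next
    case (Suc n)
    let ?i = "Suc (k' b)"
    have i: "?i \<in> {1..r}" using Suc(2) by auto
    then obtain b' where b': "k' b' = ?i" by (metis W.obtain_index atLeastAtMost_iff)
    have "r - k' b' = n" using Suc(2) b' by simp
    then have "vec_tensor (axis a0 1) (axis b' 1) \<in> S" using Suc(1) by blast
    moreover have \<sigma>i: "\<sigma>' ?i \<in> {1..r}" using i W.\<sigma> by (meson bij_betw_apply)
    ultimately have "Eop (tensor_module V W) (\<sigma>' ?i) *v vec_tensor (axis a0 1) (axis b' 1) \<in> S"
      by (intro E_S)
    moreover have "Eop V (\<sigma>' ?i) *v axis a0 1 = 0"
      using V.highest_weight_vector_axis[OF \<mu> a0] \<sigma>i by (simp add: highest_weight_vector_def)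
    ultimately have "vec_tensor (axis a0 1) (inverse (c' ?i) *s axis b 1) \<in> S"
      by (simp add: tensor_module_def matrix_vector_mult_add_rdistrib kron_vec_tensor vec_tensor_zero
          W.E_axis[OF i b' refl])
    then have "c' ?i *s vec_tensor (1 *s axis a0 1) (inverse (c' ?i) *s axis b 1) \<in> S"
      by (intro scale) simp
    then show ?case unfolding vec_tensor_scale using W.c[OF i] by (simp add: vector_smult_assoc)
  qed
  have all_right: "vec_tensor (axis a 1) y \<in> S" if "\<And>b. vec_tensor (axis a 1) (axis b 1) \<in> S" for a y
  proof -
    have 1: "vec_tensor (axis a 1) (\<Sum>b\<in>B. y $ b *s axis b 1) \<in> S" for B
    proof (induction B rule: infinite_finite_induct)
      case (insert b B)
      have "vec_tensor (1 *s axis a 1) (y $ b *s axis b 1) \<in> S"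
        unfolding vec_tensor_scale by (intro scale that)
      then show ?case using insert by (simp add: vec_tensor_add_right add)
    qed (simp_all add: vec_tensor_zero zero)
    have "(\<Sum>b\<in>UNIV. y $ b *s axis b 1) = y" by (rule basis_expansion)
    with 1[of UNIV] show ?thesis by simp
  qed
  \<comment> \<open>F acts as F (x) 1 plus a term whose first factor still has the previous rank;
    that term is covered by the induction hypothesis for every second factor.\<close>
  have "vec_tensor (axis a 1) (axis b 1) \<in> S" for a b
  proof (induction "k a" arbitrary: a b)
    case 0
    then have "a = a0" using a0 V.rank_eq_iff[of a a0] by simp
    then show ?case using right by simp
  next
    case (Suc n)
    let ?i = "k a"
    have i: "?i \<in> {1..r}" using Suc(2) V.rank_le[of a] by auto
    obtain a' where a': "k a' = n" by (rule V.obtain_index[of n]) (use Suc(2) V.rank_le[of a] in auto)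
    have IH: "vec_tensor (axis a' 1) y \<in> S" for y using Suc(1)[OF a'[symmetric]] by (rule all_right)
    have \<sigma>i: "\<sigma> ?i \<in> {1..r}" using i V.\<sigma> by (meson bij_betw_apply)
    have sa: "Suc (k a') = ?i" using a' Suc(2) by simp
    have "Fop (tensor_module V W) (\<sigma> ?i) *v vec_tensor (axis a' 1) (axis b 1) \<in> S"
      by (intro F_S \<sigma>i IH)
    moreover have "Fop (tensor_module V W) (\<sigma> ?i) *v vec_tensor (axis a' 1) (axis b 1) =
      vec_tensor (c ?i *s axis a 1) (1 *s axis b 1) + vec_tensor (qpow q (of_bool (k a' = ?i) - of_bool (Suc (k a') = ?i)) *s axis a' 1) (1 *s (Fop W (\<sigma> ?i) *v axis b 1))"
      by (simp add: tensor_module_def matrix_vector_mult_add_rdistrib kron_vec_tensor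
          V.F_axis[OF i refl sa] V.K_inv_axis[OF i])
    ultimately have "vec_tensor (c ?i *s axis a 1) (1 *s axis b 1) + vec_tensor (qpow q (of_bool (k a' = ?i) - of_bool (Suc (k a') = ?i)) *s axis a' 1) (1 *s (Fop W (\<sigma> ?i) *v axis b 1)) \<in> S"
      by simp
    from diff[OF this scale[OF IH]] have "vec_tensor (c ?i *s axis a 1) (1 *s axis b 1) \<in> S"
      unfolding vec_tensor_scale by (metis add_diff_cancel_right' mult_1_right)
    then have "inverse (c ?i) *s vec_tensor (c ?i *s axis a 1) (1 *s axis b 1) \<in> S" by (rule scale)
    then show ?case unfolding vec_tensor_scale using V.c[OF i] by (simp add: vector_smult_assoc)
  qed
  then have "R *v axis x 1 = R' *v axis x 1" for x
    by (cases x) (simp add: S_def vec_tensor_axis)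
  then have "R $ y $ x = R' $ y $ x" for x y
    by (simp only: matrix_vector_axis[symmetric])
  then show ?thesis by (simp add: vec_eq_iff)
qed

section \<open>The intertwining property of the explicit matrices\<close>

lemma hecke_left:
  "(hecke q \<nu> gt ** A) $ (a, b) $ y = qpow q \<nu> * ((if a = b then qpow q 1 else 1) * A $ (b, a) $ y
    + (if gt a b then qdiff q * A $ (a, b) $ y else 0))"
proof -
  have "(\<Sum>i\<in>UNIV. hecke q \<nu> gt $ (a, b) $ (i, j) * A $ (i, j) $ y) =
    (if j = a then qpow q \<nu> * ((if a = b then qpow q 1 else 1) * A $ (b, a) $ y) else 0)
    + (if j = b then if gt a b then qpow q \<nu> * (qdiff q * A $ (a, b) $ y) else 0 else 0)" for j
  proof -
    have "hecke q \<nu> gt $ (a, b) $ (i, j) * A $ (i, j) $ y =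
     (if i = b then (if j = a then qpow q \<nu> * ((if a = b then qpow q 1 else 1) * A $ (b, a) $ y) else 0) else 0)
     + (if i = a then (if j = b then if gt a b then qpow q \<nu> * (qdiff q * A $ (a, b) $ y) else 0 else 0) else 0)" for i
      by (auto simp: hecke_def algebra_simps)
    then show ?thesis by (simp add: sum.distrib)
  qed
  then show ?thesis unfolding matrix_mult_pairs by (simp add: sum.distrib distrib_left)
qed

lemma hecke_right:
  "(A ** hecke q \<nu> gt) $ x $ (m, n) = qpow q \<nu> * ((if m = n then qpow q 1 else 1) * A $ x $ (n, m)
    + (if gt m n then qdiff q * A $ x $ (m, n) else 0))"
proof -
  have "(\<Sum>i\<in>UNIV. A $ x $ (i, j) * hecke q \<nu> gt $ (i, j) $ (m, n)) =
    (if j = m then qpow q \<nu> * ((if m = n then qpow q 1 else 1) * A $ x $ (n, m)) else 0)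
    + (if j = n then if gt m n then qpow q \<nu> * (qdiff q * A $ x $ (m, n)) else 0 else 0)" for j
  proof -
    have "A $ x $ (i, j) * hecke q \<nu> gt $ (i, j) $ (m, n) =
     (if i = n then (if j = m then qpow q \<nu> * ((if m = n then qpow q 1 else 1) * A $ x $ (n, m)) else 0) else 0)
     + (if i = m then (if j = n then if gt m n then qpow q \<nu> * (qdiff q * A $ x $ (m, n)) else 0 else 0) else 0)" for i
      by (auto simp: hecke_def algebra_simps)
    then show ?thesis by (simp add: sum.distrib)
  qed
  then show ?thesis unfolding matrix_mult_pairs by (simp add: sum.distrib distrib_left)
qed

text \<open>A generator E or F links just two basis vectors lo and hi of adjacent rank, and every
  other vector lies on the same side of both. With x, y for q, 1/q the commutation with a braiding
  becomes a finite case distinction on entries.\<close>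

context
  fixes gt :: "'n \<Rightarrow> 'n \<Rightarrow> bool" and lo hi :: 'n and x y t :: complex and \<kappa> :: "'n \<Rightarrow> complex"
  assumes xy: "x * y = 1" "y * x = 1"
    and order: "lo \<noteq> hi" "hi \<noteq> lo" "gt hi lo" "\<not> gt lo hi" "\<And>z. \<not> gt z z"
      "\<And>z. z \<noteq> lo \<Longrightarrow> z \<noteq> hi \<Longrightarrow> gt z lo = gt z hi"
      "\<And>z. z \<noteq> lo \<Longrightarrow> z \<noteq> hi \<Longrightarrow> gt lo z = gt hi z"
begin

lemma hecke_raise_aux:
  fixes A :: "'n \<Rightarrow> 'n \<Rightarrow> 'n \<Rightarrow> 'n \<Rightarrow> complex"
  assumes A: "A = (\<lambda>a b m n. (if a = lo \<and> m = hi \<and> b = n then t * \<kappa> b else 0) + (if a = m \<and> b = lo \<and> n = hi then t else 0))"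
    and \<kappa>: "\<kappa> lo = x" "\<kappa> hi = y" "\<And>z. z \<noteq> lo \<Longrightarrow> z \<noteq> hi \<Longrightarrow> \<kappa> z = 1"
  shows "(if a = b then x else 1) * A b a m n + (if gt a b then (x - y) * A a b m n else 0)
    = (if m = n then x else 1) * A a b n m + (if gt m n then (x - y) * A a b m n else 0)"
proof -
  have xy': "x * (y * z) = z" "y * (x * z) = z" for z using xy by (simp_all add: mult.assoc[symmetric])
  consider "m = hi" "n = hi" | "m = hi" "n = lo" | "m = lo" "n = hi" | "m = hi" "n \<noteq> hi" "n \<noteq> lo"
    | "n = hi" "m \<noteq> hi" "m \<noteq> lo" | "m \<noteq> hi" "n \<noteq> hi" by blast
  then show ?thesis
  proof cases
    case 1
    then show ?thesis by (auto simp: A order \<kappa> xy xy' algebra_simps)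
  next
    case 2
    then show ?thesis by (auto simp: A order \<kappa> xy xy' algebra_simps)
  next
    case 3
    then show ?thesis by (auto simp: A order \<kappa> xy xy' algebra_simps)
  next
    case 4
    then show ?thesis using order(6,7)[of n] by (auto simp: A order(1-5) \<kappa> xy xy' algebra_simps)
  next
    case 5
    then show ?thesis using order(6,7)[of m] by (auto simp: A order(1-5) \<kappa> xy xy' algebra_simps)
  next
    case 6
    then show ?thesis by (auto simp: A)
  qed
qed

lemma hecke_lower_aux:
  fixes A :: "'n \<Rightarrow> 'n \<Rightarrow> 'n \<Rightarrow> 'n \<Rightarrow> complex"
  assumes A: "A = (\<lambda>a b m n. (if a = hi \<and> m = lo \<and> b = n then t else 0) + (if a = m \<and> b = hi \<and> n = lo then t * \<kappa> a else 0))"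
    and \<kappa>: "\<kappa> lo = y" "\<kappa> hi = x" "\<And>z. z \<noteq> lo \<Longrightarrow> z \<noteq> hi \<Longrightarrow> \<kappa> z = 1"
  shows "(if a = b then x else 1) * A b a m n + (if gt a b then (x - y) * A a b m n else 0)
    = (if m = n then x else 1) * A a b n m + (if gt m n then (x - y) * A a b m n else 0)"
proof -
  have xy': "x * (y * z) = z" "y * (x * z) = z" for z using xy by (simp_all add: mult.assoc[symmetric])
  consider "m = lo" "n = lo" | "m = hi" "n = lo" | "m = lo" "n = hi" | "m = lo" "n \<noteq> hi" "n \<noteq> lo"
    | "n = lo" "m \<noteq> hi" "m \<noteq> lo" | "m \<noteq> lo" "n \<noteq> lo" by blast
  then show ?thesis
  proof cases
    case 1
    then show ?thesis by (auto simp: A order \<kappa> xy xy' algebra_simps)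
  next
    case 2
    then show ?thesis by (auto simp: A order \<kappa> xy xy' algebra_simps)
  next
    case 3
    then show ?thesis by (auto simp: A order \<kappa> xy xy' algebra_simps)
  next
    case 4
    then show ?thesis using order(6,7)[of n] by (auto simp: A order(1-5) \<kappa> xy xy' algebra_simps)
  next
    case 5
    then show ?thesis using order(6,7)[of m] by (auto simp: A order(1-5) \<kappa> xy xy' algebra_simps)
  next
    case 6
    then show ?thesis by (auto simp: A)
  qed
qed

text \<open>The correction sums of \<open>mixed_inv\<close> are already evaluated here, hence the
  conditions on a = lo and m = hi in the last summands.\<close>

lemma mixed_raise_aux:
  fixes A A' :: "'n \<Rightarrow> 'n \<Rightarrow> 'n \<Rightarrow> 'n \<Rightarrow> complex"
  assumes A: "A = (\<lambda>a b m n. (if a = hi \<and> m = lo \<and> b = n then - x * t * \<kappa> b else 0) + (if a = m \<and> b = lo \<and> n = hi then t else 0))"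
    and A': "A' = (\<lambda>a b m n. (if a = lo \<and> m = hi \<and> b = n then t * \<kappa>' b else 0) + (if a = m \<and> b = hi \<and> n = lo then - x * t else 0))"
    and \<kappa>: "\<kappa> lo = x" "\<kappa> hi = y" "\<And>z. z \<noteq> lo \<Longrightarrow> z \<noteq> hi \<Longrightarrow> \<kappa> z = 1"
    and \<kappa>': "\<kappa>' lo = y" "\<kappa>' hi = x" "\<And>z. z \<noteq> lo \<Longrightarrow> z \<noteq> hi \<Longrightarrow> \<kappa>' z = 1"
  shows "(if a = b then x else 1) * A b a m n + (if a = b then (x - y) * (if a = lo \<and> m = lo \<and> n = hi then - t else 0) else 0)
    = (if m = n then x else 1) * A' a b n m + (if m = n then (x - y) * (if m = hi \<and> a = lo \<and> b = hi then - x * t else 0) else 0)"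
proof -
  have xy': "x * (y * z) = z" "y * (x * z) = z" for z using xy by (simp_all add: mult.assoc[symmetric])
  consider "m = lo" "n = lo" | "m = hi" "n = lo" | "m = lo" "n = hi" | "m = hi" "n = hi"
    | "m = lo" "n \<noteq> hi" "n \<noteq> lo" | "n = hi" "m \<noteq> hi" "m \<noteq> lo" | "m \<noteq> lo" "n \<noteq> hi" by blast
  then show ?thesis
    by cases (auto simp: A A' order(1,2) \<kappa> \<kappa>' xy xy' algebra_simps)
qed

lemma mixed_lower_aux:
  fixes A A' :: "'n \<Rightarrow> 'n \<Rightarrow> 'n \<Rightarrow> 'n \<Rightarrow> complex"
  assumes A: "A = (\<lambda>a b m n. (if a = lo \<and> m = hi \<and> b = n then - y * t else 0) + (if a = m \<and> b = hi \<and> n = lo then t * \<kappa> a else 0))"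
    and A': "A' = (\<lambda>a b m n. (if a = hi \<and> m = lo \<and> b = n then t else 0) + (if a = m \<and> b = lo \<and> n = hi then - y * t * \<kappa>' a else 0))"
    and \<kappa>: "\<kappa> lo = x" "\<kappa> hi = y" "\<And>z. z \<noteq> lo \<Longrightarrow> z \<noteq> hi \<Longrightarrow> \<kappa> z = 1"
    and \<kappa>': "\<kappa>' lo = y" "\<kappa>' hi = x" "\<And>z. z \<noteq> lo \<Longrightarrow> z \<noteq> hi \<Longrightarrow> \<kappa>' z = 1"
  shows "(if a = b then x else 1) * A b a m n + (if a = b then (x - y) * (if a = lo \<and> m = hi \<and> n = lo then y * t else 0) else 0)
    = (if m = n then x else 1) * A' a b n m + (if m = n then (x - y) * (if m = hi \<and> a = hi \<and> b = lo then t else 0) else 0)"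
proof -
  have xy': "x * (y * z) = z" "y * (x * z) = z" for z using xy by (simp_all add: mult.assoc[symmetric])
  consider "m = lo" "n = lo" | "m = hi" "n = lo" | "m = lo" "n = hi" | "m = hi" "n = hi"
    | "m = hi" "n \<noteq> hi" "n \<noteq> lo" | "n = lo" "m \<noteq> hi" "m \<noteq> lo" | "m \<noteq> hi" "n \<noteq> lo" by blast
  then show ?thesis
    by cases (auto simp: A A' order(1,2) \<kappa> \<kappa>' xy xy' algebra_simps)
qed

end

lemma mixed_inv_left:
  "(mixed_inv q \<nu> k ** A) $ (a, b) $ y = qpow q \<nu> * ((if a = b then qpow q 1 else 1) * A $ (b, a) $ y
    + (if a = b then qdiff q * (\<Sum>j\<in>{j. k a < k j}. A $ (j, j) $ y) else 0))"
proof -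
  have "(\<Sum>i\<in>UNIV. mixed_inv q \<nu> k $ (a, b) $ (i, j) * A $ (i, j) $ y) =
    (if j = a then qpow q \<nu> * ((if a = b then qpow q 1 else 1) * A $ (b, a) $ y) else 0)
    + (if k a < k j then if a = b then qpow q \<nu> * (qdiff q * A $ (j, j) $ y) else 0 else 0)" for j
  proof -
    have "mixed_inv q \<nu> k $ (a, b) $ (i, j) * A $ (i, j) $ y =
     (if i = b then (if j = a then qpow q \<nu> * ((if a = b then qpow q 1 else 1) * A $ (b, a) $ y) else 0) else 0)
     + (if i = j then (if k a < k j then if a = b then qpow q \<nu> * (qdiff q * A $ (j, j) $ y) else 0 else 0) else 0)" for i
      by (auto simp: mixed_inv_def algebra_simps)
    then show ?thesis by (simp add: sum.distrib)
  qed
  then show ?thesis unfolding matrix_mult_pairs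
    by (simp add: sum.distrib distrib_left sum_if_Collect sum_distrib_left)
qed

lemma mixed_inv_right:
  "(A ** mixed_inv q \<nu> k) $ x $ (m, n) = qpow q \<nu> * ((if m = n then qpow q 1 else 1) * A $ x $ (n, m)
    + (if m = n then qdiff q * (\<Sum>i\<in>{i. k i < k m}. A $ x $ (i, i)) else 0))"
proof -
  have "(\<Sum>i\<in>UNIV. A $ x $ (i, j) * mixed_inv q \<nu> k $ (i, j) $ (m, n)) =
    (if j = m then qpow q \<nu> * ((if m = n then qpow q 1 else 1) * A $ x $ (n, m)) else 0)
    + (if k j < k m then if m = n then qpow q \<nu> * (qdiff q * A $ x $ (j, j)) else 0 else 0)" for j
  proof -
    have "A $ x $ (i, j) * mixed_inv q \<nu> k $ (i, j) $ (m, n) =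
     (if i = n then (if j = m then qpow q \<nu> * ((if m = n then qpow q 1 else 1) * A $ x $ (n, m)) else 0) else 0)
     + (if i = j then (if k j < k m then if m = n then qpow q \<nu> * (qdiff q * A $ x $ (j, j)) else 0 else 0) else 0)" for i
      by (auto simp: mixed_inv_def algebra_simps)
    then show ?thesis by (simp add: sum.distrib)
  qed
  then show ?thesis unfolding matrix_mult_pairs
    by (simp add: sum.distrib distrib_left sum_if_Collect sum_distrib_left)
qed

lemma sum_Collect_two:
  assumes "u \<noteq> v"
  shows "(\<Sum>j\<in>{j::'i::finite. Pr j}. (if j = u then X else 0) + (if j = v then Y else 0)) =
    (if Pr u then X else 0) + (if Pr v then Y else (0 :: 'x::comm_monoid_add))"
  by (simp add: sum.distrib)

context chain
begin

lemma dual_K_inv: assumes i: "i \<in> {1..r}"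
  shows "matrix_inv (Kop (dual_module V) (\<sigma> i)) = Kop V (\<sigma> i)"
proof (rule matrix_inv_eqI)
  have eq: "Kop (dual_module V) (\<sigma> i) = (\<chi> a b. if a = b then qpow q (of_bool (k a = i) - of_bool (Suc (k a) = i)) else 0)"
    by (simp add: vec_eq_iff dual_K[OF i])
  show "Kop (dual_module V) (\<sigma> i) ** Kop V (\<sigma> i) = mat 1"
    unfolding eq vec_eq_iff diagonal_matrix_mult
    by (auto simp: K[OF i] mat_def qpow_add[OF q, symmetric] q)
qed

context
  fixes i lo hi
  assumes i: "i \<in> {1..r}" and lo: "Suc (k lo) = i" and hi: "k hi = i"
begin

lemma lo_iff: "Suc (k x) = i \<longleftrightarrow> x = lo"
  using lo rank_eq_iff[of x lo] by auto

lemma hi_iff: "k x = i \<longleftrightarrow> x = hi"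
  using hi rank_eq_iff[of x hi] by auto

lemma lo_neq_hi: "lo \<noteq> hi" "hi \<noteq> lo"
  using lo hi by auto

definition \<kappa> :: "'n \<Rightarrow> complex" where "\<kappa> b = qpow q (of_bool (b = lo) - of_bool (b = hi))"
definition \<kappa>' :: "'n \<Rightarrow> complex" where "\<kappa>' b = qpow q (of_bool (b = hi) - of_bool (b = lo))"

lemma \<kappa>_simps: "\<kappa> lo = qpow q 1" "\<kappa> hi = qpow q (- 1)" "z \<noteq> lo \<Longrightarrow> z \<noteq> hi \<Longrightarrow> \<kappa> z = 1"
  "\<kappa>' lo = qpow q (- 1)" "\<kappa>' hi = qpow q 1" "z \<noteq> lo \<Longrightarrow> z \<noteq> hi \<Longrightarrow> \<kappa>' z = 1"
  using lo_neq_hi q by (simp_all add: \<kappa>_def \<kappa>'_def)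

lemma entries:
  "Kop V (\<sigma> i) $ a $ b = (if a = b then \<kappa> a else 0)"
  "Eop V (\<sigma> i) $ a $ b = (if b = hi \<and> a = lo then inverse (c i) else 0)"
  "Fop V (\<sigma> i) $ a $ b = (if a = hi \<and> b = lo then c i else 0)"
  "matrix_inv (Kop V (\<sigma> i)) $ a $ b = (if a = b then \<kappa>' a else 0)"
  "Kop (dual_module V) (\<sigma> i) $ a $ b = (if a = b then \<kappa>' a else 0)"
  "matrix_inv (Kop (dual_module V) (\<sigma> i)) $ a $ b = (if a = b then \<kappa> a else 0)"
  "Eop (dual_module V) (\<sigma> i) $ a $ b = (if b = lo \<and> a = hi then - qpow q 1 * inverse (c i) else 0)"
  "Fop (dual_module V) (\<sigma> i) $ a $ b = (if a = lo \<and> b = hi then - qpow q (- 1) * c i else 0)"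
  unfolding dual_K_inv[OF i]
  by (simp_all only: K[OF i] E[OF i] F[OF i] K_inv[OF i] dual_K[OF i] dual_E[OF i] dual_F[OF i]
      lo_iff hi_iff \<kappa>_def \<kappa>'_def vec_lambda_beta)

lemma order:
  "k lo < k hi" "\<not> k hi < k lo" "z \<noteq> lo \<Longrightarrow> z \<noteq> hi \<Longrightarrow> k lo < k z \<longleftrightarrow> k hi < k z"
  "z \<noteq> lo \<Longrightarrow> z \<noteq> hi \<Longrightarrow> k z < k lo \<longleftrightarrow> k z < k hi"
  using lo hi rank_eq_iff[of z lo] rank_eq_iff[of z hi] by auto

lemma qq: "qpow q 1 * qpow q (- 1) = 1" "qpow q (- 1) * qpow q 1 = 1"
  by (simp_all add: qpow_add[OF q, symmetric] q)

lemma hecke_E: "hecke q \<nu> gtk ** Eop (tensor_module V V) (\<sigma> i) = Eop (tensor_module V V) (\<sigma> i) ** hecke q \<nu> gtk"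
proof -
  let ?A = "\<lambda>a b m n. (if a = lo \<and> m = hi \<and> b = n then inverse (c i) * \<kappa> b else 0) + (if a = m \<and> b = lo \<and> n = hi then inverse (c i) else 0)"
  have A: "Eop (tensor_module V V) (\<sigma> i) $ (a, b) $ (m, n) = ?A a b m n" for a b m n
    using lo_neq_hi by (auto simp: tensor_module_def kron_def mat_def entries)
  have "(hecke q \<nu> gtk ** Eop (tensor_module V V) (\<sigma> i)) $ (a, b) $ (m, n)
    = (Eop (tensor_module V V) (\<sigma> i) ** hecke q \<nu> gtk) $ (a, b) $ (m, n)" for a b m n
    unfolding hecke_left hecke_right A qdiff_def
    by (rule arg_cong[of _ _ "\<lambda>x. qpow q \<nu> * x"], rule hecke_raise_aux[OF qq lo_neq_hi, where gt = gtk and t = "inverse (c i)" and \<kappa> = \<kappa>])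
      (simp_all add: order \<kappa>_simps)
  then show ?thesis by (simp add: vec_eq_iff)
qed

lemma hecke_F: "hecke q \<nu> gtk ** Fop (tensor_module V V) (\<sigma> i) = Fop (tensor_module V V) (\<sigma> i) ** hecke q \<nu> gtk"
proof -
  let ?A = "\<lambda>a b m n. (if a = hi \<and> m = lo \<and> b = n then c i else 0) + (if a = m \<and> b = hi \<and> n = lo then c i * \<kappa>' a else 0)"
  have A: "Fop (tensor_module V V) (\<sigma> i) $ (a, b) $ (m, n) = ?A a b m n" for a b m n
    using lo_neq_hi by (auto simp: tensor_module_def kron_def mat_def entries)
  have "(hecke q \<nu> gtk ** Fop (tensor_module V V) (\<sigma> i)) $ (a, b) $ (m, n)
    = (Fop (tensor_module V V) (\<sigma> i) ** hecke q \<nu> gtk) $ (a, b) $ (m, n)" for a b m n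
    unfolding hecke_left hecke_right A qdiff_def
    by (rule arg_cong[of _ _ "\<lambda>x. qpow q \<nu> * x"], rule hecke_lower_aux[OF qq lo_neq_hi, where gt = gtk and t = "c i" and \<kappa> = \<kappa>'])
      (simp_all add: order \<kappa>_simps)
  then show ?thesis by (simp add: vec_eq_iff)
qed

lemma hecke_K: "hecke q \<nu> gtk ** Kop (tensor_module V V) (\<sigma> i) = Kop (tensor_module V V) (\<sigma> i) ** hecke q \<nu> gtk"
proof -
  have A: "Kop (tensor_module V V) (\<sigma> i) $ (a, b) $ (m, n) = (if a = m \<and> b = n then \<kappa> a * \<kappa> b else 0)" for a b m n
    by (simp add: tensor_module_def kron_def entries)
  have "(hecke q \<nu> gtk ** Kop (tensor_module V V) (\<sigma> i)) $ (a, b) $ (m, n)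
    = (Kop (tensor_module V V) (\<sigma> i) ** hecke q \<nu> gtk) $ (a, b) $ (m, n)" for a b m n
    unfolding hecke_left hecke_right A by (auto simp: mult.commute)
  then show ?thesis by (simp add: vec_eq_iff)
qed

abbreviation "VD \<equiv> tensor_module V (dual_module V)"
abbreviation "DV \<equiv> tensor_module (dual_module V) V"

text \<open>It is the inverse that is checked on entries, since its correction has constant
  coefficients.\<close>

lemma mixed_intertwine:
  assumes "mixed_inv q \<nu> k ** A = A' ** mixed_inv q \<nu> k"
  shows "mixed q \<nu> k ** A' = A ** mixed q \<nu> k"
proof -
  have "mixed_inv q \<nu> k ** mixed q \<nu> k = mat 1"
    by (simp add: matrix_left_right_inverse[of "mixed_inv q \<nu> k"] mixed_mixed_inv)
  then have "mixed q \<nu> k ** A' = mixed q \<nu> k ** (A' ** mixed_inv q \<nu> k) ** mixed q \<nu> k"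
    by (simp add: matrix_mul_assoc[symmetric])
  also have "\<dots> = (mixed q \<nu> k ** mixed_inv q \<nu> k) ** A ** mixed q \<nu> k"
    unfolding assms[symmetric] by (simp add: matrix_mul_assoc)
  finally show ?thesis by (simp add: mixed_mixed_inv)
qed

lemma mixed_E: "mixed q \<nu> k ** Eop VD (\<sigma> i) = Eop DV (\<sigma> i) ** mixed q \<nu> k"
proof (rule mixed_intertwine)
  let ?t = "inverse (c i)"
  let ?A = "\<lambda>a b m n. (if a = hi \<and> m = lo \<and> b = n then - qpow q 1 * ?t * \<kappa> b else 0) + (if a = m \<and> b = lo \<and> n = hi then ?t else 0)"
  let ?A' = "\<lambda>a b m n. (if a = lo \<and> m = hi \<and> b = n then ?t * \<kappa>' b else 0) + (if a = m \<and> b = hi \<and> n = lo then - qpow q 1 * ?t else 0)"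
  have A: "Eop DV (\<sigma> i) $ (a, b) $ (m, n) = ?A a b m n" for a b m n
    using lo_neq_hi by (auto simp: tensor_module_def kron_def mat_def entries)
  have A': "Eop VD (\<sigma> i) $ (a, b) $ (m, n) = ?A' a b m n" for a b m n
    using lo_neq_hi by (auto simp: tensor_module_def kron_def mat_def entries)
  \<comment> \<open>The terms at lo and hi are opposite, so the sum survives only if the bound on
    the rank separates them.\<close>
  have 1: "(\<Sum>j\<in>{j. k a < k j}. ?A j j m n) = (if a = lo \<and> m = lo \<and> n = hi then - ?t else 0)" for a m n
  proof -
    have "(\<Sum>j\<in>{j. k a < k j}. ?A j j m n) = (\<Sum>j\<in>{j. k a < k j}.
        (if j = hi then (if m = lo \<and> n = hi then - ?t else 0) else 0) + (if j = lo then (if m = lo \<and> n = hi then ?t else 0) else 0))"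
      using lo_neq_hi by (intro sum.cong refl) (auto simp: \<kappa>_simps qq mult.assoc mult.left_commute[of ?t])
    also have "\<dots> = (if a = lo \<and> m = lo \<and> n = hi then - ?t else 0)"
      unfolding sum_Collect_two[OF lo_neq_hi(2)] using order lo_neq_hi by (cases "a = lo"; cases "a = hi") auto
    finally show ?thesis .
  qed
  have 2: "(\<Sum>j\<in>{j. k j < k m}. ?A' a b j j) = (if m = hi \<and> a = lo \<and> b = hi then - qpow q 1 * ?t else 0)" for a b m
  proof -
    have "(\<Sum>j\<in>{j. k j < k m}. ?A' a b j j) = (\<Sum>j\<in>{j. k j < k m}.
        (if j = hi then (if a = lo \<and> b = hi then qpow q 1 * ?t else 0) else 0) + (if j = lo then (if a = lo \<and> b = hi then - qpow q 1 * ?t else 0) else 0))"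
      using lo_neq_hi by (intro sum.cong refl) (auto simp: \<kappa>_simps)
    also have "\<dots> = (if m = hi \<and> a = lo \<and> b = hi then - qpow q 1 * ?t else 0)"
      unfolding sum_Collect_two[OF lo_neq_hi(2)] using order lo_neq_hi by (cases "m = lo"; cases "m = hi") auto
    finally show ?thesis .
  qed
  have "(mixed_inv q \<nu> k ** Eop DV (\<sigma> i)) $ (a, b) $ (m, n) = (Eop VD (\<sigma> i) ** mixed_inv q \<nu> k) $ (a, b) $ (m, n)" for a b m n
    unfolding mixed_inv_left mixed_inv_right A A' 1 2 qdiff_def
    by (rule arg_cong[of _ _ "\<lambda>x. qpow q \<nu> * x"], rule mixed_raise_aux[OF qq lo_neq_hi, where gt = gtk and t = ?t and \<kappa> = \<kappa> and \<kappa>' = \<kappa>' and A = ?A and A' = ?A'])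
      (simp_all add: order \<kappa>_simps)
  then show "mixed_inv q \<nu> k ** Eop DV (\<sigma> i) = Eop VD (\<sigma> i) ** mixed_inv q \<nu> k" by (simp add: vec_eq_iff)
qed

lemma mixed_F: "mixed q \<nu> k ** Fop VD (\<sigma> i) = Fop DV (\<sigma> i) ** mixed q \<nu> k"
proof (rule mixed_intertwine)
  let ?t = "c i"
  let ?A = "\<lambda>a b m n. (if a = lo \<and> m = hi \<and> b = n then - qpow q (- 1) * ?t else 0) + (if a = m \<and> b = hi \<and> n = lo then ?t * \<kappa> a else 0)"
  let ?A' = "\<lambda>a b m n. (if a = hi \<and> m = lo \<and> b = n then ?t else 0) + (if a = m \<and> b = lo \<and> n = hi then - qpow q (- 1) * ?t * \<kappa>' a else 0)"
  have A: "Fop DV (\<sigma> i) $ (a, b) $ (m, n) = ?A a b m n" for a b m n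
    using lo_neq_hi by (auto simp: tensor_module_def kron_def mat_def entries)
  have A': "Fop VD (\<sigma> i) $ (a, b) $ (m, n) = ?A' a b m n" for a b m n
    using lo_neq_hi by (auto simp: tensor_module_def kron_def mat_def entries)
  have 1: "(\<Sum>j\<in>{j. k a < k j}. ?A j j m n) = (if a = lo \<and> m = hi \<and> n = lo then qpow q (- 1) * ?t else 0)" for a m n
  proof -
    have "(\<Sum>j\<in>{j. k a < k j}. ?A j j m n) = (\<Sum>j\<in>{j. k a < k j}.
        (if j = hi then (if m = hi \<and> n = lo then qpow q (- 1) * ?t else 0) else 0) + (if j = lo then (if m = hi \<and> n = lo then - qpow q (- 1) * ?t else 0) else 0))"
      using lo_neq_hi by (intro sum.cong refl) (auto simp: \<kappa>_simps)
    also have "\<dots> = (if a = lo \<and> m = hi \<and> n = lo then qpow q (- 1) * ?t else 0)"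
      unfolding sum_Collect_two[OF lo_neq_hi(2)] using order lo_neq_hi by (cases "a = lo"; cases "a = hi") auto
    finally show ?thesis .
  qed
  have 2: "(\<Sum>j\<in>{j. k j < k m}. ?A' a b j j) = (if m = hi \<and> a = hi \<and> b = lo then ?t else 0)" for a b m
  proof -
    have "(\<Sum>j\<in>{j. k j < k m}. ?A' a b j j) = (\<Sum>j\<in>{j. k j < k m}.
        (if j = hi then (if a = hi \<and> b = lo then - ?t else 0) else 0) + (if j = lo then (if a = hi \<and> b = lo then ?t else 0) else 0))"
      using lo_neq_hi by (intro sum.cong refl) (auto simp: \<kappa>_simps qq mult.assoc mult.commute[of ?t])
    also have "\<dots> = (if m = hi \<and> a = hi \<and> b = lo then ?t else 0)"
      unfolding sum_Collect_two[OF lo_neq_hi(2)] using order lo_neq_hi by (cases "m = lo"; cases "m = hi") auto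
    finally show ?thesis .
  qed
  have "(mixed_inv q \<nu> k ** Fop DV (\<sigma> i)) $ (a, b) $ (m, n) = (Fop VD (\<sigma> i) ** mixed_inv q \<nu> k) $ (a, b) $ (m, n)" for a b m n
    unfolding mixed_inv_left mixed_inv_right A A' 1 2 qdiff_def
    by (rule arg_cong[of _ _ "\<lambda>x. qpow q \<nu> * x"], rule mixed_lower_aux[OF qq lo_neq_hi, where gt = gtk and t = ?t and \<kappa> = \<kappa> and \<kappa>' = \<kappa>' and A = ?A and A' = ?A'])
      (simp_all add: order \<kappa>_simps)
  then show "mixed_inv q \<nu> k ** Fop DV (\<sigma> i) = Fop VD (\<sigma> i) ** mixed_inv q \<nu> k" by (simp add: vec_eq_iff)
qed

lemma mixed_K: "mixed q \<nu> k ** Kop VD (\<sigma> i) = Kop DV (\<sigma> i) ** mixed q \<nu> k"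
proof (rule mixed_intertwine)
  have \<kappa>\<kappa>: "\<kappa> a * \<kappa>' a = 1" for a by (simp add: \<kappa>_def \<kappa>'_def qpow_add[OF q, symmetric] q)
  have A: "Kop DV (\<sigma> i) $ (a, b) $ (m, n) = (if a = m \<and> b = n then \<kappa> b * \<kappa>' a else 0)" for a b m n
    by (simp add: tensor_module_def kron_def entries)
  have A': "Kop VD (\<sigma> i) $ (a, b) $ (m, n) = (if a = m \<and> b = n then \<kappa> a * \<kappa>' b else 0)" for a b m n
    by (simp add: tensor_module_def kron_def entries)
  have 1: "(\<Sum>j\<in>{j. k a < k j}. if j = m \<and> j = n then \<kappa> j * \<kappa>' j else 0) = (if m = n \<and> k a < k m then 1 else 0)" for a m n
  proof -
    have "(\<Sum>j\<in>{j. k a < k j}. if j = m \<and> j = n then \<kappa> j * \<kappa>' j else 0) = (\<Sum>j\<in>{j. k a < k j}. if j = m then (if m = n then 1 else 0) else 0)"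
      by (intro sum.cong refl) (auto simp: \<kappa>\<kappa>)
    then show ?thesis by simp
  qed
  have 2: "(\<Sum>j\<in>{j. k j < k m}. if a = j \<and> b = j then \<kappa> a * \<kappa>' b else 0) = (if a = b \<and> k a < k m then 1 else 0)" for a b m
  proof -
    have "(\<Sum>j\<in>{j. k j < k m}. if a = j \<and> b = j then \<kappa> a * \<kappa>' b else 0) = (\<Sum>j\<in>{j. k j < k m}. if j = a then (if a = b then 1 else 0) else 0)"
      by (intro sum.cong refl) (auto simp: \<kappa>\<kappa>)
    then show ?thesis by simp
  qed
  have "(mixed_inv q \<nu> k ** Kop DV (\<sigma> i)) $ (a, b) $ (m, n) = (Kop VD (\<sigma> i) ** mixed_inv q \<nu> k) $ (a, b) $ (m, n)" for a b m n
    unfolding mixed_inv_left mixed_inv_right A A' 1 2 by auto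
  then show "mixed_inv q \<nu> k ** Kop DV (\<sigma> i) = Kop VD (\<sigma> i) ** mixed_inv q \<nu> k" by (simp add: vec_eq_iff)
qed

end

section \<open>Identification of the braidings\<close>

lemma obtain_pair:
  assumes "i \<in> {1..r}" obtains lo hi where "Suc (k lo) = i" "k hi = i"
proof -
  obtain lo where "k lo = i - 1" by (rule obtain_index[of "i - 1"]) (use assms in auto)
  moreover obtain hi where "k hi = i" by (rule obtain_index[of i]) (use assms in auto)
  ultimately show ?thesis using that[of lo hi] assms by simp
qed

lemma is_braiding_hecke:
  assumes "1 \<le> r" and \<mu>: "fits \<mu>" and \<nu>: "weight_form r \<mu> (w0 r \<mu>) = \<nu>"
  shows "is_braiding r q \<mu> V \<mu> V (hecke q \<nu> gtk)"
  unfolding is_braiding_def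
proof (intro conjI allI impI)
  show "\<forall>i\<in>{1..r}. hecke q \<nu> gtk ** Kop (tensor_module V V) i = Kop (tensor_module V V) i ** hecke q \<nu> gtk \<and>
      hecke q \<nu> gtk ** Eop (tensor_module V V) i = Eop (tensor_module V V) i ** hecke q \<nu> gtk \<and>
      hecke q \<nu> gtk ** Fop (tensor_module V V) i = Fop (tensor_module V V) i ** hecke q \<nu> gtk"
    unfolding ball_\<sigma>[of "\<lambda>i. hecke q \<nu> gtk ** Kop (tensor_module V V) i = Kop (tensor_module V V) i ** hecke q \<nu> gtk \<and>
      hecke q \<nu> gtk ** Eop (tensor_module V V) i = Eop (tensor_module V V) i ** hecke q \<nu> gtk \<and>
      hecke q \<nu> gtk ** Fop (tensor_module V V) i = Fop (tensor_module V V) i ** hecke q \<nu> gtk"]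
  proof
    fix i assume i: "i \<in> {1..r}"
    obtain lo hi where "Suc (k lo) = i" "k hi = i" by (rule obtain_pair[OF i])
    from hecke_K[OF i this] hecke_E[OF i this] hecke_F[OF i this]
    show "hecke q \<nu> gtk ** Kop (tensor_module V V) (\<sigma> i) = Kop (tensor_module V V) (\<sigma> i) ** hecke q \<nu> gtk \<and>
      hecke q \<nu> gtk ** Eop (tensor_module V V) (\<sigma> i) = Eop (tensor_module V V) (\<sigma> i) ** hecke q \<nu> gtk \<and>
      hecke q \<nu> gtk ** Fop (tensor_module V V) (\<sigma> i) = Fop (tensor_module V V) (\<sigma> i) ** hecke q \<nu> gtk" by blast
  qed
  fix x y assume xy: "highest_weight_vector r q V \<mu> x \<and> lowest_weight_vector r q V (w0 r \<mu>) y"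
  obtain a where a: "k a = 0" by (rule obtain_index[of 0]) auto
  obtain b where b: "k b = r" by (rule obtain_index[of r]) auto
  obtain s t where x: "x = s *s axis a 1" and y: "y = t *s axis b 1"
    using highest_weight_vector_eq[OF _ a] lowest_weight_vector_eq[OF _ b] xy by blast
  \<comment> \<open>As r is positive the two ends of the chain differ; the flip entry is then 1 and
    the normalisation is q^\<nu> alone.\<close>
  have "a \<noteq> b" using a b assms(1) by auto
  have "hecke q \<nu> gtk *v axis (a, b) 1 = qpow q \<nu> *s axis (b, a) 1"
    unfolding vec_eq_iff matrix_vector_axis vector_smult_component
  proof
    fix z :: "'n \<times> 'n"
    obtain u v where z: "z = (u, v)" by (cases z)
    have "\<not> k b < k a" using a by simp
    then show "hecke q \<nu> gtk $ z $ (a, b) = qpow q \<nu> * axis (b, a) 1 $ z"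
      using \<open>a \<noteq> b\<close> unfolding z hecke_def axis_def
      by (cases "u = b"; cases "v = a"; cases "u = a"; cases "v = b") simp_all
  qed
  then show "hecke q \<nu> gtk *v vec_tensor x y = qpow q (weight_form r \<mu> (w0 r \<mu>)) *s vec_tensor y x"
    unfolding \<nu> x y
    by (simp add: vec_tensor_scale vec_tensor_axis vector_scalar_commute vector_smult_assoc mult_ac)
qed

text \<open>The lowest weight vector of the dual is the covector of the highest weight vector of V,
  so the normalisation is read off from a diagonal entry; hence the additional exponent -1.\<close>

lemma is_braiding_mixed:
  assumes \<mu>: "fits \<mu>" and \<nu>: "weight_form r \<mu> (w0 r \<mu>') = - \<nu> - 1"
  shows "is_braiding r q \<mu> V \<mu>' (dual_module V) (mixed q \<nu> k)"
  unfolding is_braiding_def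
proof (intro conjI allI impI)
  let ?VD = "tensor_module V (dual_module V)" and ?DV = "tensor_module (dual_module V) V"
  show "\<forall>i\<in>{1..r}. mixed q \<nu> k ** Kop ?VD i = Kop ?DV i ** mixed q \<nu> k \<and>
      mixed q \<nu> k ** Eop ?VD i = Eop ?DV i ** mixed q \<nu> k \<and>
      mixed q \<nu> k ** Fop ?VD i = Fop ?DV i ** mixed q \<nu> k"
    unfolding ball_\<sigma>[of "\<lambda>i. mixed q \<nu> k ** Kop ?VD i = Kop ?DV i ** mixed q \<nu> k \<and>
      mixed q \<nu> k ** Eop ?VD i = Eop ?DV i ** mixed q \<nu> k \<and>
      mixed q \<nu> k ** Fop ?VD i = Fop ?DV i ** mixed q \<nu> k"]
  proof
    fix i assume i: "i \<in> {1..r}"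
    obtain lo hi where "Suc (k lo) = i" "k hi = i" by (rule obtain_pair[OF i])
    from mixed_K[OF i this] mixed_E[OF i this] mixed_F[OF i this]
    show "mixed q \<nu> k ** Kop ?VD (\<sigma> i) = Kop ?DV (\<sigma> i) ** mixed q \<nu> k \<and>
      mixed q \<nu> k ** Eop ?VD (\<sigma> i) = Eop ?DV (\<sigma> i) ** mixed q \<nu> k \<and>
      mixed q \<nu> k ** Fop ?VD (\<sigma> i) = Fop ?DV (\<sigma> i) ** mixed q \<nu> k" by blast
  qed
  interpret D: chain q r "\<lambda>a. r - k a" "\<lambda>i. \<sigma> (r + 1 - i)" "\<lambda>i. - qpow q (- 1) * c (r + 1 - i)" "dual_module V"
    by (rule dual)
  fix x y assume xy: "highest_weight_vector r q V \<mu> x \<and> lowest_weight_vector r q (dual_module V) (w0 r \<mu>') y"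
  obtain a where a: "k a = 0" by (rule obtain_index[of 0]) auto
  have "r - k a = r" using a by simp
  then obtain s t where x: "x = s *s axis a 1" and y: "y = t *s axis a 1"
    using highest_weight_vector_eq[OF _ a] D.lowest_weight_vector_eq xy by blast
  have "mixed q \<nu> k *v axis (a, a) 1 = qpow q (- \<nu> - 1) *s axis (a, a) 1"
    unfolding vec_eq_iff matrix_vector_axis vector_smult_component using a
    by (auto simp: mixed_def axis_def qpow_add[OF q, symmetric])
  then show "mixed q \<nu> k *v vec_tensor x y = qpow q (weight_form r \<mu> (w0 r \<mu>')) *s vec_tensor y x"
    unfolding \<nu> x y
    by (simp add: vec_tensor_scale vec_tensor_axis vector_scalar_commute vector_smult_assoc mult_ac)
qed

lemma braidings:
  assumes "1 \<le> r" and \<mu>: "fits \<mu>" and \<mu>': "chain.fits r (\<lambda>i. \<sigma> (r + 1 - i)) \<mu>'"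
    and \<nu>: "weight_form r \<mu> (w0 r \<mu>) = \<nu>" "weight_form r \<mu> (w0 r \<mu>') = - \<nu> - 1" "weight_form r \<mu>' (w0 r \<mu>') = \<nu>"
  shows "braiding r q \<mu> V \<mu> V = hecke q \<nu> (\<lambda>a b. k b < k a)"
    and "braiding r q \<mu> V \<mu>' (dual_module V) = mixed q \<nu> k"
    and "braiding r q \<mu>' (dual_module V) \<mu>' (dual_module V) = hecke q \<nu> (\<lambda>a b. k a < k b)"
proof -
  have V: "chain q r k \<sigma> c V" by unfold_locales
  interpret D: chain q r "\<lambda>a. r - k a" "\<lambda>i. \<sigma> (r + 1 - i)" "\<lambda>i. - qpow q (- 1) * c (r + 1 - i)" "dual_module V"
    by (rule dual)
  have rev: "(\<lambda>a b. r - k b < r - k a) = (\<lambda>a b. k a < k b)"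
    by (intro ext) (use rank_le in \<open>auto simp: le_Suc_eq less_diff_conv2 diff_less_mono2\<close>)
  show "braiding r q \<mu> V \<mu> V = hecke q \<nu> (\<lambda>a b. k b < k a)"
    unfolding braiding_def
    using is_braiding_hecke[OF assms(1) \<mu> \<nu>(1)] braiding_unique[OF V V \<mu> \<mu>]
    by (intro the_equality) blast+
  show "braiding r q \<mu> V \<mu>' (dual_module V) = mixed q \<nu> k"
    unfolding braiding_def
    using is_braiding_mixed[OF \<mu> \<nu>(2)] braiding_unique[OF V dual \<mu> \<mu>']
    by (intro the_equality) blast+
  show "braiding r q \<mu>' (dual_module V) \<mu>' (dual_module V) = hecke q \<nu> (\<lambda>a b. k a < k b)"
    unfolding braiding_def
    using D.is_braiding_hecke[OF assms(1) \<mu>' \<nu>(3)] braiding_unique[OF dual dual \<mu>' \<mu>'] unfolding rev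
    by (intro the_equality) blast+
qed

end

section \<open>Classification of the vector representations\<close>

text \<open>The Cartan matrix, extended by zero in the second index so that shifts of weights are
  equations between functions on all of nat.\<close>

definition cartan :: "nat \<Rightarrow> nat \<Rightarrow> nat \<Rightarrow> real"
  where "cartan r i j =
    (if j \<in> {1..r} then 2 * of_bool (i = j) - of_bool (i = Suc j) - of_bool (j = Suc i) else 0)"

lemma sum_delta_real:
  "finite A \<Longrightarrow> (\<Sum>i\<in>A. f i * of_bool (i = j)) = (if j \<in> A then f j else (0 :: real))"
  by (simp add: of_bool_def if_distrib[of "\<lambda>x. _ * x"] cong: if_cong)

text \<open>For j = 0 and j = r + 1 both sides vanish, which spares a special treatment of the end
  nodes.\<close>

lemma sum_height_delta:
  "j \<le> r + 1 \<Longrightarrow> (\<Sum>i = 1..r. real i * real (r + 1 - i) * of_bool (i = j)) = real j * real (r + 1 - j)"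
  by (subst sum_delta_real) auto

text \<open>The coefficients j (r + 1 - j) are those of 2 rho in the simple roots, and 2 rho pairs
  with each simple root to 2.\<close>

lemma height_cartan:
  assumes "i \<in> {1..r}"
  shows "(\<Sum>j = 1..r. real j * real (r + 1 - j) * cartan r i j) = 2"
proof -
  obtain m where m: "i = Suc m" using assms by (cases i) auto
  have "(\<Sum>j = 1..r. real j * real (r + 1 - j) * cartan r i j) =
    2 * (\<Sum>j = 1..r. real j * real (r + 1 - j) * of_bool (j = i))
    - (\<Sum>j = 1..r. real j * real (r + 1 - j) * of_bool (j = m))
    - (\<Sum>j = 1..r. real j * real (r + 1 - j) * of_bool (j = Suc i))"
    unfolding sum_distrib_left sum_subtractf[symmetric]
    by (intro sum.cong refl) (auto simp: cartan_def m)
  also have "\<dots> = 2"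
    using assms sum_height_delta[of i r] sum_height_delta[of m r] sum_height_delta[of "Suc i" r]
    by (simp add: m of_nat_diff algebra_simps)
  finally show ?thesis .
qed

text \<open>A simple module with a highest weight vector whose weight is dual to the end node \<open>1\<close> of the
  Dynkin diagram; \<open>w a j\<close> is the exponent of the eigenvalue of \<open>K j\<close> on the basis vector \<open>a\<close>.\<close>

locale vector_module =
  fixes q :: real and r :: nat and E F :: "nat \<Rightarrow> complex^'n^'n::finite"
    and w :: "'n \<Rightarrow> nat \<Rightarrow> real" and x0 :: "complex^'n"
  assumes q: "0 < q" "q < 1" and r: "1 \<le> r"
    and E_weight: "i \<in> {1..r} \<Longrightarrow> E i $ a $ b \<noteq> 0 \<Longrightarrow> w a = (\<lambda>j. w b j + cartan r i j)"
    and F_weight: "i \<in> {1..r} \<Longrightarrow> F i $ a $ b \<noteq> 0 \<Longrightarrow> w a = (\<lambda>j. w b j - cartan r i j)"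
    and E_F: "i \<in> {1..r} \<Longrightarrow> j \<in> {1..r} \<Longrightarrow> E i *v (F j *v z) = F j *v (E i *v z) +
      (if i = j then (\<chi> a. (qpow q (w a i) - qpow q (- w a i)) / qdiff q * z $ a) else 0)"
    and simple: "vec.subspace W \<Longrightarrow>
      (\<And>i z. i \<in> {1..r} \<Longrightarrow> z \<in> W \<Longrightarrow> E i *v z \<in> W \<and> F i *v z \<in> W) \<Longrightarrow>
      (\<And>\<phi> z. z \<in> W \<Longrightarrow> (\<chi> a. \<phi> (w a) * z $ a) \<in> W) \<Longrightarrow> W = {0} \<or> W = UNIV"
    and x0: "x0 \<noteq> 0" "x0 $ a \<noteq> 0 \<Longrightarrow> w a = (\<lambda>j. of_bool (j = 1))" "i \<in> {1..r} \<Longrightarrow> E i *v x0 = 0"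
begin

text \<open>Arbitrary functions of the weight take the place of the algebra generated by the K i;
  they include the commutators of E i and F i.\<close>

definition diag :: "((nat \<Rightarrow> real) \<Rightarrow> complex) \<Rightarrow> complex^'n \<Rightarrow> complex^'n"
  where "diag \<phi> z = (\<chi> a. \<phi> (w a) * z $ a)"

text \<open>The pairing of a weight with 2 rho. Each F i lowers it by 2, and on x0 it equals
  r.\<close>

definition height :: "'n \<Rightarrow> real"
  where "height a = (\<Sum>j = 1..r. real j * real (r + 1 - j) * w a j)"

lemma E_diag:
  assumes "i \<in> {1..r}"
  shows "E i *v diag \<phi> z = diag (\<lambda>u. \<phi> (\<lambda>j. u j - cartan r i j)) (E i *v z)"
proof -
  have *: "E i $ a $ b * (\<phi> (w b) * z $ b) = \<phi> (\<lambda>j. w a j - cartan r i j) * (E i $ a $ b * z $ b)" for a b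
    by (cases "E i $ a $ b = 0") (simp_all add: E_weight[OF assms])
  have "(\<Sum>b\<in>UNIV. E i $ a $ b * (\<phi> (w b) * z $ b)) =
    \<phi> (\<lambda>j. w a j - cartan r i j) * (\<Sum>b\<in>UNIV. E i $ a $ b * z $ b)" for a
    unfolding sum_distrib_left by (intro sum.cong refl *)
  then show ?thesis by (simp add: vec_eq_iff matrix_vector_mult_def diag_def)
qed

lemma F_height:
  assumes "i \<in> {1..r}" "F i $ a $ b \<noteq> 0" shows "height a = height b - 2"
  unfolding height_def F_weight[OF assms] right_diff_distrib sum_subtractf height_cartan[OF assms(1)] ..

lemma height_x0: assumes "x0 $ a \<noteq> 0" shows "height a = real r"
  unfolding height_def x0(2)[OF assms] by (subst sum_height_delta) (use r in auto)

lemma matrix_vector_nonzero: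
  assumes "(A *v z) $ a \<noteq> 0" obtains b where "A $ a $ b \<noteq> 0" "z $ b \<noteq> (0 :: complex)"
proof -
  have "\<not> (\<forall>b. A $ a $ b * z $ b = 0)"
  proof
    assume "\<forall>b. A $ a $ b * z $ b = 0"
    then have "(A *v z) $ a = 0" unfolding matrix_vector_mult_def by (simp only: vec_lambda_beta sum.neutral_const)
    then show False using assms by simp
  qed
  then show ?thesis using that by auto
qed

text \<open>The submodule generated by y stays below the height r of x0, hence is proper, and
  simplicity makes it zero. It is generated with F i and weights only; the commutation relations
  show that the E i preserve it.\<close>

lemma singular_vector_eq_0:
  assumes E: "\<And>i. i \<in> {1..r} \<Longrightarrow> E i *v y = 0" and low: "\<And>a. y $ a \<noteq> 0 \<Longrightarrow> height a < real r"
  shows "y = 0"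
proof -
  define C where "C = (\<lambda>W. vec.subspace W \<and> (\<forall>i\<in>{1..r}. \<forall>z\<in>W. F i *v z \<in> W) \<and> (\<forall>\<phi>. \<forall>z\<in>W. diag \<phi> z \<in> W))"
  have C_Inter: "C (\<Inter>WW)" if "\<forall>W\<in>WW. C W" for WW
    using that by (auto simp: C_def vec.subspace_def)
  define W where "W = C hull {y}"
  have CW: "C W" unfolding W_def by (rule hull_in) (use C_Inter in blast)
  then have sub: "vec.subspace W" and FW: "\<And>i z. i \<in> {1..r} \<Longrightarrow> z \<in> W \<Longrightarrow> F i *v z \<in> W"
    and DW: "\<And>\<phi> z. z \<in> W \<Longrightarrow> diag \<phi> z \<in> W" by (auto simp: C_def)
  have y: "y \<in> W" unfolding W_def by (rule hull_inc) simp
  \<comment> \<open>The elements that all E i keep inside W satisfy the closure conditions defining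
    W and include y, so they are all of W.\<close>
  have "W \<subseteq> {z \<in> W. \<forall>i\<in>{1..r}. E i *v z \<in> W}" (is "_ \<subseteq> ?W'")
    unfolding W_def
  proof (rule hull_minimal)
    show "C {z \<in> C hull {y}. \<forall>i\<in>{1..r}. E i *v z \<in> C hull {y}}"
      unfolding W_def[symmetric] unfolding C_def
    proof (intro conjI ballI allI)
      show "vec.subspace ?W'" using sub
        by (auto simp: vec.subspace_def matrix_vector_right_distrib vector_scalar_commute)
    next
      fix i z assume i: "i \<in> {1..r}" and z: "z \<in> ?W'"
      show "F i *v z \<in> ?W'"
      proof (intro CollectI conjI ballI)
        show "F i *v z \<in> W" using FW i z by simp
        fix j assume j: "j \<in> {1..r}"
        have "F i *v (E j *v z) \<in> W" using FW i j z by simp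
        moreover have "(if j = i then (\<chi> a. (qpow q (w a j) - qpow q (- w a j)) / qdiff q * z $ a) else 0) \<in> W"
          using DW[of z "\<lambda>u. (qpow q (u j) - qpow q (- u j)) / qdiff q"] z vec.subspace_0[OF sub]
          unfolding diag_def by (cases "j = i") auto
        ultimately show "E j *v (F i *v z) \<in> W" unfolding E_F[OF j i] by (rule vec.subspace_add[OF sub])
      qed
    next
      fix \<phi> z assume z: "z \<in> ?W'"
      show "diag \<phi> z \<in> ?W'"
      proof (intro CollectI conjI ballI)
        show "diag \<phi> z \<in> W" using DW z by simp
        fix j assume j: "j \<in> {1..r}"
        show "E j *v diag \<phi> z \<in> W" unfolding E_diag[OF j] using DW z j by simp
      qed
    qed
    show "{y} \<subseteq> {z \<in> C hull {y}. \<forall>i\<in>{1..r}. E i *v z \<in> C hull {y}}"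
      unfolding W_def[symmetric] using y E vec.subspace_0[OF sub] by simp
  qed
  then have EW: "E i *v z \<in> W" if "i \<in> {1..r}" "z \<in> W" for i z using that by blast
  \<comment> \<open>Vectors supported below height r; the F i only lower the height, so W lies in
    this subspace while x0 does not.\<close>
  define L where "L = {z :: complex^'n. \<forall>a. z $ a \<noteq> 0 \<longrightarrow> height a < real r}"
  have "vec.subspace L"
  proof (rule vec.subspaceI)
    show "x + y \<in> L" if "x \<in> L" "y \<in> L" for x y
      unfolding L_def
    proof (intro CollectI allI impI)
      fix a assume "(x + y) $ a \<noteq> 0"
      then have "x $ a \<noteq> 0 \<or> y $ a \<noteq> 0" by auto
      then show "height a < real r" using that by (auto simp: L_def)
    qed
  qed (auto simp: L_def)
  moreover have "F i *v z \<in> L" if i: "i \<in> {1..r}" and z: "z \<in> L" for i z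
    unfolding L_def
  proof (intro CollectI allI impI)
    fix a assume "(F i *v z) $ a \<noteq> 0"
    then obtain b where b: "F i $ a $ b \<noteq> 0" "z $ b \<noteq> 0" by (rule matrix_vector_nonzero)
    then have "height b < real r" using z by (simp add: L_def)
    then show "height a < real r" using F_height[OF i b(1)] by simp
  qed
  moreover have "diag \<phi> z \<in> L" if "z \<in> L" for \<phi> z using that by (simp add: L_def diag_def)
  ultimately have "C L" by (simp add: C_def)
  then have low_W: "W \<subseteq> L" unfolding W_def by (intro hull_minimal) (use low in \<open>auto simp: L_def\<close>)
  have "W \<noteq> UNIV"
  proof
    assume "W = UNIV"
    moreover obtain a where "x0 $ a \<noteq> 0" using x0(1) by (auto simp: vec_eq_iff)
    ultimately have "x0 \<in> L" "x0 $ a \<noteq> 0" using low_W by auto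
    then show False using height_x0[of a] unfolding L_def by force
  qed
  moreover have "W = {0} \<or> W = UNIV"
    by (rule simple[OF sub]) (use EW FW DW in \<open>simp_all add: diag_def\<close>)
  ultimately show ?thesis using y by simp
qed

text \<open>The vectors F j ... F 1 x0, which turn out to be multiples of the given basis
  vectors.\<close>

primrec x :: "nat \<Rightarrow> complex^'n"
  where "x 0 = x0" | "x (Suc j) = F (Suc j) *v x j"

lemma x_weight: "j \<le> r \<Longrightarrow> x j $ a \<noteq> 0 \<Longrightarrow> w a = (\<lambda>i. if i \<in> {1..r} then of_bool (i = Suc j) - of_bool (i = j) else 0)"
proof (induction j arbitrary: a)
  case 0
  show ?case unfolding x0(2)[OF "0.prems"(2)[unfolded x.simps]] using r by (auto simp: fun_eq_iff)
next
  case (Suc j)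
  have i: "Suc j \<in> {1..r}" using Suc.prems(1) by simp
  from Suc.prems(2) have "(F (Suc j) *v x j) $ a \<noteq> 0" by simp
  then obtain b where b: "F (Suc j) $ a $ b \<noteq> 0" "x j $ b \<noteq> 0" by (rule matrix_vector_nonzero)
  have wb: "w b = (\<lambda>i. if i \<in> {1..r} then of_bool (i = Suc j) - of_bool (i = j) else 0)"
    by (rule Suc.IH) (use Suc.prems(1) b(2) in auto)
  show ?case unfolding F_weight[OF i b(1)] wb
    by (auto simp: fun_eq_iff cartan_def)
qed

lemma F_x_low:
  assumes j: "j \<le> r" and i: "i \<in> {1..r}" and a: "(F i *v x j) $ a \<noteq> 0"
  shows "height a < real r"
proof -
  have le: "height b \<le> real r" if "x j $ b \<noteq> 0" for b
    using j that
  proof (induction j arbitrary: b)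
    case 0
    then show ?case by (simp add: height_x0)
  next
    case (Suc j)
    then have i: "Suc j \<in> {1..r}" by simp
    from Suc.prems(2) have "(F (Suc j) *v x j) $ b \<noteq> 0" by simp
    then obtain b' where b': "F (Suc j) $ b $ b' \<noteq> 0" "x j $ b' \<noteq> 0" by (rule matrix_vector_nonzero)
    then show ?case using F_height[OF i b'(1)] Suc.IH[of b'] Suc.prems(1) by simp
  qed
  obtain b where b: "F i $ a $ b \<noteq> 0" "x j $ b \<noteq> 0" using a by (rule matrix_vector_nonzero)
  show ?thesis using F_height[OF i b(1)] le[OF b(2)] by simp
qed

lemma qdiff_nonzero: "qdiff q \<noteq> 0"
proof -
  have "q powr 1 < q powr (- 1)" using q by (intro powr_less_mono') auto
  then show ?thesis unfolding qdiff_def qpow_def by (simp only: right_minus_eq of_real_eq_iff)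
qed

lemma qnumber: "(qpow q 1 - qpow q (- 1)) / qdiff q = 1" "(qpow q (- 1) - qpow q 1) / qdiff q = - 1"
  using qdiff_nonzero by (simp_all add: qdiff_def divide_eq_eq)

lemma qnumber_x:
  assumes "j \<le> r" "i \<in> {1..r}"
  shows "(\<chi> a. (qpow q (w a i) - qpow q (- w a i)) / qdiff q * x j $ a) =
    (of_bool (i = Suc j) - of_bool (i = j)) *s x j"
proof -
  have "(qpow q (w a i) - qpow q (- w a i)) / qdiff q * x j $ a = (of_bool (i = Suc j) - of_bool (i = j)) * x j $ a" for a
  proof (cases "x j $ a = 0")
    case False
    have wa: "w a i = of_bool (i = Suc j) - of_bool (i = j)"
      using x_weight[OF assms(1) False] assms(2) by simp
    show ?thesis unfolding wa using qnumber by (cases "i = Suc j"; cases "i = j") simp_all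
  qed simp
  then show ?thesis by (simp add: vec_eq_iff)
qed

lemma E_F_x:
  assumes "j \<le> r" "l \<in> {1..r}" "i \<in> {1..r}"
  shows "E l *v (F i *v x j) = F i *v (E l *v x j) + of_bool (l = i) *s ((of_bool (i = Suc j) - of_bool (i = j)) *s x j)"
  unfolding E_F[OF assms(2,3)] using qnumber_x[OF assms(1,3)] by simp

text \<open>Both halves need each other: an F i that does not continue the chain produces a vector
  killed by all E i, hence zero, and the formula for E on the next vector uses that such F i vanish.
  Therefore one induction, with the vanishing kept for all earlier m.\<close>

lemma E_F_chain:
  assumes "j \<le> r"
  shows "(\<forall>i\<in>{1..r}. E i *v x j = (if i = j then x (j - 1) else 0)) \<and>
    (\<forall>m\<le>j. \<forall>i\<in>{1..r}. i \<noteq> Suc m \<longrightarrow> F i *v x m = 0)"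
  using assms
proof (induction j)
  case 0
  have "F i *v x0 = 0" if i: "i \<in> {1..r}" "i \<noteq> 1" for i
  proof (rule singular_vector_eq_0)
    fix l assume l: "l \<in> {1..r}"
    show "E l *v (F i *v x0) = 0" using E_F_x[of 0 l i] l i x0(3)[OF l] by simp
  next
    fix a assume "(F i *v x0) $ a \<noteq> 0"
    then show "height a < real r" using F_x_low[of 0 i a] i by simp
  qed
  then show ?case using x0(3) by simp
next
  case (Suc j)
  then have j: "j \<le> r" "Suc j \<in> {1..r}" and
    IHE: "\<And>i. i \<in> {1..r} \<Longrightarrow> E i *v x j = (if i = j then x (j - 1) else 0)" and
    IHF: "\<And>m i. m \<le> j \<Longrightarrow> i \<in> {1..r} \<Longrightarrow> i \<noteq> Suc m \<Longrightarrow> F i *v x m = 0" by auto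
  have E': "E i *v x (Suc j) = (if i = Suc j then x j else 0)" if i: "i \<in> {1..r}" for i
  proof -
    have "F (Suc j) *v (E i *v x j) = 0"
    proof (cases "i = j")
      case True
      then have "Suc j \<noteq> Suc (j - 1)" using i by auto
      then have "F (Suc j) *v x (j - 1) = 0" by (intro IHF j) auto
      then show ?thesis using IHE[OF i] True by simp
    qed (simp add: IHE[OF i])
    then show ?thesis using E_F_x[OF j(1) i j(2)] by (auto simp: of_bool_def)
  qed
  have F': "F i *v x (Suc j) = 0" if i: "i \<in> {1..r}" "i \<noteq> Suc (Suc j)" for i
  proof (rule singular_vector_eq_0)
    fix l assume l: "l \<in> {1..r}"
    have 1: "E l *v (F i *v x (Suc j)) = (if l = Suc j then F i *v x j else 0)
      + of_bool (l = i) *s ((- of_bool (i = Suc j)) *s x (Suc j))"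
      using E_F_x[OF Suc.prems l i(1)] i(2) unfolding E'[OF l] by (simp del: x.simps)
    show "E l *v (F i *v x (Suc j)) = 0"
    proof (cases "i = Suc j")
      \<comment> \<open>Here F applied to x j gives x (Suc j), and the commutator contributes its
        negative.\<close>
      case True
      then show ?thesis unfolding 1 by (simp add: vector_sneg_minus1[symmetric])
    next
      case False
      then show ?thesis unfolding 1 using IHF[OF order_refl i(1)] by simp
    qed
  next
    fix a assume "(F i *v x (Suc j)) $ a \<noteq> 0"
    then show "height a < real r" by (rule F_x_low[OF Suc.prems i(1)])
  qed
  show ?case using E' F' IHF by (auto simp: le_Suc_eq simp del: x.simps)
qed

lemma E_x: "j \<le> r \<Longrightarrow> i \<in> {1..r} \<Longrightarrow> E i *v x j = (if i = j then x (j - 1) else 0)"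
  using E_F_chain by blast

lemma F_x: "j \<le> r \<Longrightarrow> i \<in> {1..r} \<Longrightarrow> F i *v x j = (if i = Suc j then x (Suc j) else 0)"
  using E_F_chain[of j] by auto

text \<open>The raising operator leads back to the preceding vector, so the chain cannot break off
  before r.\<close>

lemma x_nonzero: "j \<le> r \<Longrightarrow> x j \<noteq> 0"
proof (induction j)
  case (Suc j)
  then have "E (Suc j) *v x (Suc j) \<noteq> 0" using E_x[of "Suc j" "Suc j"] by (simp del: x.simps)
  then show ?case by (auto simp del: x.simps)
qed (simp add: x0)

lemma disjoint_support:
  assumes "i \<le> r" "j \<le> r" "x i $ a \<noteq> 0" "x j $ a \<noteq> 0" shows "i = j"
proof -
  have *: "\<not> i < j" if "i \<le> r" "j \<le> r" "x i $ a \<noteq> 0" "x j $ a \<noteq> 0" for i j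
  proof
    assume "i < j"
    moreover have "w a j = of_bool (j = Suc i) - of_bool (j = i)"
      using x_weight[OF that(1,3)] that(2) \<open>i < j\<close> by simp
    moreover have "w a j = of_bool (j = Suc j) - of_bool (j = j)"
      using x_weight[OF that(2,4)] that(2) \<open>i < j\<close> by simp
    ultimately show False by (simp split: split_of_bool_asm)
  qed
  show ?thesis using *[OF assms] *[OF assms(2,1,4,3)] by simp
qed

text \<open>The span of the chain is stable under all operators and not zero; simplicity does the
  rest.\<close>

lemma span_x: "(\<exists>t. z = (\<Sum>j\<le>r. t j *s x j))"
proof -
  define W where "W = {z. \<exists>t. z = (\<Sum>j\<le>r. t j *s x j)}"
  have sub: "vec.subspace W" unfolding vec.subspace_def
  proof (intro conjI ballI allI)
    show "0 \<in> W" unfolding W_def by (intro CollectI exI[of _ "\<lambda>_. 0"]) simp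
    show "y + z \<in> W" if yz: "y \<in> W" "z \<in> W" for y z
    proof -
      from yz obtain t u where "y = (\<Sum>j\<le>r. t j *s x j)" "z = (\<Sum>j\<le>r. u j *s x j)" by (auto simp: W_def)
      then have "y + z = (\<Sum>j\<le>r. (t j + u j) *s x j)" by (simp add: sum.distrib vector_sadd_rdistrib)
      then show ?thesis unfolding W_def by (intro CollectI exI[of _ "\<lambda>j. t j + u j"])
    qed
    show "c *s z \<in> W" if z: "z \<in> W" for c z
    proof -
      from z obtain t where "z = (\<Sum>j\<le>r. t j *s x j)" by (auto simp: W_def)
      then have "c *s z = (\<Sum>j\<le>r. (c * t j) *s x j)"
        by (simp add: vec.scale_sum_right vector_smult_assoc)
      then show ?thesis unfolding W_def by (intro CollectI exI[of _ "\<lambda>j. c * t j"])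
    qed
  qed
  have x_W: "x j \<in> W" if "j \<le> r" for j
  proof -
    have "x j = (\<Sum>i\<le>r. (if i = j then 1 else 0) *s x i)" using that
      by (simp add: if_distrib[of "\<lambda>c. c *s _"] cong: if_cong)
    then show ?thesis unfolding W_def by (intro CollectI) (rule exI)
  qed
  have closed: "A *v z \<in> W" if A: "\<And>j. j \<le> r \<Longrightarrow> A *v x j \<in> W" and z: "z \<in> W" for A z
  proof -
    from z obtain t where z: "z = (\<Sum>j\<le>r. t j *s x j)" by (auto simp: W_def)
    have "A *v z = (\<Sum>j\<le>r. t j *s (A *v x j))"
      unfolding z vector_scalar_commute[symmetric]
      by (rule vec.linear_sum[OF matrix_vector_mul_linear_gen])
    then show ?thesis using A by (auto intro!: vec.subspace_sum[OF sub] vec.subspace_scale[OF sub])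
  qed
  have "W = {0} \<or> W = UNIV"
  proof (rule simple[OF sub])
    fix i z assume i: "i \<in> {1..r}" and z: "z \<in> W"
    have "E i *v x j \<in> W" if "j \<le> r" for j
      using E_x[OF that i] x_W[of "j - 1"] that vec.subspace_0[OF sub] by auto
    moreover have "F i *v x j \<in> W" if "j \<le> r" for j
      using F_x[OF that i] x_W[of "Suc j"] i vec.subspace_0[OF sub] by (auto simp del: x.simps)
    ultimately show "E i *v z \<in> W \<and> F i *v z \<in> W" using closed z by blast
  next
    fix \<phi> z assume z: "z \<in> W"
    let ?A = "(\<chi> a b. if a = b then \<phi> (w a) else 0) :: complex^'n^'n"
    have A: "?A *v y = (\<chi> a. \<phi> (w a) * y $ a)" for y
      by (simp add: vec_eq_iff matrix_vector_mult_def if_distrib[of "\<lambda>x. x * _"] cong: if_cong)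
    have "?A *v x j \<in> W" if j: "j \<le> r" for j
    proof -
      define u where "u = (\<lambda>i. if i \<in> {1..r} then of_bool (i = Suc j) - of_bool (i = j) else 0 :: real)"
      have "\<phi> (w a) * x j $ a = \<phi> u * x j $ a" for a
        using x_weight[OF j, of a] by (cases "x j $ a = 0") (simp_all add: u_def)
      then have "?A *v x j = \<phi> u *s x j" unfolding A by (simp add: vec_eq_iff)
      then show ?thesis using vec.subspace_scale[OF sub x_W[OF j]] by simp
    qed
    from closed[OF this z] show "(\<chi> a. \<phi> (w a) * z $ a) \<in> W" unfolding A .
  qed
  then have "W = UNIV" using x_W[of 0] x_nonzero[of 0] by auto
  then show ?thesis unfolding W_def by blast
qed

text \<open>The basis vector a is a combination of the chain, of which only \<open>x j\<close>
  reaches the coordinates a and b. It would therefore be nonzero at both of them.\<close>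

lemma support_singleton:
  assumes "j \<le> r" "x j $ a \<noteq> 0" "x j $ b \<noteq> 0" shows "a = b"
proof (rule ccontr)
  assume ab: "a \<noteq> b"
  obtain t where t: "axis a 1 = (\<Sum>i\<le>r. t i *s x i)" using span_x by blast
  have *: "(axis a 1 :: complex^'n) $ y = t j * x j $ y" if "x j $ y \<noteq> 0" for y
  proof -
    have "(axis a 1 :: complex^'n) $ y = (\<Sum>i\<le>r. t i * x i $ y)" unfolding t by simp
    also have "\<dots> = (\<Sum>i\<le>r. if i = j then t j * x j $ y else 0)"
      by (intro sum.cong refl) (use disjoint_support[OF _ assms(1) _ that] in auto)
    finally show ?thesis using assms(1) by simp
  qed
  show False using *[OF assms(2)] *[OF assms(3)] ab assms(3) by (simp add: axis_def)
qed

lemma support_exists: "\<exists>j\<le>r. x j $ a \<noteq> 0"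
proof (rule ccontr)
  assume *: "\<not> (\<exists>j\<le>r. x j $ a \<noteq> 0)"
  obtain t where t: "axis a 1 = (\<Sum>i\<le>r. t i *s x i)" using span_x by blast
  have "(axis a 1 :: complex^'n) $ a = (\<Sum>i\<le>r. t i * x i $ a)" unfolding t by simp
  also have "\<dots> = 0" using * by (intro sum.neutral) auto
  finally show False by (simp add: axis_def)
qed

theorem chain_basis:
  obtains k c where "bij_betw k UNIV {..r}"
    and "\<And>i. i \<in> {1..r} \<Longrightarrow> c i \<noteq> 0"
    and "\<And>i a b. i \<in> {1..r} \<Longrightarrow> E i $ a $ b = (if k b = i \<and> Suc (k a) = i then inverse (c i) else 0)"
    and "\<And>i a b. i \<in> {1..r} \<Longrightarrow> F i $ a $ b = (if k a = i \<and> Suc (k b) = i then c i else 0)"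
    and "\<And>i a. i \<in> {1..r} \<Longrightarrow> w a i = of_bool (i = Suc (k a)) - of_bool (i = k a)"
proof -
  \<comment> \<open>The rank of a basis vector is the index of the chain vector that does not vanish
    there.\<close>
  obtain k where k: "\<And>a. k a \<le> r \<and> x (k a) $ a \<noteq> 0" using support_exists by metis
  have k_iff: "x j $ a \<noteq> 0 \<longleftrightarrow> k a = j" if "j \<le> r" for j a
    using k[of a] disjoint_support[OF that, of "k a" a] that by auto
  have "\<exists>e. x j $ e \<noteq> 0" if "j \<le> r" for j using x_nonzero[OF that] by (auto simp: vec_eq_iff)
  then obtain e where e: "\<And>j. j \<le> r \<Longrightarrow> x j $ e j \<noteq> 0" by metis
  have ke: "k (e j) = j" if "j \<le> r" for j using k_iff[OF that] e[OF that] by blast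
  have ek: "e (k a) = a" for a using support_singleton[of "k a" "e (k a)" a] e[of "k a"] k[of a] by blast
  define y where "y j = x j $ e j" for j
  have y: "y j \<noteq> 0" if "j \<le> r" for j using e[OF that] by (simp add: y_def)
  have x: "x j $ a = (if k a = j then y j else 0)" if "j \<le> r" for j a
    using k_iff[OF that, of a] ek[of a] by (auto simp: y_def)
  have axis: "axis b 1 = inverse (y (k b)) *s x (k b)" for b
  proof -
    have "k a = k b \<longleftrightarrow> a = b" for a using ek by metis
    then show ?thesis using k[of b] y[of "k b"] by (auto simp: vec_eq_iff axis_def x)
  qed
  have entry: "A $ a $ b = inverse (y (k b)) * (A *v x (k b)) $ a" for A :: "complex^'n^'n" and a b
  proof -
    have "A $ a $ b = (A *v axis b 1) $ a" by (rule matrix_vector_axis[symmetric])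
    also have "\<dots> = inverse (y (k b)) * (A *v x (k b)) $ a"
      unfolding axis vector_scalar_commute by simp
    finally show ?thesis .
  qed
  show ?thesis
  \<comment> \<open>As \<open>x j\<close> is \<open>y j\<close> times a basis vector, the
    coefficient of F i between consecutive basis vectors is the quotient of consecutive y.\<close>
  proof (rule that[of k "\<lambda>i. y i / y (i - 1)"])
    show "bij_betw k UNIV {..r}"
      by (rule bij_betw_byWitness[of _ e]) (use k ke ek in auto)
    fix i assume i: "i \<in> {1..r}"
    then have i1: "i - 1 \<le> r" "i \<le> r" "Suc (i - 1) = i" by auto
    show "y i / y (i - 1) \<noteq> 0" using y i1 by simp
    fix a b
    have ka: "k a \<le> r" "k b \<le> r" using k by auto
    show "E i $ a $ b = (if k b = i \<and> Suc (k a) = i then inverse (y i / y (i - 1)) else 0)"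
      unfolding entry[of "E i"] E_x[OF ka(2) i] using i1 by (auto simp: x field_simps)
    show "F i $ a $ b = (if k a = i \<and> Suc (k b) = i then y i / y (i - 1) else 0)"
      unfolding entry[of "F i"] F_x[OF ka(2) i] using i1 by (auto simp: x field_simps simp del: x.simps)
  next
    fix i a assume i: "i \<in> {1..r}"
    show "w a i = of_bool (i = Suc (k a)) - of_bool (i = k a)"
      using x_weight[of "k a" a] k[of a] i by simp
  qed
qed

end

section \<open>Weights\<close>

text \<open>The nodes of the diagram counted from the end s, so that both choices of s are treated
  alike.\<close>

definition node :: "nat \<Rightarrow> nat \<Rightarrow> nat \<Rightarrow> nat"
  where "node r s i = (if s = 1 then i else r + 1 - i)"

lemma bij_betw_node: "bij_betw (node r s) {1..r} {1..r}"
  by (rule bij_betw_byWitness[of _ "node r s"]) (auto simp: node_def)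

lemma node_in: "i \<in> {1..r} \<Longrightarrow> node r s i \<in> {1..r}"
  by (auto simp: node_def)

lemma node_eq_iff: "1 \<le> r \<Longrightarrow> s = 1 \<or> s = r \<Longrightarrow> i \<in> {1..r} \<Longrightarrow> node r s i = s \<longleftrightarrow> i = 1"
  by (auto simp: node_def)

lemma weight_form_simple_root:
  assumes "i \<in> {1..r}" shows "weight_form r (simple_root i) \<mu> = \<mu> i - \<mu> (Suc i)"
proof -
  have "weight_form r (simple_root i) \<mu> =
    (\<Sum>k = 1..r + 1. \<mu> k * of_bool (k = i)) - (\<Sum>k = 1..r + 1. \<mu> k * of_bool (k = Suc i))"
    unfolding weight_form_def simple_root_def sum_subtractf[symmetric]
    by (intro sum.cong refl) (simp add: algebra_simps)
  then show ?thesis using assms by (simp add: sum_delta_real)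
qed

lemma simple_root_cartan:
  assumes "i \<in> {1..r}" "j \<in> {1..r}"
  shows "weight_form r (simple_root (node r s j)) (simple_root (node r s i)) = cartan r i j"
proof -
  have "(node r s i = node r s j) = (i = j)" using assms by (auto simp: node_def)
  moreover have "weight_form r (simple_root (node r s j)) (simple_root (node r s i)) =
      2 * of_bool (node r s i = node r s j) - of_bool (node r s j = Suc (node r s i)) - of_bool (node r s i = Suc (node r s j))"
    unfolding weight_form_simple_root[OF node_in[OF assms(2)]] by (auto simp: simple_root_def)
  moreover have "(node r s j = Suc (node r s i)) = (if s = 1 then j = Suc i else i = Suc j)"
    "(node r s i = Suc (node r s j)) = (if s = 1 then i = Suc j else j = Suc i)"
    using assms by (auto simp: node_def)
  ultimately show ?thesis using assms(2) by (simp add: cartan_def)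
qed

text \<open>The index k is the smaller one in r + 1 - k positive roots and the larger one in k - 1
  of them.\<close>

lemma two_rho_eq:
  assumes "k \<in> {1..r + 1}" shows "two_rho r k = real r + 2 - 2 * real k"
proof -
  let ?A = "{(i, j). 1 \<le> i \<and> i < j \<and> j \<le> r + 1}"
  have fin: "finite ?A" by (rule finite_subset[of _ "{..r + 1} \<times> {..r + 1}"]) auto
  have "two_rho r k = real (card {x \<in> ?A. k = fst x}) - real (card {x \<in> ?A. k = snd x})"
  proof -
    have "two_rho r k = (\<Sum>x\<in>?A. of_bool (k = fst x)) - (\<Sum>x\<in>?A. of_bool (k = snd x))"
      unfolding two_rho_def sum_subtractf[symmetric] by (intro sum.cong) auto
    also have "(\<Sum>x\<in>?A. of_bool (k = fst x)) = real (card {x \<in> ?A. k = fst x})"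
      using fin by (simp add: sum.If_cases of_bool_def Int_def)
    also have "(\<Sum>x\<in>?A. of_bool (k = snd x)) = real (card {x \<in> ?A. k = snd x})"
      using fin by (simp add: sum.If_cases of_bool_def Int_def)
    finally show ?thesis .
  qed
  moreover have "{x \<in> ?A. k = fst x} = {k} \<times> {k<..r + 1}" using assms by auto
  moreover have "{x \<in> ?A. k = snd x} = {1..<k} \<times> {k}" using assms by auto
  ultimately show ?thesis using assms by (simp add: card_cartesian_product of_nat_diff)
qed

text \<open>Summation by parts: r + 2 - 2k is the difference of k (r + 1 - k) and its
  predecessor.\<close>

lemma two_rho_height:
  "weight_form r (two_rho r) \<mu> = (\<Sum>i = 1..r. real i * real (r + 1 - i) * weight_form r (simple_root i) \<mu>)"
proof -
  have "weight_form r (two_rho r) \<mu> = (\<Sum>k = 1..r + 1. (real k * real (r + 1 - k) - real (k - 1) * real (r + 2 - k)) * \<mu> k)"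
    unfolding weight_form_def
  proof (intro sum.cong refl)
    fix k assume k: "k \<in> {1..r + 1}"
    then have "real (r + 1 - k) = real r + 1 - real k" "real (r + 2 - k) = real r + 2 - real k" "real (k - 1) = real k - 1"
      by (auto simp: of_nat_diff)
    then show "two_rho r k * \<mu> k = (real k * real (r + 1 - k) - real (k - 1) * real (r + 2 - k)) * \<mu> k"
      unfolding two_rho_eq[OF k] by (simp add: algebra_simps)
  qed
  also have "\<dots> = (\<Sum>k = 1..r + 1. real k * real (r + 1 - k) * \<mu> k) - (\<Sum>k = 1..r + 1. real (k - 1) * real (r + 2 - k) * \<mu> k)"
    by (simp add: left_diff_distrib sum_subtractf)
  also have "(\<Sum>k = 1..r + 1. real k * real (r + 1 - k) * \<mu> k) = (\<Sum>k = 1..r. real k * real (r + 1 - k) * \<mu> k)"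
    by simp
  also have "(\<Sum>k = 1..r + 1. real (k - 1) * real (r + 2 - k) * \<mu> k) = (\<Sum>k = 0..r. real k * real (r + 1 - k) * \<mu> (Suc k))"
    using sum.shift_bounds_cl_Suc_ivl[of "\<lambda>k. real (k - 1) * real (r + 2 - k) * \<mu> k" 0 r] by simp
  also have "\<dots> = (\<Sum>k = 1..r. real k * real (r + 1 - k) * \<mu> (Suc k))"
    by (simp add: sum.atLeast_Suc_atMost)
  finally show ?thesis
    by (simp add: sum_subtractf[symmetric] right_diff_distrib weight_form_simple_root del: sum.cl_ivl_Suc)
qed

text \<open>The coefficients of 2 rho are symmetric under reversal of the diagram.\<close>

lemma two_rho_node:
  "weight_form r (two_rho r) \<mu> = (\<Sum>i = 1..r. real i * real (r + 1 - i) * weight_form r (simple_root (node r s i)) \<mu>)"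
proof -
  have "(\<Sum>i = 1..r. real i * real (r + 1 - i) * weight_form r (simple_root (node r s i)) \<mu>) =
    (\<Sum>i = 1..r. real (node r s i) * real (r + 1 - node r s i) * weight_form r (simple_root (node r s i)) \<mu>)"
  proof (rule sum.cong[OF refl])
    fix i assume "i \<in> {1..r}"
    then have "real i * real (r + 1 - i) = real (node r s i) * real (r + 1 - node r s i)"
      by (cases "s = 1") (simp_all add: node_def)
    then show "real i * real (r + 1 - i) * weight_form r (simple_root (node r s i)) \<mu> =
      real (node r s i) * real (r + 1 - node r s i) * weight_form r (simple_root (node r s i)) \<mu>"
      by (rule arg_cong)
  qed
  then show ?thesis unfolding two_rho_height
    using sum.reindex_bij_betw[OF bij_betw_node[of r s], of "\<lambda>i. real i * real (r + 1 - i) * weight_form r (simple_root i) \<mu>"]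
    by linarith
qed

context
  fixes r s :: nat
  assumes r: "1 \<le> r" and s: "s = 1 \<or> s = r"
begin

lemma fund_weight_first:
  assumes "s = 1" "k \<in> {1..r + 1}" shows "fund_weight r s k = of_bool (k = 1) - 1 / (real r + 1)"
  using assms by (cases "k = 1") (simp_all add: fund_weight_def add.commute)

text \<open>Up to sign and reversal of the coordinates this is the first fundamental weight, so the
  same few inner products serve both ends.\<close>

lemma fund_weight_last:
  assumes "s \<noteq> 1" "k \<in> {1..r + 1}" shows "fund_weight r s k = - (of_bool (k = r + 1) - 1 / (real r + 1))"
proof -
  have "real r / (1 + real r) = 1 - 1 / (1 + real r)" by (simp add: divide_simps)
  then show ?thesis using assms s by (cases "k = r + 1") (simp_all add: fund_weight_def add.commute)
qed

lemma w0_fund_weight_first: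
  assumes "s = 1" "k \<in> {1..r + 1}" shows "w0 r (fund_weight r s) k = of_bool (k = r + 1) - 1 / (real r + 1)"
proof -
  have k: "r + 2 - k \<in> {1..r + 1}" "(r + 2 - k = 1) = (k = r + 1)" using assms by auto
  have "w0 r (fund_weight r s) k = fund_weight r s (r + 2 - k)" using assms by (simp add: w0_def)
  then show ?thesis unfolding fund_weight_first[OF assms(1) k(1)] k(2) .
qed

lemma w0_fund_weight_last:
  assumes "s \<noteq> 1" "k \<in> {1..r + 1}" shows "w0 r (fund_weight r s) k = - (of_bool (k = 1) - 1 / (real r + 1))"
proof -
  have k: "r + 2 - k \<in> {1..r + 1}" "(r + 2 - k = r + 1) = (k = 1)" using assms by auto
  have "w0 r (fund_weight r s) k = fund_weight r s (r + 2 - k)" using assms by (simp add: w0_def)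
  then show ?thesis unfolding fund_weight_last[OF assms(1) k(1)] k(2) .
qed

lemma weight_form_cong:
  "(\<And>k. k \<in> {1..r + 1} \<Longrightarrow> \<mu> k = \<mu>' k) \<Longrightarrow> (\<And>k. k \<in> {1..r + 1} \<Longrightarrow> \<nu> k = \<nu>' k) \<Longrightarrow>
    weight_form r \<mu> \<nu> = weight_form r \<mu>' \<nu>'"
  unfolding weight_form_def by (intro sum.cong) auto

lemma weight_form_uminus:
  "weight_form r (\<lambda>k. - \<mu> k) \<nu> = - weight_form r \<mu> \<nu>" "weight_form r \<mu> (\<lambda>k. - \<nu> k) = - weight_form r \<mu> \<nu>"
  by (simp_all add: weight_form_def sum_negf)

lemma weight_form_affine:
  assumes "i \<in> {1..r + 1}" "j \<in> {1..r + 1}"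
  shows "weight_form r (\<lambda>k. of_bool (k = i) - t) (\<lambda>k. of_bool (k = j) - t) =
    of_bool (i = j) - 2 * t + (real r + 1) * t\<^sup>2"
proof -
  have "weight_form r (\<lambda>k. of_bool (k = i) - t) (\<lambda>k. of_bool (k = j) - t) =
    (\<Sum>k = 1..r + 1. of_bool (k = j) * of_bool (k = i)) - (\<Sum>k = 1..r + 1. t * of_bool (k = i))
    - (\<Sum>k = 1..r + 1. t * of_bool (k = j)) + (\<Sum>k = 1..r + 1. t\<^sup>2)"
    unfolding weight_form_def sum_subtractf[symmetric] sum.distrib[symmetric]
    by (intro sum.cong refl) (simp add: algebra_simps power2_eq_square)
  moreover have "(\<Sum>k = 1..r + 1. of_bool (k = j) * of_bool (k = i)) = (of_bool (i = j) :: real)"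
    using assms by (subst sum_delta_real) auto
  moreover have "(\<Sum>k = 1..r + 1. t * of_bool (k = i)) = t" "(\<Sum>k = 1..r + 1. t * of_bool (k = j)) = t"
    using assms by (subst sum_delta_real; simp)+
  ultimately show ?thesis by simp
qed

lemma weight_form_ends:
  defines "t \<equiv> 1 / (real r + 1)"
  shows "weight_form r (\<lambda>k. of_bool (k = 1) - t) (\<lambda>k. of_bool (k = r + 1) - t) = - t"
    "weight_form r (\<lambda>k. of_bool (k = r + 1) - t) (\<lambda>k. of_bool (k = 1) - t) = - t"
    "weight_form r (\<lambda>k. of_bool (k = 1) - t) (\<lambda>k. of_bool (k = 1) - t) = 1 - t"
    "weight_form r (\<lambda>k. of_bool (k = r + 1) - t) (\<lambda>k. of_bool (k = r + 1) - t) = 1 - t"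
proof -
  have "(real r + 1) * t\<^sup>2 = t" by (simp add: t_def power2_eq_square)
  then show "weight_form r (\<lambda>k. of_bool (k = 1) - t) (\<lambda>k. of_bool (k = r + 1) - t) = - t"
    "weight_form r (\<lambda>k. of_bool (k = r + 1) - t) (\<lambda>k. of_bool (k = 1) - t) = - t"
    "weight_form r (\<lambda>k. of_bool (k = 1) - t) (\<lambda>k. of_bool (k = 1) - t) = 1 - t"
    "weight_form r (\<lambda>k. of_bool (k = r + 1) - t) (\<lambda>k. of_bool (k = r + 1) - t) = 1 - t"
    using r by (subst weight_form_affine; simp)+
qed

lemma ww_eq: "ww r s = 1 - 1 / (real r + 1)"
proof (cases "s = 1")
  case True
  show ?thesis unfolding ww_def weight_form_ends(3)[symmetric]
    by (intro weight_form_cong fund_weight_first True)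
next
  case False
  then have "ww r s = weight_form r (\<lambda>k. - (of_bool (k = r + 1) - 1 / (real r + 1))) (\<lambda>k. - (of_bool (k = r + 1) - 1 / (real r + 1)))"
    unfolding ww_def by (intro weight_form_cong fund_weight_last)
  then show ?thesis unfolding weight_form_uminus weight_form_ends(4) by simp
qed

lemma weight_form_fund_w0: "weight_form r (fund_weight r s) (w0 r (fund_weight r s)) = - 1 / (real r + 1)"
proof (cases "s = 1")
  case True
  then have "weight_form r (fund_weight r s) (w0 r (fund_weight r s)) =
      weight_form r (\<lambda>k. of_bool (k = 1) - 1 / (real r + 1)) (\<lambda>k. of_bool (k = r + 1) - 1 / (real r + 1))"
    by (intro weight_form_cong fund_weight_first w0_fund_weight_first)
  then show ?thesis unfolding weight_form_ends(1) by simp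
next
  case False
  then have "weight_form r (fund_weight r s) (w0 r (fund_weight r s)) =
      weight_form r (\<lambda>k. - (of_bool (k = r + 1) - 1 / (real r + 1))) (\<lambda>k. - (of_bool (k = 1) - 1 / (real r + 1)))"
    by (intro weight_form_cong fund_weight_last w0_fund_weight_last)
  then show ?thesis unfolding weight_form_uminus weight_form_ends(2) by simp
qed

lemma w0_dual_weight: "k \<in> {1..r + 1} \<Longrightarrow> w0 r (dual_weight r \<mu>) k = - \<mu> k"
  by (auto simp: w0_def dual_weight_def)

lemma weight_form_fund_w0_dual:
  "weight_form r (fund_weight r s) (w0 r (dual_weight r (fund_weight r s))) = - ww r s"
  unfolding ww_def weight_form_uminus(2)[symmetric]
  by (rule weight_form_cong[OF refl w0_dual_weight])

lemma weight_form_dual_w0_dual: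
  "weight_form r (dual_weight r (fund_weight r s)) (w0 r (dual_weight r (fund_weight r s))) = - 1 / (real r + 1)"
proof -
  have "weight_form r (dual_weight r (fund_weight r s)) (w0 r (dual_weight r (fund_weight r s))) =
      weight_form r (\<lambda>k. - w0 r (fund_weight r s) k) (\<lambda>k. - fund_weight r s k)"
    by (rule weight_form_cong[OF _ w0_dual_weight]) (simp add: dual_weight_def)
  also have "\<dots> = weight_form r (fund_weight r s) (w0 r (fund_weight r s))"
    unfolding weight_form_uminus by (simp add: weight_form_def mult.commute)
  finally show ?thesis unfolding weight_form_fund_w0 .
qed

lemma simple_root_fund:
  assumes "i \<in> {1..r}"
  shows "weight_form r (simple_root i) (fund_weight r s) = of_bool (i = s)"
    and "weight_form r (simple_root i) (w0 r (fund_weight r s)) = - of_bool (r + 1 - i = s)"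
proof -
  have i: "i \<in> {1..r + 1}" "Suc i \<in> {1..r + 1}" using assms by auto
  show "weight_form r (simple_root i) (fund_weight r s) = of_bool (i = s)"
  proof (cases "s = 1")
    case True
    then show ?thesis using assms
      unfolding weight_form_simple_root[OF assms] fund_weight_first[OF True i(1)] fund_weight_first[OF True i(2)] by simp
  next
    case False
    then show ?thesis using assms s
      unfolding weight_form_simple_root[OF assms] fund_weight_last[OF False i(1)] fund_weight_last[OF False i(2)] by simp
  qed
  show "weight_form r (simple_root i) (w0 r (fund_weight r s)) = - of_bool (r + 1 - i = s)"
  proof (cases "s = 1")
    case True
    have "(r + 1 - i = 1) = (i = r)" using assms by auto
    then show ?thesis using assms True
      unfolding weight_form_simple_root[OF assms] w0_fund_weight_first[OF True i(1)] w0_fund_weight_first[OF True i(2)] by simp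
  next
    case False
    have "(r + 1 - i = r) = (i = 1)" using assms by auto
    then show ?thesis using assms s False
      unfolding weight_form_simple_root[OF assms] w0_fund_weight_last[OF False i(1)] w0_fund_weight_last[OF False i(2)] by auto
  qed
qed

lemma simple_root_dual:
  assumes "i \<in> {1..r}"
  shows "weight_form r (simple_root i) (dual_weight r (fund_weight r s)) = of_bool (r + 1 - i = s)"
    and "weight_form r (simple_root i) (w0 r (dual_weight r (fund_weight r s))) = - of_bool (i = s)"
proof -
  have i: "i \<in> {1..r + 1}" "Suc i \<in> {1..r + 1}" using assms by auto
  show "weight_form r (simple_root i) (dual_weight r (fund_weight r s)) = of_bool (r + 1 - i = s)"
    using simple_root_fund(2)[OF assms] by (simp add: weight_form_uminus dual_weight_def)
  show "weight_form r (simple_root i) (w0 r (dual_weight r (fund_weight r s))) = - of_bool (i = s)"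
    using simple_root_fund(1)[OF assms] by (simp add: weight_form_simple_root[OF assms] w0_dual_weight[OF i(1)] w0_dual_weight[OF i(2)])
qed

lemma wr_eq: "wr r s = real r"
proof -
  have "wr r s = weight_form r (two_rho r) (fund_weight r s)"
    by (simp add: wr_def weight_form_def mult.commute)
  also have "\<dots> = (\<Sum>i = 1..r. real i * real (r + 1 - i) * of_bool (i = s))"
    unfolding two_rho_height by (intro sum.cong refl) (simp add: simple_root_fund)
  also have "\<dots> = real r" using r s by (subst sum_height_delta) auto
  finally show ?thesis .
qed

end

text \<open>Since q is not 1, weights can be recovered from the eigenvalues of the K i.\<close>

lemma qpow_eq_iff:
  assumes "0 < q" "q < 1" shows "qpow q x = qpow q y \<longleftrightarrow> x = y"
  using assms unfolding qpow_def of_real_eq_iff by (simp add: powr_inj)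

lemma mat_mult_entry: "(mat x ** A) $ a $ b = (x :: complex) * A $ a $ b"
  by (simp add: mat_def matrix_matrix_mult_def if_distrib[of "\<lambda>x. x * _"] cong: if_cong)

section \<open>From the hypotheses on V to the explicit braidings\<close>

context
  fixes r s :: nat and q :: real and V :: "'n::finite uq_module" and wt :: "'n \<Rightarrow> weight"
  assumes r: "1 \<le> r" and s: "s = 1 \<or> s = r" and q: "0 < q" "q < 1"
    and V: "is_simple_hw_module r q (fund_weight r s) V" and wt: "is_weight_basis r q V wt"
begin

lemma K_weight_basis:
  assumes "i \<in> {1..r}"
  shows "Kop V i = (\<chi> a b. if a = b then qpow q (weight_form r (simple_root i) (wt a)) else 0)"
proof -
  have "Kop V i $ a $ b = (if a = b then qpow q (weight_form r (simple_root i) (wt a)) else 0)" for a b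
  proof -
    have "Kop V i *v axis b 1 = qpow q (weight_form r (simple_root i) (wt b)) *s axis b 1"
      using wt assms by (simp add: is_weight_basis_def has_weight_def)
    from arg_cong[OF this, of "\<lambda>z. z $ a"] show ?thesis
      unfolding matrix_vector_axis by (auto simp: axis_def)
  qed
  then show ?thesis by (simp add: vec_eq_iff)
qed

lemma K_inv_weight_basis:
  assumes "i \<in> {1..r}"
  shows "matrix_inv (Kop V i) = (\<chi> a b. if a = b then qpow q (- weight_form r (simple_root i) (wt a)) else 0)"
proof (rule matrix_inv_eqI)
  show "Kop V i ** (\<chi> a b. if a = b then qpow q (- weight_form r (simple_root i) (wt a)) else 0) = mat 1"
    unfolding vec_eq_iff matrix_mult_diagonal K_weight_basis[OF assms]
    by (simp add: mat_def qpow_add[OF q(1), symmetric] q)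
qed

definition node_weight :: "'n \<Rightarrow> nat \<Rightarrow> real"
  where "node_weight a j = (if j \<in> {1..r} then weight_form r (simple_root (node r s j)) (wt a) else 0)"

lemma uq_relations:
  assumes "i \<in> {1..r}" "j \<in> {1..r}"
  shows "invertible (Kop V i)"
    and "Kop V i ** Eop V j ** matrix_inv (Kop V i)
        = mat (qpow q (weight_form r (simple_root i) (simple_root j))) ** Eop V j"
    and "Kop V i ** Fop V j ** matrix_inv (Kop V i)
        = mat (qpow q (- weight_form r (simple_root i) (simple_root j))) ** Fop V j"
    and "Eop V i ** Fop V j - Fop V j ** Eop V i
        = (if i = j then mat (1 / (qpow q 1 - qpow q (-1))) ** (Kop V i - matrix_inv (Kop V i)) else 0)"
proof -
  have "is_uq_module r q V" using V by (simp add: is_simple_hw_module_def)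
  then show "invertible (Kop V i)"
    and "Kop V i ** Eop V j ** matrix_inv (Kop V i)
        = mat (qpow q (weight_form r (simple_root i) (simple_root j))) ** Eop V j"
    and "Kop V i ** Fop V j ** matrix_inv (Kop V i)
        = mat (qpow q (- weight_form r (simple_root i) (simple_root j))) ** Fop V j"
    and "Eop V i ** Fop V j - Fop V j ** Eop V i
        = (if i = j then mat (1 / (qpow q 1 - qpow q (-1))) ** (Kop V i - matrix_inv (Kop V i)) else 0)"
    unfolding is_uq_module_def using assms by blast+
qed

text \<open>K is diagonal, so conjugation by it multiplies an entry by q to the difference of two
  weights; t is 1 for raising and -1 for lowering operators.\<close>

lemma weight_shift:
  assumes i: "i \<in> {1..r}" and rel: "\<And>j. j \<in> {1..r} \<Longrightarrow>
      Kop V (node r s j) ** A ** matrix_inv (Kop V (node r s j)) = mat (qpow q (t * cartan r i j)) ** A"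
    and nz: "A $ a $ b \<noteq> 0"
  shows "node_weight a = (\<lambda>j. node_weight b j + t * cartan r i j)"
proof
  fix j
  show "node_weight a j = node_weight b j + t * cartan r i j"
  proof (cases "j \<in> {1..r}")
    case True
    note nj = node_in[OF True, of s]
    let ?K = "Kop V (node r s j)"
    have "qpow q (node_weight a j) * A $ a $ b * qpow q (- node_weight b j) = (?K ** A ** matrix_inv ?K) $ a $ b"
      unfolding K_inv_weight_basis[OF nj] matrix_mult_diagonal unfolding K_weight_basis[OF nj] diagonal_matrix_mult
      using True by (simp add: node_weight_def)
    also have "\<dots> = qpow q (t * cartan r i j) * A $ a $ b" unfolding rel[OF True] mat_mult_entry ..
    finally have "A $ a $ b * (qpow q (node_weight a j) * qpow q (- node_weight b j)) = A $ a $ b * qpow q (t * cartan r i j)"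
      by (simp add: mult_ac)
    then have "qpow q (node_weight a j + - node_weight b j) = qpow q (t * cartan r i j)"
      unfolding qpow_add[OF q(1)] using nz by simp
    then show ?thesis unfolding qpow_eq_iff[OF q] by simp
  next
    case False
    then have "node_weight a j = 0" "node_weight b j = 0" "cartan r i j = 0" by (auto simp: node_weight_def cartan_def)
    then show ?thesis by simp
  qed
qed

lemma node_surj: "i \<in> {1..r} \<Longrightarrow> \<exists>j\<in>{1..r}. i = node r s j"
  using bij_betw_imp_surj_on[OF bij_betw_node[of r s]] by blast

lemma vector_module_exists:
  "\<exists>x. vector_module q r (\<lambda>i. Eop V (node r s i)) (\<lambda>i. Fop V (node r s i)) node_weight x"
proof -
  obtain x where x: "highest_weight_vector r q V (fund_weight r s) x"
    using V by (auto simp: is_simple_hw_module_def)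
  have "vector_module q r (\<lambda>i. Eop V (node r s i)) (\<lambda>i. Fop V (node r s i)) node_weight x"
  proof
    show "0 < q" "q < 1" "1 \<le> r" using q r by auto
    show "x \<noteq> 0" using x by (simp add: highest_weight_vector_def)
    show "Eop V (node r s i) *v x = 0" if "i \<in> {1..r}" for i
      using x node_in[OF that] by (simp add: highest_weight_vector_def)
    show "node_weight a = (\<lambda>j. of_bool (j = 1))" if "x $ a \<noteq> 0" for a
    proof
      fix j
      show "node_weight a j = of_bool (j = 1)"
      proof (cases "j \<in> {1..r}")
        case True
        note nj = node_in[OF True, of s]
        have "Kop V (node r s j) *v x = qpow q (weight_form r (simple_root (node r s j)) (fund_weight r s)) *s x"
          using x nj by (simp add: highest_weight_vector_def has_weight_def)
        moreover have "(Kop V (node r s j) *v x) $ a = qpow q (node_weight a j) * x $ a"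
          unfolding K_weight_basis[OF nj] matrix_vector_mult_def using True
          by (simp add: if_distrib[of "\<lambda>x. x * _"] node_weight_def cong: if_cong)
        ultimately have "qpow q (node_weight a j) = qpow q (weight_form r (simple_root (node r s j)) (fund_weight r s))"
          using that by simp
        then show ?thesis unfolding qpow_eq_iff[OF q] simple_root_fund(1)[OF r s nj] node_eq_iff[OF r s True] .
      next
        case False
        then show ?thesis using r by (auto simp: node_weight_def)
      qed
    qed
    fix i assume i: "i \<in> {1..r}"
    note ni = node_in[OF i, of s]
    show "node_weight a = (\<lambda>j. node_weight b j + cartan r i j)" if "Eop V (node r s i) $ a $ b \<noteq> 0" for a b
      using weight_shift[OF i _ that, of 1] uq_relations(2)[OF node_in ni] simple_root_cartan[OF i] by simp
    show "node_weight a = (\<lambda>j. node_weight b j - cartan r i j)" if "Fop V (node r s i) $ a $ b \<noteq> 0" for a b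
      using weight_shift[OF i _ that, of "- 1"] uq_relations(3)[OF node_in ni] simple_root_cartan[OF i] by simp
    fix j z assume j: "j \<in> {1..r}"
    note nj = node_in[OF j, of s]
    have inj: "node r s i = node r s j \<longleftrightarrow> i = j"
      using bij_betw_imp_inj_on[OF bij_betw_node[of r s]] i j by (rule inj_on_eq_iff)
    have EF: "Eop V (node r s i) ** Fop V (node r s j) =
      (if i = j then mat (1 / (qpow q 1 - qpow q (-1))) ** (Kop V (node r s i) - matrix_inv (Kop V (node r s i))) else 0)
      + Fop V (node r s j) ** Eop V (node r s i)"
      using uq_relations(4)[OF ni nj] unfolding inj diff_eq_eq .
    have "(mat (1 / (qpow q 1 - qpow q (-1))) ** (Kop V (node r s i) - matrix_inv (Kop V (node r s i)))) *v z =
      (\<chi> a. (qpow q (node_weight a i) - qpow q (- node_weight a i)) / qdiff q * z $ a)"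
    proof -
      have "(mat (1 / (qpow q 1 - qpow q (-1))) ** (Kop V (node r s i) - matrix_inv (Kop V (node r s i)))) $ a $ b =
        (if b = a then (qpow q (node_weight a i) - qpow q (- node_weight a i)) / qdiff q else 0)" for a b
        unfolding mat_mult_entry vector_minus_component K_inv_weight_basis[OF ni] unfolding K_weight_basis[OF ni]
        using i by (simp add: node_weight_def qdiff_def)
      then show ?thesis
        by (simp add: vec_eq_iff matrix_vector_mult_def if_distrib[of "\<lambda>x. x * _"] cong: if_cong)
    qed
    then show "Eop V (node r s i) *v (Fop V (node r s j) *v z) =
       Fop V (node r s j) *v (Eop V (node r s i) *v z) +
       (if i = j then \<chi> a. (qpow q (node_weight a i) - qpow q (- node_weight a i)) / qdiff q * z $ a else 0)"
      unfolding matrix_vector_mul_assoc EF matrix_vector_mult_add_rdistrib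
      by (cases "i = j") (simp_all add: add.commute)
  next
    fix W :: "(complex^'n) set"
    assume W: "vec.subspace W"
      and EF: "\<And>i z. i \<in> {1..r} \<Longrightarrow> z \<in> W \<Longrightarrow> Eop V (node r s i) *v z \<in> W \<and> Fop V (node r s i) *v z \<in> W"
      and D: "\<And>\<phi> z. z \<in> W \<Longrightarrow> (\<chi> a. \<phi> (node_weight a) * z $ a) \<in> W"
    have "Kop V i *v z \<in> W \<and> Eop V i *v z \<in> W \<and> Fop V i *v z \<in> W" if i: "i \<in> {1..r}" and z: "z \<in> W" for i z
    proof -
      obtain j where j: "j \<in> {1..r}" "i = node r s j" using node_surj[OF i] by blast
      have "Kop V i *v z = (\<chi> a. qpow q (node_weight a j) * z $ a)"
        unfolding K_weight_basis[OF i] using j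
        by (simp add: vec_eq_iff matrix_vector_mult_def if_distrib[of "\<lambda>x. x * _"] node_weight_def cong: if_cong)
      then show ?thesis using D[OF z, of "\<lambda>u. qpow q (u j)"] EF[OF j(1) z] j(2) by simp
    qed
    then show "W = {0} \<or> W = UNIV"
      using V W by (simp add: is_simple_hw_module_def is_simple_def)
  qed
  then show ?thesis by blast
qed

lemma quantum_legs_exists:
  "\<exists>k. quantum_legs q r k (- 1 / (real r + 1)) (quantum_braidings r s q V) wt"
proof -
  obtain x where "vector_module q r (\<lambda>i. Eop V (node r s i)) (\<lambda>i. Fop V (node r s i)) node_weight x"
    using vector_module_exists by blast
  from vector_module.chain_basis[OF this] obtain k c
    where k: "bij_betw k UNIV {..r}" and c: "\<And>i. i \<in> {1..r} \<Longrightarrow> c i \<noteq> 0"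
      and E: "\<And>i a b. i \<in> {1..r} \<Longrightarrow> Eop V (node r s i) $ a $ b = (if k b = i \<and> Suc (k a) = i then inverse (c i) else 0)"
      and F: "\<And>i a b. i \<in> {1..r} \<Longrightarrow> Fop V (node r s i) $ a $ b = (if k a = i \<and> Suc (k b) = i then c i else 0)"
      and W: "\<And>i a. i \<in> {1..r} \<Longrightarrow> node_weight a i = of_bool (i = Suc (k a)) - of_bool (i = k a)"
    by blast
  have w: "weight_form r (simple_root (node r s i)) (wt a) = of_bool (i = Suc (k a)) - of_bool (i = k a)" if "i \<in> {1..r}" for i a
    using W[OF that, of a] that by (simp add: node_weight_def)
  have ch: "chain q r k (node r s) c V"
  proof
    show "Kop V (node r s i) $ a $ b = (if a = b then qpow q (of_bool (Suc (k a) = i) - of_bool (k a = i)) else 0)"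
      if "i \<in> {1..r}" for i a b
      unfolding K_weight_basis[OF node_in[OF that]] w[OF that] eq_commute[of "Suc (k a)" i] eq_commute[of "k a" i]
      by simp
  qed (use q k c E F bij_betw_node in auto)
  have fits: "chain.fits r (node r s) (fund_weight r s)"
    unfolding chain.fits_def[OF ch]
  proof
    fix i assume i: "i \<in> {1..r}"
    have "(r + 1 - node r s i = s) = (i = r)" using i r s by (auto simp: node_def)
    then show "weight_form r (simple_root (node r s i)) (fund_weight r s) = of_bool (i = 1) \<and>
        weight_form r (simple_root (node r s i)) (w0 r (fund_weight r s)) = - of_bool (i = r)"
      unfolding simple_root_fund[OF r s node_in[OF i]] node_eq_iff[OF r s i] by simp
  qed
  have dual_fits: "chain.fits r (\<lambda>i. node r s (r + 1 - i)) (dual_weight r (fund_weight r s))"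
    unfolding chain.fits_def[OF chain.dual[OF ch]]
  proof
    fix i assume i: "i \<in> {1..r}"
    then have i': "r + 1 - i \<in> {1..r}" by auto
    have "(r + 1 - node r s (r + 1 - i) = s) = (i = 1)" "(r + 1 - i = 1) = (i = r)"
      using i r s by (auto simp: node_def)
    then show "weight_form r (simple_root (node r s (r + 1 - i))) (dual_weight r (fund_weight r s)) = of_bool (i = 1) \<and>
        weight_form r (simple_root (node r s (r + 1 - i))) (w0 r (dual_weight r (fund_weight r s))) = - of_bool (i = r)"
      unfolding simple_root_dual[OF r s node_in[OF i']] node_eq_iff[OF r s i'] by simp
  qed
  \<comment> \<open>The longest element takes the dual weight to -omega_s, so this is -(omega_s,
    omega_s) = -\<nu> - 1.\<close>
  have \<nu>: "weight_form r (fund_weight r s) (w0 r (dual_weight r (fund_weight r s))) = - (- 1 / (real r + 1)) - 1"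
    unfolding weight_form_fund_w0_dual[OF r s] ww_eq[OF r s] by simp
  note B = chain.braidings[OF ch r fits dual_fits weight_form_fund_w0[OF r s] \<nu> weight_form_dual_w0_dual[OF r s]]
  have "quantum_legs q r k (- 1 / (real r + 1)) (quantum_braidings r s q V) wt"
  proof
    show "0 < q" "bij_betw k UNIV {..r}" using q k by auto
    show "RVV (quantum_braidings r s q V) = hecke q (- 1 / (real r + 1)) (\<lambda>a b. k b < k a)"
      "RVD (quantum_braidings r s q V) = mixed q (- 1 / (real r + 1)) k"
      "RDD (quantum_braidings r s q V) = hecke q (- 1 / (real r + 1)) (\<lambda>a b. k a < k b)"
      by (simp_all only: quantum_braidings_def Let_def braidings.simps B)
    fix a
    have ka: "k a \<le> r" using k by (auto simp: bij_betw_def)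
    \<comment> \<open>The basis vector of rank k has weight 1 at node k + 1 and -1 at node k, so the
      pairing is (k + 1)(r - k) - k (r + 1 - k) = r - 2k; at the ends of the chain the missing node
      has coefficient zero.\<close>
    have "weight_form r (two_rho r) (wt a) =
      (\<Sum>i = 1..r. real i * real (r + 1 - i) * of_bool (i = Suc (k a))) - (\<Sum>i = 1..r. real i * real (r + 1 - i) * of_bool (i = k a))"
      unfolding two_rho_node[of _ _ s] sum_subtractf[symmetric] right_diff_distrib[symmetric]
      by (intro sum.cong refl) (simp only: w)
    also have "\<dots> = real (Suc (k a)) * real (r - k a) - real (k a) * real (r + 1 - k a)"
      using ka sum_height_delta[of "Suc (k a)" r] sum_height_delta[of "k a" r]
      by (simp only: Suc_le_mono add_Suc_right diff_Suc_Suc Suc_eq_plus1[symmetric])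
    finally show "weight_form r (two_rho r) (wt a) = real r - 2 * real (k a)"
      using ka by (simp add: of_nat_diff algebra_simps)
  qed
  then show ?thesis by blast
qed

end

section \<open>The classical limit\<close>

text \<open>The squared norm as a polynomial in the coordinates and their conjugates, to which the
  Wirtinger rules apply directly.\<close>

definition norm_square :: "complex^'n::finite \<Rightarrow> complex"
  where "norm_square Z = (\<Sum>i\<in>UNIV. Z $ i * cnj (Z $ i))"

lemma norm_power2_eq: "complex_of_real ((norm Z)\<^sup>2) = norm_square Z"
proof -
  have "(norm Z)\<^sup>2 = (\<Sum>i\<in>UNIV. (norm (Z $ i))\<^sup>2)"
    by (simp add: norm_vec_def L2_set_def sum_nonneg)
  then show ?thesis by (simp add: norm_square_def complex_norm_square del: of_real_power)
qed

lemma norm_square_nonzero: "Z $ m = 1 \<Longrightarrow> norm_square Z \<noteq> 0"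
  unfolding norm_power2_eq[symmetric] by auto

definition wirtinger :: "'n frame \<Rightarrow> (complex^'n \<Rightarrow> complex) \<Rightarrow> complex"
  where "wirtinger a D = (case a of Dz i \<Rightarrow> (D (axis i 1) - \<i> * D (axis i \<i>)) / 2
    | Dzbar i \<Rightarrow> (D (axis i 1) + \<i> * D (axis i \<i>)) / 2)"

definition dz :: "'n frame \<Rightarrow> 'n \<Rightarrow> complex"
  where "dz a j = (case a of Dz i \<Rightarrow> of_bool (i = j) | Dzbar i \<Rightarrow> 0)"

definition dzb :: "'n frame \<Rightarrow> 'n \<Rightarrow> complex"
  where "dzb a j = (case a of Dz i \<Rightarrow> 0 | Dzbar i \<Rightarrow> of_bool (i = j))"

lemma frame_deriv_eq:
  assumes "(h has_derivative D) (at Z)" shows "frame_deriv a h Z = wirtinger a D"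
  using frechet_derivative_at[OF assms] by (cases a) (simp_all add: wirtinger_def)

lemma wirtinger_comp: "wirtinger a (\<lambda>x. x $ j) = dz a j"
  by (cases a) (auto simp: wirtinger_def dz_def axis_def)

lemma wirtinger_comp_cnj: "wirtinger a (\<lambda>x. cnj (x $ j)) = dzb a j"
  by (cases a) (auto simp: wirtinger_def dzb_def axis_def)

lemma wirtinger_add: "wirtinger a (\<lambda>x. D x + D' x) = wirtinger a D + wirtinger a D'"
  by (cases a) (simp_all add: wirtinger_def field_simps)

lemma wirtinger_mult_left: "wirtinger a (\<lambda>x. c * D x) = c * wirtinger a D"
  by (cases a) (simp_all add: wirtinger_def field_simps)

lemma wirtinger_mult_right: "wirtinger a (\<lambda>x. D x * c) = wirtinger a D * c"
  by (cases a) (simp_all add: wirtinger_def field_simps)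

lemma wirtinger_0: "wirtinger a (\<lambda>x. 0) = 0"
  by (cases a) (simp_all add: wirtinger_def)

text \<open>\<open>frame_deriv\<close> by itself says nothing about differentiability; with
  existence of a derivative included, sum, product and quotient rules hold.\<close>

definition has_frame_deriv :: "(complex^'n::finite \<Rightarrow> complex) \<Rightarrow> 'n frame \<Rightarrow> complex^'n \<Rightarrow> complex \<Rightarrow> bool"
  where "has_frame_deriv h a Z v \<longleftrightarrow> (\<exists>D. (h has_derivative D) (at Z) \<and> wirtinger a D = v)"

lemma has_frame_deriv_imp: "has_frame_deriv h a Z v \<Longrightarrow> frame_deriv a h Z = v"
  using frame_deriv_eq by (auto simp: has_frame_deriv_def)

lemma has_frame_deriv_comp: "has_frame_deriv (\<lambda>W. W $ j) a Z (dz a j)"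
  unfolding has_frame_deriv_def
  by (rule exI[of _ "\<lambda>x. x $ j"]) (simp add: wirtinger_comp bounded_linear.has_derivative[OF bounded_linear_vec_nth])

lemma has_frame_deriv_cnj: "has_frame_deriv (\<lambda>W. cnj (W $ j)) a Z (dzb a j)"
  unfolding has_frame_deriv_def
  by (rule exI[of _ "\<lambda>x. cnj (x $ j)"])
    (simp add: wirtinger_comp_cnj has_derivative_cnj bounded_linear.has_derivative[OF bounded_linear_vec_nth])

lemma has_frame_deriv_const: "has_frame_deriv (\<lambda>W. c) a Z 0"
  unfolding has_frame_deriv_def by (rule exI[of _ "\<lambda>x. 0"]) (simp add: wirtinger_0)

lemma has_frame_deriv_add: "has_frame_deriv f a Z u \<Longrightarrow> has_frame_deriv g a Z v \<Longrightarrow> has_frame_deriv (\<lambda>W. f W + g W) a Z (u + v)"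
  unfolding has_frame_deriv_def by (metis has_derivative_add wirtinger_add)

lemma has_frame_deriv_mult:
  assumes "has_frame_deriv f a Z u" "has_frame_deriv g a Z v" shows "has_frame_deriv (\<lambda>W. f W * g W) a Z (u * g Z + f Z * v)"
proof -
  obtain D D' where D: "(f has_derivative D) (at Z)" "wirtinger a D = u" "(g has_derivative D') (at Z)" "wirtinger a D' = v"
    using assms by (auto simp: has_frame_deriv_def)
  then have "((\<lambda>W. f W * g W) has_derivative (\<lambda>x. f Z * D' x + D x * g Z)) (at Z)"
    by (intro has_derivative_mult)
  moreover have "wirtinger a (\<lambda>x. f Z * D' x + D x * g Z) = u * g Z + f Z * v"
    unfolding wirtinger_add wirtinger_mult_left wirtinger_mult_right D by simp
  ultimately show ?thesis unfolding has_frame_deriv_def by blast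
qed

lemma has_frame_deriv_minus: "has_frame_deriv f a Z u \<Longrightarrow> has_frame_deriv (\<lambda>W. - f W) a Z (- u)"
  using has_frame_deriv_mult[OF has_frame_deriv_const[of "- 1" a Z], of f u] by simp

lemma has_frame_deriv_diff: "has_frame_deriv f a Z u \<Longrightarrow> has_frame_deriv g a Z v \<Longrightarrow> has_frame_deriv (\<lambda>W. f W - g W) a Z (u - v)"
  using has_frame_deriv_add[OF _ has_frame_deriv_minus, of f a Z u g v] by simp

lemma has_frame_deriv_sum: "(\<And>i. i \<in> A \<Longrightarrow> has_frame_deriv (f i) a Z (u i)) \<Longrightarrow> has_frame_deriv (\<lambda>W. \<Sum>i\<in>A. f i W) a Z (\<Sum>i\<in>A. u i)"
  by (induction A rule: infinite_finite_induct) (simp_all add: has_frame_deriv_const has_frame_deriv_add)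

lemma has_frame_deriv_inverse:
  assumes "has_frame_deriv f a Z u" "f Z \<noteq> 0" shows "has_frame_deriv (\<lambda>W. inverse (f W)) a Z (- (inverse (f Z) * u * inverse (f Z)))"
proof -
  obtain D where D: "(f has_derivative D) (at Z)" "wirtinger a D = u" using assms by (auto simp: has_frame_deriv_def)
  have "((\<lambda>W. inverse (f W)) has_derivative (\<lambda>x. - (inverse (f Z) * D x * inverse (f Z)))) (at Z)"
    by (rule Deriv.has_derivative_inverse[OF assms(2) D(1)])
  moreover have "wirtinger a (\<lambda>x. - (inverse (f Z) * D x * inverse (f Z))) = - (inverse (f Z) * u * inverse (f Z))"
    using wirtinger_mult_left[of a "- 1" "\<lambda>x. inverse (f Z) * D x * inverse (f Z)"]
    by (simp add: wirtinger_mult_left wirtinger_mult_right D)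
  ultimately show ?thesis unfolding has_frame_deriv_def by blast
qed

lemma has_frame_deriv_transform:
  assumes "has_frame_deriv f a Z u" "open S" "Z \<in> S" "\<And>W. W \<in> S \<Longrightarrow> f W = g W" shows "has_frame_deriv g a Z u"
  using assms has_derivative_transform_within_open[of f _ Z UNIV S g] by (auto simp: has_frame_deriv_def)

lemma has_frame_deriv_norm_square: "has_frame_deriv norm_square a Z (\<Sum>i\<in>UNIV. dz a i * cnj (Z $ i) + Z $ i * dzb a i)"
  unfolding norm_square_def by (intro has_frame_deriv_sum has_frame_deriv_mult has_frame_deriv_comp has_frame_deriv_cnj)

lemma dn_eq: "(\<Sum>i\<in>UNIV. dz a i * cnj (Z $ i) + Z $ i * dzb a i) =
    (case a of Dz i \<Rightarrow> cnj (Z $ i) | Dzbar i \<Rightarrow> Z $ i)"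
  by (cases a) (simp_all add: dz_def dzb_def if_distrib[of "\<lambda>x. x * _"] if_distrib[of "\<lambda>x. _ * x"] of_bool_def cong: if_cong)

text \<open>The orthogonal projection along Z divided by the squared norm. It is the matrix of the
  Fubini-Study metric, and the differentials of p and its own derivatives are expressed in
  it.\<close>

definition hmat :: "'n \<Rightarrow> 'n \<Rightarrow> complex^'n::finite \<Rightarrow> complex"
  where "hmat i b W = inverse (norm_square W) * (of_bool (i = b) - W $ i * cnj (W $ b) * inverse (norm_square W))"

lemma has_frame_deriv_hmat_Dz:
  assumes "norm_square Z \<noteq> 0"
  shows "has_frame_deriv (hmat i b) (Dz c) Z (- (cnj (Z $ c) * hmat i b Z + cnj (Z $ b) * hmat i c Z) * inverse (norm_square Z))"
proof -
  have "has_frame_deriv (hmat i b) (Dz c) Z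
    (- (inverse (norm_square Z) * cnj (Z $ c) * inverse (norm_square Z)) * (of_bool (i = b) - Z $ i * cnj (Z $ b) * inverse (norm_square Z)) +
     inverse (norm_square Z) * (0 - ((dz (Dz c) i * cnj (Z $ b) + Z $ i * dzb (Dz c) b) * inverse (norm_square Z) +
       Z $ i * cnj (Z $ b) * - (inverse (norm_square Z) * cnj (Z $ c) * inverse (norm_square Z)))))"
    unfolding hmat_def using has_frame_deriv_norm_square[of "Dz c" Z] assms
    by (intro has_frame_deriv_mult has_frame_deriv_diff has_frame_deriv_inverse has_frame_deriv_const has_frame_deriv_comp has_frame_deriv_cnj) (simp_all add: dn_eq)
  moreover have "of_bool (c = i) = (of_bool (i = c) :: complex)" by auto
  ultimately show ?thesis by (simp add: dz_def dzb_def hmat_def algebra_simps)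
qed

lemma has_frame_deriv_hmat_Dzbar:
  assumes "norm_square Z \<noteq> 0"
  shows "has_frame_deriv (hmat i b) (Dzbar c) Z (- (Z $ c * hmat i b Z + Z $ i * hmat c b Z) * inverse (norm_square Z))"
proof -
  have "has_frame_deriv (hmat i b) (Dzbar c) Z
    (- (inverse (norm_square Z) * Z $ c * inverse (norm_square Z)) * (of_bool (i = b) - Z $ i * cnj (Z $ b) * inverse (norm_square Z)) +
     inverse (norm_square Z) * (0 - ((dz (Dzbar c) i * cnj (Z $ b) + Z $ i * dzb (Dzbar c) b) * inverse (norm_square Z) +
       Z $ i * cnj (Z $ b) * - (inverse (norm_square Z) * Z $ c * inverse (norm_square Z)))))"
    unfolding hmat_def using has_frame_deriv_norm_square[of "Dzbar c" Z] assms
    by (intro has_frame_deriv_mult has_frame_deriv_diff has_frame_deriv_inverse has_frame_deriv_const has_frame_deriv_comp has_frame_deriv_cnj) (simp_all add: dn_eq)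
  then show ?thesis by (simp add: dz_def dzb_def hmat_def algebra_simps)
qed

lemma p_cl_eq: "p_cl i j W = W $ i * cnj (W $ j) * inverse (norm_square W)"
  by (simp only: p_cl_def norm_power2_eq divide_inverse)

lemma has_frame_deriv_p_cl:
  assumes "norm_square Z \<noteq> 0"
  shows "has_frame_deriv (p_cl i j) (Dz b) Z (cnj (Z $ j) * hmat i b Z)" "has_frame_deriv (p_cl i j) (Dzbar b) Z (Z $ i * hmat b j Z)"
proof -
  have *: "has_frame_deriv (p_cl i j) a Z ((dz a i * cnj (Z $ j) + Z $ i * dzb a j) * inverse (norm_square Z) +
     Z $ i * cnj (Z $ j) * - (inverse (norm_square Z) * (case a of Dz i \<Rightarrow> cnj (Z $ i) | Dzbar i \<Rightarrow> Z $ i) * inverse (norm_square Z)))" for a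
    unfolding p_cl_eq using has_frame_deriv_norm_square[of a Z] assms
    by (intro has_frame_deriv_mult has_frame_deriv_inverse has_frame_deriv_comp has_frame_deriv_cnj) (simp_all add: dn_eq)
  have "of_bool (b = i) = (of_bool (i = b) :: complex)" by auto
  then show "has_frame_deriv (p_cl i j) (Dz b) Z (cnj (Z $ j) * hmat i b Z)" "has_frame_deriv (p_cl i j) (Dzbar b) Z (Z $ i * hmat b j Z)"
    using *[of "Dz b"] *[of "Dzbar b"] by (simp_all add: dz_def dzb_def hmat_def algebra_simps)
qed

lemma dolbeault_p:
  assumes "norm_square Z \<noteq> 0"
  shows "dolbeault (p_cl i j) Z (Dz b) = cnj (Z $ j) * hmat i b Z" "dolbeault (p_cl i j) Z (Dzbar b) = 0"
    "dolbeault_bar (p_cl i j) Z (Dzbar b) = Z $ i * hmat b j Z" "dolbeault_bar (p_cl i j) Z (Dz b) = 0"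
  using has_frame_deriv_imp[OF has_frame_deriv_p_cl(1)[OF assms]] has_frame_deriv_imp[OF has_frame_deriv_p_cl(2)[OF assms]]
  by (simp_all only: dolbeault_def dolbeault_bar_def frame.case)

lemma open_norm_square_nonzero: "open {W :: complex^'n::finite. norm_square W \<noteq> 0}"
proof -
  have "{W :: complex^'n. norm_square W \<noteq> 0} = - {0}"
    by (auto simp: norm_power2_eq[symmetric])
  then show ?thesis by (simp add: open_Compl)
qed

lemma has_frame_deriv_dolbeault:
  assumes "norm_square Z \<noteq> 0"
  shows "has_frame_deriv (\<lambda>W. dolbeault (p_cl i j) W (Dz b)) (Dz c) Z
      (- (cnj (Z $ c) * hmat i b Z + cnj (Z $ b) * hmat i c Z) * inverse (norm_square Z) * cnj (Z $ j))"
    and "has_frame_deriv (\<lambda>W. dolbeault (p_cl i j) W (Dz b)) (Dzbar c) Z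
      (norm_square Z * hmat c j Z * hmat i b Z - p_cl i j Z * hmat c b Z)"
    and "has_frame_deriv (\<lambda>W. dolbeault (p_cl i j) W (Dzbar b)) a Z 0"
    and "has_frame_deriv (\<lambda>W. dolbeault_bar (p_cl i j) W (Dzbar b)) (Dzbar c) Z
      (- (Z $ c * hmat b j Z + Z $ b * hmat c j Z) * inverse (norm_square Z) * Z $ i)"
    and "has_frame_deriv (\<lambda>W. dolbeault_bar (p_cl i j) W (Dzbar b)) (Dz c) Z
      (norm_square Z * hmat i c Z * hmat b j Z - p_cl i j Z * hmat b c Z)"
    and "has_frame_deriv (\<lambda>W. dolbeault_bar (p_cl i j) W (Dz b)) a Z 0"
proof -
  have Z: "Z \<in> {W. norm_square W \<noteq> 0}" using assms by simp
  \<comment> \<open>The formula for the differential has to hold on a neighbourhood of Z, not merely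
    where the coordinate m equals 1, before it can be differentiated.\<close>
  note tr = has_frame_deriv_transform[OF _ open_norm_square_nonzero Z]
  have 1: "has_frame_deriv (\<lambda>W. cnj (W $ j) * hmat i b W) (Dz c) Z
      (- (cnj (Z $ c) * hmat i b Z + cnj (Z $ b) * hmat i c Z) * inverse (norm_square Z) * cnj (Z $ j))"
    using has_frame_deriv_mult[OF has_frame_deriv_cnj[of j] has_frame_deriv_hmat_Dz[OF assms, of i b c]] by (simp add: dzb_def mult_ac)
  show "has_frame_deriv (\<lambda>W. dolbeault (p_cl i j) W (Dz b)) (Dz c) Z
      (- (cnj (Z $ c) * hmat i b Z + cnj (Z $ b) * hmat i c Z) * inverse (norm_square Z) * cnj (Z $ j))"
    by (rule tr[OF 1]) (simp add: dolbeault_p)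
  \<comment> \<open>Trades the Kronecker symbol from differentiating a coordinate for
    \<open>hmat\<close> and an entry of p.\<close>
  have d: "of_bool (c = j) = norm_square Z * hmat c j Z + Z $ c * cnj (Z $ j) * inverse (norm_square Z)" for c j
    unfolding hmat_def mult.assoc[symmetric] right_inverse[OF assms] by simp
  have "dzb (Dzbar c) j * hmat i b Z + cnj (Z $ j) * (- (Z $ c * hmat i b Z + Z $ i * hmat c b Z) * inverse (norm_square Z))
    = norm_square Z * hmat c j Z * hmat i b Z - p_cl i j Z * hmat c b Z"
    unfolding dzb_def frame.case d p_cl_eq by (simp add: algebra_simps)
  then have 2: "has_frame_deriv (\<lambda>W. cnj (W $ j) * hmat i b W) (Dzbar c) Z
      (norm_square Z * hmat c j Z * hmat i b Z - p_cl i j Z * hmat c b Z)"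
    using has_frame_deriv_mult[OF has_frame_deriv_cnj[of j] has_frame_deriv_hmat_Dzbar[OF assms, of i b c]] by simp
  show "has_frame_deriv (\<lambda>W. dolbeault (p_cl i j) W (Dz b)) (Dzbar c) Z
      (norm_square Z * hmat c j Z * hmat i b Z - p_cl i j Z * hmat c b Z)"
    by (rule tr[OF 2]) (simp add: dolbeault_p)
  show "has_frame_deriv (\<lambda>W. dolbeault (p_cl i j) W (Dzbar b)) a Z 0"
    by (rule tr[OF has_frame_deriv_const[of 0]]) (simp add: dolbeault_p)
  have 3: "has_frame_deriv (\<lambda>W. W $ i * hmat b j W) (Dzbar c) Z
      (- (Z $ c * hmat b j Z + Z $ b * hmat c j Z) * inverse (norm_square Z) * Z $ i)"
    using has_frame_deriv_mult[OF has_frame_deriv_comp[of i] has_frame_deriv_hmat_Dzbar[OF assms, of b j c]] by (simp add: dz_def mult_ac)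
  show "has_frame_deriv (\<lambda>W. dolbeault_bar (p_cl i j) W (Dzbar b)) (Dzbar c) Z
      (- (Z $ c * hmat b j Z + Z $ b * hmat c j Z) * inverse (norm_square Z) * Z $ i)"
    by (rule tr[OF 3]) (simp add: dolbeault_p)
  have "of_bool (c = i) = (of_bool (i = c) :: complex)" by auto
  then have "dz (Dz c) i * hmat b j Z + Z $ i * (- (cnj (Z $ c) * hmat b j Z + cnj (Z $ j) * hmat b c Z) * inverse (norm_square Z))
    = norm_square Z * hmat i c Z * hmat b j Z - p_cl i j Z * hmat b c Z"
    unfolding dz_def frame.case p_cl_eq by (simp add: d[of i c] algebra_simps del: of_bool_eq_iff)
  then have 4: "has_frame_deriv (\<lambda>W. W $ i * hmat b j W) (Dz c) Z
      (norm_square Z * hmat i c Z * hmat b j Z - p_cl i j Z * hmat b c Z)"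
    using has_frame_deriv_mult[OF has_frame_deriv_comp[of i] has_frame_deriv_hmat_Dz[OF assms, of b j c]] by simp
  show "has_frame_deriv (\<lambda>W. dolbeault_bar (p_cl i j) W (Dzbar b)) (Dz c) Z
      (norm_square Z * hmat i c Z * hmat b j Z - p_cl i j Z * hmat b c Z)"
    by (rule tr[OF 4]) (simp add: dolbeault_p)
  show "has_frame_deriv (\<lambda>W. dolbeault_bar (p_cl i j) W (Dz b)) a Z 0"
    by (rule tr[OF has_frame_deriv_const[of 0]]) (simp add: dolbeault_p)
qed

text \<open>Up to the squared norm \<open>hmat\<close> is a projection.\<close>

lemma hmat_square: assumes "norm_square Z \<noteq> 0" shows "(\<Sum>k\<in>UNIV. hmat c k Z * hmat k b Z) = hmat c b Z * inverse (norm_square Z)"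
proof -
  have "hmat c k Z * hmat k b Z = (inverse (norm_square Z))\<^sup>2 * ((if k = c then of_bool (c = b) - Z $ c * cnj (Z $ b) * inverse (norm_square Z) else 0)
     - (if k = b then Z $ c * cnj (Z $ b) * inverse (norm_square Z) else 0)
     + Z $ c * cnj (Z $ b) * (inverse (norm_square Z))\<^sup>2 * (Z $ k * cnj (Z $ k)))" for k
    by (cases "k = c"; cases "k = b") (simp_all add: hmat_def power2_eq_square algebra_simps)
  then have "(\<Sum>k\<in>UNIV. hmat c k Z * hmat k b Z) = (inverse (norm_square Z))\<^sup>2 * ((of_bool (c = b) - Z $ c * cnj (Z $ b) * inverse (norm_square Z))
     - (Z $ c * cnj (Z $ b) * inverse (norm_square Z))
     + Z $ c * cnj (Z $ b) * (inverse (norm_square Z))\<^sup>2 * norm_square Z)"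
    by (simp add: sum_distrib_left[symmetric] sum.distrib sum_subtractf norm_square_def)
  then have "(\<Sum>k\<in>UNIV. hmat c k Z * hmat k b Z) = (inverse (norm_square Z))\<^sup>2 * (of_bool (c = b) - Z $ c * cnj (Z $ b) * inverse (norm_square Z))"
    using assms by (simp add: power2_eq_square)
  then show ?thesis by (simp only: hmat_def power2_eq_square mult_ac)
qed

section \<open>The connection in the chart\<close>

lemma on_legs_flip:
  assumes "P = (\<chi> a b. of_bool (a = prod.swap b))"
  shows "on_legs P X a b = X b a" "matrix_inv P = P"
proof -
  have "on_legs P X a b = (\<Sum>x\<in>UNIV. if x = (b, a) then X b a else 0)"
    unfolding on_legs_def assms
  proof (rule sum.cong[OF refl])
    fix x :: "'a \<times> 'a"
    show "(case x of (i, j) \<Rightarrow> (\<chi> a b. of_bool (a = prod.swap b)) $ (a, b) $ (i, j) *\<^sub>C X i j) = (if x = (b, a) then X b a else 0)"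
      by (cases "x = (b, a)"; cases x) (auto simp: scaleC_one scaleC_zero_left of_bool_def)
  qed
  then show "on_legs P X a b = X b a" by simp
  show "matrix_inv P = P"
  proof (rule matrix_inv_eqI)
    have "(P ** P) $ x $ y = (\<Sum>z\<in>UNIV. if z = prod.swap x then of_bool (x = y) else 0)" for x y
      unfolding assms matrix_matrix_mult_def vec_lambda_beta
      by (intro sum.cong refl) (auto simp: prod_eq_iff)
    then show "P ** P = mat 1" by (simp add: vec_eq_iff mat_def)
  qed
qed

lemma T1234_flip: "T1234 flip_braidings X a b c d = X c d a b"
  unfolding T1234_def S123_def tildeS234_def flip_braidings_def Let_def braidings.simps
    on_legs_flip(2)[OF refl] on_legs12_def on_legs23_def on_legs34_def on_legs_flip(1)[OF refl] ..

lemma qpow_1: "qpow 1 x = 1"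
  by (simp add: qpow_def)

lemma nabla_classical:
  "nabla_del r s 1 wt flip_braidings p scaleC (concat_legs form_tensor Q P) i j a b =
    (\<Sum>k\<in>UNIV. Q k j a * P i k b) - p i j * (\<Sum>i\<in>UNIV. \<Sum>k\<in>UNIV. Q i k a * P k i b)"
  "nabla_delbar r s 1 wt p scaleC (concat_legs form_tensor P Q) i j a b =
    (\<Sum>k\<in>UNIV. P i k a * Q k j b) - p i j * (\<Sum>i\<in>UNIV. \<Sum>k\<in>UNIV. P i k a * Q k i b)"
  by (simp_all add: nabla_del_def nabla_delbar_def qpow_1 scaleC_one metric_part_def E'12_def E23_def T1234_flip
      concat_legs_def form_tensor_def scaleC_fun_def scaleC_complex_def sum_fun_app)

text \<open>The Fubini-Study metric is Kaehler, so only components of pure type are nonzero.\<close>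

definition christoffel :: "'n::finite coefficients"
  where "christoffel Z e a b = (case (e, a, b) of
      (Dz e, Dz a, Dz b) \<Rightarrow> - (of_bool (e = a) * cnj (Z $ b) + of_bool (e = b) * cnj (Z $ a)) * inverse (norm_square Z)
    | (Dzbar e, Dzbar a, Dzbar b) \<Rightarrow> - (of_bool (e = a) * Z $ b + of_bool (e = b) * Z $ a) * inverse (norm_square Z)
    | _ \<Rightarrow> 0)"

lemma christoffel_simps:
  "christoffel Z (Dz e) (Dz a) (Dz b) = - (of_bool (e = a) * cnj (Z $ b) + of_bool (e = b) * cnj (Z $ a)) * inverse (norm_square Z)"
  "christoffel Z (Dzbar e) (Dzbar a) (Dzbar b) = - (of_bool (e = a) * Z $ b + of_bool (e = b) * Z $ a) * inverse (norm_square Z)"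
  "christoffel Z (Dzbar e) (Dz a) x = 0" "christoffel Z (Dzbar e) x (Dz a) = 0"
  "christoffel Z (Dz e) (Dzbar a) x = 0" "christoffel Z (Dz e) x (Dzbar a) = 0"
  by (simp_all add: christoffel_def split: frame.split)

lemma sum_chart_frame:
  "(\<Sum>c\<in>chart_frame (m :: 'n::finite). h c) = (\<Sum>c\<in>- {m}. h (Dz c)) + (\<Sum>c\<in>- {m}. h (Dzbar c))"
proof -
  have "inj_on Dz X" "inj_on Dzbar X" for X :: "'n set" by (auto simp: inj_on_def)
  then show ?thesis unfolding chart_frame_def
    by (subst sum.union_disjoint) (auto simp: sum.reindex)
qed

lemma christoffel_sum:
  assumes "c \<noteq> m" "b \<noteq> m"
  shows "(\<Sum>e\<in>- {m}. christoffel Z (Dz e) (Dz c) (Dz b) * g e) = - (cnj (Z $ b) * g c + cnj (Z $ c) * g b) * inverse (norm_square Z)"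
    "(\<Sum>e\<in>- {m}. christoffel Z (Dzbar e) (Dzbar c) (Dzbar b) * g e) = - (Z $ b * g c + Z $ c * g b) * inverse (norm_square Z)"
proof -
  have *: "(\<Sum>e\<in>- {m}. - (of_bool (e = c) * x + of_bool (e = b) * y) * t * g e) = - (x * g c + y * g b) * t" for x y t :: complex
  proof -
    have "- (of_bool (e = c) * x + of_bool (e = b) * y) * t * g e =
      (if e = c then - (x * g c * t) else 0) + (if e = b then - (y * g b * t) else 0)" for e by (auto simp: algebra_simps)
    then show ?thesis using assms by (simp add: sum.distrib algebra_simps)
  qed
  show "(\<Sum>e\<in>- {m}. christoffel Z (Dz e) (Dz c) (Dz b) * g e) = - (cnj (Z $ b) * g c + cnj (Z $ c) * g b) * inverse (norm_square Z)"
    "(\<Sum>e\<in>- {m}. christoffel Z (Dzbar e) (Dzbar c) (Dzbar b) * g e) = - (Z $ b * g c + Z $ c * g b) * inverse (norm_square Z)"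
    unfolding christoffel_simps * by simp_all
qed

text \<open>For components of equal type the right side vanishes and the Christoffel term cancels
  the derivative. For components of different type the Christoffel term vanishes and the derivative
  is the right side, p entering through the Kronecker symbol.\<close>

lemma nabla_p:
  assumes Z: "norm_square Z \<noteq> 0" and a: "a \<in> chart_frame m" and b: "b \<in> chart_frame m"
  defines "p \<equiv> \<lambda>i j. p_cl i j Z" and "P \<equiv> \<lambda>i j. dolbeault (p_cl i j) Z" and "Q \<equiv> \<lambda>i j. dolbeault_bar (p_cl i j) Z"
  shows "frame_deriv a (\<lambda>W. dolbeault (p_cl i j) W b) Z - (\<Sum>e\<in>- {m}. christoffel Z (Dz e) a b * (cnj (Z $ j) * hmat i e Z)) =
      (\<Sum>k\<in>UNIV. Q k j a * P i k b) - p i j * (\<Sum>i\<in>UNIV. \<Sum>k\<in>UNIV. Q i k a * P k i b)"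
    and "frame_deriv a (\<lambda>W. dolbeault_bar (p_cl i j) W b) Z - (\<Sum>e\<in>- {m}. christoffel Z (Dzbar e) a b * (Z $ i * hmat e j Z)) =
      (\<Sum>k\<in>UNIV. P i k a * Q k j b) - p i j * (\<Sum>i\<in>UNIV. \<Sum>k\<in>UNIV. P i k a * Q k i b)"
proof -
  have n: "(\<Sum>k\<in>UNIV. x * (Z $ k * cnj (Z $ k))) = x * norm_square Z" for x by (simp add: norm_square_def sum_distrib_left)
  have QP: "(\<Sum>k\<in>UNIV. Q k j (Dzbar c) * P i k (Dz d)) = norm_square Z * hmat c j Z * hmat i d Z"
    "(\<Sum>k\<in>UNIV. P i k (Dz d) * Q k j (Dzbar c)) = norm_square Z * hmat i d Z * hmat c j Z" for i j c d
    using n[of "hmat c j Z * hmat i d Z"] unfolding P_def Q_def dolbeault_p[OF Z] by (simp_all add: mult_ac)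
  \<comment> \<open>The trace of the two differentials is \<open>hmat\<close> itself: the metric is
    the Fubini-Study one.\<close>
  have tr: "(\<Sum>i\<in>UNIV. \<Sum>k\<in>UNIV. Q i k (Dzbar c) * P k i (Dz d)) = hmat c d Z" for c d
  proof -
    have "(\<Sum>i\<in>UNIV. \<Sum>k\<in>UNIV. Q i k (Dzbar c) * P k i (Dz d)) =
      (\<Sum>i\<in>UNIV. (\<Sum>k\<in>UNIV. hmat c k Z * hmat k d Z) * (Z $ i * cnj (Z $ i)))"
      unfolding P_def Q_def dolbeault_p[OF Z] sum_distrib_right by (simp add: mult_ac)
    then show ?thesis using Z unfolding n hmat_square[OF Z] by simp
  qed
  have tr': "(\<Sum>i\<in>UNIV. \<Sum>k\<in>UNIV. P i k (Dz d) * Q k i (Dzbar c)) = hmat c d Z" for c d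
    unfolding tr[symmetric] by (subst sum.swap) (simp add: mult.commute)
  have 0: "P i k (Dzbar c) = 0" "Q i k (Dz c) = 0" for i k c by (simp_all add: P_def Q_def dolbeault_p Z)
  note fd = has_frame_deriv_dolbeault[OF Z, THEN has_frame_deriv_imp]
  show "frame_deriv a (\<lambda>W. dolbeault (p_cl i j) W b) Z - (\<Sum>e\<in>- {m}. christoffel Z (Dz e) a b * (cnj (Z $ j) * hmat i e Z)) =
      (\<Sum>k\<in>UNIV. Q k j a * P i k b) - p i j * (\<Sum>i\<in>UNIV. \<Sum>k\<in>UNIV. Q i k a * P k i b)"
  proof (cases b)
    case (Dzbar d)
    then show ?thesis by (simp add: fd christoffel_simps 0)
  next
    case (Dz d)
    then have d: "d \<noteq> m" using b by (auto simp: chart_frame_def)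
    show ?thesis
    proof (cases a)
      case (Dzbar c)
      then show ?thesis unfolding Dz Dzbar fd tr unfolding QP by (simp add: christoffel_simps p_def)
    next
      case (Dz c)
      then have "c \<noteq> m" using a by (auto simp: chart_frame_def)
      then show ?thesis unfolding Dz \<open>b = Dz d\<close> fd christoffel_sum(1)[OF \<open>c \<noteq> m\<close> d] by (simp add: 0 algebra_simps)
    qed
  qed
  show "frame_deriv a (\<lambda>W. dolbeault_bar (p_cl i j) W b) Z - (\<Sum>e\<in>- {m}. christoffel Z (Dzbar e) a b * (Z $ i * hmat e j Z)) =
      (\<Sum>k\<in>UNIV. P i k a * Q k j b) - p i j * (\<Sum>i\<in>UNIV. \<Sum>k\<in>UNIV. P i k a * Q k i b)"
  proof (cases b)
    case (Dz d)
    then show ?thesis by (simp add: fd christoffel_simps 0)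
  next
    case (Dzbar d)
    then have d: "d \<noteq> m" using b by (auto simp: chart_frame_def)
    show ?thesis
    proof (cases a)
      case (Dz c)
      then show ?thesis unfolding Dzbar Dz fd tr' unfolding QP by (simp add: christoffel_simps p_def)
    next
      case (Dzbar c)
      then have "c \<noteq> m" using a by (auto simp: chart_frame_def)
      then show ?thesis unfolding Dzbar \<open>b = Dzbar d\<close> fd christoffel_sum(2)[OF \<open>c \<noteq> m\<close> d] by (simp add: 0 algebra_simps)
    qed
  qed
qed

text \<open>Row m has no diagonal term and Z has coordinate 1 there, so it forces the contraction of
  D with the conjugate of Z to vanish; row e then reduces to a multiple of D e.\<close>

lemma frame_coefficients_unique:
  assumes Z: "Z $ m = 1" and D: "\<And>i. (\<Sum>e\<in>- {m}. D e * hmat i e Z) = 0" and e: "e \<noteq> m"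
  shows "D e = 0"
proof -
  note n = norm_square_nonzero[OF Z]
  have *: "(\<Sum>e\<in>- {m}. D e * hmat i e Z) = inverse (norm_square Z) * ((\<Sum>e\<in>- {m}. if e = i then D e else 0)
      - Z $ i * inverse (norm_square Z) * (\<Sum>e\<in>- {m}. D e * cnj (Z $ e)))" for i
    unfolding sum_distrib_left sum_subtractf[symmetric] hmat_def
    by (intro sum.cong refl) (simp add: algebra_simps)
  have 0: "(\<Sum>e\<in>- {m}. D e * cnj (Z $ e)) = 0"
    using D[of m] n Z unfolding * by simp
  show ?thesis using D[of e] n e unfolding * 0 by simp
qed

lemma frame_coefficients_unique':
  assumes Z: "Z $ m = 1" and D: "\<And>j. (\<Sum>e\<in>- {m}. D e * hmat e j Z) = 0" and e: "e \<noteq> m"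
  shows "D e = 0"
proof -
  note n = norm_square_nonzero[OF Z]
  have *: "(\<Sum>e\<in>- {m}. D e * hmat e j Z) = inverse (norm_square Z) * ((\<Sum>e\<in>- {m}. if e = j then D e else 0)
      - cnj (Z $ j) * inverse (norm_square Z) * (\<Sum>e\<in>- {m}. D e * Z $ e))" for j
    unfolding sum_distrib_left sum_subtractf[symmetric] hmat_def
    by (intro sum.cong refl) (simp add: algebra_simps)
  have 0: "(\<Sum>e\<in>- {m}. D e * Z $ e) = 0"
    using D[of m] n Z unfolding * by simp
  show ?thesis using D[of e] n e unfolding * 0 by simp
qed

text \<open>The condition sees components in the chart frame only, so equality is claimed for chart
  indices.\<close>

lemma is_classical_nabla_iff:
  "is_classical_nabla r s wt m \<Gamma> \<longleftrightarrow> (\<forall>Z. Z $ m = 1 \<longrightarrow>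
    (\<forall>a\<in>chart_frame m. \<forall>b\<in>chart_frame m. \<forall>c\<in>chart_frame m. \<Gamma> Z c a b = christoffel Z c a b))"
proof -
  have cov: "cov_deriv m \<Gamma> (dolbeault (p_cl i j)) Z a b = frame_deriv a (\<lambda>W. dolbeault (p_cl i j) W b) Z -
      (\<Sum>e\<in>- {m}. \<Gamma> Z (Dz e) a b * (cnj (Z $ j) * hmat i e Z))"
    "cov_deriv m \<Gamma> (dolbeault_bar (p_cl i j)) Z a b = frame_deriv a (\<lambda>W. dolbeault_bar (p_cl i j) W b) Z -
      (\<Sum>e\<in>- {m}. \<Gamma> Z (Dzbar e) a b * (Z $ i * hmat e j Z))" if "Z $ m = 1" for i j Z a b
    unfolding cov_deriv_def sum_chart_frame dolbeault_p[OF norm_square_nonzero[OF that]] by simp_all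
  have iff: "(\<forall>i j. cov_deriv m \<Gamma> (dolbeault (p_cl i j)) Z a b
           = nabla_del r s 1 wt flip_braidings (\<lambda>i j. p_cl i j Z) scaleC
              (concat_legs form_tensor (\<lambda>i j. dolbeault_bar (p_cl i j) Z) (\<lambda>i j. dolbeault (p_cl i j) Z)) i j a b \<and>
         cov_deriv m \<Gamma> (dolbeault_bar (p_cl i j)) Z a b
           = nabla_delbar r s 1 wt (\<lambda>i j. p_cl i j Z) scaleC
              (concat_legs form_tensor (\<lambda>i j. dolbeault (p_cl i j) Z) (\<lambda>i j. dolbeault_bar (p_cl i j) Z)) i j a b)
      \<longleftrightarrow> (\<forall>c\<in>chart_frame m. \<Gamma> Z c a b = christoffel Z c a b)"
    if Z: "Z $ m = 1" and a: "a \<in> chart_frame m" and b: "b \<in> chart_frame m" for Z a b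
  proof -
    note nab = nabla_classical nabla_p[OF norm_square_nonzero[OF Z] a b, symmetric] cov[OF Z]
    show ?thesis unfolding nab
    proof (intro iffI ballI allI conjI)
      fix c
      assume eq: "\<forall>i j. frame_deriv a (\<lambda>W. dolbeault (p_cl i j) W b) Z - (\<Sum>e\<in>- {m}. \<Gamma> Z (Dz e) a b * (cnj (Z $ j) * hmat i e Z)) =
          frame_deriv a (\<lambda>W. dolbeault (p_cl i j) W b) Z - (\<Sum>e\<in>- {m}. christoffel Z (Dz e) a b * (cnj (Z $ j) * hmat i e Z)) \<and>
          frame_deriv a (\<lambda>W. dolbeault_bar (p_cl i j) W b) Z - (\<Sum>e\<in>- {m}. \<Gamma> Z (Dzbar e) a b * (Z $ i * hmat e j Z)) =
          frame_deriv a (\<lambda>W. dolbeault_bar (p_cl i j) W b) Z - (\<Sum>e\<in>- {m}. christoffel Z (Dzbar e) a b * (Z $ i * hmat e j Z))"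
        and c: "c \<in> chart_frame m"
      \<comment> \<open>The column m is taken because its factor, the conjugate of the coordinate m,
        is 1.\<close>
      have 1: "(\<Sum>e\<in>- {m}. (\<Gamma> Z (Dz e) a b - christoffel Z (Dz e) a b) * hmat i e Z) = 0" for i
        using eq[rule_format, of i m] Z by (simp add: left_diff_distrib sum_subtractf)
      have 2: "(\<Sum>e\<in>- {m}. (\<Gamma> Z (Dzbar e) a b - christoffel Z (Dzbar e) a b) * hmat e j Z) = 0" for j
        using eq[rule_format, of m j] Z by (simp add: left_diff_distrib sum_subtractf)
      show "\<Gamma> Z c a b = christoffel Z c a b"
      proof (cases c)
        case (Dz e)
        then show ?thesis using frame_coefficients_unique[OF Z 1, of e] c by (auto simp: chart_frame_def)
      next
        case (Dzbar e)
        then show ?thesis using frame_coefficients_unique'[OF Z 2, of e] c by (auto simp: chart_frame_def)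
      qed
    next
      fix i j
      assume "\<forall>c\<in>chart_frame m. \<Gamma> Z c a b = christoffel Z c a b"
      then have *: "\<Gamma> Z (Dz e) a b = christoffel Z (Dz e) a b" "\<Gamma> Z (Dzbar e) a b = christoffel Z (Dzbar e) a b" if "e \<in> - {m}" for e
        using that by (auto simp: chart_frame_def)
      show "frame_deriv a (\<lambda>W. dolbeault (p_cl i j) W b) Z - (\<Sum>e\<in>- {m}. \<Gamma> Z (Dz e) a b * (cnj (Z $ j) * hmat i e Z)) =
          frame_deriv a (\<lambda>W. dolbeault (p_cl i j) W b) Z - (\<Sum>e\<in>- {m}. christoffel Z (Dz e) a b * (cnj (Z $ j) * hmat i e Z))"
        using * by (intro arg_cong2[where f = minus] sum.cong refl) simp
      show "frame_deriv a (\<lambda>W. dolbeault_bar (p_cl i j) W b) Z - (\<Sum>e\<in>- {m}. \<Gamma> Z (Dzbar e) a b * (Z $ i * hmat e j Z)) =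
          frame_deriv a (\<lambda>W. dolbeault_bar (p_cl i j) W b) Z - (\<Sum>e\<in>- {m}. christoffel Z (Dzbar e) a b * (Z $ i * hmat e j Z))"
        using * by (intro arg_cong2[where f = minus] sum.cong refl) simp
    qed
  qed
  show ?thesis
  proof
    assume *: "is_classical_nabla r s wt m \<Gamma>"
    show "\<forall>Z. Z $ m = 1 \<longrightarrow>
      (\<forall>a\<in>chart_frame m. \<forall>b\<in>chart_frame m. \<forall>c\<in>chart_frame m. \<Gamma> Z c a b = christoffel Z c a b)"
    proof (intro allI impI ballI)
      fix Z :: "complex^'a" and a b c
      assume Z: "Z $ m = 1" and a: "a \<in> chart_frame m" and b: "b \<in> chart_frame m" and c: "c \<in> chart_frame m"
      show "\<Gamma> Z c a b = christoffel Z c a b"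
        by (rule iff[OF Z a b, THEN iffD1, rule_format, OF _ c])
          (use * Z a b in \<open>simp add: is_classical_nabla_def Let_def\<close>)
    qed
  next
    assume "\<forall>Z. Z $ m = 1 \<longrightarrow>
      (\<forall>a\<in>chart_frame m. \<forall>b\<in>chart_frame m. \<forall>c\<in>chart_frame m. \<Gamma> Z c a b = christoffel Z c a b)"
    then show "is_classical_nabla r s wt m \<Gamma>"
      using iff unfolding is_classical_nabla_def Let_def by blast
  qed
qed

section \<open>Compatibility with the Fubini-Study metric\<close>

lemma fubini_study_simps:
  "fubini_study Z (Dz i) (Dzbar j) = hmat j i Z" "fubini_study Z (Dzbar j) (Dz i) = hmat j i Z"
  "fubini_study Z (Dz i) (Dz j) = 0" "fubini_study Z (Dzbar i) (Dzbar j) = 0" if "norm_square Z \<noteq> 0"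
  using that unfolding fubini_study_def Let_def norm_power2_eq
  by (simp_all add: hmat_def power2_eq_square field_simps of_bool_def)

lemma christoffel_sym: "christoffel Z c a b = christoffel Z c b a"
  by (cases a; cases b; cases c) (simp_all add: christoffel_simps add.commute)

text \<open>For two indices of equal type both sides vanish by type. For mixed indices the
  derivative of \<open>hmat\<close> has two terms, exactly those that the Christoffel symbols of the
  type of c produce.\<close>

lemma has_frame_deriv_fubini_study:
  assumes Z: "norm_square Z \<noteq> 0" and chart: "a \<in> chart_frame m" "b \<in> chart_frame m" "c \<in> chart_frame m"
  shows "frame_deriv c (\<lambda>W. fubini_study W a b) Z =
    (\<Sum>e\<in>chart_frame m. christoffel Z e c a * fubini_study Z e b + christoffel Z e c b * fubini_study Z a e)"
proof -
  have Z': "Z \<in> {W. norm_square W \<noteq> 0}" using Z by simp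
  note tr = has_frame_deriv_imp[OF has_frame_deriv_transform[OF _ open_norm_square_nonzero Z']]
  have 0: "has_frame_deriv (\<lambda>W. 0) c Z 0" for c by (rule has_frame_deriv_const)
  have Dz_in: "i \<noteq> m" if "Dz i \<in> chart_frame m" for i using that by (auto simp: chart_frame_def)
  have Dzbar_in: "i \<noteq> m" if "Dzbar i \<in> chart_frame m" for i using that by (auto simp: chart_frame_def)
  have mixed: "frame_deriv c (\<lambda>W. fubini_study W (Dz i) (Dzbar j)) Z =
    (\<Sum>e\<in>chart_frame m. christoffel Z e c (Dz i) * fubini_study Z e (Dzbar j) + christoffel Z e c (Dzbar j) * fubini_study Z (Dz i) e)"
    if i: "i \<noteq> m" and j: "j \<noteq> m" for i j
  proof (cases c)
    case (Dz d)
    then have d: "d \<noteq> m" using chart(3) Dz_in by simp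
    have "frame_deriv c (\<lambda>W. fubini_study W (Dz i) (Dzbar j)) Z =
      - (cnj (Z $ d) * hmat j i Z + cnj (Z $ i) * hmat j d Z) * inverse (norm_square Z)"
      unfolding Dz by (rule tr[OF has_frame_deriv_hmat_Dz[OF Z]]) (simp add: fubini_study_simps)
    also have "\<dots> = (\<Sum>e\<in>- {m}. christoffel Z (Dz e) (Dz d) (Dz i) * hmat j e Z)"
      unfolding christoffel_sum(1)[OF d i] by (simp add: add.commute)
    finally show ?thesis unfolding sum_chart_frame Dz fubini_study_simps[OF Z] by (simp add: christoffel_simps)
  next
    case (Dzbar d)
    then have d: "d \<noteq> m" using chart(3) Dzbar_in by simp
    have "frame_deriv c (\<lambda>W. fubini_study W (Dz i) (Dzbar j)) Z =
      - (Z $ d * hmat j i Z + Z $ j * hmat d i Z) * inverse (norm_square Z)"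
      unfolding Dzbar by (rule tr[OF has_frame_deriv_hmat_Dzbar[OF Z]]) (simp add: fubini_study_simps)
    also have "\<dots> = (\<Sum>e\<in>- {m}. christoffel Z (Dzbar e) (Dzbar d) (Dzbar j) * hmat e i Z)"
      unfolding christoffel_sum(2)[OF d j] by (simp add: add.commute)
    finally show ?thesis unfolding sum_chart_frame Dzbar fubini_study_simps[OF Z] by (simp add: christoffel_simps)
  qed
  have sym: "fubini_study W x y = fubini_study W y x" for W :: "complex^'a" and x y
    by (cases x; cases y) (simp_all add: fubini_study_def Let_def)
  show ?thesis
  proof (cases a)
    case (Dz i)
    note a = Dz
    show ?thesis
    proof (cases b)
      case (Dz j)
      have "frame_deriv c (\<lambda>W. fubini_study W a b) Z = 0"
        unfolding a Dz by (rule tr[OF 0]) (simp add: fubini_study_simps)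
      then show ?thesis unfolding sum_chart_frame a Dz fubini_study_simps[OF Z]
        by (cases c) (simp_all add: christoffel_simps)
    next
      case (Dzbar j)
      then show ?thesis using mixed a chart Dz_in Dzbar_in by simp
    qed
  next
    case (Dzbar i)
    note a = Dzbar
    show ?thesis
    proof (cases b)
      case (Dzbar j)
      have "frame_deriv c (\<lambda>W. fubini_study W a b) Z = 0"
        unfolding a Dzbar by (rule tr[OF 0]) (simp add: fubini_study_simps)
      then show ?thesis unfolding sum_chart_frame a Dzbar fubini_study_simps[OF Z]
        by (cases c) (simp_all add: christoffel_simps)
    next
      case (Dz j)
      have "j \<noteq> m" "i \<noteq> m" using a Dz chart Dz_in Dzbar_in by auto
      from mixed[OF this] show ?thesis unfolding a Dz sym[of _ "Dzbar i"] sym[of _ _ "Dz j"]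
        by (simp only: add.commute)
    qed
  qed
qed

lemma is_levi_civita_christoffel:
  assumes \<Gamma>: "\<And>Z a b c. Z $ m = 1 \<Longrightarrow> a \<in> chart_frame m \<Longrightarrow> b \<in> chart_frame m \<Longrightarrow> c \<in> chart_frame m \<Longrightarrow>
    \<Gamma> Z c a b = christoffel Z c a b"
  shows "is_levi_civita m fubini_study \<Gamma>"
  unfolding is_levi_civita_def
proof (intro allI impI ballI conjI)
  fix Z :: "complex^'a" and a b c
  assume Z: "Z $ m = 1" and a: "a \<in> chart_frame m" and b: "b \<in> chart_frame m" and c: "c \<in> chart_frame m"
  show "\<Gamma> Z c a b = \<Gamma> Z c b a" unfolding \<Gamma>[OF Z a b c] \<Gamma>[OF Z b a c] by (rule christoffel_sym)
  show "frame_deriv c (\<lambda>W. fubini_study W a b) Z = (\<Sum>e\<in>chart_frame m. \<Gamma> Z e c a * fubini_study Z e b + \<Gamma> Z e c b * fubini_study Z a e)"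
    unfolding has_frame_deriv_fubini_study[OF norm_square_nonzero[OF Z] a b c]
    by (intro sum.cong refl) (simp only: \<Gamma>[OF Z c a] \<Gamma>[OF Z c b])
qed

theorem classical_limit:
  "(\<exists>\<Gamma>. is_classical_nabla r s wt m \<Gamma>) \<and>
    (\<forall>\<Gamma>. is_classical_nabla r s wt m \<Gamma> \<longrightarrow> is_levi_civita m fubini_study \<Gamma>)"
proof
  show "\<exists>\<Gamma>. is_classical_nabla r s wt m \<Gamma>"
    unfolding is_classical_nabla_iff by blast
  show "\<forall>\<Gamma>. is_classical_nabla r s wt m \<Gamma> \<longrightarrow> is_levi_civita m fubini_study \<Gamma>"
    unfolding is_classical_nabla_iff using is_levi_civita_christoffel by blast
qed

section \<open>The weak Levi-Civita connection\<close>

theorem theorem7p7: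
  fixes r s :: nat and q :: real
    and V :: "'n::finite uq_module" and wt :: "'n \<Rightarrow> weight" and R :: "'n braidings"
    and f v :: "'n \<Rightarrow> 'a::complex_algebra_1" and B :: "'a set" and p :: "('n, 'a) legs2"
    and lP :: "'a \<Rightarrow> 'wp::complex_vec \<Rightarrow> 'wp" and rP :: "'wp \<Rightarrow> 'a \<Rightarrow> 'wp"
    and dp :: "('n, 'wp) legs2" and del :: "'a \<Rightarrow> 'wp"
    and lM :: "'a \<Rightarrow> 'wm::complex_vec \<Rightarrow> 'wm" and rM :: "'wm \<Rightarrow> 'a \<Rightarrow> 'wm"
    and dbp :: "('n, 'wm) legs2" and delbar :: "'a \<Rightarrow> 'wm"
    and l :: "'a \<Rightarrow> 'wp \<times> 'wm \<Rightarrow> 'wp \<times> 'wm" and rt :: "'wp \<times> 'wm \<Rightarrow> 'a \<Rightarrow> 'wp \<times> 'wm"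
    and d :: "'a \<Rightarrow> 'wp \<times> 'wm"
    and Dp Dbp :: "('n, 'wp \<times> 'wm) legs2"
    and tn :: "'wp \<times> 'wm \<Rightarrow> 'wp \<times> 'wm \<Rightarrow> 't::complex_vec"
    and \<pi> :: "'t \<Rightarrow> 'z::complex_vec" and rt2 :: "'z \<Rightarrow> 'a \<Rightarrow> 'z" and d2 :: "'wp \<times> 'wm \<Rightarrow> 'z"
    and tn2 :: "'z \<Rightarrow> 'wp \<times> 'wm \<Rightarrow> 'u::complex_vec"
    and gpm gmp :: 't
    and nab :: "'wp \<times> 'wm \<Rightarrow> 't"
  assumes "1 \<le> r" and "0 < q" and "q < 1" and "s = 1 \<or> s = r"
    \<comment> \<open>\<open>V = V(\<omega>\<^sub>s)\<close> with a weight basis, and its braidings\<close>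
    and "is_simple_hw_module r q (fund_weight r s) V" and "is_weight_basis r q V wt"
    and "R = quantum_braidings r s q V"
    \<comment> \<open>the algebra \<open>A\<close> and the quantum projective space \<open>B\<close>\<close>
    and "presented_algebra (case_gens f v) (algebra_relations r s q R)"
    and "B = degree_zero_part (case_gens f v)" and "p = (\<lambda>i j. f i * v j)"
    \<comment> \<open>\<open>\<Omega>\<^sub>+\<close>\<close>
    and "presented_left_module B lP (\<lambda>(i, j). dp i j) (omega_plus_relations r s q wt R p)"
    and "bimodule B lP rP"
    and "\<And>i j k m. rP (dp i j) (p k m) = qpow q (aa r s) *\<^sub>C T1234 R (concat_legs lP p dp) i j k m"
    and "derivation B lP rP del" and "\<And>i j. del (p i j) = dp i j"
    \<comment> \<open>\<open>\<Omega>\<^sub>-\<close>\<close>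
    and "presented_left_module B lM (\<lambda>(i, j). dbp i j) (omega_minus_relations r s q wt R p)"
    and "bimodule B lM rM"
    and "\<And>i j k m. rM (dbp i j) (p k m) = qpow q (- aa r s) *\<^sub>C T1234 R (concat_legs lM p dbp) i j k m"
    and "derivation B lM rM delbar" and "\<And>i j. delbar (p i j) = dbp i j"
    \<comment> \<open>\<open>\<Omega> = \<Omega>\<^sub>+ \<oplus> \<Omega>\<^sub>-\<close>\<close>
    and "l = sum_lact lP lM" and "rt = sum_ract rP rM" and "d = (\<lambda>b. (del b, delbar b))"
    and "Dp = (\<lambda>i j. (dp i j, 0))" and "Dbp = (\<lambda>i j. (0, dbp i j))"
    \<comment> \<open>\<open>\<Omega> \<otimes>\<^sub>B \<Omega>\<close>, \<open>\<Omega>\<^sup>2\<close> and \<open>\<Omega>\<^sup>2 \<otimes>\<^sub>B \<Omega>\<close>\<close>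
    and "is_tensor_product B rt l tn"
    and "is_universal_degree2 B l rt d tn \<pi> rt2 d2"
    and "is_tensor_product B rt2 l tn2"
    \<comment> \<open>the metric and the connection\<close>
    and "gpm = metric_part r q wt (concat_legs tn Dp Dbp)"
    and "gmp = metric_part r q wt (concat_legs tn Dbp Dp)"
    and "is_connection B l d tn nab"
    and "\<And>i j. nab (Dp i j) = nabla_del r s q wt R p (tensor_lact tn l) (concat_legs tn Dbp Dp) i j"
    and "\<And>i j. nab (Dbp i j) = nabla_delbar r s q wt p (tensor_lact tn l) (concat_legs tn Dp Dbp) i j"
  shows "(\<forall>x. torsion \<pi> d2 nab x = 0) \<and>
    cotorsion tn \<pi> d2 tn2 nab (gpm + gmp) = 0 \<and>
    (\<forall>m. (\<exists>\<Gamma>. is_classical_nabla r s wt m \<Gamma>) \<and>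
      (\<forall>\<Gamma>. is_classical_nabla r s wt m \<Gamma> \<longrightarrow> is_levi_civita m fubini_study \<Gamma>))"
proof -
  have r: "1 \<le> r" and q: "0 < q" "q < 1" and s: "s = 1 \<or> s = r" by fact+
  \<comment> \<open>The rank function makes the braidings explicit and is absent from the
    claim.\<close>
  obtain k where legs: "quantum_legs q r k (- 1 / (real r + 1)) R wt"
    using quantum_legs_exists[OF r s q assms(5,6)] unfolding \<open>R = quantum_braidings r s q V\<close> by blast
  note weak = weak_levi_civita[OF legs ww_eq[OF r s] wr_eq[OF r s] assms(8-28,31-33)]
  show ?thesis
    unfolding \<open>gpm = _\<close> \<open>gmp = _\<close>
    by (intro conjI[OF allI conjI] allI weak classical_limit)
qed

end
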